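(* There is a $CoCoalg_k$-enriched functor $\tau:cHALG_k\longrightarrow\widetilde{cHALG}_k$ which is the identity on objects and whose mapping on hom-objects is given by $$\tau(\mathcal U,\mathcal U'):cHALG_k(\mathcal U,\mathcal U')=\mathcal M_c(\mathcal U,\mathcal U')\longrightarrow\mathcal M_c\big((HH_\bullet(\mathcal U),sh(\mathcal U)),(HH_\bullet(\mathcal U'),sh(\mathcal U'))\big)=\widetilde{cHALG}_k(\mathcal U,\mathcal U')$$ for commutative Hopf algebroids $\mathcal U$, $\mathcal U'$ over $k$.
   Context: $k$ is a field; $Vect_k(V,W)$ denotes the space of $k$-linear maps; $CoCoalg_k$ is the symmetric monoidal category of cocommutative $k$-coalgebras. Sweedler notation is used with summation suppressed. Left bialgebroid $(U,A_L,s_L,t_L,\Delta_L,\epsilon_L)$ over $k$ (write $A=A_L$): unital $k$-algebras $U,A$; $k$-algebra morphisms $s_L:A\to U$, $t_L:A^{op}\to U$ with commuting images; $U$ is an $(A,A)$-bimodule via $a\cdot u\cdot b=s_L(a)t_L(b)u$ and $U\otimes_{A_L}U$ is formed with this structure (so $t_L(a)u\otimes v=u\otimes s_L(a)v$); $(U,\Delta_L:U\to U\otimes_{A_L}U,\epsilon_L:U\to A_L)$ is a coalgebra in $(A,A)$-bimodules such that $\Delta_L$ takes values in $U\times_{A_L}U:=\{\sum u_i\otimes u_i' : \sum u_it_L(a)\otimes u'_i=\sum u_i\otimes u_i's_L(a)\ \forall a\in A\}$ (an algebra under factorwise multiplication), $\Delta_L:U\to U\times_{A_L}U$ is a unital algebra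 morphism, and $\epsilon_L(us_L(\epsilon_L(u')))=\epsilon_L(uu')=\epsilon_L(ut_L(\epsilon_L(u')))$. Hopf algebroid $\mathcal U=(U,A_L,s_L,t_L,\Delta_L,\epsilon_L,S)$: a left bialgebroid with an involutive ($S^2=\mathrm{id}$) anti-automorphism $S$ of the $k$-algebra $U$ with $S\circ t_L=s_L$ and, in $U\otimes_{A_L}U$ for all $u\in U$, $S(u_{(1)})_{(1)}u_{(2)}\otimes S(u_{(1)})_{(2)}=1_U\otimes S(u)$ and $S(u_{(2)})_{(1)}\otimes S(u_{(2)})_{(2)}u_{(1)}=S(u)\otimes 1_U$. It is commutative if $U$ and $A$ are commutative rings. Measuring of algebras: for $k$-algebras $R,R'$ and a $k$-coalgebra $C$ with counit $\epsilon_C$, a linear map $\psi:C\to Vect_k(R,R')$ with $\psi(x)(ab)=\psi(x_{(1)})(a)\psi(x_{(2)})(b)$ and $\psi(x)(1_R)=\epsilon_C(x)1_{R'}$. One writes $x(a)$ for $\psi(x)(a)$. $\mathcal M_c(R,R')$, with measuring $\varphi_c(R,R'):\mathcal M_c(R,R')\to Vect_k(R,R')$, denotes the final object among measurings from $R$ to $R'$ by cocommutative coalgebras; these objects enrich $k$-algebras over $CoCoalg_k$, with composition and units induced by composition of measurings and by scalar multiples of identities. Measuring of Hopf algebroids from $\mathcal U$ to $\mathcal U'$ by a cocommutative $k$-coalgebra $C$: a pair of algebra measurings $\Psi:C\to Vect_k(U,U')$, $\psi:C\to Vect_k(A_L,A'_L)$ such that for all $x\in C$: $\Psi(x)s_L=s_L'\psi(x)$,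 $\Psi(x)t_L=t'_L\psi(x)$, $\Psi(x)S=S'\Psi(x)$, $\psi(x)\epsilon_L=\epsilon_L'\Psi(x)$, and $\Delta'_L(\Psi(x)(u))=\Psi(x_{(1)})(u_{(1)})\otimes\Psi(x_{(2)})(u_{(2)})$ in $U'\otimes_{A'_L}U'$ for all $u\in U$. For Hopf algebroids, $\mathcal M_c(\mathcal U,\mathcal U')$ with measuring $(\Phi,\phi)$ denotes the universal (final) cocommutative measuring from $\mathcal U$ to $\mathcal U'$. $HALG_k$ is the $CoCoalg_k$-enriched category of Hopf algebroids with hom-objects $\mathcal M_c(\mathcal U,\mathcal U')$, composition induced by the measuring $x\otimes x'\mapsto(\Phi'(x')\circ\Phi(x),\phi'(x')\circ\phi(x))$ and units $k\to\mathcal M_c(\mathcal U,\mathcal U)$ induced by $\lambda\mapsto(\lambda\,\mathrm{id}_U,\lambda\,\mathrm{id}_{A_L})$; $cHALG_k$ is its full subcategory on commutative Hopf algebroids. $HH_\bullet(\mathcal U)=\bigoplus_nHH_n(\mathcal U)$ is the homology of the complex $C_\bullet(\mathcal U)$ with differential $\sum_i(-1)^id_i$, where, with $A_R=A_L^{op}$, $s_R=t_L$, $\epsilon_R=\epsilon_L\circ S$ and $U$ an $(A_R,A_R)$-bimodule via $a\cdot u\cdot b=s_R(a)us_R(b)$, $C_n(\mathcal U)=U\otimes_{A_R}\cdots\otimes_{A_R}U$ ($n$ factors), $C_0(\mathcal U)=A_R$; $d_0(u^1\otimes\dots\otimes u^n)=\epsilon_R(u^1)\cdot u^2\otimes\dots\otimes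 u^n$, $d_i(u^1\otimes\dots\otimes u^n)=u^1\otimes\dots\otimes u^iu^{i+1}\otimes\dots\otimes u^n$ ($1\le i\le n-1$), $d_n(u^1\otimes\dots\otimes u^n)=u^1\otimes\dots\otimes u^{n-1}\cdot\epsilon_R(S(u^n))$ (for $n=1$: $d_0=\epsilon_R$, $d_1=\epsilon_R\circ S$). Shuffle product: $sh_{pq}(\mathcal U):C_p(\mathcal U)\otimes C_q(\mathcal U)\to C_{p+q}(\mathcal U)$ is, for $p,q\ge1$, $$(u^1\otimes\dots\otimes u^p)\otimes(u^{p+1}\otimes\dots\otimes u^{p+q})\mapsto\sum_{\sigma\in Sh(p,q)}sgn(\sigma)\,u^{\sigma^{-1}(1)}\otimes\dots\otimes u^{\sigma^{-1}(p+q)},$$ $Sh(p,q)=\{\sigma\in S_{p+q}:\sigma(1)<\dots<\sigma(p),\ \sigma(p+1)<\dots<\sigma(p+q)\}$; $sh_{00}$ is the multiplication of $A$; $sh_{p0}((u^1\otimes\dots\otimes u^p)\otimes a)=t_L(a)u^1\otimes\dots\otimes u^p$; $sh_{0q}(a\otimes(u^1\otimes\dots\otimes u^q))=u^1\otimes\dots\otimes u^qt_L(a)$. For commutative $\mathcal U$ it induces a graded algebra structure $(HH_\bullet(\mathcal U),sh(\mathcal U))$. A cocommutative measuring $(\Psi,\psi)$ of commutative Hopf algebroids induces an algebra measuring $\underline\Psi^{hoc}:C\to Vect_k(HH_\bullet(\mathcal U),HH_\bullet(\mathcal U'))$ for the shuffle products, where $\underline\Psi^{hoc}(x)$ is induced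 by $u^1\otimes\dots\otimes u^n\mapsto x_{(1)}(u^1)\otimes\dots\otimes x_{(n)}(u^n)$ (and $\psi(x)$ in degree $0$). $\widetilde{cHALG}_k$ is the $CoCoalg_k$-enriched category whose objects are commutative Hopf algebroids and whose hom-objects are $\mathcal M_c((HH_\bullet(\mathcal U),sh(\mathcal U)),(HH_\bullet(\mathcal U'),sh(\mathcal U')))$, with composition and units from the enrichment of algebras. The map $\tau(\mathcal U,\mathcal U')$ is the coalgebra morphism, provided by the universal property of the target, with $\varphi_c(HH_\bullet(\mathcal U),HH_\bullet(\mathcal U'))\circ\tau(\mathcal U,\mathcal U')=\underline\Phi^{hoc}$. *)

theory Defs
  imports
    "HOL-Algebra.QuotRing"
    "HOL-Algebra.Module"
    "HOL-Library.Poly_Mapping"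
    "HOL-Library.FuncSet"
    "HOL-Combinatorics.Permutations"
begin

section \<open>Vector spaces, generators and relations\<close>

text \<open>
  The field k is a type \<open>'k\<close> of class \<open>field\<close>. The record \<open>ground\<close> is this
  field both as a ring in the sense of HOL-Algebra and as a vector space over itself; a k-vector
  space is a module \<open>V\<close> over \<open>ground\<close>, with an arbitrary carrier set. The ring
  multiplication and unit of a \<open>module\<close> record play no role unless the record is
  used as an algebra.
\<close>

definition ground :: "('k::field, 'k) module" where
  "ground = \<lparr>carrier = UNIV, monoid.mult = (*), one = 1, zero = 0, add = (+), smult = (*)\<rparr>"

abbreviation vspace :: "('k::field, 'v, 'z) module_scheme \<Rightarrow> bool" where
  "vspace V \<equiv> module ground V"

definition klinear ::
  "('k::field, 'v, 'z) module_scheme \<Rightarrow> ('k, 'w, 'y) module_scheme \<Rightarrow> ('v \<Rightarrow> 'w) \<Rightarrow> bool" where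
  "klinear V W f \<longleftrightarrow> f \<in> carrier V \<rightarrow> carrier W \<and>
     (\<forall>x\<in>carrier V. \<forall>y\<in>carrier V. f (x \<oplus>\<^bsub>V\<^esub> y) = f x \<oplus>\<^bsub>W\<^esub> f y) \<and>
     (\<forall>c. \<forall>x\<in>carrier V. f (c \<odot>\<^bsub>V\<^esub> x) = c \<odot>\<^bsub>W\<^esub> f x)"

definition quot_space :: "('k::field, 'v, 'z) module_scheme \<Rightarrow> 'v set \<Rightarrow> ('k, 'v set) module" where
  "quot_space V N = \<lparr>carrier = a_rcosets\<^bsub>V\<^esub> N, monoid.mult = undefined, one = undefined,
     zero = N, add = set_add V, smult = (\<lambda>c X. \<Union>x\<in>X. N +>\<^bsub>V\<^esub> (c \<odot>\<^bsub>V\<^esub> x))\<rparr>"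

definition free_space :: "'x set \<Rightarrow> ('k::field, 'x \<Rightarrow>\<^sub>0 'k) module" where
  "free_space X = \<lparr>carrier = {p. Poly_Mapping.keys p \<subseteq> X}, monoid.mult = undefined, one = undefined,
     zero = 0, add = (+), smult = (\<lambda>c. Poly_Mapping.map ((*) c))\<rparr>"

abbreviation basis_elt :: "'x \<Rightarrow> ('x \<Rightarrow>\<^sub>0 'k::field)" where
  "basis_elt x \<equiv> Poly_Mapping.single x 1"

definition rel_space :: "'x set \<Rightarrow> ('x \<Rightarrow>\<^sub>0 'k::field) set \<Rightarrow> ('x \<Rightarrow>\<^sub>0 'k) set" where
  "rel_space X Rel = \<Inter>{N. submodule N ground (free_space X) \<and> Rel \<subseteq> N}"

definition pres :: "'x set \<Rightarrow> ('x \<Rightarrow>\<^sub>0 'k::field) set \<Rightarrow> ('k, ('x \<Rightarrow>\<^sub>0 'k) set) module" where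
  "pres X Rel = quot_space (free_space X) (rel_space X Rel)"

definition pgen :: "'x set \<Rightarrow> ('x \<Rightarrow>\<^sub>0 'k::field) set \<Rightarrow> 'x \<Rightarrow> ('x \<Rightarrow>\<^sub>0 'k) set" where
  "pgen X Rel x = rel_space X Rel +>\<^bsub>(free_space X :: ('k, 'x \<Rightarrow>\<^sub>0 'k) module)\<^esub> basis_elt x"

text \<open>
  Linear (bilinear) extension to presented spaces of a map \<open>g\<close> given on generators: the common
  value of the linear extension of \<open>g\<close> on all representatives of \<open>t\<close> (of \<open>t\<close> and \<open>t'\<close>). The
  bilinear version is needed where \<open>g\<close> respects the relations in one argument only for special
  elements in the other one, as for the factorwise product on the Takeuchi product.
\<close>

definition lin_ext ::
  "('k::field, 'w, 'z) module_scheme \<Rightarrow> ('x \<Rightarrow> 'w) \<Rightarrow> ('x \<Rightarrow>\<^sub>0 'k) set \<Rightarrow> 'w" where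
  "lin_ext W g t = the_elem ((\<lambda>p. \<Oplus>\<^bsub>W\<^esub>x\<in>Poly_Mapping.keys p. Poly_Mapping.lookup p x \<odot>\<^bsub>W\<^esub> g x) ` t)"

definition lin_ext2 ::
  "('k::field, 'w, 'z) module_scheme \<Rightarrow> ('x \<Rightarrow> 'y \<Rightarrow> 'w) \<Rightarrow>
     ('x \<Rightarrow>\<^sub>0 'k) set \<Rightarrow> ('y \<Rightarrow>\<^sub>0 'k) set \<Rightarrow> 'w" where
  "lin_ext2 W g t t' = the_elem ((\<lambda>(p, q). \<Oplus>\<^bsub>W\<^esub>x\<in>Poly_Mapping.keys p. \<Oplus>\<^bsub>W\<^esub>y\<in>Poly_Mapping.keys q.
       (Poly_Mapping.lookup p x * Poly_Mapping.lookup q y) \<odot>\<^bsub>W\<^esub> g x y) ` (t \<times> t'))"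


section \<open>Tensor products\<close>

text \<open>
  The tensor product of a list \<open>Ms\<close> of vector spaces is generated by the lists \<open>xs\<close> with
  \<open>xs ! i \<in> carrier (Ms ! i)\<close>, so no bracketing of multiple tensor products has to be chosen.
  The relations take an extra argument \<open>\<iota>\<close>, an embedding of lists into another type
  of generators; it is the identity for tensor products.
\<close>

definition tensor_gens :: "('k::field, 'v, 'z) module_scheme list \<Rightarrow> 'v list set" where
  "tensor_gens Ms = {xs. list_all2 (\<lambda>x M. x \<in> carrier M) xs Ms}"

definition multilin_rels ::
  "('v list \<Rightarrow> 'x) \<Rightarrow> ('k::field, 'v, 'z) module_scheme list \<Rightarrow> ('x \<Rightarrow>\<^sub>0 'k) set" where
  "multilin_rels \<iota> Ms =
     {basis_elt (\<iota> (xs @ (x \<oplus>\<^bsub>Ms ! length xs\<^esub> y) # ys))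
        - basis_elt (\<iota> (xs @ x # ys)) - basis_elt (\<iota> (xs @ y # ys)) | xs x y ys.
        xs @ x # ys \<in> tensor_gens Ms \<and> xs @ y # ys \<in> tensor_gens Ms} \<union>
     {basis_elt (\<iota> (xs @ (c \<odot>\<^bsub>Ms ! length xs\<^esub> x) # ys))
        - Poly_Mapping.single (\<iota> (xs @ x # ys)) c | xs c x ys.
        xs @ x # ys \<in> tensor_gens Ms}"

definition balanced_rels ::
  "('v list \<Rightarrow> 'x) \<Rightarrow> 'a set \<Rightarrow> ('v \<Rightarrow> 'a \<Rightarrow> 'v) \<Rightarrow> ('a \<Rightarrow> 'v \<Rightarrow> 'v) \<Rightarrow>
     ('k::field, 'v, 'z) module_scheme list \<Rightarrow> ('x \<Rightarrow>\<^sub>0 'k) set" where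
  "balanced_rels \<iota> A ract lact Ms =
     {basis_elt (\<iota> (xs @ [ract x a, y] @ ys)) - basis_elt (\<iota> (xs @ [x, lact a y] @ ys)) | xs x a y ys.
        a \<in> A \<and> xs @ [x, y] @ ys \<in> tensor_gens Ms}"

definition tensor :: "('k::field, 'v, 'z) module_scheme list \<Rightarrow> ('k, ('v list \<Rightarrow>\<^sub>0 'k) set) module" where
  "tensor Ms = pres (tensor_gens Ms) (multilin_rels (\<lambda>xs. xs) Ms)"

definition tens :: "('k::field, 'v, 'z) module_scheme list \<Rightarrow> 'v list \<Rightarrow> ('v list \<Rightarrow>\<^sub>0 'k) set" where
  "tens Ms xs = pgen (tensor_gens Ms) (multilin_rels (\<lambda>xs. xs) Ms) xs"

text \<open>
  Sweedler sums: for \<open>t = \<Sum> x \<otimes> y\<close>, \<open>sweedler W f t\<close> is \<open>\<Sum> f x y\<close>;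
  for \<open>t = \<Sum> x \<otimes> y\<close> and \<open>t' = \<Sum> x' \<otimes> y'\<close>, \<open>sweedler2 W f t t'\<close> is \<open>\<Sum> f x y x' y'\<close>.
\<close>

abbreviation sweedler ::
  "('k::field, 'w, 'z) module_scheme \<Rightarrow> ('v \<Rightarrow> 'v \<Rightarrow> 'w) \<Rightarrow> ('v list \<Rightarrow>\<^sub>0 'k) set \<Rightarrow> 'w" where
  "sweedler W f t \<equiv> lin_ext W (\<lambda>xs. f (xs ! 0) (xs ! 1)) t"

abbreviation sweedler2 ::
  "('k::field, 'w, 'z) module_scheme \<Rightarrow> ('v \<Rightarrow> 'v \<Rightarrow> 'u \<Rightarrow> 'u \<Rightarrow> 'w) \<Rightarrow>
     ('v list \<Rightarrow>\<^sub>0 'k) set \<Rightarrow> ('u list \<Rightarrow>\<^sub>0 'k) set \<Rightarrow> 'w" where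
  "sweedler2 W f t t' \<equiv> lin_ext2 W (\<lambda>xs ys. f (xs ! 0) (xs ! 1) (ys ! 0) (ys ! 1)) t t'"


section \<open>Algebras and coalgebras\<close>

text \<open>The locale \<open>algebra\<close> of HOL-Algebra is restricted to commutative algebras.\<close>

definition k_algebra :: "('k::field, 'r, 'z) module_scheme \<Rightarrow> bool" where
  "k_algebra R \<longleftrightarrow> vspace R \<and> ring R \<and>
     (\<forall>c. \<forall>x\<in>carrier R. \<forall>y\<in>carrier R.
        (c \<odot>\<^bsub>R\<^esub> x) \<otimes>\<^bsub>R\<^esub> y = c \<odot>\<^bsub>R\<^esub> (x \<otimes>\<^bsub>R\<^esub> y) \<and> x \<otimes>\<^bsub>R\<^esub> (c \<odot>\<^bsub>R\<^esub> y) = c \<odot>\<^bsub>R\<^esub> (x \<otimes>\<^bsub>R\<^esub> y))"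

definition alg_hom ::
  "('k::field, 'r, 'z) module_scheme \<Rightarrow> ('k, 's, 'y) module_scheme \<Rightarrow> ('r \<Rightarrow> 's) \<Rightarrow> bool" where
  "alg_hom R R' f \<longleftrightarrow> klinear R R' f \<and> f \<in> ring_hom R R'"

definition op_alg :: "('k::field, 'r) module \<Rightarrow> ('k, 'r) module" where
  "op_alg R = R\<lparr>monoid.mult := (\<lambda>x y. y \<otimes>\<^bsub>R\<^esub> x)\<rparr>"

record (overloaded) ('k, 'c) coalg = "('k::field, 'c) module" +
  comult :: "'c \<Rightarrow> ('c list \<Rightarrow>\<^sub>0 'k) set"
  counit :: "'c \<Rightarrow> 'k"

definition coalgebra :: "('k::field, 'c) coalg \<Rightarrow> bool" where
  "coalgebra C \<longleftrightarrow> vspace C \<and>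
     klinear C (tensor [C, C]) (comult C) \<and> klinear C ground (counit C) \<and>
     (\<forall>x\<in>carrier C.
        sweedler (tensor [C, C, C])
          (\<lambda>x1 x2. sweedler (tensor [C, C, C]) (\<lambda>y z. tens [C, C, C] [y, z, x2]) (comult C x1)) (comult C x)
        = sweedler (tensor [C, C, C])
          (\<lambda>x1 x2. sweedler (tensor [C, C, C]) (\<lambda>y z. tens [C, C, C] [x1, y, z]) (comult C x2)) (comult C x)) \<and>
     (\<forall>x\<in>carrier C. sweedler C (\<lambda>x1 x2. counit C x1 \<odot>\<^bsub>C\<^esub> x2) (comult C x) = x \<and>
                    sweedler C (\<lambda>x1 x2. counit C x2 \<odot>\<^bsub>C\<^esub> x1) (comult C x) = x)"

definition cocomm_coalgebra :: "('k::field, 'c) coalg \<Rightarrow> bool" where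
  "cocomm_coalgebra C \<longleftrightarrow> coalgebra C \<and>
     (\<forall>x\<in>carrier C. sweedler (tensor [C, C]) (\<lambda>x1 x2. tens [C, C] [x2, x1]) (comult C x) = comult C x)"

definition coalg_hom :: "('k::field, 'c) coalg \<Rightarrow> ('k, 'd) coalg \<Rightarrow> ('c \<Rightarrow> 'd) \<Rightarrow> bool" where
  "coalg_hom C D f \<longleftrightarrow> klinear C D f \<and>
     (\<forall>x\<in>carrier C. comult D (f x) = sweedler (tensor [D, D]) (\<lambda>x1 x2. tens [D, D] [f x1, f x2]) (comult C x)) \<and>
     (\<forall>x\<in>carrier C. counit D (f x) = counit C x)"

definition unit_coalg :: "('k::field, 'k) coalg" where
  "unit_coalg = module.extend ground (coalg.fields (\<lambda>c. tens [ground, ground] [c, 1]) (\<lambda>c. c))"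

definition tensor_coalg ::
  "('k::field, 'c) coalg \<Rightarrow> ('k, 'c) coalg \<Rightarrow> ('k, ('c list \<Rightarrow>\<^sub>0 'k) set) coalg" where
  "tensor_coalg C D = (let T = tensor [C, D] in module.extend T (coalg.fields
     (\<lambda>t. sweedler (tensor [T, T]) (\<lambda>x y. sweedler2 (tensor [T, T])
        (\<lambda>x1 x2 y1 y2. tens [T, T] [tens [C, D] [x1, y1], tens [C, D] [x2, y2]]) (comult C x) (comult D y)) t)
     (\<lambda>t. sweedler ground (\<lambda>x y. counit C x * counit D y) t)))"

text \<open>The iterated coproduct with values in the \<open>n\<close>-fold tensor power; for \<open>n = 0\<close> it is the counit.\<close>

primrec iter_comult :: "('k::field, 'c) coalg \<Rightarrow> nat \<Rightarrow> 'c \<Rightarrow> ('c list \<Rightarrow>\<^sub>0 'k) set" where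
  "iter_comult C 0 x = counit C x \<odot>\<^bsub>tensor (replicate 0 C)\<^esub> tens (replicate 0 C) []"
| "iter_comult C (Suc n) x = sweedler (tensor (replicate (Suc n) C))
     (\<lambda>x1 x2. lin_ext (tensor (replicate (Suc n) C)) (\<lambda>xs. tens (replicate (Suc n) C) (x1 # xs)) (iter_comult C n x2))
     (comult C x)"


section \<open>Categories enriched over cocommutative coalgebras\<close>

text \<open>\<open>Comp E X Y Z\<close> is defined on \<open>Hom E X Y \<otimes> Hom E Y Z\<close>.\<close>

record (overloaded) ('o, 'k, 'm) ecat =
  Ob :: "'o set"
  Hom :: "'o \<Rightarrow> 'o \<Rightarrow> ('k::field, 'm) coalg"
  Comp :: "'o \<Rightarrow> 'o \<Rightarrow> 'o \<Rightarrow> ('m list \<Rightarrow>\<^sub>0 'k) set \<Rightarrow> 'm"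
  Unit :: "'o \<Rightarrow> 'k \<Rightarrow> 'm"

definition enriched_category :: "('o, 'k::field, 'm) ecat \<Rightarrow> bool" where
  "enriched_category E \<longleftrightarrow>
     (\<forall>X\<in>Ob E. \<forall>Y\<in>Ob E. cocomm_coalgebra (Hom E X Y)) \<and>
     (\<forall>X\<in>Ob E. \<forall>Y\<in>Ob E. \<forall>Z\<in>Ob E.
        coalg_hom (tensor_coalg (Hom E X Y) (Hom E Y Z)) (Hom E X Z) (Comp E X Y Z)) \<and>
     (\<forall>X\<in>Ob E. coalg_hom unit_coalg (Hom E X X) (Unit E X)) \<and>
     (\<forall>W\<in>Ob E. \<forall>X\<in>Ob E. \<forall>Y\<in>Ob E. \<forall>Z\<in>Ob E.
        \<forall>f\<in>carrier (Hom E W X). \<forall>g\<in>carrier (Hom E X Y). \<forall>h\<in>carrier (Hom E Y Z).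
          Comp E W Y Z (tens [Hom E W Y, Hom E Y Z] [Comp E W X Y (tens [Hom E W X, Hom E X Y] [f, g]), h])
          = Comp E W X Z (tens [Hom E W X, Hom E X Z] [f, Comp E X Y Z (tens [Hom E X Y, Hom E Y Z] [g, h])])) \<and>
     (\<forall>X\<in>Ob E. \<forall>Y\<in>Ob E. \<forall>f\<in>carrier (Hom E X Y). \<forall>c.
        Comp E X X Y (tens [Hom E X X, Hom E X Y] [Unit E X c, f]) = c \<odot>\<^bsub>Hom E X Y\<^esub> f \<and>
        Comp E X Y Y (tens [Hom E X Y, Hom E Y Y] [f, Unit E Y c]) = c \<odot>\<^bsub>Hom E X Y\<^esub> f)"

definition enriched_functor ::
  "('o, 'k::field, 'm) ecat \<Rightarrow> ('p, 'k, 'n) ecat \<Rightarrow> ('o \<Rightarrow> 'p) \<Rightarrow> ('o \<Rightarrow> 'o \<Rightarrow> 'm \<Rightarrow> 'n) \<Rightarrow> bool" where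
  "enriched_functor E F F0 F1 \<longleftrightarrow>
     enriched_category E \<and> enriched_category F \<and>
     (\<forall>X\<in>Ob E. F0 X \<in> Ob F) \<and>
     (\<forall>X\<in>Ob E. \<forall>Y\<in>Ob E. coalg_hom (Hom E X Y) (Hom F (F0 X) (F0 Y)) (F1 X Y)) \<and>
     (\<forall>X\<in>Ob E. \<forall>Y\<in>Ob E. \<forall>Z\<in>Ob E. \<forall>t\<in>carrier (tensor_coalg (Hom E X Y) (Hom E Y Z)).
        F1 X Z (Comp E X Y Z t) = Comp F (F0 X) (F0 Y) (F0 Z)
          (sweedler (tensor [Hom F (F0 X) (F0 Y), Hom F (F0 Y) (F0 Z)])
            (\<lambda>f g. tens [Hom F (F0 X) (F0 Y), Hom F (F0 Y) (F0 Z)] [F1 X Y f, F1 Y Z g]) t)) \<and>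
     (\<forall>X\<in>Ob E. \<forall>c. F1 X X (Unit E X c) = Unit F (F0 X) c)"


section \<open>Measurings of algebras\<close>

text \<open>A linear map \<open>C \<rightarrow> Vect_k(V, W)\<close>, spelled out as a map linear in both arguments.\<close>

definition linear_family ::
  "('k::field, 'c) coalg \<Rightarrow> ('k, 'v) module \<Rightarrow> ('k, 'w) module \<Rightarrow> ('c \<Rightarrow> 'v \<Rightarrow> 'w) \<Rightarrow> bool" where
  "linear_family C V W \<psi> \<longleftrightarrow>
     (\<forall>x\<in>carrier C. klinear V W (\<psi> x)) \<and> (\<forall>v\<in>carrier V. klinear C W (\<lambda>x. \<psi> x v))"

definition alg_measuring ::
  "('k::field, 'r) module \<Rightarrow> ('k, 's) module \<Rightarrow> ('k, 'c) coalg \<Rightarrow> ('c \<Rightarrow> 'r \<Rightarrow> 's) \<Rightarrow> bool" where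
  "alg_measuring R R' C \<psi> \<longleftrightarrow> linear_family C R R' \<psi> \<and>
     (\<forall>x\<in>carrier C. \<forall>a\<in>carrier R. \<forall>b\<in>carrier R.
        \<psi> x (a \<otimes>\<^bsub>R\<^esub> b) = sweedler R' (\<lambda>x1 x2. \<psi> x1 a \<otimes>\<^bsub>R'\<^esub> \<psi> x2 b) (comult C x)) \<and>
     (\<forall>x\<in>carrier C. \<psi> x \<one>\<^bsub>R\<^esub> = counit C x \<odot>\<^bsub>R'\<^esub> \<one>\<^bsub>R'\<^esub>)"

text \<open>Finality is tested on the coalgebras whose carrier is a set of elements of the type \<open>'c\<close>.\<close>

definition final_alg_measuring ::
  "'c itself \<Rightarrow> ('k::field, 'r) module \<Rightarrow> ('k, 's) module \<Rightarrow> ('k, 'm) coalg \<Rightarrow> ('m \<Rightarrow> 'r \<Rightarrow> 's) \<Rightarrow> bool" where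
  "final_alg_measuring _ R R' M \<phi> \<longleftrightarrow> cocomm_coalgebra M \<and> alg_measuring R R' M \<phi> \<and>
     (\<forall>(C :: ('k, 'c) coalg) \<psi>. cocomm_coalgebra C \<and> alg_measuring R R' C \<psi> \<longrightarrow>
        (\<exists>!f. f \<in> extensional (carrier C) \<and> coalg_hom C M f \<and>
              (\<forall>x\<in>carrier C. \<forall>a\<in>carrier R. \<phi> (f x) a = \<psi> x a)))"

text \<open>
  A type large enough to be the universe in which final measurings are taken, for measurings that
  are maps into \<open>'v\<close>: every element of a cocommutative coalgebra lies in a subcoalgebra of
  countable dimension, which can be realised on a subset of \<open>nat \<Rightarrow> 'k\<close>, and the
  final measuring is a quotient of the direct sum of all measurings of that kind.
\<close>

type_synonym ('k, 'v) meas_univ =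
  "(('k, nat \<Rightarrow> 'k) coalg \<times> ((nat \<Rightarrow> 'k) \<Rightarrow> 'v) \<Rightarrow> nat \<Rightarrow> 'k) set"

definition Mc_phi ::
  "('k::field, 'r) module \<Rightarrow> ('k, 's) module \<Rightarrow>
     ('k, ('k, 'r \<Rightarrow> 's) meas_univ) coalg \<times> (('k, 'r \<Rightarrow> 's) meas_univ \<Rightarrow> 'r \<Rightarrow> 's)" where
  "Mc_phi R R' = (SOME (M, \<phi>). final_alg_measuring TYPE(('k, 'r \<Rightarrow> 's) meas_univ) R R' M \<phi>)"

definition Mc :: "('k::field, 'r) module \<Rightarrow> ('k, 's) module \<Rightarrow> ('k, ('k, 'r \<Rightarrow> 's) meas_univ) coalg" where
  "Mc R R' = fst (Mc_phi R R')"

definition phi_c ::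
  "('k::field, 'r) module \<Rightarrow> ('k, 's) module \<Rightarrow> ('k, 'r \<Rightarrow> 's) meas_univ \<Rightarrow> 'r \<Rightarrow> 's" where
  "phi_c R R' = snd (Mc_phi R R')"

definition Mc_induced ::
  "('k::field, 'r) module \<Rightarrow> ('k, 's) module \<Rightarrow> ('k, 'c) coalg \<Rightarrow> ('c \<Rightarrow> 'r \<Rightarrow> 's) \<Rightarrow>
     'c \<Rightarrow> ('k, 'r \<Rightarrow> 's) meas_univ" where
  "Mc_induced R R' C \<psi> = (THE f. f \<in> extensional (carrier C) \<and> coalg_hom C (Mc R R') f \<and>
     (\<forall>x\<in>carrier C. \<forall>a\<in>carrier R. phi_c R R' (f x) a = \<psi> x a))"

definition Mc_comp ::
  "('k::field, 'r) module \<Rightarrow> ('k, 'r) module \<Rightarrow> ('k, 'r) module \<Rightarrow>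
     (('k, 'r \<Rightarrow> 'r) meas_univ list \<Rightarrow>\<^sub>0 'k) set \<Rightarrow> ('k, 'r \<Rightarrow> 'r) meas_univ" where
  "Mc_comp R R' R'' = Mc_induced R R'' (tensor_coalg (Mc R R') (Mc R' R''))
     (\<lambda>t a. sweedler R'' (\<lambda>x x'. phi_c R' R'' x' (phi_c R R' x a)) t)"

definition Mc_unit :: "('k::field, 'r) module \<Rightarrow> 'k \<Rightarrow> ('k, 'r \<Rightarrow> 'r) meas_univ" where
  "Mc_unit R = Mc_induced R R unit_coalg (\<lambda>c a. c \<odot>\<^bsub>R\<^esub> a)"


section \<open>Hopf algebroids\<close>

record (overloaded) ('k, 'u, 'a) hopf_algebroid =
  total :: "('k::field, 'u) module"
  base :: "('k, 'a) module"
  src :: "'a \<Rightarrow> 'u"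
  tgt :: "'a \<Rightarrow> 'u"
  cop :: "'u \<Rightarrow> ('u list \<Rightarrow>\<^sub>0 'k) set"
  coun :: "'u \<Rightarrow> 'a"
  antip :: "'u \<Rightarrow> 'u"

text \<open>
  The \<open>n\<close>-fold tensor product of \<open>U\<close> over \<open>A\<^sub>L\<close>, with respect to
  \<open>a \<cdot> u \<cdot> b = s\<^sub>L(a) t\<^sub>L(b) u\<close>. Thus \<open>cop\<close> takes values in \<open>tensorL H 2\<close>.
\<close>

definition tensorL_rels :: "('k::field, 'u, 'a) hopf_algebroid \<Rightarrow> nat \<Rightarrow> ('u list \<Rightarrow>\<^sub>0 'k) set" where
  "tensorL_rels H n = multilin_rels (\<lambda>us. us) (replicate n (total H)) \<union>
     balanced_rels (\<lambda>us. us) (carrier (base H))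
       (\<lambda>u a. tgt H a \<otimes>\<^bsub>total H\<^esub> u) (\<lambda>a u. src H a \<otimes>\<^bsub>total H\<^esub> u) (replicate n (total H))"

definition tensorL :: "('k::field, 'u, 'a) hopf_algebroid \<Rightarrow> nat \<Rightarrow> ('k, ('u list \<Rightarrow>\<^sub>0 'k) set) module" where
  "tensorL H n = pres (tensor_gens (replicate n (total H))) (tensorL_rels H n)"

definition tensL :: "('k::field, 'u, 'a) hopf_algebroid \<Rightarrow> 'u list \<Rightarrow> ('u list \<Rightarrow>\<^sub>0 'k) set" where
  "tensL H us = pgen (tensor_gens (replicate (length us) (total H))) (tensorL_rels H (length us)) us"

definition takeuchi :: "('k::field, 'u, 'a) hopf_algebroid \<Rightarrow> ('u list \<Rightarrow>\<^sub>0 'k) set set" where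
  "takeuchi H = {w \<in> carrier (tensorL H 2). \<forall>a\<in>carrier (base H).
     sweedler (tensorL H 2) (\<lambda>u u'. tensL H [u \<otimes>\<^bsub>total H\<^esub> tgt H a, u']) w
     = sweedler (tensorL H 2) (\<lambda>u u'. tensL H [u, u' \<otimes>\<^bsub>total H\<^esub> src H a]) w}"

definition left_bialgebroid :: "('k::field, 'u, 'a) hopf_algebroid \<Rightarrow> bool" where
  "left_bialgebroid H \<longleftrightarrow>
    (let U = total H; A = base H; s = src H; t = tgt H; \<Delta> = cop H; \<epsilon> = coun H in
     k_algebra U \<and> k_algebra A \<and> alg_hom A U s \<and> alg_hom (op_alg A) U t \<and>
     (\<forall>a\<in>carrier A. \<forall>b\<in>carrier A. s a \<otimes>\<^bsub>U\<^esub> t b = t b \<otimes>\<^bsub>U\<^esub> s a) \<and>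
     klinear U (tensorL H 2) \<Delta> \<and> klinear U A \<epsilon> \<and>
     (\<forall>a\<in>carrier A. \<forall>b\<in>carrier A. \<forall>u\<in>carrier U.
        \<Delta> (s a \<otimes>\<^bsub>U\<^esub> t b \<otimes>\<^bsub>U\<^esub> u)
          = sweedler (tensorL H 2) (\<lambda>u1 u2. tensL H [s a \<otimes>\<^bsub>U\<^esub> u1, t b \<otimes>\<^bsub>U\<^esub> u2]) (\<Delta> u) \<and>
        \<epsilon> (s a \<otimes>\<^bsub>U\<^esub> t b \<otimes>\<^bsub>U\<^esub> u) = a \<otimes>\<^bsub>A\<^esub> \<epsilon> u \<otimes>\<^bsub>A\<^esub> b) \<and>
     (\<forall>u\<in>carrier U.
        sweedler (tensorL H 3) (\<lambda>u1 u2. sweedler (tensorL H 3) (\<lambda>v w. tensL H [v, w, u2]) (\<Delta> u1)) (\<Delta> u)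
        = sweedler (tensorL H 3) (\<lambda>u1 u2. sweedler (tensorL H 3) (\<lambda>v w. tensL H [u1, v, w]) (\<Delta> u2)) (\<Delta> u)) \<and>
     (\<forall>u\<in>carrier U. sweedler U (\<lambda>u1 u2. s (\<epsilon> u1) \<otimes>\<^bsub>U\<^esub> u2) (\<Delta> u) = u \<and>
                    sweedler U (\<lambda>u1 u2. t (\<epsilon> u2) \<otimes>\<^bsub>U\<^esub> u1) (\<Delta> u) = u) \<and>
     \<Delta> ` carrier U \<subseteq> takeuchi H \<and>
     \<Delta> \<one>\<^bsub>U\<^esub> = tensL H [\<one>\<^bsub>U\<^esub>, \<one>\<^bsub>U\<^esub>] \<and>
     (\<forall>u\<in>carrier U. \<forall>v\<in>carrier U.
        \<Delta> (u \<otimes>\<^bsub>U\<^esub> v)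
          = sweedler2 (tensorL H 2) (\<lambda>u1 u2 v1 v2. tensL H [u1 \<otimes>\<^bsub>U\<^esub> v1, u2 \<otimes>\<^bsub>U\<^esub> v2]) (\<Delta> u) (\<Delta> v)) \<and>
     (\<forall>u\<in>carrier U. \<forall>v\<in>carrier U.
        \<epsilon> (u \<otimes>\<^bsub>U\<^esub> s (\<epsilon> v)) = \<epsilon> (u \<otimes>\<^bsub>U\<^esub> v) \<and> \<epsilon> (u \<otimes>\<^bsub>U\<^esub> v) = \<epsilon> (u \<otimes>\<^bsub>U\<^esub> t (\<epsilon> v))))"

definition is_hopf_algebroid :: "('k::field, 'u, 'a) hopf_algebroid \<Rightarrow> bool" where
  "is_hopf_algebroid H \<longleftrightarrow> left_bialgebroid H \<and>
    (let U = total H; A = base H; s = src H; t = tgt H; \<Delta> = cop H; S = antip H in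
     alg_hom U (op_alg U) S \<and> (\<forall>u\<in>carrier U. S (S u) = u) \<and>
     (\<forall>a\<in>carrier A. S (t a) = s a) \<and>
     (\<forall>u\<in>carrier U.
        sweedler (tensorL H 2)
          (\<lambda>u1 u2. sweedler (tensorL H 2) (\<lambda>v1 v2. tensL H [v1 \<otimes>\<^bsub>U\<^esub> u2, v2]) (\<Delta> (S u1))) (\<Delta> u)
        = tensL H [\<one>\<^bsub>U\<^esub>, S u] \<and>
        sweedler (tensorL H 2)
          (\<lambda>u1 u2. sweedler (tensorL H 2) (\<lambda>v1 v2. tensL H [v1, v2 \<otimes>\<^bsub>U\<^esub> u1]) (\<Delta> (S u2))) (\<Delta> u)
        = tensL H [S u, \<one>\<^bsub>U\<^esub>]))"

definition comm_hopf_algebroid :: "('k::field, 'u, 'a) hopf_algebroid \<Rightarrow> bool" where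
  "comm_hopf_algebroid H \<longleftrightarrow> is_hopf_algebroid H \<and> cring (total H) \<and> cring (base H)"


section \<open>Measurings of Hopf algebroids\<close>

definition hopf_measuring ::
  "('k::field, 'u, 'a) hopf_algebroid \<Rightarrow> ('k, 'v, 'b) hopf_algebroid \<Rightarrow> ('k, 'c) coalg \<Rightarrow>
     ('c \<Rightarrow> 'u \<Rightarrow> 'v) \<Rightarrow> ('c \<Rightarrow> 'a \<Rightarrow> 'b) \<Rightarrow> bool" where
  "hopf_measuring H H' C \<Psi> \<psi> \<longleftrightarrow>
     alg_measuring (total H) (total H') C \<Psi> \<and> alg_measuring (base H) (base H') C \<psi> \<and>
     (\<forall>x\<in>carrier C.
        (\<forall>a\<in>carrier (base H). \<Psi> x (src H a) = src H' (\<psi> x a) \<and> \<Psi> x (tgt H a) = tgt H' (\<psi> x a)) \<and>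
        (\<forall>u\<in>carrier (total H).
           \<Psi> x (antip H u) = antip H' (\<Psi> x u) \<and> \<psi> x (coun H u) = coun H' (\<Psi> x u) \<and>
           cop H' (\<Psi> x u) = sweedler2 (tensorL H' 2)
             (\<lambda>x1 x2 u1 u2. tensL H' [\<Psi> x1 u1, \<Psi> x2 u2]) (comult C x) (cop H u)))"

definition final_hopf_measuring ::
  "'c itself \<Rightarrow> ('k::field, 'u, 'a) hopf_algebroid \<Rightarrow> ('k, 'v, 'b) hopf_algebroid \<Rightarrow> ('k, 'm) coalg \<Rightarrow>
     ('m \<Rightarrow> 'u \<Rightarrow> 'v) \<Rightarrow> ('m \<Rightarrow> 'a \<Rightarrow> 'b) \<Rightarrow> bool" where
  "final_hopf_measuring _ H H' M \<Phi> \<phi> \<longleftrightarrow> cocomm_coalgebra M \<and> hopf_measuring H H' M \<Phi> \<phi> \<and>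
     (\<forall>(C :: ('k, 'c) coalg) \<Psi> \<psi>. cocomm_coalgebra C \<and> hopf_measuring H H' C \<Psi> \<psi> \<longrightarrow>
        (\<exists>!f. f \<in> extensional (carrier C) \<and> coalg_hom C M f \<and>
              (\<forall>x\<in>carrier C. (\<forall>u\<in>carrier (total H). \<Phi> (f x) u = \<Psi> x u) \<and>
                             (\<forall>a\<in>carrier (base H). \<phi> (f x) a = \<psi> x a))))"

type_synonym ('k, 'u, 'a, 'v, 'b) hopf_univ = "('k, ('u \<Rightarrow> 'v) \<times> ('a \<Rightarrow> 'b)) meas_univ"

definition HMc_phi ::
  "('k::field, 'u, 'a) hopf_algebroid \<Rightarrow> ('k, 'v, 'b) hopf_algebroid \<Rightarrow>
     ('k, ('k, 'u, 'a, 'v, 'b) hopf_univ) coalg \<times>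
     (('k, 'u, 'a, 'v, 'b) hopf_univ \<Rightarrow> 'u \<Rightarrow> 'v) \<times> (('k, 'u, 'a, 'v, 'b) hopf_univ \<Rightarrow> 'a \<Rightarrow> 'b)" where
  "HMc_phi H H' = (SOME (M, \<Phi>, \<phi>).
     final_hopf_measuring TYPE(('k, 'u, 'a, 'v, 'b) hopf_univ) H H' M \<Phi> \<phi>)"

definition HMc ::
  "('k::field, 'u, 'a) hopf_algebroid \<Rightarrow> ('k, 'v, 'b) hopf_algebroid \<Rightarrow>
     ('k, ('k, 'u, 'a, 'v, 'b) hopf_univ) coalg" where
  "HMc H H' = fst (HMc_phi H H')"

definition Phi_tot ::
  "('k::field, 'u, 'a) hopf_algebroid \<Rightarrow> ('k, 'v, 'b) hopf_algebroid \<Rightarrow>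
     ('k, 'u, 'a, 'v, 'b) hopf_univ \<Rightarrow> 'u \<Rightarrow> 'v" where
  "Phi_tot H H' = fst (snd (HMc_phi H H'))"

definition phi_base ::
  "('k::field, 'u, 'a) hopf_algebroid \<Rightarrow> ('k, 'v, 'b) hopf_algebroid \<Rightarrow>
     ('k, 'u, 'a, 'v, 'b) hopf_univ \<Rightarrow> 'a \<Rightarrow> 'b" where
  "phi_base H H' = snd (snd (HMc_phi H H'))"

definition HMc_induced ::
  "('k::field, 'u, 'a) hopf_algebroid \<Rightarrow> ('k, 'v, 'b) hopf_algebroid \<Rightarrow> ('k, 'c) coalg \<Rightarrow>
     ('c \<Rightarrow> 'u \<Rightarrow> 'v) \<Rightarrow> ('c \<Rightarrow> 'a \<Rightarrow> 'b) \<Rightarrow> 'c \<Rightarrow> ('k, 'u, 'a, 'v, 'b) hopf_univ" where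
  "HMc_induced H H' C \<Psi> \<psi> = (THE f. f \<in> extensional (carrier C) \<and> coalg_hom C (HMc H H') f \<and>
     (\<forall>x\<in>carrier C. (\<forall>u\<in>carrier (total H). Phi_tot H H' (f x) u = \<Psi> x u) \<and>
                    (\<forall>a\<in>carrier (base H). phi_base H H' (f x) a = \<psi> x a)))"

definition HALG ::
  "(('k::field, 'u, 'a) hopf_algebroid, 'k, ('k, 'u, 'a, 'u, 'a) hopf_univ) ecat" where
  "HALG = \<lparr>Ob = {H. is_hopf_algebroid H}, Hom = HMc,
     Comp = (\<lambda>H H' H''. HMc_induced H H'' (tensor_coalg (HMc H H') (HMc H' H''))
       (\<lambda>t u. sweedler (total H'') (\<lambda>x x'. Phi_tot H' H'' x' (Phi_tot H H' x u)) t)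
       (\<lambda>t a. sweedler (base H'') (\<lambda>x x'. phi_base H' H'' x' (phi_base H H' x a)) t)),
     Unit = (\<lambda>H. HMc_induced H H unit_coalg (\<lambda>c u. c \<odot>\<^bsub>total H\<^esub> u) (\<lambda>c a. c \<odot>\<^bsub>base H\<^esub> a))\<rparr>"

definition cHALG ::
  "(('k::field, 'u, 'a) hopf_algebroid, 'k, ('k, 'u, 'a, 'u, 'a) hopf_univ) ecat" where
  "cHALG = HALG\<lparr>Ob := {H. comm_hopf_algebroid H}\<rparr>"


section \<open>Hochschild homology and the shuffle product\<close>

text \<open>
  The graded vector space \<open>C_\<bullet>(U) = \<Oplus>\<^sub>n C_n(U)\<close> is presented by homogeneous generators and
  relations: in degree 0 the elements of \<open>A\<close> with the linear relations among them, in degree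
  \<open>n \<ge> 1\<close> the elementary tensors of length \<open>n\<close> with the relations of the tensor product over
  \<open>A\<^sub>R = A\<^sub>L\<^sup>o\<^sup>p\<close>. Here \<open>a \<cdot> u \<cdot> b = s\<^sub>R(a) u s\<^sub>R(b)\<close> with \<open>s\<^sub>R = t\<^sub>L\<close>.
\<close>

datatype ('u, 'a) word = Base 'a | Tens "'u list"

definition chain_gens :: "('k::field, 'u, 'a) hopf_algebroid \<Rightarrow> nat \<Rightarrow> ('u, 'a) word set" where
  "chain_gens H n =
     (if n = 0 then Base ` carrier (base H) else Tens ` tensor_gens (replicate n (total H)))"

definition chain_rels :: "('k::field, 'u, 'a) hopf_algebroid \<Rightarrow> nat \<Rightarrow> (('u, 'a) word \<Rightarrow>\<^sub>0 'k) set" where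
  "chain_rels H n =
     (if n = 0 then multilin_rels (\<lambda>as. Base (hd as)) [base H]
      else multilin_rels Tens (replicate n (total H)) \<union>
        balanced_rels Tens (carrier (base H))
          (\<lambda>u a. u \<otimes>\<^bsub>total H\<^esub> tgt H a) (\<lambda>a u. tgt H a \<otimes>\<^bsub>total H\<^esub> u) (replicate n (total H)))"

definition chains ::
  "('k::field, 'u, 'a) hopf_algebroid \<Rightarrow> ('k, (('u, 'a) word \<Rightarrow>\<^sub>0 'k) set) module" where
  "chains H = pres (\<Union>n. chain_gens H n) (\<Union>n. chain_rels H n)"

definition chain ::
  "('k::field, 'u, 'a) hopf_algebroid \<Rightarrow> ('u, 'a) word \<Rightarrow> (('u, 'a) word \<Rightarrow>\<^sub>0 'k) set" where
  "chain H w = pgen (\<Union>n. chain_gens H n) (\<Union>n. chain_rels H n) w"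

definition counR :: "('k::field, 'u, 'a) hopf_algebroid \<Rightarrow> 'u \<Rightarrow> 'a" where
  "counR H u = coun H (antip H u)"

text \<open>The face \<open>d_i\<close> on the elementary tensor \<open>us\<close> of length \<open>n \<ge> 1\<close>, for \<open>i \<le> n\<close>.\<close>

definition face :: "('k::field, 'u, 'a) hopf_algebroid \<Rightarrow> nat \<Rightarrow> 'u list \<Rightarrow> ('u, 'a) word" where
  "face H i us = (let n = length us; U = total H in
     if n = 1 then Base (if i = 0 then counR H (us ! 0) else counR H (antip H (us ! 0)))
     else if i = 0 then Tens ((tgt H (counR H (us ! 0)) \<otimes>\<^bsub>U\<^esub> us ! 1) # drop 2 us)
     else if i < n then Tens (take (i - 1) us @ (us ! (i - 1) \<otimes>\<^bsub>U\<^esub> us ! i) # drop (i + 1) us)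
     else Tens (take (n - 2) us @ [us ! (n - 2) \<otimes>\<^bsub>U\<^esub> tgt H (counR H (antip H (us ! (n - 1))))]))"

definition differential ::
  "('k::field, 'u, 'a) hopf_algebroid \<Rightarrow> (('u, 'a) word \<Rightarrow>\<^sub>0 'k) set \<Rightarrow> (('u, 'a) word \<Rightarrow>\<^sub>0 'k) set" where
  "differential H = lin_ext (chains H) (\<lambda>w. case w of
       Base a \<Rightarrow> \<zero>\<^bsub>chains H\<^esub>
     | Tens us \<Rightarrow> (\<Oplus>\<^bsub>chains H\<^esub>i\<in>{..length us}. (- 1) ^ i \<odot>\<^bsub>chains H\<^esub> chain H (face H i us)))"

text \<open>Shuffles are indexed from 0.\<close>

definition Sh :: "nat \<Rightarrow> nat \<Rightarrow> (nat \<Rightarrow> nat) set" where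
  "Sh p q = {\<sigma>. \<sigma> permutes {..<p + q} \<and> strict_mono_on {..<p} \<sigma> \<and> strict_mono_on {p..<p + q} \<sigma>}"

definition shuffle ::
  "('k::field, 'u, 'a) hopf_algebroid \<Rightarrow> (('u, 'a) word \<Rightarrow>\<^sub>0 'k) set \<Rightarrow> (('u, 'a) word \<Rightarrow>\<^sub>0 'k) set \<Rightarrow>
     (('u, 'a) word \<Rightarrow>\<^sub>0 'k) set" where
  "shuffle H = lin_ext2 (chains H) (\<lambda>v w. case (v, w) of
       (Base a, Base b) \<Rightarrow> chain H (Base (a \<otimes>\<^bsub>base H\<^esub> b))
     | (Tens us, Base a) \<Rightarrow> chain H (Tens ((tgt H a \<otimes>\<^bsub>total H\<^esub> hd us) # tl us))
     | (Base a, Tens us) \<Rightarrow> chain H (Tens (butlast us @ [last us \<otimes>\<^bsub>total H\<^esub> tgt H a]))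
     | (Tens us, Tens vs) \<Rightarrow> (\<Oplus>\<^bsub>chains H\<^esub>\<sigma>\<in>Sh (length us) (length vs).
         of_int (sign \<sigma>) \<odot>\<^bsub>chains H\<^esub>
           chain H (Tens (map (\<lambda>i. (us @ vs) ! inv_into UNIV \<sigma> i) [0..<length us + length vs]))))"

definition cycles :: "('k::field, 'u, 'a) hopf_algebroid \<Rightarrow> (('u, 'a) word \<Rightarrow>\<^sub>0 'k) set set" where
  "cycles H = {t \<in> carrier (chains H). differential H t = \<zero>\<^bsub>chains H\<^esub>}"

definition boundaries :: "('k::field, 'u, 'a) hopf_algebroid \<Rightarrow> (('u, 'a) word \<Rightarrow>\<^sub>0 'k) set set" where
  "boundaries H = differential H ` carrier (chains H)"

text \<open>
  \<open>HH_\<bullet>(U) = \<Oplus>\<^sub>n HH_n(U)\<close>, as the homology of the graded space \<open>C_\<bullet>(U)\<close> with its differential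
  of degree -1, and with the product induced by the shuffle product.
\<close>

definition HH ::
  "('k::field, 'u, 'a) hopf_algebroid \<Rightarrow> ('k, (('u, 'a) word \<Rightarrow>\<^sub>0 'k) set set) module" where
  "HH H = (quot_space ((chains H)\<lparr>carrier := cycles H\<rparr>) (boundaries H))
     \<lparr>monoid.mult := (\<lambda>X Y. \<Union>x\<in>X. \<Union>y\<in>Y. boundaries H +>\<^bsub>chains H\<^esub> shuffle H x y),
      one := boundaries H +>\<^bsub>chains H\<^esub> chain H (Base \<one>\<^bsub>base H\<^esub>)\<rparr>"

definition chain_meas ::
  "('k::field, 'v, 'b) hopf_algebroid \<Rightarrow> ('k, 'c) coalg \<Rightarrow> ('c \<Rightarrow> 'u \<Rightarrow> 'v) \<Rightarrow> ('c \<Rightarrow> 'a \<Rightarrow> 'b) \<Rightarrow>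
     'c \<Rightarrow> (('u, 'a) word \<Rightarrow>\<^sub>0 'k) set \<Rightarrow> (('v, 'b) word \<Rightarrow>\<^sub>0 'k) set" where
  "chain_meas H' C \<Psi> \<psi> x = lin_ext (chains H') (\<lambda>w. case w of
       Base a \<Rightarrow> chain H' (Base (\<psi> x a))
     | Tens us \<Rightarrow> lin_ext (chains H') (\<lambda>xs. chain H' (Tens (map2 \<Psi> xs us))) (iter_comult C (length us) x))"

definition hoc ::
  "('k::field, 'v, 'b) hopf_algebroid \<Rightarrow> ('k, 'c) coalg \<Rightarrow> ('c \<Rightarrow> 'u \<Rightarrow> 'v) \<Rightarrow> ('c \<Rightarrow> 'a \<Rightarrow> 'b) \<Rightarrow>
     'c \<Rightarrow> (('u, 'a) word \<Rightarrow>\<^sub>0 'k) set set \<Rightarrow> (('v, 'b) word \<Rightarrow>\<^sub>0 'k) set set" where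
  "hoc H' C \<Psi> \<psi> x X = (\<Union>t\<in>X. boundaries H' +>\<^bsub>chains H'\<^esub> chain_meas H' C \<Psi> \<psi> x t)"


section \<open>The target category and the map on hom-objects\<close>

type_synonym ('k, 'u, 'a) hh_univ =
  "('k, (('u, 'a) word \<Rightarrow>\<^sub>0 'k) set set \<Rightarrow> (('u, 'a) word \<Rightarrow>\<^sub>0 'k) set set) meas_univ"

definition cHALG_tilde ::
  "(('k::field, 'u, 'a) hopf_algebroid, 'k, ('k, 'u, 'a) hh_univ) ecat" where
  "cHALG_tilde = \<lparr>Ob = {H. comm_hopf_algebroid H}, Hom = (\<lambda>H H'. Mc (HH H) (HH H')),
     Comp = (\<lambda>H H' H''. Mc_comp (HH H) (HH H') (HH H'')), Unit = (\<lambda>H. Mc_unit (HH H))\<rparr>"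

definition Phi_hoc ::
  "('k::field, 'u, 'a) hopf_algebroid \<Rightarrow> ('k, 'u, 'a) hopf_algebroid \<Rightarrow>
     ('k, 'u, 'a, 'u, 'a) hopf_univ \<Rightarrow> (('u, 'a) word \<Rightarrow>\<^sub>0 'k) set set \<Rightarrow> (('u, 'a) word \<Rightarrow>\<^sub>0 'k) set set" where
  "Phi_hoc H H' = hoc H' (HMc H H') (Phi_tot H H') (phi_base H H')"

definition tau ::
  "('k::field, 'u, 'a) hopf_algebroid \<Rightarrow> ('k, 'u, 'a) hopf_algebroid \<Rightarrow>
     ('k, 'u, 'a, 'u, 'a) hopf_univ \<Rightarrow> ('k, 'u, 'a) hh_univ" where
  "tau H H' = Mc_induced (HH H) (HH H') (HMc H H') (Phi_hoc H H')"

end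

theory Submission
  imports Defs "HOL-Library.Countable_Set"
begin

text \<open>
  A final measuring is realised as the largest separated quotient of a direct sum of countable-dimensional
  measurings; hence linear maps separate its elements modulo coideals, and the identities for composition, units
  and functoriality reduce to identities between the linear maps that the measurings parametrise.
  On chains, every operation is a recursion over the first tensor factor. A measuring acts by
  \<open>\<theta>\<^sub>x(u \<otimes> w) = \<Psi>(x\<^sub>1)(u) \<otimes> \<theta>\<^sub>y(w)\<close> with \<open>y = x\<^sub>2\<close>, the shuffle product satisfies
  \<open>(u \<otimes> x) \<cdot> (v \<otimes> y) = u \<otimes> (x \<cdot> (v \<otimes> y)) \<plusminus> v \<otimes> ((u \<otimes> x) \<cdot> y)\<close>, and so the Leibniz rule and the
  compatibility of \<open>\<theta>\<close> with differentials and shuffles follow by induction.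
\<close>

text \<open>The definitions choose \<open>Mc\<close> and \<open>HMc\<close> by \<open>SOME\<close>,
  with finality promised only for coalgebras on one universe type, while composition is induced from
  tensor coalgebras living on other types. Separatedness bridges the gap: it mentions no test
  coalgebra, passes from the constructed object to whichever final object was chosen, and yields
  uniqueness of maps from coalgebras of every type. Existence is obtained by gluing over
  countable-dimensional subcoalgebras. A second difficulty is that formulas on generators are
  evaluated as unique elements of images, hence each must be shown independent of representatives.
  Over a Hopf algebroid this fails termwise: carrying a base element across a tensor sign permutes
  Sweedler legs, and only the sum over a cocommutative coproduct is balanced. Kernels of maps
  between tensor products are avoided: coideals are tested in the tensor square of the quotient, and
  subcoalgebras come with linear retractions. Signs of the shuffle product depend on degree; they
  are carried by the operator \<open>sop\<close>, so that identities can be stated for arbitrary,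
  inhomogeneous chains.\<close>

abbreviation (input) mem_carrier (infix ".:" 50) where "x .: V == x \<in> carrier V"
abbreviation (input) vadd ("_ +[_] _" [65, 0, 66] 65) where "x +[V] y == x \<oplus>\<^bsub>V\<^esub> y"
abbreviation (input) vsmult ("_ *.[_] _" [70, 0, 71] 70) where "c *.[V] x == c \<odot>\<^bsub>V\<^esub> x"
abbreviation (input) rmult ("_ **[_] _" [70, 0, 71] 70) where "x **[U] y == x \<otimes>\<^bsub>U\<^esub> y"
abbreviation (input) vcoset ("_ +>[_] _" [60, 0, 61] 60) where "N +>[V] x == N +>\<^bsub>V\<^esub> x"
abbreviation (input) vzero ("0.[_]") where "0.[V] == \<zero>\<^bsub>V\<^esub>"
abbreviation (input) rone ("1.[_]") where "1.[U] == \<one>\<^bsub>U\<^esub>"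

abbreviation (input) "lin == klinear"
abbreviation (input) "ccoalg == cocomm_coalgebra"
abbreviation (input) "chopf == comm_hopf_algebroid"
abbreviation (input) "tgens == tensor_gens"
abbreviation (input) "ameas == alg_measuring"
abbreviation (input) "hmeas == hopf_measuring"
abbreviation (input) "keys == Poly_Mapping.keys"
abbreviation (input) "lookup == Poly_Mapping.lookup"
abbreviation (input) "single == Poly_Mapping.single"
abbreviation (input) "car == carrier"
abbreviation (input) "quot == quot_space"
abbreviation (input) "chom == coalg_hom"
abbreviation (input) "CompT == Comp cHALG_tilde"
type_synonym ('k, 'u, 'a) halg = "('k, 'u, 'a) hopf_algebroid"
type_synonym ('k, 'v, 'z) msch = "('k, 'v, 'z) module_scheme"
abbreviation (input) iff_ascii (infixr "<->" 25) where "a <-> b == (a :: bool) = b"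

section \<open>Vector spaces over the ground field\<close>

lemma ground_simps [simp]:
 "car (ground :: ('k::field,'k) module) = UNIV"
 "0.[(ground :: ('k::field,'k) module)] = 0" "1.[(ground :: ('k::field,'k) module)] = 1"
 "x +[(ground :: ('k::field,'k) module)] y = x + y"
 "x **[(ground :: ('k::field,'k) module)] y = x * y"
 "x *.[(ground :: ('k::field,'k) module)] y = x * y"
 by (simp_all add: ground_def)

lemma cring_ground: "cring (ground :: ('k::field,'k) module)"
proof (rule cringI)
 show "abelian_group (ground :: ('k,'k) module)"
 by (rule abelian_groupI) (auto simp:add.assoc add.commute intro: exI[of _ "- x" for x])
 show "comm_monoid (ground :: ('k,'k) module)"
 by (rule comm_monoidI) (auto simp:mult.assoc mult.commute)
qed (auto simp:distrib_right)

lemma vspaceI: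
 fixes V :: "('k::field,'v,'z) msch"
 assumes "0.[V] .: V"
 and "!!x y. x .: V ==> y .: V ==> x +[V] y .: V"
 and cl: "!!c x. x .: V ==> c *.[V] x .: V"
 and "!!x y z. x .: V ==> y .: V ==> z .: V ==>
 (x +[V] y) +[V] z = x +[V] (y +[V] z)"
 and cm: "!!x y. x .: V ==> y .: V ==> x +[V] y = y +[V] x"
 and "!!x. x .: V ==> 0.[V] +[V] x = x"
 and neg: "!!x. x .: V ==> (- 1) *.[V] x +[V] x = 0.[V]"
 and "!!a b x. x .: V ==> (a + b) *.[V] x = a *.[V] x +[V] b *.[V] x"
 and "!!a x y. x .: V ==> y .: V ==>
 a *.[V] (x +[V] y) = a *.[V] x +[V] a *.[V] y"
 and "!!a b x. x .: V ==> (a * b) *.[V] x = a *.[V] (b *.[V] x)"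
 and "!!x. x .: V ==> 1 *.[V] x = x"
 shows "vspace V"
proof (rule moduleI[OF cring_ground])
 show "abelian_group V"
 proof (rule abelian_groupI)
 fix x assume "x .: V"
 then show "EX y:car V. y +[V] x = 0.[V]" using neg cl by blast
 qed (use assms in auto)
qed (use assms in auto)

context
 fixes V :: "('k::field,'v,'z) msch"
 assumes V: "vspace V"
begin

interpretation module ground V by (rule V)

lemma vs_abelian: "abelian_group V" ..

lemma vs_closed [simp, intro]:
 "0.[V] .: V"
 "x .: V ==> y .: V ==> x +[V] y .: V"
 "x .: V ==> c *.[V] x .: V"
 by auto

lemma vs_add_ac:
 "x .: V ==> y .: V ==> x +[V] y = y +[V] x"
 "x .: V ==> y .: V ==> z .: V ==> (x +[V] y) +[V] z = x +[V] (y +[V] z)"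
 "x .: V ==> y .: V ==> z .: V ==> x +[V] (y +[V] z) = y +[V] (x +[V] z)"
 by (auto simp:M.a_ac)

lemma vs_zero [simp]:
 "x .: V ==> 0.[V] +[V] x = x" "x .: V ==> x +[V] 0.[V] = x"
 "c *.[V] 0.[V] = 0.[V]" "x .: V ==> 0 *.[V] x = 0.[V]" "x .: V ==> 1 *.[V] x = x"
 using smult_l_null[of x] smult_r_null[of c] smult_one[of x] by auto

lemma vs_smult:
 "x .: V ==> (a + b) *.[V] x = a *.[V] x +[V] b *.[V] x"
 "x .: V ==> y .: V ==> a *.[V] (x +[V] y) = a *.[V] x +[V] a *.[V] y"
 "x .: V ==> (a * b) *.[V] x = a *.[V] (b *.[V] x)"
 using smult_l_distr[of a b x] smult_r_distr[of a x y] smult_assoc1[of a b x] by auto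

lemma vs_smultC: "x .: V ==> a *.[V] (b *.[V] x) = b *.[V] (a *.[V] x)"
 by (simp only:vs_smult(3)[symmetric] mult.commute)

lemma vs_neg:
 assumes x: "x .: V"
 shows "x +[V] (- 1) *.[V] x = 0.[V]" "\<ominus>\<^bsub>V\<^esub> x = (- 1) *.[V] x"
proof -
 have "1 *.[V] x +[V] (- 1) *.[V] x = (1 + - 1) *.[V] x" by (simp only:vs_smult(1)[OF x])
 then show *: "x +[V] (- 1) *.[V] x = 0.[V]" using x by simp
 then show "\<ominus>\<^bsub>V\<^esub> x = (- 1) *.[V] x" using x M.minus_equality[of "(- 1) *.[V] x" x]
 by (simp add:vs_add_ac(1))
qed

lemma vs_eq_iff:
 assumes "x .: V" "y .: V"
 shows "x = y <-> x +[V] (- 1) *.[V] y = 0.[V]"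
 using assms vs_neg[OF assms(2)] M.add.inv_solve_right'[of "0.[V]" x y] by (auto simp:a_minus_def)

lemma vs_finsum_closed [simp, intro]: "f:A \<rightarrow> car V ==> finsum V f A .: V"
 by (rule M.finsum_closed)

lemma submI:
 assumes "N <= car V" "0.[V] : N" "!!x y. x:N ==> y:N ==> x +[V] y:N"
 "!!c x. x:N ==> c *.[V] x:N"
 shows "submodule N ground V"
proof (rule submoduleI)
 fix x assume "x:N"
 then show "\<ominus>\<^bsub>V\<^esub> x:N" using assms vs_neg(2)[of x] by auto
qed (use assms in auto)

lemma submD:
 assumes "submodule N ground V"
 shows "N <= car V" "0.[V] : N" "x:N ==> y:N ==> x +[V] y:N" "x:N ==> c *.[V] x:N"
 using submoduleE[OF assms] subgroup.one_closed[OF submodule.axioms(1)[OF assms]] by auto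

lemma vspace_restrict: "submodule N ground V ==> vspace (V\<lparr>carrier := N\<rparr>)"
 by (rule submodule.submodule_is_module[OF _ module_axioms])

end

lemma linI:
 assumes "!!x. x .: V ==> f x .: W"
 "!!x y. x .: V ==> y .: V ==> f (x +[V] y) = f x +[W] f y"
 "!!c x. x .: V ==> f (c *.[V] x) = c *.[W] f x"
 shows "lin V W f"
 using assms by (auto simp:klinear_def)

lemma linD:
 assumes "lin V W f"
 shows "x .: V ==> f x .: W"
 "x .: V ==> y .: V ==> f (x +[V] y) = f x +[W] f y"
 "x .: V ==> f (c *.[V] x) = c *.[W] f x"
 using assms by (auto simp:klinear_def)
lemmas lin1 = linD(1) and lin2 = linD(2) and lin3 = linD(3)

lemma lin_zero: "lin V W f ==> vspace V ==> vspace W ==> f 0.[V] = 0.[W]"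
 using linD(1)[of V W f "0.[V]"] lin3[of V W f "0.[V]" 0] by simp

lemma lin_cong:
 assumes "vspace V" "!!x. x .: V ==> f x = g x"
 shows "lin V W f <-> lin V W g"
 using assms by (auto simp:klinear_def Pi_def)

lemma linc: "lin V W f ==> lin W X g ==> lin V X (%x. g (f x))"
 by (auto simp:klinear_def Pi_def)

lemma lin_id: "lin V V (%x. x)"
 by (auto simp:klinear_def)

lemma lin_finsum:
 assumes f: "lin V W f" and V: "vspace V" and W: "vspace W" and g: "g:A \<rightarrow> car V"
 shows "f (finsum V g A) = finsum W (%i. f (g i)) A"
proof -
 interpret V: module ground V by (rule V)
 interpret W: module ground W by (rule W)
 show ?thesis
 proof (cases "finite A")
 case True
 then show ?thesis using g
 proof (induction A)
 case (insert a A)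
 then have "f (g a) .: W" "(%i. f (g i)):A \<rightarrow> car W"
 using linD(1)[OF f] by auto
 with insert show ?case by (simp add:V.M.finsum_closed linD(2)[OF f])
 qed (simp add:lin_zero[OF f V W])
 qed (simp add:V.M.finsum_infinite W.M.finsum_infinite lin_zero[OF f V W])
qed

lemma vspace_ground: "vspace (ground :: ('k::field,'k) module)"
 by (rule vspaceI) (auto simp:algebra_simps)

lemma finsum_ground: "finsum (ground :: ('k::field,'k) module) f A = sum f A"
proof -
 interpret W: abelian_group "ground :: ('k::field,'k) module" by (rule vs_abelian[OF vspace_ground])
 show ?thesis
 by (cases "finite A", induction A rule:finite_induct) (auto simp:Pi_def W.add.finprod_infinite)
qed

text \<open>Zorn's lemma gives a maximal subspace \<open>K\<close> meeting the image of \<open>j\<close> trivially; it is a complement.\<close>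

lemma left_inverse:
 fixes E :: "('k::field,'e,'y) msch" and C :: "('k,'c,'z) msch"
 assumes E: "vspace E" and C: "vspace C" and j: "lin E C j"
 and inj: "!!e. e .: E ==> j e = 0.[C] ==> e = 0.[E]"
 obtains r where "lin C E r" "!!e. e .: E ==> r (j e) = e"
proof -
 let ?P = "{K. submodule K ground C & (ALL e:car E. j e:K --> e = 0.[E])}"
 have z: "{0.[C]} : ?P" using inj C by (auto intro!:submI)
 have "EX K:?P. ALL X:?P. K <= X --> X = K"
 proof (rule Zorn_Lemma2, intro ballI)
 fix c assume c: "c:Zorn.chains ?P"
 show "EX U:?P. ALL X:c. X <= U"
 proof (cases "c = {}")
 case False
 have sub: "submodule X ground C" if "X:c" for X using c that by (auto simp:Zorn.chains_def)
 have ch: "X <= Y | Y <= X" if "X:c" "Y:c" for X Y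
 using c that by (auto simp:Zorn.chains_def chain_subset_def)
 have "submodule (\<Union>c) ground C"
 proof (rule submI[OF C])
 show "\<Union>c <= car C" using submD(1)[OF C sub] by auto
 show "0.[C] : \<Union>c" using False submD(2)[OF C sub] by auto
 fix x y assume "x : \<Union>c" "y : \<Union>c"
 then show "x +[C] y : \<Union>c" using ch submD(3)[OF C sub] by (elim UnionE) (metis UnionI subsetD)
 qed (use submD(4)[OF C sub] in auto)
 moreover have "e = 0.[E]" if "e .: E" "j e : \<Union>c" for e
 using that c by (auto simp:Zorn.chains_def)
 ultimately have "\<Union>c : ?P" by blast
 then show ?thesis by blast
 qed (use z in auto)
 qed
 then obtain K where K: "submodule K ground C" "!!e. e .: E ==> j e:K ==> e = 0.[E]"
 and max: "!!X. X : ?P ==> K <= X ==> X = K" by (elim bexE) (simp, blast)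
 note KD = submD[OF C K(1)]
 have jc [simp]: "!!e. e .: E ==> j e .: C" by (rule linD(1)[OF j])
 note [simp] = E C
 \<comment> \<open>The difference of the two decompositions puts \<open>j\<close> of e - e' into
   \<open>K\<close>, which meets the image of \<open>j\<close> only in zero.\<close>
 have uniq: "e = e'" if "e .: E" "e' .: E" "k:K" "k':K" "j e +[C] k = j e' +[C] k'" for e e' k k'
 proof -
 have kk: "k .: C" "k' .: C" using that KD(1) by auto
 have "j (e +[E] (- 1) *.[E] e') = j e +[C] (- 1) *.[C] j e'" using that by (simp add:linD[OF j])
 also have "... = (j e +[C] k) +[C] ((- 1) *.[C] k +[C] (- 1) *.[C] j e')"
 proof -
 have "(j e +[C] k) +[C] ((- 1) *.[C] k +[C] (- 1) *.[C] j e')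
 = j e +[C] ((k +[C] (- 1) *.[C] k) +[C] (- 1) *.[C] j e')"
 using that(1,2) kk by (simp add:vs_add_ac(2,3)[OF C] vs_add_ac(1)[OF C, of k])
 then show ?thesis using that kk by (simp add:vs_neg[OF C])
 qed
 also have "... = (k' +[C] (- 1) *.[C] k) +[C] (j e' +[C] (- 1) *.[C] j e')"
 unfolding that(5) using that kk by (simp add:vs_add_ac[OF C])
 also have "... = k' +[C] (- 1) *.[C] k" using that kk by (simp add:vs_neg[OF C])
 finally have "j (e +[E] (- 1) *.[E] e'):K" using KD that by simp
 then have "e +[E] (- 1) *.[E] e' = 0.[E]" using K(2) that by simp
 then show ?thesis using vs_eq_iff[OF E that(1,2)] by simp
 qed
 \<comment> \<open>If \<open>x\<close> is not in \<open>K\<close>, maximality makes the span of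
   \<open>K\<close> and \<open>x\<close> meet the image of \<open>j\<close> nontrivially. In an
   equation j e = k + c x with e nonzero the coefficient c cannot vanish, so \<open>x\<close> can be
   solved for.\<close>
 have ex: "EX e k. e .: E & k:K & x = j e +[C] k" if x: "x .: C" for x
 proof (cases "x:K")
 case True
 then show ?thesis using KD(1) x by (intro exI[of _ "0.[E]"] exI[of _ x]) (auto simp:lin_zero[OF j E C])
 next
 case False
 let ?K = "{k +[C] c *.[C] x | k c. k:K}"
 have KC: "!!k. k:K ==> k .: C" using KD by auto
 have sub: "submodule ?K ground C"
 proof (rule submI[OF C])
 show "?K <= car C" using x KC by auto
 show "0.[C] : ?K" using x KD(2) by (auto intro!:exI[of _ "0.[C]"] exI[of _ 0])
 fix a b assume "a : ?K" "b : ?K"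
 then obtain k c k' c' where "a = k +[C] c *.[C] x" "b = k' +[C] c' *.[C] x" "k:K" "k':K" by blast
 then have "a +[C] b = (k +[C] k') +[C] (c + c') *.[C] x" "k +[C] k':K"
 using x KC KD(3) by (auto simp:vs_smult[OF C] vs_add_ac[OF C])
 then show "a +[C] b : ?K" by blast
 next
 fix d a assume "a : ?K"
 then obtain k c where "a = k +[C] c *.[C] x" "k:K" by blast
 then have "d *.[C] a = (d *.[C] k) +[C] (d * c) *.[C] x" "d *.[C] k:K"
 using x KC KD(4) by (auto simp:vs_smult[OF C] vs_add_ac[OF C])
 then show "d *.[C] a : ?K" by blast
 qed
 have "x : ?K" using x KD(2) by (auto intro!:exI[of _ "0.[C]"] exI[of _ 1])
 then have "?K ~= K" using False by blast
 moreover have "K <= ?K"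
 proof
 fix k assume "k:K"
 moreover from this have "k = k +[C] 0 *.[C] x" using x KC by simp
 ultimately show "k : ?K" by blast
 qed
 ultimately have "?K \<notin> ?P" using max by blast
 then obtain e k c where e: "e .: E" "k:K" "j e = k +[C] c *.[C] x" "e ~= 0.[E]" using sub by blast
 have c: "c ~= 0"
 proof
 assume "c = 0"
 then have "j e:K" using e x KC by simp
 then show False using K(2) e by blast
 qed
 have "c *.[C] x = j e +[C] (- 1) *.[C] k"
 proof -
 have "j e +[C] (- 1) *.[C] k = c *.[C] x +[C] (k +[C] (- 1) *.[C] k)"
 unfolding e(3) using e(2) KC x by (simp add:vs_add_ac[OF C])
 then show ?thesis using vs_neg(1)[OF C KC[OF e(2)]] x by simp
 qed
 then have "inverse c *.[C] (c *.[C] x) = inverse c *.[C] (j e +[C] (- 1) *.[C] k)" by simp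
 moreover have "inverse c *.[C] (c *.[C] x) = x" using vs_smult(3)[OF C x, of "inverse c" c] c x by simp
 ultimately have "x = inverse c *.[C] (j e +[C] (- 1) *.[C] k)" by simp
 also have "... = j (inverse c *.[E] e) +[C] (inverse c *.[C] ((- 1) *.[C] k))"
 using e(1,2) KC by (simp add:vs_smult(2)[OF C] lin3[OF j])
 finally have "x = j (inverse c *.[E] e) +[C] (inverse c *.[C] ((- 1) *.[C] k))" .
 moreover have "inverse c *.[C] ((- 1) *.[C] k):K" "inverse c *.[E] e .: E" using e KD(4) by auto
 ultimately show ?thesis by blast
 qed
 define r where "r = (%x. THE e. e .: E & (EX k:K. x = j e +[C] k))"
 have req: "r (j e +[C] k) = e" if "e .: E" "k:K" for e k
 unfolding r_def by (rule the_equality) (use that uniq in blast)+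
 have KC: "!!k. k:K ==> k .: C" using KD by auto
 show ?thesis
 proof
 show "lin C E r"
 proof (rule linI)
 fix x assume "x .: C"
 then obtain e k where "e .: E" "k:K" "x = j e +[C] k" using ex by blast
 then show "r x .: E" by (simp add:req)
 next
 fix x y assume "x .: C" "y .: C"
 then obtain e k e' k' where *: "e .: E" "k:K" "x = j e +[C] k" "e' .: E" "k':K" "y = j e' +[C] k'"
 using ex by meson
 then have "x +[C] y = j (e +[E] e') +[C] (k +[C] k')"
 using KC by (simp add:vs_add_ac[OF C] lin2[OF j])
 then show "r (x +[C] y) = r x +[E] r y" using * KD(3) by (simp add:req)
 next
 fix c x assume "x .: C"
 then obtain e k where *: "e .: E" "k:K" "x = j e +[C] k" using ex by blast
 then have "c *.[C] x = j (c *.[E] e) +[C] (c *.[C] k)"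
 using KC by (simp add:vs_smult(2)[OF C] lin3[OF j])
 then show "r (c *.[C] x) = c *.[E] r x" using * KD(4) by (simp add:req)
 qed
 fix e assume "e .: E"
 then show "r (j e) = e" using req[of e "0.[C]"] KD(2) by simp
 qed
qed

text \<open>Reduces linear identities in arbitrary vector spaces to identities in the ground field.\<close>

lemma vs_eqI:
 fixes V :: "('k::field,'v,'z) msch"
 assumes V: "vspace V" and x: "x .: V" and y: "y .: V"
 and *: "!!L :: 'v=>'k. lin V ground L ==> (!!u v. u .: V ==> v .: V ==> L (u +[V] v) = L u + L v) ==>
 (!!c u. u .: V ==> L (c *.[V] u) = c * L u) ==> L 0.[V] = 0 ==> L x = L y"
 shows "x = y"
proof (rule ccontr)
 assume neq: "x ~= y"
 let ?d = "x +[V] (- 1) *.[V] y"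
 note [simp] = V x y vspace_ground
 have d: "?d ~= 0.[V]" using vs_eq_iff[OF V x y] neq by simp
 obtain r :: "'v=>'k" where r: "lin V ground r" "!!c. r (c *.[V] ?d) = c"
 proof (rule left_inverse[of ground V "%c. c *.[V] ?d"])
 show "lin ground V (%c. c *.[V] ?d)" 
 by (rule linI) (use vs_smult[OF V vs_closed(2)[OF V x vs_closed(3)[OF V y]]] in auto)
 fix e assume "e *.[V] ?d = 0.[V]"
 then have "inverse e *.[V] (e *.[V] ?d) = 0.[V]" by simp
 then have "(inverse e * e) *.[V] ?d = 0.[V]" by (simp add:vs_smult(3))
 then show "e = 0.[ground]" using d by (cases "e = 0") auto
 qed auto
 have "r x = r y" by (rule *[OF r(1)]) (use linD[OF r(1)] lin_zero[OF r(1)] in auto)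
 moreover have "r ?d = 1" using r(2)[of 1] by simp
 ultimately show False using linD(2)[OF r(1) x, of "(- 1) *.[V] y"] lin3[OF r(1) y, of "- 1"] by simp
qed

section \<open>Finitely supported combinations and their evaluation\<close>

lemma poly_mapping_span_induct [consumes 1, case_names single zero add]:
 assumes "keys (p :: 'x \<Rightarrow>\<^sub>0 'k::comm_monoid_add) <= X" and s: "!!x c. x:X ==> P (single x c)" and z: "P 0"
 and a: "!!p q. keys p <= X ==> keys q <= X ==> P p ==> P q ==> P (p + q)"
 shows "P p"
proof -
 let ?m = "%S. SUM x:S. single x (lookup p x)"
 have "p = ?m (keys p)"
 by (rule poly_mapping_eqI) (auto simp:lookup_sum lookup_single when_def in_keys_iff)
 moreover have "keys (?m S) <= X & P (?m S)" if "finite S" "S <= X" for S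
 using that
 proof (induction S)
 case (insert x S)
 have "keys (single x (lookup p x) + ?m S) <= X"
 using insert keys_add[of "single x (lookup p x)" "?m S"] by (auto split: if_splits)
 then show ?case using insert by (auto intro!:a s split: if_splits)
 qed (simp add:z)
 ultimately show ?thesis using assms(1) by (metis finite_keys)
qed

text \<open>Scalar counterpart of \<open>ev\<close>. A linear functional turns \<open>ev\<close>
  into \<open>sc\<close> (\<open>L_ev\<close>), so identities between linear combinations in an
  abstract space reduce, through \<open>vs_eqI\<close>, to sums in the field.\<close>

definition sc :: "('x \<Rightarrow>\<^sub>0 'k::field)=>('x=>'k)=>'k" where
 "sc p h = (SUM x:keys p. lookup p x * h x)"

definition ev :: "('k::field,'w,'z) msch=>('x=>'w)=>('x \<Rightarrow>\<^sub>0 'k)=>'w" where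
 "ev W g p = (\<Oplus>\<^bsub>W\<^esub>x\<in>keys p. lookup p x *.[W] g x)"

lemma sc_superset:
 assumes "finite S" "keys p <= S"
 shows "sc p h = (SUM x:S. lookup p x * h x)"
 unfolding sc_def by (rule sum.mono_neutral_left) (insert assms, auto simp:in_keys_iff)

lemma sc_add: "sc (p + q) h = sc p h + sc q h"
proof -
 let ?S = "keys p \<union> keys q"
 have "sc (p + q) h = (SUM x:?S. lookup (p + q) x * h x)"
 by (rule sc_superset) (auto dest: subsetD[OF keys_add])
 also have "... = (SUM x:?S. lookup p x * h x) + (SUM x:?S. lookup q x * h x)"
 by (simp add:lookup_add distrib_right sum.distrib)
 also have "... = sc p h + sc q h"
 by (simp add:sc_superset[of ?S p] sc_superset[of ?S q])
 finally show ?thesis .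
qed

lemma lookup_scale [simp]: "lookup (Poly_Mapping.map ((*) (c::'k::field)) p) x = c * lookup p x"
 by (simp add:map.rep_eq when_def)

lemma keys_scale: "keys (Poly_Mapping.map ((*) (c::'k::field)) p) <= keys p"
 by (auto simp:in_keys_iff)

lemma sc_scale: "sc (Poly_Mapping.map ((*) c) p) h = c * sc p h"
proof -
 have "sc (Poly_Mapping.map ((*) c) p) h = (SUM x:keys p. c * lookup p x * h x)"
 using sc_superset[OF _ keys_scale, of p c h] by simp
 then show ?thesis by (simp add:sc_def sum_distrib_left mult.assoc)
qed

lemma sc_single [simp]: "sc (single x c) h = c * h x"
 by (cases "c = 0") (auto simp:sc_def)

lemma sc_zero [simp]: "sc 0 h = 0"
 by (simp add:sc_def)

lemma sc_diff: "sc (p - q) h = sc p h - sc q h"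
proof -
 have "sc (p - q + q) h = sc (p - q) h + sc q h" by (rule sc_add)
 then show ?thesis by simp
qed

lemma sc_cong: "(!!x. x:keys p ==> h x = h' x) ==> sc p h = sc p h'"
 by (simp add:sc_def)

lemma sc_fun_add: "sc p (%x. h x + h' x) = sc p h + sc p h'"
 by (simp add:sc_def distrib_left sum.distrib)

lemma sc_swap: "sc p (%x. sc q (h x)) = sc q (%y. sc p (%x. h x y))"
 unfolding sc_def sum_distrib_left by (subst sum.swap) (simp add:mult_ac)

lemma ev_closed [simp, intro]:
 "vspace W ==> (!!x. x:keys p ==> g x .: W) ==> ev W g p .: W"
 unfolding ev_def by (rule vs_finsum_closed) auto

lemma ev_cong:
 assumes "vspace W" "!!x. x:keys p ==> g x = h x" "!!x. x:keys p ==> h x .: W"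
 shows "ev W g p = ev W h p"
proof -
 interpret abelian_group W by (rule vs_abelian[OF assms(1)])
 show ?thesis unfolding ev_def by (rule add.finprod_cong') (use assms in auto)
qed

lemma lin_ev:
 assumes "lin V W f" "vspace V" "vspace W" "!!x. x:keys p ==> g x .: V"
 shows "f (ev V g p) = ev W (%x. f (g x)) p"
proof -
 interpret W: abelian_group W by (rule vs_abelian[OF assms(3)])
 have "f (ev V g p) = finsum W (%x. f (lookup p x *.[V] g x)) (keys p)"
 unfolding ev_def by (rule lin_finsum[OF assms(1-3)]) (use assms in auto)
 also have "... = ev W (%x. f (g x)) p"
 unfolding ev_def by (rule W.add.finprod_cong') (use assms(3,4) linD[OF assms(1)] in auto)
 finally show ?thesis .
qed

lemma ev_ground: "ev ground g p = sc p g"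
 by (simp add:ev_def sc_def finsum_ground)

lemma L_ev:
 assumes "lin V ground L" "vspace V" "!!x. x:keys p ==> g x .: V"
 shows "L (ev V g p) = sc p (%x. L (g x))"
 using lin_ev[OF assms(1,2) vspace_ground assms(3)] by (simp add:ev_ground)

lemma L_finsum:
 assumes "lin V ground L" "vspace V" "f:A \<rightarrow> car V"
 shows "L (finsum V f A) = (SUM i:A. L (f i))"
 using lin_finsum[OF assms(1,2) vspace_ground assms(3)] by (simp add:finsum_ground)

lemma ev_single:
 assumes "vspace W" "g x .: W"
 shows "ev W g (single x c) = c *.[W] g x"
proof (rule vs_eqI[OF assms(1)])
 show "ev W g (single x c) .: W" using assms by (intro ev_closed) (auto split: if_splits)
next
 fix L assume *: "lin W ground L" "!!c u. u .: W ==> L (c *.[W] u) = c * L u"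
 show "L (ev W g (single x c)) = L (c *.[W] g x)"
 using assms by (subst L_ev[OF *(1)]) (auto simp:*(2) split: if_splits)
qed (use assms in auto)

lemma ev_add:
 assumes W: "vspace W" and g: "!!x. x:keys p \<union> keys q ==> g x .: W"
 shows "ev W g (p + q) = ev W g p +[W] ev W g q"
proof -
 have k: "!!x. x:keys (p + q) ==> g x .: W" using g keys_add[of p q] by auto
 show ?thesis
 by (rule vs_eqI[OF W]) (insert W g k, auto simp:L_ev sc_add)
qed

lemma ev_scale:
 assumes W: "vspace W" and g: "!!x. x:keys p ==> g x .: W"
 shows "ev W g (Poly_Mapping.map ((*) c) p) = c *.[W] ev W g p"
proof -
 have k: "!!x. x:keys (Poly_Mapping.map ((*) c) p) ==> g x .: W" using g keys_scale[of c p] by auto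
 show ?thesis
 by (rule vs_eqI[OF W]) (insert W g k, auto simp:L_ev sc_scale)
qed

lemma ev_diff:
 assumes W: "vspace W" and g: "!!x. x:keys p \<union> keys q ==> g x .: W"
 shows "ev W g (p - q) = ev W g p +[W] (- 1) *.[W] ev W g q"
proof -
 have "!!x. x:keys (p - q) ==> x:keys p \<union> keys q"
 by (auto simp:in_keys_iff lookup_minus)
 then have k: "!!x. x:keys (p - q) ==> g x .: W" using g by blast
 show ?thesis
 by (rule vs_eqI[OF W]) (insert W g k, auto simp:L_ev sc_diff)
qed

lemma ev_swap:
 assumes W: "vspace W" and "!!x y. x:keys p ==> y:keys q ==> g x y .: W"
 shows "ev W (%x. ev W (g x) q) p = ev W (%y. ev W (%x. g x y) p) q"
proof (rule vs_eqI[OF W])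
 fix L assume L: "lin W ground L"
 have "L (ev W (%x. ev W (g x) q) p) = sc p (%x. sc q (%y. L (g x y)))"
 using assms by (subst L_ev[OF L W]) (auto intro!:sc_cong simp:L_ev[OF L W])
 also have "... = sc q (%y. sc p (%x. L (g x y)))" by (rule sc_swap)
 also have "... = L (ev W (%y. ev W (%x. g x y) p) q)"
 using assms by (subst L_ev[OF L W]) (auto intro!:sc_cong simp:L_ev[OF L W])
 finally show "L (ev W (%x. ev W (g x) q) p) = L (ev W (%y. ev W (%x. g x y) p) q)" .
qed (use assms in auto)

lemma ev_fun_add:
 assumes W: "vspace W" and "!!x. x:keys p ==> g x .: W" "!!x. x:keys p ==> h x .: W"
 shows "ev W (%x. g x +[W] h x) p = ev W g p +[W] ev W h p"
proof (rule vs_eqI[OF W])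
 fix L assume L: "lin W ground L" "!!u v. u .: W ==> v .: W ==> L (u +[W] v) = L u + L v"
 have "L (ev W (%x. g x +[W] h x) p) = sc p (%x. L (g x) + L (h x))"
 using assms by (subst L_ev[OF L(1) W]) (auto intro!:sc_cong simp:L)
 then show "L (ev W (%x. g x +[W] h x) p) = L (ev W g p +[W] ev W h p)"
 using assms by (simp add:sc_fun_add L L_ev[OF L(1) W])
qed (use assms in auto)

lemma ev_fun_smult:
 assumes W: "vspace W" and "!!x. x:keys p ==> g x .: W"
 shows "ev W (%x. c *.[W] g x) p = c *.[W] ev W g p"
proof (rule lin_ev[symmetric, OF _ W W])
 show "lin W W (%x. c *.[W] x)"
 by (rule linI) (insert W, auto simp:vs_smult(2) vs_smult(3)[symmetric] mult.commute)
qed (use assms in auto)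

lemma ev_zero [simp]: "ev W g 0 = 0.[W]" if "vspace W"
proof -
 interpret W: abelian_group W by (rule vs_abelian[OF that])
 show ?thesis by (simp add:ev_def)
qed

section \<open>Quotients and presentations\<close>

context
 fixes V :: "('k::field,'v,'z) msch" and N :: "'v set"
 assumes V: "vspace V" and N: "submodule N ground V"
begin

interpretation abelian_group V by (rule vs_abelian[OF V])
interpretation N: abelian_subgroup N V
 using submodule.axioms(1)[OF N] by (intro abelian_subgroupI3 additive_subgroupI abelian_group_axioms)

lemma coset_eq_iff:
 assumes "x .: V" "y .: V"
 shows "N +>[V] x = N +>[V] y <-> x +[V] (- 1) *.[V] y:N"
proof -
 have "N +>[V] x = N +>[V] y <-> x:N +>[V] y"
 using N.a_repr_independence'[OF _ assms(2), of x] N.a_rcos_self[OF assms(1)] by blast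
 also have "... <-> x \<ominus>\<^bsub>V\<^esub> y:N" using assms N.a_rcos_module[OF assms(2,1)] by (simp add:a_minus_def)
 finally show ?thesis using assms by (simp add:a_minus_def vs_neg[OF V])
qed

lemma coset_self: "x .: V ==> x:N +>[V] x"
 by (rule N.a_rcos_self)

lemma coset_rep: "x .: V ==> y:N +>[V] x ==> y .: V & N +>[V] y = N +>[V] x"
 using N.a_repr_independence'[of y x] N.a_elemrcos_carrier[of x y] by blast

lemma quot_carrier: "car (quot V N) = (%x. N +>[V] x) ` car V"
 by (auto simp:quot_space_def A_RCOSETS_def')

lemma coset_zero: "x .: V ==> N +>[V] x = N <-> x:N"
 using coset_eq_iff[of x "0.[V]"] V N.a_rcos_const[OF N.zero_closed] by simp

lemma quot_ops:
 assumes "x .: V"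
 shows "y .: V ==> (N +>[V] x) +[quot V N] (N +>[V] y) = N +>[V] (x +[V] y)"
 "c *.[quot V N] (N +>[V] x) = N +>[V] (c *.[V] x)"
 "0.[quot V N] = N +>[V] 0.[V]"
proof -
 show "y .: V ==> (N +>[V] x) +[quot V N] (N +>[V] y) = N +>[V] (x +[V] y)"
 using assms by (simp add:quot_space_def N.a_rcos_sum)
 show "0.[quot V N] = N +>[V] 0.[V]"
 using coset_zero[of "0.[V]"] V by (simp add:quot_space_def)
 \<comment> \<open>Scalar multiplication in \<open>quot_space\<close> is a union over all
   representatives; it collapses to a single coset because every representative contributes the same
   one.\<close>
 have "N +>[V] (c *.[V] y) = N +>[V] (c *.[V] x)" if y: "y:N +>[V] x" for y
 proof -
 have y': "y .: V" "y +[V] (- 1) *.[V] x:N" using coset_rep[OF assms y] coset_eq_iff[of y x] assms by auto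
 then have "c *.[V] (y +[V] (- 1) *.[V] x):N" using submD(4)[OF V N] by blast
 moreover have "c *.[V] (y +[V] (- 1) *.[V] x) = c *.[V] y +[V] (- 1) *.[V] (c *.[V] x)"
 using y' assms V by (simp add:vs_smult(2) vs_smult(3)[OF V, symmetric] mult.commute)
 ultimately show ?thesis using coset_eq_iff y' assms V by auto
 qed
 then have "(UN y:N +>[V] x. N +>[V] (c *.[V] y)) = (UN y:N +>[V] x. N +>[V] (c *.[V] x))"
 by (intro SUP_cong refl)
 also have "... = N +>[V] (c *.[V] x)" using coset_self[OF assms] by (simp only:UN_constant) (auto split: if_splits)
 finally show "c *.[quot V N] (N +>[V] x) = N +>[V] (c *.[V] x)"
 by (simp add:quot_space_def)
qed

lemma vspace_quot: "vspace (quot V N)"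
proof -
 have z: "0.[quot V N] = N +>[V] 0.[V]" by (rule quot_ops(3)[of "0.[V]"]) (simp add:V)
 note [simp] = V quot_ops(1,2) z
 show ?thesis
 by (rule vspaceI; unfold quot_carrier; (elim imageE)?)
 (simp_all add: vs_smult[OF V] vs_neg[OF V] vs_add_ac[OF V])
qed

lemma lin_coset: "lin V (quot V N) (%x. N +>[V] x)"
 by (rule linI) (auto simp:quot_carrier quot_ops)

lemma lin_desc:
 fixes W :: "('k,'w,'y) msch"
 assumes W: "vspace W" and f: "lin V W f" and z: "!!x. x:N ==> f x = 0.[W]"
 obtains f' where "lin (quot V N) W f'" "!!x. x .: V ==> f' (N +>[V] x) = f x"
proof -
 define f' where "f' X = f (SOME x. x:X)" for X
 have e: "f' (N +>[V] x) = f x" if x: "x .: V" for x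
 proof -
 let ?y = "SOME y. y:N +>[V] x"
 have "?y:N +>[V] x" by (rule someI[of _ x]) (rule coset_self[OF x])
 then have y: "?y .: V" "?y +[V] (- 1) *.[V] x:N"
 using coset_rep[OF x] coset_eq_iff[of ?y x] x by auto
 then have "f ?y +[W] (- 1) *.[W] f x = 0.[W]"
 using z[OF y(2)] x V by (simp add:linD[OF f])
 then show ?thesis using vs_eq_iff[OF W, of "f ?y" "f x"] lin1[OF f] x y by (simp add:f'_def)
 qed
 show ?thesis
 proof
 show "lin (quot V N) W f'"
 by (rule linI) (insert V linD[OF f], auto simp:quot_carrier quot_ops e)
 qed (rule e)
qed

end

section \<open>Free spaces and spaces given by generators and relations\<close>

lemma free_space_simps [simp]:
 "car (free_space X) = {p. keys p <= X}" "0.[free_space X] = 0"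
 "p +[free_space X] q = p + q" "c *.[free_space X] p = Poly_Mapping.map ((*) c) p"
 by (auto simp:free_space_def)

lemma vspace_free: "vspace (free_space X :: ('k::field,'x \<Rightarrow>\<^sub>0 'k) module)"
proof (rule vspaceI, goal_cases)
 case (2 p q) then show ?case using keys_add[of p q] by auto
next
 case (3 c p) then show ?case using keys_scale[of c p] by auto
qed (auto simp:add_ac lookup_add algebra_simps intro!:poly_mapping_eqI)

lemma lin_ev_free:
 "vspace W ==> g:X \<rightarrow> car W ==> lin (free_space X) W (ev W g)"
 by (rule linI) (auto intro!:ev_add ev_scale)

lemma submodule_kernel:
 assumes "vspace V" "vspace W" "lin V W f"
 shows "submodule {x:car V. f x = 0.[W]} ground V"
 by (rule submI) (use assms linD[OF assms(3)] lin_zero[OF assms(3)] in auto)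

context
 fixes X :: "'x set" and R :: "('x \<Rightarrow>\<^sub>0 'k::field) set"
 assumes R: "R <= car (free_space X)"
begin

lemma rel_space_sub: "submodule (rel_space X R) ground (free_space X)"
proof -
 let ?F = "free_space X :: ('k,'x \<Rightarrow>\<^sub>0 'k) module"
 have "submodule (car ?F) ground ?F"
 by (rule submI[OF vspace_free]) (simp_all only: subset_refl vs_closed[OF vspace_free])
 then have ne: "car ?F : {N. submodule N ground ?F & R <= N}" using R by blast
 show ?thesis unfolding rel_space_def
 proof (rule submI[OF vspace_free])
 show "\<Inter> {N. submodule N ground ?F & R <= N} <= car ?F" using ne by blast
 qed (use submD(2-4)[OF vspace_free] in blast)+
qed

lemma rel_space_least:
 assumes "submodule N ground (free_space X)" "R <= N"
 shows "rel_space X R <= N"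
 using assms unfolding rel_space_def by blast

lemma rel_in: "r:R ==> r:rel_space X R"
 unfolding rel_space_def by blast

abbreviation (input) "cls == %p. rel_space X R +>[(free_space X :: ('k,'x \<Rightarrow>\<^sub>0 'k) module)] p"

lemma vspace_pres: "vspace (pres X R)"
 unfolding pres_def by (rule vspace_quot[OF vspace_free rel_space_sub])

lemma lin_cls: "lin (free_space X) (pres X R) cls"
 unfolding pres_def by (rule lin_coset[OF vspace_free rel_space_sub])

lemma pgen_closed: "x:X ==> pgen X R x .: pres X R"
 unfolding pgen_def by (rule linD(1)[OF lin_cls]) simp

lemma ev_basis: 
 fixes p :: "'x \<Rightarrow>\<^sub>0 'k"
 assumes "keys p <= X"
 shows "ev (free_space X) basis_elt p = p"
proof (rule vs_eqI[OF vspace_free[of X]])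
 fix L :: "('x \<Rightarrow>\<^sub>0 'k)=>'k" assume L: "lin (free_space X) ground L"
 have *: "L p = sc p (%x. L (basis_elt x))" if "keys p <= X" for p
 using that
 proof (induction p rule:poly_mapping_span_induct)
 case (single x c)
 then show ?case using linD(3)[OF L, of "basis_elt x" c] lin_zero[OF L vspace_free vspace_ground]
 by (cases "c = 0") (auto simp:map_single)
 next
 case zero
 then show ?case using lin_zero[OF L vspace_free vspace_ground] by simp
 next
 case (add p q)
 then show ?case using linD(2)[OF L, of p q] by (auto simp:sc_add)
 qed
 show "L (ev (free_space X) basis_elt p) = L p"
 by (subst L_ev[OF L vspace_free]) (use assms *[OF assms] in auto)
qed (insert assms, auto intro!:ev_closed vspace_free simp del: free_space_simps, auto)

lemma cls_ev: "keys p <= X ==> cls p = ev (pres X R) (pgen X R) p"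
 by (subst ev_basis[symmetric, of p], simp, subst lin_ev[OF lin_cls vspace_free vspace_pres])
 (auto simp:pgen_def[abs_def])

lemma pres_carrier: "car (pres X R) = cls ` {p. keys p <= X}"
 unfolding pres_def by (subst quot_carrier[OF vspace_free rel_space_sub]) simp

lemma pres_mem:
 assumes "t .: pres X R" "p:t"
 shows "keys p <= X" "t = ev (pres X R) (pgen X R) p"
proof -
 obtain q where q: "keys q <= X" "t = cls q" using assms(1) pres_carrier by auto
 then have "p .: free_space X & cls p = cls q" by (intro coset_rep[OF vspace_free rel_space_sub]) (use assms in auto)
 then show "keys p <= X" "t = ev (pres X R) (pgen X R) p" using q cls_ev[of p] by auto
qed

lemma pres_rep:
 assumes "t .: pres X R"
 obtains p where "p:t"
proof -
 obtain p where "keys p <= X" "t = cls p" using assms pres_carrier by auto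
 then show ?thesis using coset_self[OF vspace_free rel_space_sub, of p] that by simp
qed

lemma pres_induct [consumes 1, case_names gen zero add smult]:
 assumes t: "t .: pres X R" and "!!x. x:X ==> P (pgen X R x)" "P 0.[pres X R]"
 "!!s t. s .: pres X R ==> t .: pres X R ==> P s ==> P t ==> P (s +[pres X R] t)"
 "!!c t. t .: pres X R ==> P t ==> P (c *.[pres X R] t)"
 shows "P t"
proof -
 obtain p where p: "keys p <= X" "t = cls p" using t pres_carrier by auto
 have "P (cls p)" using p(1)
 proof (induction p rule:poly_mapping_span_induct)
 case (single x c)
 then have x: "x:X" by simp
 have "cls (single x c) = c *.[pres X R] pgen X R x"
 using linD(3)[OF lin_cls, of "basis_elt x" c] x by (simp add:pgen_def map_single)
 then show ?case using assms(2,5) pgen_closed x by simp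
 next
 case zero
 then show ?case using assms(3) lin_zero[OF lin_cls vspace_free vspace_pres] by simp
 next
 case (add p q)
 then have "cls (p + q) = cls p +[pres X R] cls q" "P (cls p)" "P (cls q)"
 using linD(2)[OF lin_cls, of p q] by auto
 moreover have "cls p .: pres X R" "cls q .: pres X R"
 using add linD(1)[OF lin_cls] by auto
 ultimately show ?case using assms(4) by simp
 qed
 then show ?thesis using p by simp
qed

lemma lin_ext_ev: "lin_ext W g t = the_elem (ev W g ` t)"
 by (simp add:lin_ext_def ev_def[abs_def])

text \<open>\<open>lin_ext\<close> is the unique element of an image, so it has the expected value
  only once \<open>ev W g\<close> is known to be constant on the class. A linear \<open>F\<close>
  with the same values on generators provides this constancy.\<close>

lemma lin_ext_eq:
 assumes W: "vspace W" and F: "lin (pres X R) W F" and g: "!!x. x:X ==> g x = F (pgen X R x)"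
 and t: "t .: pres X R"
 shows "lin_ext W g t = F t" "p:t ==> ev W g p = F t"
proof -
 have *: "ev W g p = F t" if "p:t" for p
 proof -
 have k: "keys p <= X" using pres_mem[OF t that] by auto
 have "F t = ev W (%x. F (pgen X R x)) p"
 by (subst pres_mem(2)[OF t that], rule lin_ev[OF F vspace_pres W]) (use k pgen_closed in blast)
 also have "... = ev W g p"
 by (rule ev_cong[OF W, symmetric]) (use g k pgen_closed linD(1)[OF F] in blast)+
 finally show ?thesis by simp
 qed
 then show "p:t ==> ev W g p = F t" .
 obtain p where p: "p:t" by (rule pres_rep[OF t])
 have "ev W g ` t = {F t}" using * p by auto
 then show "lin_ext W g t = F t" unfolding lin_ext_ev by simp
qed

text \<open>Vanishing on the relations is enough: the kernel of \<open>ev W g\<close> is a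
  submodule, hence contains the smallest submodule containing \<open>R\<close>, and evaluation
  descends to the quotient.\<close>

lemma lin_ext_klinear:
 assumes W: "vspace W" and g: "!!x. x:X ==> g x .: W" and r: "!!r. r:R ==> ev W g r = 0.[W]"
 shows "lin (pres X R) W (lin_ext W g)" "x:X ==> lin_ext W g (pgen X R x) = g x"
proof -
 let ?K = "{p:car (free_space X). ev W g p = 0.[W]}"
 have gX: "g:X \<rightarrow> car W" using g by auto
 have "submodule ?K ground (free_space X)" by (rule submodule_kernel[OF vspace_free W lin_ev_free[OF W gX]])
 then have "rel_space X R <= ?K" by (rule rel_space_least) (use R r in auto)
 then obtain f where f: "lin (pres X R) W f" "!!p. p .: free_space X ==> f (cls p) = ev W g p"
 unfolding pres_def using lin_desc[OF vspace_free rel_space_sub W lin_ev_free[OF W gX]] by blast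
 have fg: "f (pgen X R x) = g x" if "x:X" for x
 unfolding pgen_def using f(2)[of "basis_elt x"] that ev_single[OF W, of g x 1] g W by auto
 have eq: "lin_ext W g t = f t" if "t .: pres X R" for t
 by (rule lin_ext_eq(1)[OF W f(1) _ that]) (simp add:fg)
 show "lin (pres X R) W (lin_ext W g)"
 by (subst lin_cong[OF vspace_pres eq]) (auto simp:f(1))
 show "x:X ==> lin_ext W g (pgen X R x) = g x" using eq pgen_closed fg by simp
qed

lemma lin_eqI:
 assumes "vspace W" "lin (pres X R) W f" "lin (pres X R) W g"
 "!!x. x:X ==> f (pgen X R x) = g (pgen X R x)" "t .: pres X R"
 shows "f t = g t"
 using assms(5)
 by (induction rule:pres_induct)
 (use assms linD[OF assms(2)] linD[OF assms(3)] lin_zero[OF assms(2) vspace_pres] lin_zero[OF assms(3) vspace_pres] in auto)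

text \<open>A presented space satisfies its own relations. Read through
  \<open>ev_multilin_rels\<close> and \<open>ev_balanced_rels\<close>, this makes the tautological
  map from generators multilinear and balanced.\<close>

lemma pgen_rel: "r:R ==> ev (pres X R) (pgen X R) r = 0.[pres X R]"
proof -
 assume r: "r:R"
 have "cls r = rel_space X R"
 using coset_zero[OF vspace_free rel_space_sub] R rel_in[OF r] r by auto
 moreover have "cls r = ev (pres X R) (pgen X R) r" using cls_ev[of r] R r by auto
 ultimately show ?thesis by (simp add:pres_def quot_space_def)
qed

end

section \<open>Tensor products and Sweedler sums\<close>

declare One_nat_def [simp del]

lemma nth_Cons_one [simp]: "(x # xs) ! 1 = xs ! 0"
 by (simp add:One_nat_def)

lemma gens_nth: "xs @ x # ys:tgens Ms ==> x .: (Ms ! length xs) & length xs < length Ms"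
 by (auto simp:tensor_gens_def list_all2_conv_all_nth dest: spec[of _ "length xs"])

lemma gens_upd:
 assumes "xs @ x # ys:tgens Ms" "x' .: (Ms ! length xs)"
 shows "xs @ x' # ys:tgens Ms"
proof -
 let ?P = "%x M. x .: M"
 obtain us vs where *: "Ms = us @ vs" "length us = length xs" "list_all2 ?P xs us" "list_all2 ?P (x # ys) vs"
 using assms(1) by (auto simp:tensor_gens_def list_all2_append1)
 then obtain m vs' where "vs = m # vs'" "list_all2 ?P ys vs'" by (auto simp:list_all2_Cons1)
 then show ?thesis using * assms(2) by (simp add:tensor_gens_def list_all2_appendI nth_append)
qed

text \<open>Multilinearity with one varying entry in a list, shaped like
  \<open>multilin_rels\<close>, so that it becomes equivalent to evaluation killing those
  relations.\<close>

definition mlin :: "('k::field,'v,'z) msch list=>('k,'w,'y) msch=>('v list=>'w)=>bool" where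
 "mlin Ms W g <->
 (ALL xs x y ys. xs @ x # ys:tgens Ms --> xs @ y # ys:tgens Ms -->
 g (xs @ (x +[Ms ! length xs] y) # ys) = g (xs @ x # ys) +[W] g (xs @ y # ys)) &
 (ALL xs c x ys. xs @ x # ys:tgens Ms -->
 g (xs @ (c *.[Ms ! length xs] x) # ys) = c *.[W] g (xs @ x # ys))"

definition balanced :: "'a set=>('v=>'a=>'v)=>('a=>'v=>'v)=>('k::field,'v,'z) msch list=>('v list=>'w)=>bool" where
 "balanced A ract lact Ms g <-> (ALL xs x a y ys. a:A --> xs @ [x,y] @ ys:tgens Ms -->
 g (xs @ [ract x a,y] @ ys) = g (xs @ [x,lact a y] @ ys))"

lemma ev_combos:
 assumes W: "vspace W" and "g x .: W" "g y .: W" "g z .: W"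
 shows "ev W g (basis_elt x - basis_elt y - basis_elt z) = 0.[W] <-> g x = g y +[W] g z"
 "ev W g (basis_elt x - single y c) = 0.[W] <-> g x = c *.[W] g y"
proof -
 have k: "u:keys (basis_elt x - basis_elt y) ==> u = x | u = y" for u
 by (auto simp:in_keys_iff lookup_minus lookup_single when_def split: if_splits)
 have "ev W g (basis_elt x - basis_elt y - basis_elt z)
 = (g x +[W] (- 1) *.[W] g y) +[W] (- 1) *.[W] g z"
 using assms k by (subst ev_diff, simp, force, subst ev_diff) (auto simp:ev_single)
 also have "... = g x +[W] (- 1) *.[W] (g y +[W] g z)"
 using assms by (intro vs_eqI[OF W]) (auto simp:algebra_simps)
 also have "... = 0.[W] <-> g x = g y +[W] g z" using assms by (subst vs_eq_iff[OF W]) auto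
 finally show "ev W g (basis_elt x - basis_elt y - basis_elt z) = 0.[W] <-> g x = g y +[W] g z" .
 have "ev W g (basis_elt x - single y c) = g x +[W] (- 1) *.[W] (c *.[W] g y)"
 using assms by (subst ev_diff) (auto simp:ev_single split: if_splits)
 then show "ev W g (basis_elt x - single y c) = 0.[W] <-> g x = c *.[W] g y"
 using assms vs_eq_iff[OF W, of "g x" "c *.[W] g y"] by auto
qed

text \<open>The embedding \<open>io\<close> stays arbitrary because the same relations occur for
  tensors, with the identity, and for chains, with \<open>Tens\<close> or with base elements as
  one-letter lists.\<close>

lemma ev_multilin_rels:
 assumes W: "vspace W" and Ms: "!!M. M:set Ms ==> vspace M" and g: "!!xs. xs:tgens Ms ==> g (io xs) .: W"
 shows "(ALL r:multilin_rels io Ms. ev W g r = 0.[W]) <-> mlin Ms W (%xs. g (io xs))"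
proof -
 have cl: "xs @ (x +[Ms ! length xs] y) # ys:tgens Ms" "xs @ (c *.[Ms ! length xs] x) # ys:tgens Ms"
 if "xs @ x # ys:tgens Ms" "xs @ y # ys:tgens Ms" for xs x y ys c
 using gens_upd[OF that(1)] gens_nth[OF that(1)] gens_nth[OF that(2)] Ms[OF nth_mem, of "length xs"] by auto
 have e1: "ev W g (basis_elt (io (xs @ (x +[Ms ! length xs] y) # ys)) - basis_elt (io (xs @ x # ys)) - basis_elt (io (xs @ y # ys))) = 0.[W] <->
 g (io (xs @ (x +[Ms ! length xs] y) # ys)) = g (io (xs @ x # ys)) +[W] g (io (xs @ y # ys))"
 if "xs @ x # ys:tgens Ms" "xs @ y # ys:tgens Ms" for xs x y ys
 using ev_combos(1)[OF W, of g] g cl(1)[OF that] that by blast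
 have e2: "ev W g (basis_elt (io (xs @ (c *.[Ms ! length xs] x) # ys)) - single (io (xs @ x # ys)) c) = 0.[W] <->
 g (io (xs @ (c *.[Ms ! length xs] x) # ys)) = c *.[W] g (io (xs @ x # ys))"
 if "xs @ x # ys:tgens Ms" for xs x ys c
 using ev_combos(2)[OF W, of g] g cl(2)[OF that that] that by blast
 show ?thesis
 unfolding multilin_rels_def mlin_def ball_Un
 proof (intro arg_cong2[where f = "(&)"] iffI)
 qed (use e1 e2 in blast)+
qed

lemma ev_balanced_rels:
 assumes W: "vspace W"
 and g: "!!a xs x y ys. a:A ==> xs @ [x,y] @ ys:tgens Ms ==> g (io (xs @ [ract x a,y] @ ys)) .: W & g (io (xs @ [x,lact a y] @ ys)) .: W"
 shows "(ALL r:balanced_rels io A ract lact Ms. ev W g r = 0.[W]) <-> balanced A ract lact Ms (%xs. g (io xs))"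
proof -
 have "ev W g (basis_elt (io (xs @ [ract x a,y] @ ys)) - basis_elt (io (xs @ [x,lact a y] @ ys))) = 0.[W] <->
 g (io (xs @ [ract x a,y] @ ys)) = g (io (xs @ [x,lact a y] @ ys))"
 if "a:A" "xs @ [x,y] @ ys:tgens Ms" for a xs x y ys
 using ev_combos(2)[OF W, of g "io (xs @ [ract x a,y] @ ys)" _ "io (xs @ [x,lact a y] @ ys)" 1] g[OF that] W by auto
 then show ?thesis unfolding balanced_rels_def balanced_def by blast
qed

lemma multilin_rels_free:
 assumes Ms: "!!M. M:set Ms ==> vspace M" and X: "!!xs. xs:tgens Ms ==> io xs:X"
 shows "multilin_rels io Ms <= car (free_space X)"
proof -
 have cl: "xs @ (x +[Ms ! length xs] y) # ys:tgens Ms" "xs @ (c *.[Ms ! length xs] x) # ys:tgens Ms"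
 if "xs @ x # ys:tgens Ms" "xs @ y # ys:tgens Ms" for xs x y ys c
 using gens_upd[OF that(1)] gens_nth[OF that(1)] gens_nth[OF that(2)] Ms[OF nth_mem, of "length xs"] by auto
 show ?thesis
 proof
 fix r assume "r:multilin_rels io Ms"
 then consider xs x y ys where "xs @ x # ys:tgens Ms" "xs @ y # ys:tgens Ms"
 "r = basis_elt (io (xs @ (x +[Ms ! length xs] y) # ys)) - basis_elt (io (xs @ x # ys)) - basis_elt (io (xs @ y # ys))"
 | xs x ys c where "xs @ x # ys:tgens Ms"
 "r = basis_elt (io (xs @ (c *.[Ms ! length xs] x) # ys)) - single (io (xs @ x # ys)) c"
 unfolding multilin_rels_def by blast
 then show "r .: free_space X"
 proof cases
 case 1
 then have "{io (xs @ (x +[Ms ! length xs] y) # ys),io (xs @ x # ys),io (xs @ y # ys)} <= X" using cl X by auto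
 then show ?thesis unfolding 1 by (auto simp:in_keys_iff lookup_minus lookup_single when_def split: if_splits)
 next
 case 2
 then have "{io (xs @ (c *.[Ms ! length xs] x) # ys),io (xs @ x # ys)} <= X" using cl X by auto
 then show ?thesis unfolding 2 by (auto simp:in_keys_iff lookup_minus lookup_single when_def split: if_splits)
 qed
 qed
qed

lemma balanced_rels_free:
 assumes X: "!!a xs x y ys. a:A ==> xs @ [x,y] @ ys:tgens Ms ==> io (xs @ [ract x a,y] @ ys):X & io (xs @ [x,lact a y] @ ys):X"
 shows "balanced_rels io A ract lact Ms <= car (free_space X)"
proof
 fix r assume "r:balanced_rels io A ract lact Ms"
 then obtain a xs x y ys where *: "a:A" "xs @ [x,y] @ ys:tgens Ms"
 "r = basis_elt (io (xs @ [ract x a,y] @ ys)) - basis_elt (io (xs @ [x,lact a y] @ ys))"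
 unfolding balanced_rels_def by blast
 show "r .: free_space X"
 unfolding *(3) using X[OF *(1,2)] by (auto simp:in_keys_iff lookup_minus lookup_single when_def split: if_splits)
qed

context
 fixes Ms :: "('k::field,'v,'z) msch list"
 assumes Ms: "!!M. M:set Ms ==> vspace M"
begin

lemma tensor_rels_free: "multilin_rels (%xs. xs) Ms <= car (free_space (tgens Ms))"
 by (rule multilin_rels_free) (auto simp:Ms)

lemma vspace_tensor: "vspace (tensor Ms)"
 unfolding tensor_def by (rule vspace_pres[OF tensor_rels_free])

lemma tens_closed: "xs:tgens Ms ==> tens Ms xs .: tensor Ms"
 unfolding tensor_def tens_def by (rule pgen_closed[OF tensor_rels_free])

lemma mlin_tens: "mlin Ms (tensor Ms) (tens Ms)"
 using ev_multilin_rels[where g = "tens Ms" and io = "%xs. xs", OF vspace_tensor Ms] tens_closed pgen_rel[OF tensor_rels_free]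
 by (auto simp:tensor_def tens_def[abs_def])

lemma tensor_ext:
 assumes W: "vspace W" and g: "!!xs. xs:tgens Ms ==> g xs .: W" and m: "mlin Ms W g"
 shows "lin (tensor Ms) W (lin_ext W g)" "xs:tgens Ms ==> lin_ext W g (tens Ms xs) = g xs"
 "t .: tensor Ms ==> p:t ==> ev W g p = lin_ext W g t"
proof -
 have r: "!!r. r:multilin_rels (%xs. xs) Ms ==> ev W g r = 0.[W]"
 using ev_multilin_rels[where g = g and io = "%xs. xs" and Ms = Ms, OF W Ms g] m by simp
 show 1: "lin (tensor Ms) W (lin_ext W g)" and 2: "xs:tgens Ms ==> lin_ext W g (tens Ms xs) = g xs" for xs
 unfolding tensor_def tens_def by (rule lin_ext_klinear[OF tensor_rels_free W g r]; simp)+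
 show "t .: tensor Ms ==> p:t ==> ev W g p = lin_ext W g t"
 using lin_ext_eq(2)[OF tensor_rels_free W 1[unfolded tensor_def], of g t p] 2 by (simp add:tensor_def tens_def)
qed

lemma tensor_eqI:
 assumes "vspace W" "lin (tensor Ms) W f" "lin (tensor Ms) W g" "t .: tensor Ms"
 "!!xs. xs:tgens Ms ==> f (tens Ms xs) = g (tens Ms xs)"
 shows "f t = g t"
 using lin_eqI[OF tensor_rels_free assms(1), of f g t] assms by (simp add:tensor_def tens_def)

lemma tensor_rep:
 assumes "t .: tensor Ms"
 obtains p where "p:t" "keys p <= tgens Ms" "t = ev (tensor Ms) (tens Ms) p"
proof -
 have t: "t .: (pres (tgens Ms) (multilin_rels (%xs. xs) Ms))" using assms by (simp add:tensor_def)
 obtain p where p: "p:t" by (rule pres_rep[OF tensor_rels_free t])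
 show ?thesis
 by (rule that[OF p]) (insert pres_mem[OF tensor_rels_free t p], simp_all add: tensor_def tens_def[abs_def])
qed

end

section \<open>Bilinear and trilinear maps on tensor products\<close>

definition bilin :: "('k::field,'c,'x) msch=>('k,'d,'y) msch=>('k,'w,'z) msch=>('c=>'d=>'w)=>bool" where
 "bilin C D W f <-> (ALL y:car D. lin C W (%x. f x y)) & (ALL x:car C. lin D W (f x))"

lemma bilinI:
 assumes "!!y. y .: D ==> lin C W (%x. f x y)" "!!x. x .: C ==> lin D W (%y. f x y)"
 shows "bilin C D W f"
 using assms by (auto simp:bilin_def)

lemma bilinD:
 assumes "bilin C D W f"
 shows "y .: D ==> lin C W (%x. f x y)" "x .: C ==> lin D W (f x)"
 "x .: C ==> y .: D ==> f x y .: W"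
 using assms by (auto simp:bilin_def intro: lin1)
lemmas bl1 = bilinD(1) and bl2 = bilinD(2) and bl3 = bilinD(3)

definition trilin :: "('k::field,'c,'x) msch=>('k,'d,'y) msch=>('k,'e,'u) msch=>('k,'w,'z) msch=>('c=>'d=>'e=>'w)=>bool" where
 "trilin C D E W f <-> (ALL y:car D. ALL z:car E. lin C W (%x. f x y z)) &
 (ALL x:car C. ALL z:car E. lin D W (%y. f x y z)) &
 (ALL x:car C. ALL y:car D. lin E W (%z. f x y z))"

lemma trilinI:
 assumes "!!y z. y .: D ==> z .: E ==> lin C W (%x. f x y z)"
 "!!x z. x .: C ==> z .: E ==> lin D W (%y. f x y z)"
 "!!x y. x .: C ==> y .: D ==> lin E W (%z. f x y z)"
 shows "trilin C D E W f"
 using assms by (auto simp:trilin_def)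

lemma trilin_parts:
 assumes "trilin C D E W f"
 shows "z .: E ==> bilin C D W (%x y. f x y z)" "x .: C ==> bilin D E W (f x)"
 "x .: C ==> y .: D ==> z .: E ==> f x y z .: W"
 using assms linD(1)[of C W "%x. f x y z" x] by (auto simp:trilin_def bilin_def)

lemma tgens_2: "xs:tgens [C,D] <-> (EX x y. xs = [x,y] & x .: C & y .: D)"
 by (auto simp:tensor_gens_def list_all2_Cons2)

lemma tgens_3: "xs:tgens [C,D,E] <-> (EX x y z. xs = [x,y,z] & x .: C & y .: D & z .: E)"
 by (auto simp:tensor_gens_def list_all2_Cons2)

lemma mlin_bilin: "bilin C D W f ==> mlin [C,D] W (%xs. f (xs ! 0) (xs ! 1))"
 using linD(2,3)[OF bilinD(1), of C D W f] linD(2,3)[OF bilinD(2), of C D W f]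
 unfolding mlin_def tgens_2 by (auto simp:append_eq_Cons_conv)

lemma mlin_trilin: "trilin C D E W f ==> mlin [C,D,E] W (%xs. f (xs ! 0) (xs ! 1) (xs ! 2))"
proof -
 assume "trilin C D E W f"
 then have *: "!!y z. y .: D ==> z .: E ==> lin C W (%x. f x y z)"
 "!!x z. x .: C ==> z .: E ==> lin D W (%y. f x y z)"
 "!!x y. x .: C ==> y .: D ==> lin E W (%z. f x y z)"
 by (auto simp:trilin_def)
 show ?thesis
 using linD(2,3)[OF *(1)] linD(2,3)[OF *(2)] linD(2,3)[OF *(3)]
 unfolding mlin_def tgens_3 by (auto simp:append_eq_Cons_conv)
qed

lemma bilin_mlin:
 assumes "vspace C" "vspace D" "mlin [C,D] W g" "!!x y. x .: C ==> y .: D ==> g [x,y] .: W"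
 shows "bilin C D W (%x y. g [x,y])"
proof (rule bilinI; rule linI)
 fix x x' y assume "y .: D" "x .: C" "x' .: C"
 then show "g [x +[C] x',y] = g [x,y] +[W] g [x',y]"
 using assms(3)[unfolded mlin_def, THEN conjunct1, rule_format, of "[]" x "[y]" x'] by (simp add:tgens_2)
next
 fix x c y assume "y .: D" "x .: C"
 then show "g [c *.[C] x,y] = c *.[W] g [x,y]"
 using assms(3)[unfolded mlin_def, THEN conjunct2, rule_format, of "[]" x "[y]" c] by (simp add:tgens_2)
next
 fix x y y' assume "y .: D" "x .: C" "y' .: D"
 then show "g [x,y +[D] y'] = g [x,y] +[W] g [x,y']"
 using assms(3)[unfolded mlin_def, THEN conjunct1, rule_format, of "[x]" y "[]" y'] by (simp add:tgens_2)
next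
 fix x c y assume "y .: D" "x .: C"
 then show "g [x,c *.[D] y] = c *.[W] g [x,y]"
 using assms(3)[unfolded mlin_def, THEN conjunct2, rule_format, of "[x]" y "[]" c] by (simp add:tgens_2)
qed (use assms(4) in auto)

lemma trilin_mlin:
 assumes "vspace C" "vspace D" "vspace E" "mlin [C,D,E] W g"
 "!!x y z. x .: C ==> y .: D ==> z .: E ==> g [x,y,z] .: W"
 shows "trilin C D E W (%x y z. g [x,y,z])"
proof (rule trilinI; rule linI)
 fix x x' y z assume "y .: D" "x .: C" "x' .: C" "z .: E"
 then show "g [x +[C] x',y,z] = g [x,y,z] +[W] g [x',y,z]"
 using assms(4)[unfolded mlin_def, THEN conjunct1, rule_format, of "[]" x "[y,z]" x'] by (simp add:tgens_3)
next
 fix x c y z assume "y .: D" "x .: C" "z .: E"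
 then show "g [c *.[C] x,y,z] = c *.[W] g [x,y,z]"
 using assms(4)[unfolded mlin_def, THEN conjunct2, rule_format, of "[]" x "[y,z]" c] by (simp add:tgens_3)
next
 fix x y y' z assume "y .: D" "x .: C" "y' .: D" "z .: E"
 then show "g [x,y +[D] y',z] = g [x,y,z] +[W] g [x,y',z]"
 using assms(4)[unfolded mlin_def, THEN conjunct1, rule_format, of "[x]" y "[z]" y'] by (simp add:tgens_3)
next
 fix x c y z assume "y .: D" "x .: C" "z .: E"
 then show "g [x,c *.[D] y,z] = c *.[W] g [x,y,z]"
 using assms(4)[unfolded mlin_def, THEN conjunct2, rule_format, of "[x]" y "[z]" c] by (simp add:tgens_3)
next
 fix x y z z' assume "y .: D" "x .: C" "z' .: E" "z .: E"
 then show "g [x,y,z +[E] z'] = g [x,y,z] +[W] g [x,y,z']"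
 using assms(4)[unfolded mlin_def, THEN conjunct1, rule_format, of "[x,y]" z "[]" z'] by (simp add:tgens_3)
next
 fix x c y z assume "y .: D" "x .: C" "z .: E"
 then show "g [x,y,c *.[E] z] = c *.[W] g [x,y,z]"
 using assms(4)[unfolded mlin_def, THEN conjunct2, rule_format, of "[x,y]" z "[]" c] by (simp add:tgens_3)
qed (use assms(5) in auto)

lemma tensor2:
 assumes C: "vspace C" and D: "vspace D"
 shows "vspace (tensor [C,D])" "bilin C D (tensor [C,D]) (%x y. tens [C,D][x,y])"
 "x .: C ==> y .: D ==> tens [C,D][x,y] .: (tensor [C,D])"
proof -
 have v: "!!M. M:set [C,D] ==> vspace M" using C D by auto
 show "vspace (tensor [C,D])" by (rule vspace_tensor[OF v])
 have c: "x .: C ==> y .: D ==> tens [C,D][x,y] .: (tensor [C,D])" for x y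
 by (rule tens_closed[OF v]) (simp_all add: tgens_2)
 then show "x .: C ==> y .: D ==> tens [C,D][x,y] .: (tensor [C,D])" .
 show "bilin C D (tensor [C,D]) (%x y. tens [C,D][x,y])"
 by (rule bilin_mlin[OF C D mlin_tens[OF v] c])
qed

lemma tensor3:
 assumes C: "vspace C" and D: "vspace D" and E: "vspace E"
 shows "vspace (tensor [C,D,E])" "trilin C D E (tensor [C,D,E]) (%x y z. tens [C,D,E][x,y,z])"
 "x .: C ==> y .: D ==> z .: E ==> tens [C,D,E][x,y,z] .: (tensor [C,D,E])"
proof -
 have v: "!!M. M:set [C,D,E] ==> vspace M" using C D E by auto
 show "vspace (tensor [C,D,E])" by (rule vspace_tensor[OF v])
 have c: "x .: C ==> y .: D ==> z .: E ==> tens [C,D,E][x,y,z] .: (tensor [C,D,E])" for x y z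
 by (rule tens_closed[OF v]) (simp_all add: tgens_3)
 then show "x .: C ==> y .: D ==> z .: E ==> tens [C,D,E][x,y,z] .: (tensor [C,D,E])" .
 show "trilin C D E (tensor [C,D,E]) (%x y z. tens [C,D,E][x,y,z])"
 by (rule trilin_mlin[OF C D E mlin_tens[OF v] c])
qed

lemma sweedler_bilin:
 assumes C: "vspace C" and D: "vspace D" and W: "vspace W" and f: "bilin C D W f"
 shows "lin (tensor [C,D]) W (sweedler W f)"
 "x .: C ==> y .: D ==> sweedler W f (tens [C,D][x,y]) = f x y"
 "t .: (tensor [C,D]) ==> p:t ==> ev W (%xs. f (xs ! 0) (xs ! 1)) p = sweedler W f t"
proof -
 have v: "!!M. M:set [C,D] ==> vspace M" using C D by auto
 have c: "xs:tgens [C,D] ==> f (xs ! 0) (xs ! 1) .: W" for xs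
 using bilinD(3)[OF f] by (auto simp:tgens_2)
 note * = tensor_ext[OF v W c mlin_bilin[OF f]]
 show "lin (tensor [C,D]) W (sweedler W f)" by (rule *(1))
 show "x .: C ==> y .: D ==> sweedler W f (tens [C,D][x,y]) = f x y"
 by (subst *(2)) (simp_all add: tgens_2)
 show "t .: (tensor [C,D]) ==> p:t ==> ev W (%xs. f (xs ! 0) (xs ! 1)) p = sweedler W f t"
 by (rule *(3))
qed

lemma trilin_ext:
 assumes C: "vspace C" and D: "vspace D" and E: "vspace E" and W: "vspace W" and f: "trilin C D E W f"
 obtains F where "lin (tensor [C,D,E]) W F"
 "!!x y z. x .: C ==> y .: D ==> z .: E ==> F (tens [C,D,E][x,y,z]) = f x y z"
proof -
 have v: "!!M. M:set [C,D,E] ==> vspace M" using C D E by auto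
 have c: "xs:tgens [C,D,E] ==> f (xs ! 0) (xs ! 1) (xs ! 2) .: W" for xs
 using trilin_parts(3)[OF f] by (auto simp:tgens_3)
 note * = tensor_ext[OF v W c mlin_trilin[OF f]]
 show ?thesis
 by (rule that[OF *(1)]) (insert *(2), auto simp:tgens_3)
qed

lemma tensor2_eqI:
 assumes "vspace C" "vspace D" "vspace W" "lin (tensor [C,D]) W f" "lin (tensor [C,D]) W g" "t .: (tensor [C,D])"
 "!!x y. x .: C ==> y .: D ==> f (tens [C,D][x,y]) = g (tens [C,D][x,y])"
 shows "f t = g t"
 by (rule tensor_eqI[OF _ assms(3-6)]) (insert assms, auto simp:tgens_2)

text \<open>
 \<open>sw C W f x\<close> is the Sweedler sum over a fixed representative of the coproduct of \<open>x\<close>; unlike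
 for \<open>sweedler\<close>, linear maps and finite sums can be moved through it without bilinearity of \<open>f\<close>.
\<close>

definition crep :: "('k::field,'c) coalg=>'c=>('c list \<Rightarrow>\<^sub>0 'k)" where
 "crep C x = (SOME p. p:comult C x)"

definition sw :: "('k::field,'c) coalg=>('k,'w,'z) msch=>('c=>'c=>'w)=>'c=>'w" where
 "sw C W f x = ev W (%xs. f (xs ! 0) (xs ! 1)) (crep C x)"

text \<open>Linear coproduct and counit without any laws. Direct sums and quotients are first known
  in this form; the laws of a coalgebra are derived for the quotient afterwards, and Sweedler sums
  must be available in between.\<close>

definition precoalg :: "('k::field,'c) coalg=>bool" where
 "precoalg C <-> vspace C & lin C (tensor [C,C]) (comult C) & lin C ground (counit C)"

lemma preD:
 assumes "precoalg C"
 shows "vspace C" "lin C (tensor [C,C]) (comult C)" "lin C ground (counit C)"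
 "x .: C ==> comult C x .: (tensor [C,C])"
 using assms linD(1) by (auto simp:precoalg_def)
lemmas pre1 = preD(1)

lemma coalg_pre: "coalgebra C ==> precoalg C"
 by (simp add:coalgebra_def precoalg_def)

lemma cc_coalg: "ccoalg C ==> coalgebra C"
 by (simp add:cocomm_coalgebra_def)

lemma coalg_vs: "coalgebra C ==> vspace C"
 by (simp add:coalgebra_def)
lemmas cc_pre = cc_coalg[THEN coalg_pre] and cc_vs = cc_coalg[THEN coalg_vs]

context
 fixes C :: "('k::field,'c) coalg"
 assumes C: "precoalg C"
begin

lemma crep:
 assumes "x .: C"
 shows "crep C x:comult C x" "xs:keys (crep C x) ==> xs ! 0 .: C & xs ! 1 .: C"
proof -
 have v: "!!M. M:set [C,C] ==> vspace M" using preD(1)[OF C] by auto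
 obtain p where "p:comult C x" by (rule tensor_rep[OF v preD(4)[OF C assms]])
 then show *: "crep C x:comult C x" unfolding crep_def by (rule someI)
 have "keys (crep C x) <= tgens [C,C]"
 by (rule pres_mem(1)[OF tensor_rels_free[OF v], of _ "comult C x"]) (insert preD(4)[OF C assms] *, simp_all add: tensor_def)
 then show "xs:keys (crep C x) ==> xs ! 0 .: C & xs ! 1 .: C"
 by (auto simp:tgens_2 dest!: subsetD)
qed

lemma sw_closed:
 assumes "vspace W" "x .: C" "!!a b. a .: C ==> b .: C ==> f a b .: W"
 shows "sw C W f x .: W"
 unfolding sw_def by (rule ev_closed[OF assms(1)]) (use crep(2)[OF assms(2)] assms(3) in auto)

lemma sw_cong:
 assumes "vspace W" "x .: C" "!!a b. a .: C ==> b .: C ==> f a b = g a b"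
 "!!a b. a .: C ==> b .: C ==> g a b .: W"
 shows "sw C W f x = sw C W g x"
 unfolding sw_def by (rule ev_cong[OF assms(1)]) (use crep(2)[OF assms(2)] assms(3,4) in auto)

lemma sw_push:
 assumes "lin V W L" "vspace V" "vspace W" "x .: C" "!!a b. a .: C ==> b .: C ==> f a b .: V"
 shows "L (sw C V f x) = sw C W (%a b. L (f a b)) x"
 unfolding sw_def by (rule lin_ev[OF assms(1-3)]) (use crep(2)[OF assms(4)] assms(5) in auto)

lemma sw_fun_add:
 assumes "vspace W" "x .: C" "!!a b. a .: C ==> b .: C ==> f a b .: W"
 "!!a b. a .: C ==> b .: C ==> g a b .: W"
 shows "sw C W (%a b. f a b +[W] g a b) x = sw C W f x +[W] sw C W g x"
 unfolding sw_def by (rule ev_fun_add[OF assms(1)]) (use crep(2)[OF assms(2)] assms(3,4) in auto)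

lemma sw_fun_smult:
 assumes "vspace W" "x .: C" "!!a b. a .: C ==> b .: C ==> f a b .: W"
 shows "sw C W (%a b. c *.[W] f a b) x = c *.[W] sw C W f x"
 unfolding sw_def by (rule ev_fun_smult[OF assms(1)]) (use crep(2)[OF assms(2)] assms(3) in auto)

lemma lin_sw_fun:
 assumes "vspace V" "vspace W" "x .: C" "!!a b. a .: C ==> b .: C ==> lin V W (%v. f v a b)"
 shows "lin V W (%v. sw C W (f v) x)"
proof (rule linI)
 note * = linD[OF assms(4)]
 fix v w c assume v: "v .: V"
 then show "sw C W (f v) x .: W" by (intro sw_closed) (use assms * in auto)
 show "sw C W (f (c *.[V] v)) x = c *.[W] sw C W (f v) x"
 using assms v * by (subst sw_fun_smult[symmetric]) (auto intro!:sw_cong)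
 assume "w .: V"
 with v show "sw C W (f (v +[V] w)) x = sw C W (f v) x +[W] sw C W (f w) x"
 using assms * by (subst sw_fun_add[symmetric]) (auto intro!:sw_cong)
qed

text \<open>Bilinearity makes the evaluation independent of the representative of the coproduct, so
  the chosen one computes the Sweedler sum.\<close>

lemma sweedler_sw:
 assumes W: "vspace W" and f: "bilin C C W f" and x: "x .: C"
 shows "sweedler W f (comult C x) = sw C W f x"
 unfolding sw_def
 by (rule sweedler_bilin(3)[symmetric, OF preD(1)[OF C] pre1[OF C] W f preD(4)[OF C x] crep(1)[OF x]])

lemma lin_sw:
 assumes W: "vspace W" and f: "bilin C C W f"
 shows "lin C W (sw C W f)"
proof -
 have "lin C W (%x. sweedler W f (comult C x))"
 by (rule linc[OF preD(2)[OF C] sweedler_bilin(1)[OF preD(1)[OF C] pre1[OF C] W f]])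
 then show ?thesis
 using lin_cong[OF preD(1)[OF C], of "sw C W f" "%x. sweedler W f (comult C x)" W] sweedler_sw[OF W f] by simp
qed

lemma comult_sw: "x .: C ==> comult C x = sw C (tensor [C,C]) (%a b. tens [C,C][a,b]) x"
proof -
 assume x: "x .: C"
 note v = preD(1)[OF C]
 have "comult C x = sweedler (tensor [C,C]) (%a b. tens [C,C][a,b]) (comult C x)"
 by (rule tensor2_eqI[OF v v tensor2(1)[OF v v] lin_id sweedler_bilin(1)[OF v v tensor2(1,2)[OF v v]] preD(4)[OF C x]])
 (simp add:sweedler_bilin(2)[OF v v tensor2(1,2)[OF v v]])
 then show ?thesis by (simp add:sweedler_sw[OF tensor2(1,2)[OF v v] x])
qed

end

text \<open>Both coproducts are given by fixed finite representatives, so this is an exchange of two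
  finite summations.\<close>

lemma sw_swap:
 assumes "precoalg C" "precoalg D" "vspace W" "x .: C" "y .: D"
 "!!a b c d. a .: C ==> b .: C ==> c .: D ==> d .: D ==> f a b c d .: W"
 shows "sw C W (%a b. sw D W (f a b) y) x = sw D W (%c d. sw C W (%a b. f a b c d) x) y"
 using assms crep(2)[OF assms(1,4)] crep(2)[OF assms(2,5)]
 unfolding sw_def by (intro ev_swap) auto

text \<open>The counit law is an equation in \<open>C\<close> itself; applying \<open>L\<close>
  under the sum gives the form needed for arbitrary linear families.\<close>

lemma sw_counit:
 assumes C: "coalgebra C" and W: "vspace W" and L: "lin C W L" and x: "x .: C"
 shows "sw C W (%a b. counit C a *.[W] L b) x = L x" "sw C W (%a b. counit C b *.[W] L a) x = L x"
proof -
 note P = coalg_pre[OF C] and v = coalg_vs[OF C]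
 note e = linD[OF preD(3)[OF P]]
 have b: "bilin C C C (%a b. counit C a *.[C] b)" "bilin C C C (%a b. counit C b *.[C] a)"
 by (intro bilinI linI; use e v in \<open>simp add:vs_smult vs_smultC\<close>)+
 have "L x = L (sw C C (%a b. counit C a *.[C] b) x)" "L x = L (sw C C (%a b. counit C b *.[C] a) x)"
 using C x sweedler_sw[OF P v b(1) x] sweedler_sw[OF P v b(2) x] by (auto simp:coalgebra_def)
 moreover have "L (sw C C (%a b. counit C a *.[C] b) x) = sw C W (%a b. counit C a *.[W] L b) x"
 by (subst sw_push[OF P L v W x]) (insert v W linD[OF L] x, auto intro!:sw_cong[OF P])
 moreover have "L (sw C C (%a b. counit C b *.[C] a) x) = sw C W (%a b. counit C b *.[W] L a) x"
 by (subst sw_push[OF P L v W x]) (insert v W linD[OF L] x, auto intro!:sw_cong[OF P])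
 ultimately show "sw C W (%a b. counit C a *.[W] L b) x = L x" "sw C W (%a b. counit C b *.[W] L a) x = L x" by auto
qed

lemma bilin_sw_left:
 assumes C: "precoalg C" and W: "vspace W" and f: "trilin C C C W f"
 shows "bilin C C W (%a b. sw C W (%y z. f y z b) a)" "bilin C C W (%a b. sw C W (%y z. f a y z) b)"
proof -
 note v = preD(1)[OF C] and t = trilin_parts[OF f]
 show "bilin C C W (%a b. sw C W (%y z. f y z b) a)"
 proof (rule bilinI)
 show "y .: C ==> lin C W (%x. sw C W (%ya z. f ya z y) x)" for y by (rule lin_sw[OF C W t(1)])
 show "x .: C ==> lin C W (%y. sw C W (%ya z. f ya z y) x)" for x
 by (rule lin_sw_fun[OF C v W]) (insert f, auto simp:trilin_def)
 qed
 show "bilin C C W (%a b. sw C W (%y z. f a y z) b)"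
 proof (rule bilinI)
 show "lin C W (%y. sw C W (%y z. f x y z) y)" if "x .: C" for x by (rule lin_sw[OF C W t(2)[OF that]])
 show "y .: C ==> lin C W (%x. sw C W (%y z. f x y z) y)" for y
 by (rule lin_sw_fun[OF C v W]) (insert f, auto simp:trilin_def)
 qed
qed

text \<open>The nested sums in the definition are evaluated from the inside; the outer one requires
  the inner sum to be bilinear in the two outer legs, which \<open>bilin_sw_left\<close>
  provides.\<close>

lemma coassoc_iff:
 assumes P: "precoalg C" and x: "x .: C"
 shows "sweedler (tensor [C,C,C])
 (%x1 x2. sweedler (tensor [C,C,C]) (%y z. tens [C,C,C][y,z,x2]) (comult C x1)) (comult C x)
 = sw C (tensor [C,C,C]) (%a b. sw C (tensor [C,C,C]) (%y z. tens [C,C,C][y,z,b]) a) x"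
 "sweedler (tensor [C,C,C])
 (%x1 x2. sweedler (tensor [C,C,C]) (%y z. tens [C,C,C][x1,y,z]) (comult C x2)) (comult C x)
 = sw C (tensor [C,C,C]) (%a b. sw C (tensor [C,C,C]) (%y z. tens [C,C,C][a,y,z]) b) x"
proof -
 let ?T = "tensor [C,C,C]"
 note v = preD(1)[OF P]
 note T = tensor3[OF v v v] and t = trilin_parts[OF tensor3(2)[OF v v v]]
 have b: "bilin C C ?T (%a b. sweedler ?T (%y z. tens [C,C,C][y,z,b]) (comult C a))"
 "bilin C C ?T (%a b. sweedler ?T (%y z. tens [C,C,C][a,y,z]) (comult C b))"
 using bilin_sw_left[OF P T(1,2)] sweedler_sw[OF P T(1) t(1)] sweedler_sw[OF P T(1) t(2)]
 by (simp_all add: bilin_def klinear_def Pi_def v)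
 show "sweedler ?T (%x1 x2. sweedler ?T (%y z. tens [C,C,C][y,z,x2]) (comult C x1)) (comult C x)
 = sw C ?T (%a b. sw C ?T (%y z. tens [C,C,C][y,z,b]) a) x"
 unfolding sweedler_sw[OF P T(1) b(1) x]
 by (rule sw_cong[OF P T(1) x]) (insert sweedler_sw[OF P T(1) t(1)] T, auto intro!:sw_closed[OF P])
 show "sweedler ?T (%x1 x2. sweedler ?T (%y z. tens [C,C,C][x1,y,z]) (comult C x2)) (comult C x)
 = sw C ?T (%a b. sw C ?T (%y z. tens [C,C,C][a,y,z]) b) x"
 unfolding sweedler_sw[OF P T(1) b(2) x]
 by (rule sw_cong[OF P T(1) x]) (insert sweedler_sw[OF P T(1) t(2)] T, auto intro!:sw_closed[OF P])
qed

text \<open>A trilinear map factors through the threefold tensor product; the induced linear map is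
  applied to the coassociativity equation there and moved inside the sums.\<close>

lemma sw_coassoc:
 assumes C: "coalgebra C" and W: "vspace W" and f: "trilin C C C W f" and x: "x .: C"
 shows "sw C W (%a b. sw C W (%y z. f y z b) a) x = sw C W (%a b. sw C W (%y z. f a y z) b) x"
proof -
 let ?T = "tensor [C,C,C]"
 note P = coalg_pre[OF C] and v = coalg_vs[OF C]
 note T = tensor3[OF v v v]
 obtain F where F: "lin ?T W F" 
 "!!x y z. x .: C ==> y .: C ==> z .: C ==> F (tens [C,C,C][x,y,z]) = f x y z"
 using trilin_ext[OF v v v W f] by blast
 note fc = trilin_parts(3)[OF f]
 have "F (sw C ?T (%a b. sw C ?T (%y z. tens [C,C,C][y,z,b]) a) x) = sw C W (%a b. sw C W (%y z. f y z b) a) x"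
 proof (subst sw_push[OF P F(1) T(1) W x])
 show "sw C W (%a b. F (sw C ?T (%y z. tens [C,C,C][y,z,b]) a)) x = sw C W (%a b. sw C W (%y z. f y z b) a) x"
 proof (rule sw_cong[OF P W x])
 fix a b assume ab: "a .: C" "b .: C"
 show "F (sw C ?T (%y z. tens [C,C,C][y,z,b]) a) = sw C W (%y z. f y z b) a"
 by (subst sw_push[OF P F(1) T(1) W ab(1)]) (insert ab T F(2) fc, auto intro!:sw_cong[OF P W])
 qed (insert fc W, auto intro!:sw_closed[OF P])
 qed (insert T, auto intro!:sw_closed[OF P])
 moreover have "F (sw C ?T (%a b. sw C ?T (%y z. tens [C,C,C][a,y,z]) b) x) = sw C W (%a b. sw C W (%y z. f a y z) b) x"
 proof (subst sw_push[OF P F(1) T(1) W x])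
 show "sw C W (%a b. F (sw C ?T (%y z. tens [C,C,C][a,y,z]) b)) x = sw C W (%a b. sw C W (%y z. f a y z) b) x"
 proof (rule sw_cong[OF P W x])
 fix a b assume ab: "a .: C" "b .: C"
 show "F (sw C ?T (%y z. tens [C,C,C][a,y,z]) b) = sw C W (%y z. f a y z) b"
 by (subst sw_push[OF P F(1) T(1) W ab(2)]) (insert ab T F(2) fc, auto intro!:sw_cong[OF P W])
 qed (insert fc W, auto intro!:sw_closed[OF P])
 qed (insert T, auto intro!:sw_closed[OF P])
 moreover have "sw C ?T (%a b. sw C ?T (%y z. tens [C,C,C][y,z,b]) a) x = sw C ?T (%a b. sw C ?T (%y z. tens [C,C,C][a,y,z]) b) x"
 using C x coassoc_iff[OF P x] by (auto simp:coalgebra_def)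
 ultimately show ?thesis by simp
qed

lemma bilin_flip: "bilin C D W f ==> bilin D C W (%a b. f b a)"
 by (auto simp:bilin_def)

text \<open>Cocommutativity is assumed at the single element \<open>x\<close> of a precoalgebra,
  since \<open>cocommI\<close> exchanges legs before any coalgebra law is established.\<close>

lemma sw_flip:
 assumes P: "precoalg C" and W: "vspace W" and f: "bilin C C W f" and x: "x .: C"
 and fl: "sw C (tensor [C,C]) (%a b. tens [C,C][b,a]) x = comult C x"
 shows "sw C W (%a b. f b a) x = sw C W f x"
proof -
 note v = preD(1)[OF P]
 note T = tensor2[OF v v] and F = sweedler_bilin[OF v v W f]
 have "sw C W f x = sweedler W f (sw C (tensor [C,C]) (%a b. tens [C,C][b,a]) x)" unfolding fl by (rule sweedler_sw[symmetric, OF P W f x])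
 also have "... = sw C W (%a b. f b a) x"
 by (subst sw_push[OF P F(1) T(1) W x]) (insert T F(2) bl3[OF f] W x, auto intro!:sw_cong[OF P])
 finally show ?thesis by simp
qed

lemma sw_cocomm:
 assumes C: "ccoalg C" and W: "vspace W" and f: "bilin C C W f" and x: "x .: C"
 shows "sw C W (%a b. f b a) x = sw C W f x"
proof (rule sw_flip[OF _ W f x])
 show P: "precoalg C" by (rule cc_pre[OF C])
 note T = tensor2[OF preD(1)[OF P] pre1[OF P]]
 show "sw C (tensor [C,C]) (%a b. tens [C,C][b,a]) x = comult C x"
 using C x sweedler_sw[OF P T(1) bilin_flip[OF T(2)] x] by (simp add:cocomm_coalgebra_def)
qed

text \<open>The legs of \<open>f x\<close> are the images of the legs of \<open>x\<close>. This rule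
  carries Sweedler identities between a coalgebra and its images, subcoalgebras and
  quotients.\<close>

lemma sw_hom:
 assumes C: "precoalg C" and D: "precoalg D" and f: "chom C D f" and W: "vspace W" and B: "bilin D D W B" and x: "x .: C"
 shows "sw D W B (f x) = sw C W (%a b. B (f a) (f b)) x"
proof -
 note vC = preD(1)[OF C] and vD = preD(1)[OF D]
 note T = tensor2[OF vD vD] and F = sweedler_bilin[OF vD vD W B]
 have lf: "lin C D f" using f by (simp add:coalg_hom_def)
 note fc = linD(1)[OF lf]
 have b: "bilin C C (tensor [D,D]) (%a b. tens [D,D][f a,f b])"
 by (rule bilinI) (use linc[OF lf bilinD(1)[OF T(2)]] linc[OF lf bilinD(2)[OF T(2)]] fc in auto)
 have "sw D W B (f x) = sweedler W B (comult D (f x))" by (rule sweedler_sw[symmetric, OF D W B fc[OF x]])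
 also have "comult D (f x) = sw C (tensor [D,D]) (%a b. tens [D,D][f a,f b]) x"
 using f x sweedler_sw[OF C T(1) b x] by (simp add:coalg_hom_def)
 also have "sweedler W B (sw C (tensor [D,D]) (%a b. tens [D,D][f a,f b]) x) = sw C W (%a b. B (f a) (f b)) x"
 by (subst sw_push[OF C F(1) T(1) W x]) (insert T F(2) bl3[OF B] W x fc, auto intro!:sw_cong[OF C])
 finally show ?thesis .
qed

lemma bilin_comp:
 assumes "bilin C D W B" "lin X C f" "lin Y D g"
 shows "bilin X Y W (%a b. B (f a) (g b))"
 by (rule bilinI) (use linc[OF assms(2) bl1[OF assms(1)]] linc[OF assms(3) bl2[OF assms(1)]]
 lin1[OF assms(2)] lin1[OF assms(3)] in auto)

lemma coalg_homI:
 assumes C: "precoalg C" and D: "vspace D" and f: "lin C D f"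
 and c: "!!x. x .: C ==> comult D (f x) = sw C (tensor [D,D]) (%a b. tens [D,D][f a,f b]) x"
 and e: "!!x. x .: C ==> counit D (f x) = counit C x"
 shows "chom C D f"
 unfolding coalg_hom_def
 using f c e sweedler_sw[OF C tensor2(1)[OF D D] bilin_comp[OF tensor2(2)[OF D D] f f]] by simp

lemma coalg_hom_comult:
 assumes C: "precoalg C" and D: "vspace D" and f: "chom C D f" and x: "x .: C"
 shows "comult D (f x) = sw C (tensor [D,D]) (%a b. tens [D,D][f a,f b]) x"
 using f x sweedler_sw[OF C tensor2(1)[OF D D] bilin_comp[OF tensor2(2)[OF D D]], of f f x] by (simp add:coalg_hom_def)

text \<open>Exchange of legs turns one counit law into the other, so a single one has to be
  supplied.\<close>

lemma cocommI:
 assumes P: "precoalg C"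
 and "!!x. x .: C ==> sw C (tensor [C,C,C]) (%a b. sw C (tensor [C,C,C]) (%y z. tens [C,C,C][y,z,b]) a) x
 = sw C (tensor [C,C,C]) (%a b. sw C (tensor [C,C,C]) (%y z. tens [C,C,C][a,y,z]) b) x"
 and "!!x. x .: C ==> sw C C (%a b. counit C a *.[C] b) x = x"
 and flip: "!!x. x .: C ==> sw C (tensor [C,C]) (%a b. tens [C,C][b,a]) x = comult C x"
 shows "ccoalg C"
proof -
 note v = preD(1)[OF P]
 note e = linD[OF preD(3)[OF P]]
 have b: "bilin C C C (%a b. counit C a *.[C] b)" "bilin C C C (%a b. counit C b *.[C] a)"
 by (intro bilinI linI; use e v in \<open>simp add:vs_smult vs_smultC\<close>)+
 have "coalgebra C"
 unfolding coalgebra_def using assms(2,3) sw_flip[OF P v b(1) _ flip] coassoc_iff[OF P] sweedler_sw[OF P v b(1)] sweedler_sw[OF P v b(2)] preD[OF P] by simp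
 then show ?thesis
 unfolding cocomm_coalgebra_def using flip sweedler_sw[OF P tensor2(1) bilin_flip[OF tensor2(2)]] v by simp
qed

section \<open>Constructions of coalgebras\<close>

text \<open>Generation is tested against submodules, because equalizers of linear maps are
  submodules: two linear maps agreeing on \<open>Y\<close> then agree everywhere.\<close>

definition spans :: "('k::field,'v,'z) msch=>'v set=>bool" where
 "spans M Y <-> (ALL N. submodule N ground M & Y <= N --> car M <= N)"

lemma submodule_equalizer:
 assumes M: "vspace M" and W: "vspace W" and f: "lin M W f" and g: "lin M W g"
 shows "submodule {x:car M. f x = g x} ground M"
 by (rule submI[OF M]) (use M linD[OF f] linD[OF g] lin_zero[OF f M W] lin_zero[OF g M W] in auto)

lemma spans_eqI:
 assumes "spans M Y" "vspace M" "vspace W" "lin M W f" "lin M W g" "Y <= car M"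
 "!!y. y:Y ==> f y = g y" "x .: M"
 shows "f x = g x"
proof -
 have "Y <= {x:car M. f x = g x}" using assms(6,7) by auto
 then have "car M <= {x:car M. f x = g x}"
 using assms(1) submodule_equalizer[OF assms(2-5)] unfolding spans_def by blast
 then show ?thesis using assms(8) by auto
qed

lemma trilin_comp:
 assumes f: "trilin C D E W f" and u: "lin X C u" "lin Y D v" "lin Z E w"
 shows "trilin X Y Z W (%x y z. f (u x) (v y) (w z))"
proof -
 have *: "!!y z. y .: D ==> z .: E ==> lin C W (%x. f x y z)"
 "!!x z. x .: C ==> z .: E ==> lin D W (%y. f x y z)"
 "!!x y. x .: C ==> y .: D ==> lin E W (%z. f x y z)"
 using f by (auto simp:trilin_def)
 note c = linD(1)[OF u(1)] lin1[OF u(2)] lin1[OF u(3)]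
 show ?thesis
 proof (rule trilinI)
 show "lin X W (%x. f (u x) (v y) (w z))" if "y .: Y" "z .: Z" for y z
 by (rule linc[OF u(1) *(1)]) (rule c that)+
 show "lin Y W (%y. f (u x) (v y) (w z))" if "x .: X" "z .: Z" for x z
 by (rule linc[OF u(2) *(2)]) (rule c that)+
 show "lin Z W (%z. f (u x) (v y) (w z))" if "x .: X" "y .: Y" for x y
 by (rule linc[OF u(3) *(3)]) (rule c that)+
 qed
qed

text \<open>Sums over \<open>M\<close> at a point of the image pull back to sums over
  \<open>C\<close>, where coassociativity holds; \<open>M\<close> acquires the law at all such
  points.\<close>

lemma sw_coassoc_hom:
 assumes C: "coalgebra C" and M: "precoalg M" and f: "chom C M f" and W: "vspace W" and F: "trilin M M M W F"
 and x: "x .: C"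
 shows "sw M W (%a b. sw M W (%y z. F y z b) a) (f x) = sw M W (%a b. sw M W (%y z. F a y z) b) (f x)"
proof -
 note P = coalg_pre[OF C]
 have lf: "lin C M f" using f by (simp add:coalg_hom_def)
 note fc = linD(1)[OF lf] and Fc = trilin_parts(3)[OF F] and v = preD(1)[OF M]
 have "sw M W (%a b. sw M W (%y z. F y z b) a) (f x) = sw C W (%a b. sw M W (%y z. F y z (f b)) (f a)) x"
 by (rule sw_hom[OF P M f W bilin_sw_left(1)[OF M W F] x])
 also have "... = sw C W (%a b. sw C W (%y z. F (f y) (f z) (f b)) a) x"
 by (rule sw_cong[OF P W x], rule sw_hom[OF P M f W trilin_parts(1)[OF F]])
 (insert fc Fc W, auto intro!:sw_closed[OF P])
 also have "... = sw C W (%a b. sw C W (%y z. F (f a) (f y) (f z)) b) x"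
 by (rule sw_coassoc[OF C W trilin_comp[OF F lf lf lf] x])
 also have "... = sw C W (%a b. sw M W (%y z. F (f a) y z) (f b)) x"
 by (rule sw_cong[OF P W x], rule sw_hom[symmetric, OF P M f W trilin_parts(2)[OF F]])
 (insert fc Fc W, auto intro!:sw_closed[OF M])
 also have "... = sw M W (%a b. sw M W (%y z. F a y z) b) (f x)"
 by (rule sw_hom[symmetric, OF P M f W bilin_sw_left(2)[OF M W F] x])
 finally show ?thesis .
qed

text \<open>Every coalgebra law equates two linear functions of the element, so it can be verified
  on a spanning set of images, to which it is transported from the sources.\<close>

lemma coalg_cover:
 fixes M :: "('k::field,'m) coalg" and Cj :: "'j=>('k,'c) coalg"
 assumes M: "precoalg M" and sp: "spans M (UN j:J. f j ` car (Cj j))"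
 and C: "!!j. j:J ==> ccoalg (Cj j)" and f: "!!j. j:J ==> chom (Cj j) M (f j)"
 shows "ccoalg M"
proof -
 note v = preD(1)[OF M]
 have fc: "x .: Cj j ==> f j x .: M" if "j:J" for j x
 using f[OF that] lin1 by (auto simp:coalg_hom_def)
 have eqI: "F x = G x" if "vspace W" "lin M W F" "lin M W G"
 "!!j y. j:J ==> y .: Cj j ==> F (f j y) = G (f j y)" "x .: M"
 for F G x and W :: "('k,'w,'z) msch"
 by (rule spans_eqI[OF sp v that(1-3) _ _ that(5)]) (use fc that(4) in auto)
 note e = linD[OF preD(3)[OF M]]
 have bc: "bilin M M M (%a b. counit M a *.[M] b)"
 by (intro bilinI linI; use e v in \<open>simp add:vs_smult vs_smultC\<close>)+
 note T2 = tensor2[OF v v] and T3 = tensor3[OF v v v]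
 show ?thesis
 proof (rule cocommI[OF M])
 fix x assume x: "x .: M"
 show "sw M (tensor [M,M,M]) (%a b. sw M (tensor [M,M,M]) (%y z. tens [M,M,M][y,z,b]) a) x
 = sw M (tensor [M,M,M]) (%a b. sw M (tensor [M,M,M]) (%y z. tens [M,M,M][a,y,z]) b) x"
 by (rule eqI[OF T3(1) lin_sw[OF M T3(1) bilin_sw_left(1)[OF M T3(1,2)]] lin_sw[OF M T3(1) bilin_sw_left(2)[OF M T3(1,2)]] _ x])
 (rule sw_coassoc_hom[OF cc_coalg[OF C] M f T3(1,2)])
 have "sw M M (%a b. counit M a *.[M] b) (f j y) = f j y" if j: "j:J" and y: "y .: Cj j" for j y
 proof -
 note cj = cc_coalg[OF C[OF j]] and fj = f[OF j]
 note P = coalg_pre[OF cj]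
 have lf: "lin (Cj j) M (f j)" and ef: "!!x. x .: Cj j ==> counit M (f j x) = counit (Cj j) x"
 using fj by (auto simp:coalg_hom_def)
 have "sw M M (%a b. counit M a *.[M] b) (f j y) = sw (Cj j) M (%a b. counit M (f j a) *.[M] f j b) y" by (rule sw_hom[OF P M fj v bc y])
 also have "... = sw (Cj j) M (%a b. counit (Cj j) a *.[M] f j b) y"
 by (rule sw_cong[OF P v y]) (use ef fc[OF j] v in auto)
 finally show ?thesis using sw_counit(1)[OF cj v lf y] by simp
 qed
 then show "sw M M (%a b. counit M a *.[M] b) x = x"
 by (intro eqI[OF v lin_sw[OF M v bc] lin_id _ x]; blast)
 have "sw M (tensor [M,M]) (%a b. tens [M,M][b,a]) x = sw M (tensor [M,M]) (%a b. tens [M,M][a,b]) x"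
 proof (rule eqI[OF T2(1) lin_sw[OF M T2(1) bilin_flip[OF T2(2)]] lin_sw[OF M T2(1,2)] _ x])
 fix j y assume j: "j:J" and y: "y .: Cj j"
 note P = cc_pre[OF C[OF j]]
 have lf: "lin (Cj j) M (f j)" using f[OF j] by (simp add:coalg_hom_def)
 show "sw M (tensor [M,M]) (%a b. tens [M,M][b,a]) (f j y) = sw M (tensor [M,M]) (%a b. tens [M,M][a,b]) (f j y)"
 unfolding sw_hom[OF P M f[OF j] T2(1) bilin_flip[OF T2(2)] y] sw_hom[OF P M f[OF j] T2(1,2) y]
 by (rule sw_cocomm[OF C[OF j] T2(1) bilin_comp[OF T2(2) lf lf] y])
 qed
 then show "sw M (tensor [M,M]) (%a b. tens [M,M][b,a]) x = comult M x" using comult_sw[OF M x] by simp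
 qed
qed

text \<open>Asks for one common value on all pairs of representatives instead of linearity in each
  argument: in the coproduct condition for measurings, balancing over the base appears only after
  the sum over the first argument has been carried out.\<close>

lemma lin_ext2_const:
 assumes W: "vspace W" and ne: "t ~= {}" "t' ~= {}"
 and c: "!!p q x y. p:t ==> q:t' ==> x:keys p ==> y:keys q ==> g x y .: W"
 and v: "!!p q. p:t ==> q:t' ==> ev W (%x. ev W (g x) q) p = v"
 shows "lin_ext2 W g t t' = v"
proof -
 interpret W: abelian_group W by (rule vs_abelian[OF W])
 have *: "(\<Oplus>\<^bsub>W\<^esub>x\<in>keys p. \<Oplus>\<^bsub>W\<^esub>y\<in>keys q.
 (lookup p x * lookup q y) *.[W] g x y) = v" if "p:t" "q:t'" for p q
 proof -
 have "(\<Oplus>\<^bsub>W\<^esub>y\<in>keys q. (lookup p x * lookup q y) *.[W] g x y)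
 = lookup p x *.[W] ev W (g x) q" if x: "x:keys p" for x
 proof -
 have "(\<Oplus>\<^bsub>W\<^esub>y\<in>keys q. (lookup p x * lookup q y) *.[W] g x y)
 = ev W (%y. lookup p x *.[W] g x y) q"
 unfolding ev_def
 by (rule W.add.finprod_cong') (use c[OF \<open>p : t\<close> \<open>q : t'\<close> x] W in \<open>auto simp:vs_smult(3) intro: vs_smultC\<close>)
 also have "... = lookup p x *.[W] ev W (g x) q"
 by (rule ev_fun_smult[OF W]) (rule c[OF \<open>p : t\<close> \<open>q : t'\<close> x])
 finally show ?thesis .
 qed
 then have "(\<Oplus>\<^bsub>W\<^esub>x\<in>keys p. \<Oplus>\<^bsub>W\<^esub>y\<in>keys q.
 (lookup p x * lookup q y) *.[W] g x y) = ev W (%x. ev W (g x) q) p"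
 unfolding ev_def[of W _ p]
 by (intro W.add.finprod_cong') (insert c that W, auto intro!:vs_closed(3) ev_closed)
 then show ?thesis using v that by simp
 qed
 have "(%(p,q). \<Oplus>\<^bsub>W\<^esub>x\<in>keys p. \<Oplus>\<^bsub>W\<^esub>y\<in>keys q.
 (lookup p x * lookup q y) *.[W] g x y) ` (t \<times> t') = (%_. v) ` (t \<times> t')"
 by (rule image_cong[OF refl]) (auto simp:*)
 also have "... = {v}" using ne by (auto simp:image_constant_conv)
 finally have "(%(p,q). \<Oplus>\<^bsub>W\<^esub>x\<in>keys p. \<Oplus>\<^bsub>W\<^esub>y\<in>keys q.
 (lookup p x * lookup q y) *.[W] g x y) ` (t \<times> t') = {v}" .
 then show ?thesis unfolding lin_ext2_def by simp
qed

definition qlin :: "('k::field,'c,'x) msch=>('k,'d,'y) msch=>('k,'w,'z) msch=>('c=>'c=>'d=>'d=>'w)=>bool" where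
 "qlin C D W f <-> (ALL c:car D. ALL d:car D. bilin C C W (%a b. f a b c d)) & (ALL a:car C. ALL b:car C. bilin D D W (f a b))"

lemma qlinD:
 assumes "qlin C D W f"
 shows "c .: D ==> d .: D ==> bilin C C W (%a b. f a b c d)" "a .: C ==> b .: C ==> bilin D D W (f a b)"
 "a .: C ==> b .: C ==> c .: D ==> d .: D ==> f a b c d .: W"
 using assms bilinD(3)[of D D W "f a b" c d] by (auto simp:qlin_def)

lemma bilin_sw_param:
 assumes D: "precoalg D" and C: "vspace C" and W: "vspace W" and f: "qlin C D W f" and y: "y .: D"
 shows "bilin C C W (%a b. sw D W (f a b) y)"
proof (rule bilinI)
 fix a assume a: "a .: C"
 show "lin C W (%x. sw D W (f x a) y)"
 by (rule lin_sw_fun[OF D C W y], rule bilinD(1)[OF qlinD(1)[OF f] a]) 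
 show "lin C W (%x. sw D W (f a x) y)"
 by (rule lin_sw_fun[OF D C W y], rule bilinD(2)[OF qlinD(1)[OF f] a])
qed

lemma bilin_sw_sw:
 assumes C: "precoalg C" and D: "precoalg D" and W: "vspace W" and f: "qlin C D W f"
 shows "bilin C D W (%x y. sw C W (%a b. sw D W (f a b) y) x)"
proof (rule bilinI)
 show "lin C W (%x. sw C W (%a b. sw D W (f a b) y) x)" if "y .: D" for y
 by (rule lin_sw[OF C W bilin_sw_param[OF D preD(1)[OF C] W f that]])
 show "lin D W (%y. sw C W (%a b. sw D W (f a b) y) x)" if "x .: C" for x
 by (rule lin_sw_fun[OF C preD(1)[OF D] W that], rule lin_sw[OF D W qlinD(2)[OF f]])
qed

lemma bilin_cong:
 assumes "bilin C D W g" "vspace C" "vspace D" "!!x y. x .: C ==> y .: D ==> f x y = g x y"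
 shows "bilin C D W f"
proof (rule bilinI)
 fix y assume y: "y .: D"
 show "lin C W (%x. f x y)" using lin_cong[OF assms(2), of "%x. f x y" "%x. g x y" W] assms(4) y bilinD(1)[OF assms(1) y] by simp
next
 fix x assume x: "x .: C"
 show "lin D W (%y. f x y)" using lin_cong[OF assms(3), of "%y. f x y" "%y. g x y" W] assms(4) x bilinD(2)[OF assms(1) x] by simp
qed

lemma tensor2_rep:
 assumes "vspace C" "vspace D" "t .: (tensor [C,D])"
 shows "t ~= {}" "p:t ==> xs:keys p ==> xs ! 0 .: C & xs ! 1 .: D"
proof -
 have v: "!!M. M:set [C,D] ==> vspace M" using assms by auto
 obtain p' where "p':t" by (rule tensor_rep[OF v assms(3)])
 then show "t ~= {}" by auto
 assume p: "p:t" "xs:keys p"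
 have "keys p <= tgens [C,D]"
 by (rule pres_mem(1)[OF tensor_rels_free[OF v], of _ t]) (insert assms(3) p, simp_all add: tensor_def)
 then have "xs:tgens [C,D]" using p by auto
 then show "xs ! 0 .: C & xs ! 1 .: D" by (auto simp:tgens_2)
qed

lemma sweedler2_sw:
 assumes C: "precoalg C" and D: "precoalg D" and W: "vspace W" and f: "qlin C D W f" and x: "x .: C" and y: "y .: D"
 shows "sweedler2 W f (comult C x) (comult D y) = sw C W (%a b. sw D W (f a b) y) x"
proof (rule lin_ext2_const[OF W])
 note vC = preD(1)[OF C] and vD = preD(1)[OF D] and X = preD(4)[OF C x] and Y = preD(4)[OF D y]
 show "comult C x ~= {}" "comult D y ~= {}" by (rule tensor2_rep(1)[OF vC vC X] tensor2_rep(1)[OF vD vD Y])+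
 fix p q assume p: "p:comult C x" and q: "q:comult D y"
 note kp = tensor2_rep(2)[OF vC vC X p] and kq = tensor2_rep(2)[OF vD vD Y q]
 show "f (xs ! 0) (xs ! 1) (ys ! 0) (ys ! 1) .: W" if "xs:keys p" "ys:keys q" for xs ys
 using kp[OF that(1)] kq[OF that(2)] qlinD(3)[OF f] by auto
 have "ev W (%xs. ev W (%ys. f (xs ! 0) (xs ! 1) (ys ! 0) (ys ! 1)) q) p = ev W (%xs. sw D W (f (xs ! 0) (xs ! 1)) y) p"
 proof (rule ev_cong[OF W])
 fix xs assume "xs:keys p"
 then have m: "xs ! 0 .: C" "xs ! 1 .: C" using kp by auto
 note b = qlinD(2)[OF f m]
 show "ev W (%ys. f (xs ! 0) (xs ! 1) (ys ! 0) (ys ! 1)) q = sw D W (f (xs ! 0) (xs ! 1)) y"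
 using sweedler_bilin(3)[OF vD vD W b Y q] sweedler_sw[OF D W b y] by simp
 show "sw D W (f (xs ! 0) (xs ! 1)) y .: W" by (rule sw_closed[OF D W y bilinD(3)[OF b]])
 qed
 also have "... = sw C W (%a b. sw D W (f a b) y) x"
 using sweedler_bilin(3)[OF vC vC W bilin_sw_param[OF D vC W f y] X p] sweedler_sw[OF C W bilin_sw_param[OF D vC W f y] x] by simp
 finally show "ev W (%xs. ev W (%ys. f (xs ! 0) (xs ! 1) (ys ! 0) (ys ! 1)) q) p = sw C W (%a b. sw D W (f a b) y) x" .
qed

text \<open>\<open>tensor\<close> depends only on carriers, additions and scalar multiplications; a
  coalgebra record and its underlying space therefore have equal tensor squares, not merely
  isomorphic ones.\<close>

lemma tensor_cong:
 assumes l: "length Ms = length Ms'"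
 and eq: "!!i. i < length Ms ==> car (Ms ! i) = car (Ms' ! i) & add (Ms ! i) = add (Ms' ! i) & smult (Ms ! i) = smult (Ms' ! i)"
 shows "tensor Ms = tensor Ms'" "tens Ms = tens Ms'"
proof -
 have g: "tgens Ms = tgens Ms'" using assms by (auto simp:tensor_gens_def list_all2_conv_all_nth)
 have "multilin_rels (%xs. xs) Ms = multilin_rels (%xs. xs) Ms'"
 unfolding multilin_rels_def using g gens_nth[of _ _ _ Ms] eq by (intro arg_cong2[where f = "(\<union>)"]) (metis (no_types, lifting))+
 then show "tensor Ms = tensor Ms'" "tens Ms = tens Ms'" using g by (simp_all add: tensor_def tens_def[abs_def])
qed

lemma lin_scheme_cong:
 assumes "car V = car V'" "add V = add V'" "smult V = smult V'" "car W = car W'" "add W = add W'" "smult W = smult W'"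
 shows "lin V W f = lin V' W' f"
 using assms by (simp add:klinear_def)

section \<open>Tensor product of cocommutative coalgebras\<close>

context
 fixes C D :: "('k::field,'c) coalg"
 assumes C: "ccoalg C" and D: "ccoalg D"
begin

private abbreviation (input) "T == tensor [C,D]"
private abbreviation (input) "t2 x y == tens [C,D][x,y]"
private abbreviation (input) "TC == tensor_coalg C D"

lemma TC_simps:
 "car TC = car T" "add TC = add T" "smult TC = smult T" "zero TC = zero T"
 "comult TC t = sweedler (tensor [T,T]) (%x y. sweedler2 (tensor [T,T])
 (%x1 x2 y1 y2. tens [T,T][t2 x1 y1,t2 x2 y2]) (comult C x) (comult D y)) t"
 "counit TC t = sweedler ground (%x y. counit C x * counit D y) t"
 by (simp_all add: tensor_coalg_def Let_def module.defs coalg.defs)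

lemma tensor_coalg_tensor: "tensor [TC,TC] = tensor [T,T]" "tens [TC,TC] = tens [T,T]"
 by (rule tensor_cong; auto simp:less_Suc_eq TC_simps)+

private lemmas PC = cc_pre[OF C] and PD = cc_pre[OF D]
private lemmas vC_cc = cc_vs[OF C] and vD_cc = cc_vs[OF D]
private lemmas T2 = tensor2[OF vC_cc vD_cc]

lemma vspace_tensor_coalg: "vspace TC"
proof -
 have "module_axioms ground T" "abelian_group T" using T2(1) by (auto simp:module_def)
 show ?thesis by (rule vspaceI) (insert T2(1), auto simp:TC_simps vs_smult vs_neg vs_add_ac)
qed

lemma lin_TC: "lin TC W = lin T W" "lin W TC = lin W T"
 by (intro ext lin_scheme_cong; simp add:TC_simps)+

lemma bilin_TC: "bilin TC TC W = bilin T T W"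
 by (intro ext) (simp add:bilin_def lin_TC TC_simps)

lemma qlin_tens:
 assumes "bilin T T W B"
 shows "qlin C D W (%a b c d. B (t2 a c) (t2 b d))"
 unfolding qlin_def
 by (intro conjI ballI bilinI;
 rule linc[OF bilinD(1)[OF T2(2)] bl1[OF assms]] linc[OF bilinD(1)[OF T2(2)] bl2[OF assms]]
 linc[OF bilinD(2)[OF T2(2)] bl1[OF assms]] linc[OF bilinD(2)[OF T2(2)] bl2[OF assms]])
 (auto simp:T2(3))

lemma comult_TC_tens:
 shows "lin T (tensor [T,T]) (comult TC)"
 "x .: C ==> y .: D ==> comult TC (t2 x y)
 = sw C (tensor [T,T]) (%a b. sw D (tensor [T,T]) (%c d. tens [T,T][t2 a c,t2 b d]) y) x"
proof -
 note TT = tensor2[OF T2(1) T2(1)]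
 note q = qlin_tens[OF TT(2)]
 have b: "bilin C D (tensor [T,T]) (%x y. sweedler2 (tensor [T,T])
 (%x1 x2 y1 y2. tens [T,T][t2 x1 y1,t2 x2 y2]) (comult C x) (comult D y))"
 by (rule bilin_cong[OF bilin_sw_sw[OF PC PD TT(1) q] vC_cc vD_cc sweedler2_sw[OF PC PD TT(1) q]])
 show "lin T (tensor [T,T]) (comult TC)"
 unfolding TC_simps(5)[abs_def] by (rule sweedler_bilin(1)[OF vC_cc vD_cc TT(1) b])
 show "comult TC (t2 x y)
 = sw C (tensor [T,T]) (%a b. sw D (tensor [T,T]) (%c d. tens [T,T][t2 a c,t2 b d]) y) x"
 if "x .: C" "y .: D"
 unfolding TC_simps(5) sweedler_bilin(2)[OF vC_cc vD_cc TT(1) b that] by (rule sweedler2_sw[OF PC PD TT(1) q that])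
qed

lemma counit_TC_tens:
 shows "lin T ground (counit TC)"
 "x .: C ==> y .: D ==> counit TC (t2 x y) = counit C x * counit D y"
proof -
 note e = linD[OF preD(3)[OF PC]] linD[OF preD(3)[OF PD]]
 have b: "bilin C D ground (%x y. counit C x * counit D y)"
 by (intro bilinI linI) (insert e, auto simp:algebra_simps)
 show "lin T ground (counit TC)"
 unfolding TC_simps(6)[abs_def] by (rule sweedler_bilin(1)[OF vC_cc vD_cc vspace_ground b])
 show "counit TC (t2 x y) = counit C x * counit D y" if "x .: C" "y .: D"
 unfolding TC_simps(6) by (rule sweedler_bilin(2)[OF vC_cc vD_cc vspace_ground b that])
qed

lemma precoalg_TC: "precoalg TC"
 unfolding precoalg_def tensor_coalg_tensor
 using vspace_tensor_coalg comult_TC_tens(1) counit_TC_tens(1) by (simp add:lin_TC)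

text \<open>The coproduct of an elementary tensor interleaves the legs of \<open>x\<close> with
  those of \<open>y\<close>; the linear map induced by \<open>B\<close> on the tensor square is
  moved inside both sums.\<close>

lemma sw_TC:
 assumes W: "vspace W" and B: "bilin T T W B" and x: "x .: C" and y: "y .: D"
 shows "sw TC W B (t2 x y) = sw C W (%a b. sw D W (%c d. B (t2 a c) (t2 b d)) y) x"
proof -
 note TT = tensor2[OF T2(1) T2(1)]
 note q = qlin_tens[OF B]
 note qc = qlinD(3)[OF q] and F = sweedler_bilin[OF T2(1) T2(1) W B]
 have t: "t2 x y .: TC" using T2(3) x y by (simp add:TC_simps)
 have "sw TC W B (t2 x y) = sweedler W B (comult TC (t2 x y))"
 by (rule sweedler_sw[symmetric, OF precoalg_TC W _ t]) (simp add:bilin_TC B)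
 also have "... = sw C W (%a b. sweedler W B (sw D (tensor [T,T]) (%c d. tens [T,T][t2 a c,t2 b d]) y)) x"
 unfolding comult_TC_tens(2)[OF x y]
 by (rule sw_push[OF PC F(1) TT(1) W x]) (auto intro!:sw_closed[OF PD TT(1) y] TT(3) T2(3))
 also have "... = sw C W (%a b. sw D W (%c d. B (t2 a c) (t2 b d)) y) x"
 proof (rule sw_cong[OF PC W x])
 fix a b assume ab: "a .: C" "b .: C"
 show "sw D W (%c d. B (t2 a c) (t2 b d)) y .: W" by (rule sw_closed[OF PD W y]) (use qc ab in auto)
 have "sweedler W B (sw D (tensor [T,T]) (%c d. tens [T,T][t2 a c,t2 b d]) y)
 = sw D W (%c d. sweedler W B (tens [T,T][t2 a c,t2 b d])) y"
 by (rule sw_push[OF PD F(1) TT(1) W y]) (insert ab, auto intro!:TT(3) T2(3))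
 also have "... = sw D W (%c d. B (t2 a c) (t2 b d)) y"
 by (rule sw_cong[OF PD W y], rule F(2)) (insert ab qc, auto intro!:T2(3))
 finally show "sweedler W B (sw D (tensor [T,T]) (%c d. tens [T,T][t2 a c,t2 b d]) y)
 = sw D W (%c d. B (t2 a c) (t2 b d)) y" .
 qed
 finally show ?thesis .
qed

text \<open>The two sums over \<open>C\<close> are brought to the outside and the two over
  \<open>D\<close> to the inside, so that coassociativity of each factor can be applied on its
  own.\<close>

lemma sw_TC_twice:
 assumes W: "vspace W" and F: "trilin T T T W F" and x: "x .: C" and y: "y .: D"
 shows "sw TC W (%p q. sw TC W (%u v. F u v q) p) (t2 x y)
 = sw C W (%a b. sw C W (%a1 a2. sw D W (%c d. sw D W (%c1 c2.
 F (t2 a1 c1) (t2 a2 c2) (t2 b d)) c) y) a) x" (is ?L)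
 and "sw TC W (%p q. sw TC W (%u v. F p u v) q) (t2 x y)
 = sw C W (%a b. sw C W (%b1 b2. sw D W (%c d. sw D W (%d1 d2.
 F (t2 a c) (t2 b1 d1) (t2 b2 d2)) d) y) b) x" (is ?R)
proof -
 have FT: "trilin TC TC TC W F" using F by (simp add:trilin_def lin_TC TC_simps)
 note Fc = trilin_parts(3)[OF F] and bT = bilin_sw_left[OF precoalg_TC W FT, unfolded bilin_TC]
 have "sw TC W (%p q. sw TC W (%u v. F u v q) p) (t2 x y)
 = sw C W (%a b. sw D W (%c d. sw TC W (%u v. F u v (t2 b d)) (t2 a c)) y) x"
 by (rule sw_TC[OF W bT(1) x y])
 also have "... = sw C W (%a b. sw D W (%c d. sw C W (%a1 a2. sw D W (%c1 c2.
 F (t2 a1 c1) (t2 a2 c2) (t2 b d)) c) a) y) x"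
 by (intro sw_cong[OF PC W x] sw_cong[OF PD W y] sw_TC[OF W trilin_parts(1)[OF F]] sw_closed[OF PC W] sw_closed[OF PD W] Fc T2(3) x y)
 also have "... = sw C W (%a b. sw C W (%a1 a2. sw D W (%c d. sw D W (%c1 c2.
 F (t2 a1 c1) (t2 a2 c2) (t2 b d)) c) y) a) x"
 by (rule sw_cong[OF PC W x], rule sw_swap[OF PD PC W y])
 (assumption | rule sw_closed[OF PC W] sw_closed[OF PD W] Fc T2(3) x y)+
 finally show ?L .
 have "sw TC W (%p q. sw TC W (%u v. F p u v) q) (t2 x y)
 = sw C W (%a b. sw D W (%c d. sw TC W (%u v. F (t2 a c) u v) (t2 b d)) y) x"
 by (rule sw_TC[OF W bT(2) x y])
 also have "... = sw C W (%a b. sw D W (%c d. sw C W (%b1 b2. sw D W (%d1 d2.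
 F (t2 a c) (t2 b1 d1) (t2 b2 d2)) d) b) y) x"
 by (intro sw_cong[OF PC W x] sw_cong[OF PD W y] sw_TC[OF W trilin_parts(2)[OF F]] sw_closed[OF PC W] sw_closed[OF PD W] Fc T2(3) x y)
 also have "... = sw C W (%a b. sw C W (%b1 b2. sw D W (%c d. sw D W (%d1 d2.
 F (t2 a c) (t2 b1 d1) (t2 b2 d2)) d) y) b) x"
 by (rule sw_cong[OF PC W x], rule sw_swap[OF PD PC W y])
 (assumption | rule sw_closed[OF PC W] sw_closed[OF PD W] Fc T2(3) x y)+
 finally show ?R .
qed

text \<open>Coassociativity of \<open>D\<close> is applied under the sums over \<open>C\<close>;
  what remains is a trilinear function \<open>?H\<close> on \<open>C\<close>, to which
  coassociativity of \<open>C\<close> applies.\<close>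

lemma sw_TC_coassoc:
 assumes W: "vspace W" and F: "trilin T T T W F" and x: "x .: C" and y: "y .: D"
 shows "sw TC W (%p q. sw TC W (%u v. F u v q) p) (t2 x y) = sw TC W (%p q. sw TC W (%u v. F p u v) q) (t2 x y)"
proof -
 let ?H = "%a1 a2 a3. sw D W (%c d. sw D W (%d1 d2. F (t2 a1 c) (t2 a2 d1) (t2 a3 d2)) d) y"
 note Fc = trilin_parts(3)[OF F]
 have k: "!!y z. y .: T ==> z .: T ==> lin T W (%x. F x y z)"
 "!!x z. x .: T ==> z .: T ==> lin T W (%y. F x y z)"
 "!!x y. x .: T ==> y .: T ==> lin T W (%z. F x y z)"
 using F by (auto simp:trilin_def)
 have tD: "trilin D D D W (%c1 c2 c3. F (t2 a1 c1) (t2 a2 c2) (t2 a3 c3))"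
 if "a1 .: C" "a2 .: C" "a3 .: C" for a1 a2 a3
 by (rule trilin_comp[OF F bilinD(2)[OF T2(2)] bl2[OF T2(2)] bl2[OF T2(2)]]) (use that in auto)
 have tC: "trilin C C C W ?H"
 by (intro trilinI lin_sw_fun[OF PD vC_cc W] linc[OF bilinD(1)[OF T2(2)] k(1)] linc[OF bilinD(1)[OF T2(2)] k(2)]
 linc[OF bilinD(1)[OF T2(2)] k(3)] T2(3) y)
 have "sw TC W (%p q. sw TC W (%u v. F u v q) p) (t2 x y) = sw C W (%a b. sw C W (%a1 a2. ?H a1 a2 b) a) x"
 unfolding sw_TC_twice(1)[OF W F x y]
 by (intro sw_cong[OF PC W] sw_coassoc[OF cc_coalg[OF D] W tD] sw_closed[OF PC W] sw_closed[OF PD W] Fc T2(3) x y)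
 also have "... = sw C W (%a b. sw C W (%b1 b2. ?H a b1 b2) b) x"
 by (rule sw_coassoc[OF cc_coalg[OF C] W tC x])
 finally show ?thesis unfolding sw_TC_twice(2)[OF W F x y] .
qed

lemma cocomm_TC: "ccoalg TC"
proof -
 note P = precoalg_TC and v = vspace_tensor_coalg
 have eqI: "f t = g t" if "vspace W" "lin TC W f" "lin TC W g" "t .: TC"
 "!!x y. x .: C ==> y .: D ==> f (t2 x y) = g (t2 x y)" for f g t and W :: "('k,'w,'z) msch"
 by (rule tensor2_eqI[OF vC_cc vD_cc that(1)]) (insert that, simp_all add: lin_TC TC_simps)
 note T3 = tensor3[OF v v v] and TT = tensor2[OF v v]
 have F: "trilin T T T (tensor [TC,TC,TC]) (%x y z. tens [TC,TC,TC][x,y,z])"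
 using T3(2) by (simp add:trilin_def lin_TC TC_simps)
 note eC = linD[OF preD(3)[OF PC]] and eD = linD[OF preD(3)[OF PD]]
 note e = linD[OF preD(3)[OF P]]
 have bc: "bilin TC TC TC (%a b. counit TC a *.[TC] b)"
 by (intro bilinI linI; use e v in \<open>simp add:vs_smult vs_smultC\<close>)+
 have tC: "t2 a c .: TC" if "a .: C" "c .: D" for a c
 using T2(3) that by (simp add:TC_simps)
 show ?thesis
 proof (rule cocommI[OF P])
 fix t assume t: "t .: TC"
 show "sw TC (tensor [TC,TC,TC]) (%a b. sw TC (tensor [TC,TC,TC]) (%y z. tens [TC,TC,TC][y,z,b]) a) t
 = sw TC (tensor [TC,TC,TC]) (%a b. sw TC (tensor [TC,TC,TC]) (%y z. tens [TC,TC,TC][a,y,z]) b) t"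
 by (rule eqI[OF T3(1) lin_sw[OF P T3(1) bilin_sw_left(1)[OF P T3(1,2)]] lin_sw[OF P T3(1) bilin_sw_left(2)[OF P T3(1,2)]] t])
 (rule sw_TC_coassoc[OF T3(1) F])
 have "sw TC TC (%a b. counit TC a *.[TC] b) (t2 x y) = t2 x y"
 if x: "x .: C" and y: "y .: D" for x y
 proof -
 have kD: "lin D TC (%y. t2 x y)" if "x .: C" for x using bilinD(2)[OF T2(2) that] by (simp add:lin_TC)
 have kC: "lin C TC (%x. t2 x y)" using bilinD(1)[OF T2(2) y] by (simp add:lin_TC)
 have "sw TC TC (%a b. counit TC a *.[TC] b) (t2 x y) = sw C TC (%a b. sw D TC (%c d. counit TC (t2 a c) *.[TC] t2 b d) y) x"
 by (rule sw_TC[OF v _ x y]) (insert bc, simp add:bilin_TC)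
 also have "... = sw C TC (%a b. counit C a *.[TC] t2 b y) x"
 proof (rule sw_cong[OF PC v x])
 fix a b assume ab: "a .: C" "b .: C"
 have "sw D TC (%c d. counit TC (t2 a c) *.[TC] t2 b d) y = sw D TC (%c d. counit C a *.[TC] (counit D c *.[TC] t2 b d)) y"
 by (rule sw_cong[OF PD v y]) (insert ab tC v, simp_all add: counit_TC_tens(2) vs_smult(3))
 also have "... = counit C a *.[TC] sw D TC (%c d. counit D c *.[TC] t2 b d) y"
 by (rule sw_fun_smult[OF PD v y]) (use ab tC v in simp)
 also have "sw D TC (%c d. counit D c *.[TC] t2 b d) y = t2 b y"
 by (rule sw_counit(1)[OF cc_coalg[OF D] v kD[OF ab(2)] y])
 finally show "sw D TC (%c d. counit TC (t2 a c) *.[TC] t2 b d) y = counit C a *.[TC] t2 b y" .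
 qed (use tC y v in auto)
 also have "... = t2 x y" by (rule sw_counit(1)[OF cc_coalg[OF C] v kC x])
 finally show "sw TC TC (%a b. counit TC a *.[TC] b) (t2 x y) = t2 x y" .
 qed
 then show "sw TC TC (%a b. counit TC a *.[TC] b) t = t" by (intro eqI[OF v lin_sw[OF P v bc] lin_id t]; blast)
 let ?T = "tensor [TC,TC]"
 have b: "bilin T T ?T (%a b. tens [TC,TC][a,b])" "bilin T T ?T (%a b. tens [TC,TC][b,a])"
 using TT(2) bilin_flip[OF TT(2)] by (simp_all only: bilin_TC)
 note qc = qlin_tens[OF b(1)]
 have "sw TC ?T (%a b. tens [TC,TC][b,a]) t = sw TC ?T (%a b. tens [TC,TC][a,b]) t"
 proof (rule eqI[OF TT(1) lin_sw[OF P TT(1) bilin_flip[OF TT(2)]] lin_sw[OF P TT(1,2)] t])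
 fix x y assume x: "x .: C" and y: "y .: D"
 have "sw TC ?T (%a b. tens [TC,TC][b,a]) (t2 x y) = sw C ?T (%a b. sw D ?T (%c d. tens [TC,TC][t2 b d,t2 a c]) y) x"
 by (rule sw_TC[OF TT(1) b(2) x y])
 also have "... = sw C ?T (%a b. sw D ?T (%c d. tens [TC,TC][t2 b c,t2 a d]) y) x"
 by (rule sw_cong[OF PC TT(1) x], rule sw_cocomm[OF D TT(1) qlinD(2)[OF qc] y])
 (auto intro!:sw_closed[OF PD TT(1) y] TT(3) tC)
 also have "... = sw C ?T (%a b. sw D ?T (%c d. tens [TC,TC][t2 a c,t2 b d]) y) x"
 by (rule sw_cocomm[OF C TT(1) bilin_sw_param[OF PD vC_cc TT(1) qc y] x])
 also have "... = sw TC ?T (%a b. tens [TC,TC][a,b]) (t2 x y)"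
 by (rule sw_TC[symmetric, OF TT(1) b(1) x y])
 finally show "sw TC ?T (%a b. tens [TC,TC][b,a]) (t2 x y) = sw TC ?T (%a b. tens [TC,TC][a,b]) (t2 x y)" .
 qed
 then show "sw TC ?T (%a b. tens [TC,TC][b,a]) t = comult TC t" using comult_sw[OF P t] by simp
 qed
qed

end

section \<open>The ground field as a coalgebra\<close>

lemma unit_simps:
 "car unit_coalg = UNIV" "add unit_coalg = (+)" "smult unit_coalg = (*)" "zero unit_coalg = 0"
 "comult unit_coalg c = tens [ground,ground][c,1]" "counit unit_coalg c = c"
 by (simp_all add: unit_coalg_def ground_def module.defs coalg.defs)

text \<open>Since the coproduct of c is the tensor of c with 1, a Sweedler sum over the field has
  the single term with legs c and 1; the coalgebra laws reduce to moving scalars across tensor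
  signs.\<close>

lemma
 shows cocomm_unit_coalg: "ccoalg (unit_coalg :: ('k::field,'k) coalg)"
 and sw_unit_coalg: "vspace W ==> bilin unit_coalg unit_coalg W f ==> sw unit_coalg W f (c::'k) = f c 1"
proof -
 let ?U = "unit_coalg :: ('k,'k) coalg"
 have v: "vspace ?U" by (rule vspaceI) (auto simp:unit_simps algebra_simps)
 have te: "tensor [?U,?U] = tensor [ground,ground]" "tens [?U,?U] = tens [ground,ground]"
 by (rule tensor_cong; auto simp:less_Suc_eq unit_simps ground_def)+
 note TT = tensor2[OF v v]
 have cm: "comult ?U = (%c. tens [?U,?U][c,1])" by (rule ext) (simp add:unit_simps te)
 have P: "precoalg ?U"
 unfolding precoalg_def cm
 using v bilinD(1)[OF TT(2), of 1] by (auto simp:klinear_def unit_simps)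
 have sw: "sw ?U W f c = f c 1" if "vspace W" "bilin ?U ?U W f" for f c and W :: "('k,'w,'z) msch"
 using sweedler_sw[OF P that, of c] sweedler_bilin(2)[OF v v that, of c 1] by (simp add:cm unit_simps)
 then show "vspace W ==> bilin unit_coalg unit_coalg W f ==> sw unit_coalg W f (c::'k) = f c 1" for W :: "('k,'w,'z) msch" and f c by blast
 have sm: "f (c * d) e = f c (d * e)" if "bilin ?U ?U W f" "vspace W" for f c d e and W :: "('k,'w,'z) msch"
 using linD(3)[OF bilinD(1)[OF that(1), of e], of c d] lin3[OF bilinD(2)[OF that(1), of c], of e d]
 lin3[OF bilinD(1)[OF that(1), of e], of d c]
 by (simp add:unit_simps mult.commute)
 note T3 = tensor3[OF v v v]
 have bc: "bilin ?U ?U ?U (%a b. counit ?U a *.[?U] b)"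
 by (intro bilinI linI; simp add:unit_simps algebra_simps)+
 show "ccoalg ?U"
 proof (rule cocommI[OF P])
 fix x :: 'k
 show "sw ?U (tensor [?U,?U,?U]) (%a b. sw ?U (tensor [?U,?U,?U]) (%y z. tens [?U,?U,?U][y,z,b]) a) x
 = sw ?U (tensor [?U,?U,?U]) (%a b. sw ?U (tensor [?U,?U,?U]) (%y z. tens [?U,?U,?U][a,y,z]) b) x"
 unfolding sw[OF T3(1) bilin_sw_left(1)[OF P T3(1,2)]] sw[OF T3(1) bilin_sw_left(2)[OF P T3(1,2)]]
 using sw[OF T3(1) trilin_parts(1)[OF T3(2)]] sw[OF T3(1) trilin_parts(2)[OF T3(2)]] by (simp add:unit_simps)
 show "sw ?U ?U (%a b. counit ?U a *.[?U] b) x = x" unfolding sw[OF v bc] by (simp add:unit_simps)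
 show "sw ?U (tensor [?U,?U]) (%a b. tens [?U,?U][b,a]) x = comult ?U x"
 unfolding sw[OF TT(1) bilin_flip[OF TT(2)]]
 using sm[OF TT(2) TT(1), of 1 x 1] by (simp add:cm)
 qed
qed

section \<open>Coideals and separated families\<close>

definition lspan :: "('k::field,'v,'z) msch=>'v set=>'v set" where
 "lspan V Y = \<Inter>{N. submodule N ground V & Y <= N}"

lemma submodule_carrier: "vspace V ==> submodule (car V) ground V"
 by (rule submI) auto

lemma lspan:
 assumes V: "vspace V" and Y: "Y <= car V"
 shows "submodule (lspan V Y) ground V" "Y <= lspan V Y" "lspan V Y <= car V"
 "submodule N ground V ==> Y <= N ==> lspan V Y <= N"
proof -
 have ne: "car V : {N. submodule N ground V & Y <= N}" using submodule_carrier[OF V] Y by blast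
 show sub: "lspan V Y <= car V" using ne unfolding lspan_def by blast
 show "submodule (lspan V Y) ground V"
 by (rule submI[OF V sub]) (insert submD(2-4)[OF V], unfold lspan_def, blast+)
qed (auto simp:lspan_def)

text \<open>The descended map uses chosen representatives; replacing them one at a time shows that
  the choice does not matter.\<close>

lemma bilin_desc:
 fixes W :: "('k::field,'w,'z) msch"
 assumes V: "vspace V" and N: "submodule N ground V" and W: "vspace W" and B: "bilin V V W B"
 and z: "!!a b. a:N ==> b .: V ==> B a b = 0.[W]" "!!a b. a .: V ==> b:N ==> B a b = 0.[W]"
 obtains B' where "bilin (quot V N) (quot V N) W B'"
 "!!a b. a .: V ==> b .: V ==> B' (N +>[V] a) (N +>[V] b) = B a b"
proof -
 have nc: "!!a. a:N ==> a .: V" using submD(1)[OF V N] by auto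
 define B' where "B' X Y = B (SOME a. a:X) (SOME b. b:Y)" for X Y
 have s: "(SOME a. a:N +>[V] x) .: V & x +[V] (- 1) *.[V] (SOME a. a:N +>[V] x):N" if x: "x .: V" for x
 proof -
 have "(SOME a. a:N +>[V] x):N +>[V] x" by (rule someI[of _ x]) (rule coset_self[OF V N x])
 from coset_rep[OF V N x this] show ?thesis using coset_eq_iff[OF V N x] by metis
 qed
 have e: "B' (N +>[V] a) (N +>[V] b) = B a b" if a: "a .: V" and b: "b .: V" for a b
 proof -
 let ?a = "SOME x. x:N +>[V] a" and ?b = "SOME x. x:N +>[V] b"
 note sa = s[OF a] and sb = s[OF b]
 have "B a b +[W] (- 1) *.[W] B ?a b = B (a +[V] (- 1) *.[V] ?a) b"
 using a sa V by (simp add:linD(2,3)[OF bilinD(1)[OF B b]])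
 then have 1: "B a b = B ?a b" using z(1) sa b vs_eq_iff[OF W, of "B a b" "B ?a b"] bl3[OF B] a by simp
 have "B ?a b +[W] (- 1) *.[W] B ?a ?b = B ?a (b +[V] (- 1) *.[V] ?b)"
 using b sb sa V by (simp add:linD(2,3)[OF bilinD(2)[OF B]])
 then have "B ?a b = B ?a ?b" using z(2) sa sb vs_eq_iff[OF W, of "B ?a b" "B ?a ?b"] bl3[OF B] b by simp
 then show ?thesis using 1 by (simp add:B'_def)
 qed
 have "bilin (quot V N) (quot V N) W B'"
 by (intro bilinI linI; clarsimp simp:quot_carrier[OF V N])
 (insert V bilinD(3)[OF B] linD(2,3)[OF bilinD(1)[OF B]] linD(2,3)[OF bilinD(2)[OF B]], simp_all add: quot_ops[OF V N] e)
 then show ?thesis using e by (rule that)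
qed

text \<open>The familiar condition that the coproduct of \<open>S\<close> lies in S \<otimes> M + M
  \<otimes> S is expressed by its vanishing in the tensor square of M/S. This form needs no
  description of the kernel of the map between tensor squares.\<close>

definition coideal :: "('k::field,'c) coalg=>'c set=>bool" where
 "coideal M S <-> submodule S ground M & (ALL s:S. counit M s = 0) &
 (ALL s:S. sw M (tensor [quot M S,quot M S])
 (%a b. tens [quot M S,quot M S][S +>[M] a,S +>[M] b]) s
 = 0.[tensor [quot M S,quot M S]])"

lemma bilin_tens_coset:
 assumes V: "vspace V" and N: "submodule N ground V"
 shows "bilin V V (tensor [quot V N,quot V N]) (%a b. tens [quot V N,quot V N][N +>[V] a,N +>[V] b])"
 by (rule bilin_comp[OF tensor2(2)[OF vspace_quot[OF V N] vspace_quot[OF V N]] lin_coset[OF V N] lin_coset[OF V N]])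

lemma bilin_zero:
 assumes "bilin C D W B" "vspace C" "vspace D" "vspace W"
 shows "y .: D ==> B 0.[C] y = 0.[W]" "x .: C ==> B x 0.[D] = 0.[W]"
 using lin_zero[OF bilinD(1)[OF assms(1)] assms(2,4)] lin_zero[OF bilinD(2)[OF assms(1)] assms(3,4)] by auto

lemma tens_coset_zero:
 assumes V: "vspace V" and N: "submodule N ground V"
 shows "a:N ==> b .: V ==> tens [quot V N,quot V N][N +>[V] a,N +>[V] b] = 0.[tensor [quot V N,quot V N]]"
 "a .: V ==> b:N ==> tens [quot V N,quot V N][N +>[V] a,N +>[V] b] = 0.[tensor [quot V N,quot V N]]"
proof -
 have z: "N +>[V] c = 0.[quot V N]" if "c:N" for c
 using coset_zero[OF V N, of c] that submD(1)[OF V N] by (auto simp:quot_space_def)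
 note q = vspace_quot[OF V N] and cc = linD(1)[OF lin_coset[OF V N]]
 note bz = bilin_zero[OF tensor2(2)[OF q q] q q tensor2(1)[OF q q]]
 show "a:N ==> b .: V ==> tens [quot V N,quot V N][N +>[V] a,N +>[V] b] = 0.[tensor [quot V N,quot V N]]"
 "a .: V ==> b:N ==> tens [quot V N,quot V N][N +>[V] a,N +>[V] b] = 0.[tensor [quot V N,quot V N]]"
 using z bz cc by auto
qed

text \<open>\<open>B\<close> descends to the quotient by \<open>S\<close>, and in the tensor square
  of that quotient the coproduct of \<open>s\<close> is zero.\<close>

lemma coideal_kill:
 assumes M: "precoalg M" and S: "coideal M S" and W: "vspace W" and B: "bilin M M W B"
 and z: "!!a b. a:S ==> b .: M ==> B a b = 0.[W]" "!!a b. a .: M ==> b:S ==> B a b = 0.[W]"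
 and s: "s:S"
 shows "sw M W B s = 0.[W]"
proof -
 note v = preD(1)[OF M]
 have sub: "submodule S ground M" using S by (simp add:coideal_def)
 note q = vspace_quot[OF v sub] and cc = linD(1)[OF lin_coset[OF v sub]]
 let ?Q = "quot M S"
 have sM: "s .: M" using s submD(1)[OF v sub] by auto
 have "EX B'. bilin ?Q ?Q W B' & (ALL a:car M. ALL b:car M. B' (S +>[M] a) (S +>[M] b) = B a b)"
 proof (rule bilin_desc[OF v sub W B])
 fix B' assume "bilin ?Q ?Q W B'" "!!a b. a .: M ==> b .: M ==> B' (S +>[M] a) (S +>[M] b) = B a b"
 then show ?thesis by blast
 qed (use z in auto)
 then obtain B' where B': "bilin ?Q ?Q W B'" "!!a b. a .: M ==> b .: M ==> B' (S +>[M] a) (S +>[M] b) = B a b"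
 by blast
 note F = sweedler_bilin[OF q q W B'(1)] and TT = tensor2[OF q q]
 have "sweedler W B' (sw M (tensor [?Q,?Q]) (%a b. tens [?Q,?Q][S +>[M] a,S +>[M] b]) s)
 = sw M W (%a b. sweedler W B' (tens [?Q,?Q][S +>[M] a,S +>[M] b])) s"
 by (rule sw_push[OF M F(1) TT(1) W sM]) (rule TT(3) cc | assumption)+
 also have "... = sw M W B s"
 by (rule sw_cong[OF M W sM]) (use F(2) cc B'(2) bl3[OF B] in auto)
 finally show ?thesis using S s lin_zero[OF F(1) TT(1) W] by (simp add:coideal_def)
qed

lemma coidealI:
 assumes "precoalg M" "submodule S ground M" "!!s. s:S ==> counit M s = 0"
 "!!s. s:S ==> sw M (tensor [quot M S,quot M S])
 (%a b. tens [quot M S,quot M S][S +>[M] a,S +>[M] b]) s = 0.[tensor [quot M S,quot M S]]"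
 shows "coideal M S"
 using assms by (simp add:coideal_def)

text \<open>In the applications \<open>K\<close> is the kernel of the parametrisation by linear
  maps. That it contains no nonzero coideal makes coalgebra maps into \<open>M\<close> determined by
  the linear maps they parametrise.\<close>

definition separated :: "('k::field,'c) coalg=>'c set=>bool" where
 "separated M K <-> precoalg M & submodule K ground M & (ALL S. coideal M S & S <= K --> S <= {0.[M]})"

text \<open>
 The differences \<open>F i - G i\<close> span a coideal. The operator \<open>A i\<close> stands for an iterated Sweedler sum.
\<close>

lemma separated_eq:
 fixes M :: "('k::field,'c) coalg" and A :: "'i=>('k,(('c set) list \<Rightarrow>\<^sub>0 'k) set) module=>('i=>'i=>(('c set) list \<Rightarrow>\<^sub>0 'k) set)=>(('c set) list \<Rightarrow>\<^sub>0 'k) set"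
 assumes sep: "separated M K" and F: "!!i. i:I ==> F i .: M" and G: "!!i. i:I ==> G i .: M"
 and eps: "!!i. i:I ==> counit M (F i) = counit M (G i)"
 and K: "!!i. i:I ==> F i +[M] (- 1) *.[M] G i:K"
 and AF: "!!i Q pr. i:I ==> vspace (Q :: ('k,'c set) module) ==> lin M Q pr ==>
 sw M (tensor [Q,Q]) (%a b. tens [Q,Q][pr a,pr b]) (F i) = A i (tensor [Q,Q]) (%j l. tens [Q,Q][pr (F j),pr (F l)])"
 and AG: "!!i Q pr. i:I ==> vspace (Q :: ('k,'c set) module) ==> lin M Q pr ==>
 sw M (tensor [Q,Q]) (%a b. tens [Q,Q][pr a,pr b]) (G i) = A i (tensor [Q,Q]) (%j l. tens [Q,Q][pr (G j),pr (G l)])"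
 and cong: "!!i W f g. i:I ==> vspace W ==> (!!j l. j:I ==> l:I ==> f j l = g j l) ==>
 (!!j l. j:I ==> l:I ==> g j l .: W) ==> A i W f = A i W g"
 and i: "i:I"
 shows "F i = G i"
proof -
 have M: "precoalg M" and KM: "submodule K ground M" using sep by (auto simp:separated_def)
 note v = preD(1)[OF M]
 let ?d = "%i. F i +[M] (- 1) *.[M] G i"
 define S where "S = lspan M (?d ` I)"
 have Y: "?d ` I <= car M" using F G v by auto
 note sp = lspan[OF v Y, folded S_def]
 let ?Q = "quot M S"
 have q: "vspace ?Q" by (rule vspace_quot[OF v sp(1)])
 have b: "bilin M M (tensor [?Q,?Q]) (%a b. tens [?Q,?Q][S +>[M] a,S +>[M] b])" by (rule bilin_tens_coset[OF v sp(1)])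
 note TT = tensor2[OF q q] and ks = lin_sw[OF M TT(1) b] and cs = lin_coset[OF v sp(1)]
 have FG: "S +>[M] F j = S +>[M] G j" if "j:I" for j
 using coset_eq_iff[OF v sp(1) F[OF that] G[OF that]] sp(2) that by auto
 have "coideal M S"
 proof (rule coidealI[OF M sp(1)])
 fix s assume s: "s:S"
 have "?d ` I <= {x:car M. counit M x = 0.[ground]}"
 using F G v eps by (auto simp:linD(2,3)[OF preD(3)[OF M]])
 then show "counit M s = 0"
 using sp(4)[OF submodule_kernel[OF v vspace_ground preD(3)[OF M]]] s by auto
 have "?d ` I <= {x:car M. sw M (tensor [?Q,?Q]) (%a b. tens [?Q,?Q][S +>[M] a,S +>[M] b]) x = 0.[tensor [?Q,?Q]]}"
 proof (rule image_subsetI)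
 fix i assume i: "i:I"
 \<comment> \<open>Modulo \<open>S\<close> the families \<open>F\<close> and \<open>G\<close>
   coincide, so \<open>A i\<close> yields the same element for both; this is the vanishing of the
   coproduct of their difference in the tensor square of the quotient.\<close>
 have "A i (tensor [?Q,?Q]) (%j l. tens [?Q,?Q][S +>[M] F j,S +>[M] F l]) = A i (tensor [?Q,?Q]) (%j l. tens [?Q,?Q][S +>[M] G j,S +>[M] G l])"
 by (rule cong[OF i TT(1)]) (use FG TT(3) lin1[OF cs] G in auto)
 then have "sw M (tensor [?Q,?Q]) (%a b. tens [?Q,?Q][S +>[M] a,S +>[M] b]) (F i) = sw M (tensor [?Q,?Q]) (%a b. tens [?Q,?Q][S +>[M] a,S +>[M] b]) (G i)"
 using AF[OF i q cs] AG[OF i q cs] by simp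
 then show "?d i : {x:car M. sw M (tensor [?Q,?Q]) (%a b. tens [?Q,?Q][S +>[M] a,S +>[M] b]) x = 0.[tensor [?Q,?Q]]}"
 using F[OF i] G[OF i] v linD(1)[OF ks G[OF i]] by (simp add:linD(2,3)[OF ks] vs_neg[OF TT(1)])
 qed
 then show "sw M (tensor [?Q,?Q]) (%a b. tens [?Q,?Q][S +>[M] a,S +>[M] b]) s = 0.[tensor [?Q,?Q]]"
 using sp(4)[OF submodule_kernel[OF v TT(1) ks]] s by auto
 qed
 moreover have "S <= K" by (rule sp(4)[OF KM]) (use K in auto)
 ultimately have "S <= {0.[M]}" using sep by (simp add:separated_def)
 then have "?d i = 0.[M]" using sp(2) i by auto
 then show ?thesis using vs_eq_iff[OF v F[OF i] G[OF i]] by simp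
qed

text \<open>Instance of the preceding principle with the elements of \<open>C\<close> as indices and
  Sweedler summation in \<open>C\<close> as the operator.\<close>

lemma separated_hom_eq:
 fixes M :: "('k::field,'m) coalg"
 assumes sep: "separated M K" and C: "precoalg C" and f: "chom C M f" and g: "chom C M g"
 and K: "!!x. x .: C ==> f x +[M] (- 1) *.[M] g x:K" and x: "x .: C"
 shows "f x = g x"
proof (rule separated_eq[where F = f and G = g and A = "%x W h. sw C W h x", OF sep _ _ _ K _ _ _ x])
 have M: "precoalg M" using sep by (simp add:separated_def)
 have lf: "lin C M f" "lin C M g" using f g by (auto simp:coalg_hom_def)
 show "f x .: M" "g x .: M" "counit M (f x) = counit M (g x)" if "x .: C" for x
 using that f g linD(1)[OF lf(1)] lin1[OF lf(2)] by (auto simp:coalg_hom_def)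
 fix i Q pr assume i: "i .: C" and Q: "vspace (Q :: ('k,'m set) module)" and p: "lin M Q pr"
 note b = bilin_comp[OF tensor2(2)[OF Q Q] p p]
 show "sw M (tensor [Q,Q]) (%a b. tens [Q,Q][pr a,pr b]) (f i) = sw C (tensor [Q,Q]) (%j l. tens [Q,Q][pr (f j),pr (f l)]) i"
 "sw M (tensor [Q,Q]) (%a b. tens [Q,Q][pr a,pr b]) (g i) = sw C (tensor [Q,Q]) (%j l. tens [Q,Q][pr (g j),pr (g l)]) i"
 by (rule sw_hom[OF C M f tensor2(1)[OF Q Q] b i] sw_hom[OF C M g tensor2(1)[OF Q Q] b i])+
next
 fix i f g and W :: "('k,('m set list \<Rightarrow>\<^sub>0 'k) set) module" assume a: "i .: C" "vspace W" "!!j l. j .: C ==> l .: C ==> f j l = g j l"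
 "!!j l. j .: C ==> l .: C ==> g j l .: W"
 show "sw C W f i = sw C W g i" by (rule sw_cong[OF C a(2,1,3,4)])
qed

section \<open>Direct sums of coalgebras and their largest separated quotient\<close>

definition mk_coalg :: "('k::field,'v) module=>('v=>('v list \<Rightarrow>\<^sub>0 'k) set)=>('v=>'k)=>('k,'v) coalg" where
 "mk_coalg V de e = module.extend V (coalg.fields de e)"

lemma mk_coalg_simps [simp]:
 "car (mk_coalg V de e) = car V" "add (mk_coalg V de e) = add V" "smult (mk_coalg V de e) = smult V" "zero (mk_coalg V de e) = zero V"
 "comult (mk_coalg V de e) = de" "counit (mk_coalg V de e) = e"
 by (simp_all add: mk_coalg_def module.defs coalg.defs)

lemma mk_coalg_tensor: "tensor [mk_coalg V de e,mk_coalg V de e] = tensor [V,V]" "tens [mk_coalg V de e,mk_coalg V de e] = tens [V,V]"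
 by (rule tensor_cong; auto simp:less_Suc_eq)+

lemma lin_mk_coalg: "lin (mk_coalg V de e) W f = lin V W f" "lin W (mk_coalg V de e) g = lin W V g"
 by (intro lin_scheme_cong; simp)+

lemma vspace_mk_coalg: "vspace V ==> vspace (mk_coalg V de e)"
 by (rule vspaceI) (auto simp:vs_smult vs_neg vs_add_ac)

lemma precoalg_mk_coalg: "vspace V ==> lin V (tensor [V,V]) de ==> lin V ground e ==> precoalg (mk_coalg V de e)"
 by (simp add:precoalg_def vspace_mk_coalg lin_mk_coalg mk_coalg_tensor)

text \<open>Families are extensional outside \<open>I\<close>, so that equality of elements is
  equality of functions on the index type, which is what the shape of \<open>meas_univ\<close>
  anticipates.\<close>

definition dsum :: "'j set=>('j=>('k::field,'c,'z) msch)=>('k,'j=>'c) module" where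
 "dsum I C = \<lparr>carrier = {f:extensional I. (ALL j:I. f j .: C j) & finite {j:I. f j ~= 0.[C j]}},
 monoid.mult = undefined,one = undefined,zero = (\<lambda>j\<in>I. 0.[C j]),
 add = (%f g. \<lambda>j\<in>I. f j +[C j] g j),smult = (%c f. \<lambda>j\<in>I. c *.[C j] f j)\<rparr>"

definition dinj :: "'j set=>('j=>('k::field,'c,'z) msch)=>'j=>'c=>'j=>'c" where
 "dinj I C j x = (\<lambda>i\<in>I. if i = j then x else 0.[C i])"

context
 fixes I :: "'j set" and C :: "'j=>('k::field,'c,'z) msch"
 assumes C: "!!j. j:I ==> vspace (C j)"
begin

lemma dsum_simps:
 "f .: dsum I C <-> f:extensional I & (ALL j:I. f j .: C j) & finite {j:I. f j ~= 0.[C j]}"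
 "0.[dsum I C] = (\<lambda>j\<in>I. 0.[C j])" "f +[dsum I C] g = (\<lambda>j\<in>I. f j +[C j] g j)" "c *.[dsum I C] f = (\<lambda>j\<in>I. c *.[C j] f j)"
 by (simp_all add: dsum_def)

lemma vspace_dsum: "vspace (dsum I C)"
proof (rule vspaceI, goal_cases)
 case (2 f g)
 then have "finite ({j:I. f j ~= 0.[C j]} \<union> {j:I. g j ~= 0.[C j]})" by (simp add:dsum_simps)
 then have "finite {j:I. (\<lambda>j\<in>I. f j +[C j] g j) j ~= 0.[C j]}" by (rule finite_subset[rotated]) (use C in auto)
 then show ?case using 2 C by (simp add:dsum_simps)
next
 case (3 c f)
 then have "finite {j:I. f j ~= 0.[C j]}" by (simp add:dsum_simps)
 then have "finite {j:I. (\<lambda>j\<in>I. c *.[C j] f j) j ~= 0.[C j]}" by (rule finite_subset[rotated]) (use C in auto)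
 then show ?case using 3 C by (simp add:dsum_simps)
qed (insert C, auto simp:dsum_simps vs_add_ac vs_smult vs_neg fun_eq_iff extensional_def)

lemma dinj:
 assumes j: "j:I"
 shows "lin (C j) (dsum I C) (dinj I C j)"
proof (rule linI)
 fix x assume "x .: C j"
 moreover have "finite {i:I. dinj I C j x i ~= 0.[C i]}" by (rule finite_subset[of _ "{j}"]) (auto simp:dinj_def)
 ultimately show "dinj I C j x .: dsum I C" using C by (auto simp:dsum_simps dinj_def)
qed (insert C j, auto simp:dsum_simps dinj_def fun_eq_iff)

text \<open>Induction over a finite set containing the support, splitting off the component at one
  index at a time.\<close>

lemma spans_dsum: "spans (dsum I C) (UN j:I. dinj I C j ` car (C j))"
 unfolding spans_def
proof (intro allI impI subsetI)
 fix N f assume N: "submodule N ground (dsum I C) & (UN j:I. dinj I C j ` car (C j)) <= N" and f: "f .: dsum I C"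
 note ND = submD[OF vspace_dsum conjunct1[OF N]]
 have "f:N" if "finite F" "f .: dsum I C" "{j:I. f j ~= 0.[C j]} <= F" for F f
 using that
 proof (induction F arbitrary:f)
 case empty
 then have "f = 0.[dsum I C]" by (auto simp:dsum_simps fun_eq_iff extensional_def)
 then show ?case using ND(2) by simp
 next
 case (insert j F)
 show ?case
 proof (cases "j:I")
 case True
 let ?g = "f(j := 0.[C j])"
 have g: "?g .: dsum I C"
 proof -
 have "finite {i:I. ?g i ~= 0.[C i]}" by (rule finite_subset[of _ "{i:I. f i ~= 0.[C i]}"]) (insert insert.prems, auto simp:dsum_simps)
 then show ?thesis using insert.prems True C by (auto simp:dsum_simps extensional_def)
 qed
 then have "?g:N" by (rule insert.IH) (use insert.prems in auto)
 moreover have "dinj I C j (f j):N"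
 proof -
 have "f j .: C j" using insert.prems True by (simp add:dsum_simps)
 then show ?thesis using N True by blast
 qed
 moreover have "dinj I C j (f j) +[dsum I C] ?g = f"
 using insert.prems C True by (auto simp:dsum_simps dinj_def fun_eq_iff extensional_def)
 ultimately show ?thesis using ND(3) by metis
 qed (use insert in auto)
 qed
 then show "f:N" using f by (auto simp:dsum_simps)
qed

lemma dsum_ext:
 fixes W :: "('k,'w,'y) msch"
 assumes W: "vspace W" and h: "!!j. j:I ==> lin (C j) W (h j)"
 obtains H where "lin (dsum I C) W H" "!!j x. j:I ==> x .: C j ==> H (dinj I C j x) = h j x"
proof -
 let ?s = "%f. {j:I. f j ~= 0.[C j]}"
 define H where "H f = finsum W (%j. h j (f j)) (?s f)" for f
 have hc: "f .: dsum I C ==> (%j. h j (f j)) : ?s f \<rightarrow> car W" for f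
 using linD(1)[OF h] by (auto simp:dsum_simps)
 have Hc: "f .: dsum I C ==> H f .: W" for f
 unfolding H_def using hc W by auto
 \<comment> \<open>A functional of \<open>H f\<close> may be summed over any finite subset of
   \<open>I\<close> containing the support; this lets two families and their sum be compared over
   one index set.\<close>
 have LH: "L (H f) = (SUM j:F. L (h j (f j)))"
 if L: "lin W ground L" and f: "f .: dsum I C" and F: "finite F" "?s f <= F" "F <= I" for L f F
 proof -
 have "L (H f) = (SUM j:?s f. L (h j (f j)))" unfolding H_def by (rule L_finsum[OF L W hc[OF f]])
 also have "... = (SUM j:F. L (h j (f j)))"
 by (rule sum.mono_neutral_left) (use F C lin_zero[OF h _ W] lin_zero[OF L W vspace_ground] in auto)
 finally show ?thesis .
 qed
 have "lin (dsum I C) W H"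
 proof (rule linI[OF Hc])
 fix f g assume fg: "f .: dsum I C" "g .: dsum I C"
 let ?F = "?s f \<union> ?s g"
 have F: "finite ?F" using fg by (simp add:dsum_simps)
 show "H (f +[dsum I C] g) = H f +[W] H g"
 proof (rule vs_eqI[OF W])
 fix L assume L: "lin W ground L" "!!u v. u .: W ==> v .: W ==> L (u +[W] v) = L u + L v"
 have "L (H (f +[dsum I C] g)) = (SUM j:?F. L (h j ((f +[dsum I C] g) j)))"
 by (rule LH[OF L(1) vs_closed(2)[OF vspace_dsum fg] F]) (insert fg C, auto simp:dsum_simps)
 also have "... = (SUM j:?F. L (h j (f j)) + L (h j (g j)))"
 by (rule sum.cong) (insert fg L h linD[OF h], auto simp:dsum_simps)
 also have "... = L (H f) + L (H g)"
 by (simp add:sum.distrib LH[OF L(1) fg(1) F] LH[OF L(1) fg(2) F])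
 finally show "L (H (f +[dsum I C] g)) = L (H f +[W] H g)" using L Hc fg by simp
 qed (use Hc fg vspace_dsum W in auto)
 next
 fix c f assume f: "f .: dsum I C"
 have F: "finite (?s f)" using f by (simp add:dsum_simps)
 show "H (c *.[dsum I C] f) = c *.[W] H f"
 proof (rule vs_eqI[OF W])
 fix L assume L: "lin W ground L" "!!c u. u .: W ==> L (c *.[W] u) = c * L u"
 have "L (H (c *.[dsum I C] f)) = (SUM j:?s f. L (h j ((c *.[dsum I C] f) j)))"
 by (rule LH[OF L(1) vs_closed(3)[OF vspace_dsum f] F]) (insert f C, auto simp:dsum_simps)
 also have "... = (SUM j:?s f. c * L (h j (f j)))"
 by (rule sum.cong) (insert f L h linD[OF h], auto simp:dsum_simps)
 also have "... = c * L (H f)" by (simp add:sum_distrib_left LH[OF L(1) f F])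
 finally show "L (H (c *.[dsum I C] f)) = L (c *.[W] H f)" using L Hc f by simp
 qed (use Hc f vspace_dsum W in auto)
 qed
 moreover have "H (dinj I C j x) = h j x" if j: "j:I" and x: "x .: C j" for j x
 proof (rule vs_eqI[OF W])
 fix L assume L: "lin W ground L"
 have "L (H (dinj I C j x)) = (SUM i:{j}. L (h i (dinj I C j x i)))"
 by (rule LH[OF L linD(1)[OF dinj[OF j] x]]) (insert j, auto simp:dinj_def)
 then show "L (H (dinj I C j x)) = L (h j x)" using j by (simp add:dinj_def)
 qed (use Hc linD(1)[OF dinj] lin1[OF h] j x in auto)
 ultimately show ?thesis by (rule that)
qed

end

lemma lin_desc_ex:
 assumes "vspace V" "submodule N ground V" "vspace W" "lin V W f" "!!x. x:N ==> f x = 0.[W]"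
 shows "EX f'. lin (quot V N) W f' & (ALL x:car V. f' (N +>[V] x) = f x)"
proof (rule lin_desc[OF assms(1-4)])
 fix f' assume "lin (quot V N) W f'" "!!x. x .: V ==> f' (N +>[V] x) = f x"
 then show ?thesis by blast
qed (rule assms(5))

text \<open>Coproduct and counit vanish on a coideal as maps to the tensor square of the quotient
  and to the field, hence descend. The coalgebra laws are left to
  \<open>coalg_cover\<close>.\<close>

lemma quot_coalg:
 fixes D :: "('k::field,'d) coalg"
 assumes D: "precoalg D" and K: "coideal D K"
 obtains M :: "('k,'d set) coalg" where "precoalg M" "chom D M (%x. K +>[D] x)"
 "car M = (%x. K +>[D] x) ` car D" "0.[M] = K"
 "add M = add (quot D K)" "smult M = smult (quot D K)"
proof -
 note v = preD(1)[OF D]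
 have sub: "submodule K ground D" using K by (simp add:coideal_def)
 let ?Q = "quot D K"
 note q = vspace_quot[OF v sub] and cl = lin_coset[OF v sub] and b = bilin_tens_coset[OF v sub]
 note TT = tensor2[OF q q]
 obtain de where d: "lin ?Q (tensor [?Q,?Q]) de"
 "!!x. x .: D ==> de (K +>[D] x) = sw D (tensor [?Q,?Q]) (%a b. tens [?Q,?Q][K +>[D] a,K +>[D] b]) x"
 using lin_desc_ex[OF v sub TT(1) lin_sw[OF D TT(1) b]] K by (auto simp:coideal_def)
 obtain e where e: "lin ?Q ground e" "!!x. x .: D ==> e (K +>[D] x) = counit D x"
 using lin_desc_ex[OF v sub vspace_ground preD(3)[OF D]] K by (auto simp:coideal_def)
 let ?M = "mk_coalg ?Q de e"
 show ?thesis
 proof (rule that)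
 show "precoalg ?M" by (rule precoalg_mk_coalg[OF q d(1) e(1)])
 show "chom D ?M (%x. K +>[D] x)"
 by (rule coalg_homI[OF D vspace_mk_coalg[OF q]]) (insert cl d(2) e(2), simp_all add: lin_mk_coalg mk_coalg_tensor)
 show "car ?M = (%x. K +>[D] x) ` car D" by (simp add:quot_carrier[OF v sub])
 qed (auto simp:quot_space_def)
qed

text \<open>For a larger submodule \<open>N\<close>, not yet known to be a coideal, the coproducts
  of elements of \<open>S\<close> already vanish modulo \<open>N\<close>. This feeds both the sum of
  two coideals and the union of all coideals in a kernel.\<close>

lemma coideal_mono_kill:
 assumes "precoalg D" "coideal D S" "S <= N" "submodule N ground D" "s:S"
 shows "sw D (tensor [quot D N,quot D N]) (%a b. tens [quot D N,quot D N][N +>[D] a,N +>[D] b]) s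
 = 0.[tensor [quot D N,quot D N]]"
proof -
 note v = preD(1)[OF assms(1)]
 note q = vspace_quot[OF v assms(4)]
 show ?thesis
 by (rule coideal_kill[OF assms(1,2) tensor2(1)[OF q q] bilin_tens_coset[OF v assms(4)] _ _ assms(5)])
 (use assms(3) tens_coset_zero[OF v assms(4)] in auto)
qed

lemma coideal_sum:
 assumes D: "precoalg D" and S: "coideal D S" and R: "coideal D R"
 shows "coideal D {s +[D] r | s r. s:S & r:R}" (is "coideal D ?N")
proof -
 note v = preD(1)[OF D]
 have sub: "submodule S ground D" "submodule R ground D" using S R by (auto simp:coideal_def)
 note SD = submD[OF v sub(1)] and RD = submD[OF v sub(2)]
 have Sc: "s:S ==> s .: D" "r:R ==> r .: D" for s r using SD(1) RD(1) by auto
 have N: "submodule ?N ground D"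
 proof (rule submI[OF v])
 show "?N <= car D" using Sc v by auto
 show "0.[D] : ?N" using SD(2) RD(2) v by force
 fix x y assume "x : ?N" "y : ?N"
 then obtain s r s' r' where "x = s +[D] r" "y = s' +[D] r'" "s:S" "r:R" "s':S" "r':R" by blast
 then have "x +[D] y = (s +[D] s') +[D] (r +[D] r')" "s +[D] s':S" "r +[D] r':R"
 using v Sc SD RD by (simp_all add: vs_add_ac[OF v])
 then show "x +[D] y : ?N" by blast
 next
 fix c x assume "x : ?N"
 then obtain s r where *: "x = s +[D] r" "s:S" "r:R" by blast
 then have "c *.[D] x = (c *.[D] s) +[D] (c *.[D] r)" using v Sc by (simp add:vs_smult)
 then show "c *.[D] x : ?N" using * SD(4) RD(4) by blast
 qed
 have le: "S <= ?N" "R <= ?N"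
 proof -
 show "S <= ?N"
 proof
 fix s assume "s:S"
 then show "s : ?N" using RD(2) vs_zero(2)[OF v, of s] Sc(1)[of s] by (intro CollectI exI[of _ s] exI[of _ "0.[D]"]) auto
 qed
 show "R <= ?N"
 proof
 fix r assume "r:R"
 then show "r : ?N" using SD(2) vs_zero(1)[OF v, of r] Sc(2)[of r] by (intro CollectI exI[of _ r] exI[of _ "0.[D]"]) auto
 qed
 qed
 note q = vspace_quot[OF v N]
 note ks = linD(2)[OF lin_sw[OF D tensor2(1)[OF q q] bilin_tens_coset[OF v N]]]
 show ?thesis
 proof (rule coidealI[OF D N])
 fix x assume "x : ?N"
 then obtain s r where *: "x = s +[D] r" "s:S" "r:R" by blast
 show "counit D x = 0"
 using * S R Sc linD(2)[OF preD(3)[OF D], of s r] by (simp add:coideal_def)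
 show "sw D (tensor [quot D ?N,quot D ?N]) (%a b. tens [quot D ?N,quot D ?N][?N +>[D] a,?N +>[D] b]) x
 = 0.[tensor [quot D ?N,quot D ?N]]"
 unfolding *(1) ks[OF Sc(1)[OF *(2)] Sc(2)[OF *(3)]]
 coideal_mono_kill[OF D S le(1) N *(2)] coideal_mono_kill[OF D R le(2) N *(3)]
 by (rule vs_zero(1)[OF tensor2(1)[OF q q] vs_closed(1)[OF tensor2(1)[OF q q]]])
 qed
qed

lemma coideal_zero:
 assumes D: "precoalg D"
 shows "coideal D {0.[D]}"
proof -
 note v = preD(1)[OF D]
 have z: "submodule {0.[D]} ground D" by (rule submI[OF v]) (use v in auto)
 note q = vspace_quot[OF v z]
 show ?thesis
 using lin_zero[OF preD(3)[OF D] v vspace_ground] lin_zero[OF lin_sw[OF D tensor2(1)[OF q q] bilin_tens_coset[OF v z]] v tensor2(1)[OF q q]]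
 by (intro coidealI[OF D z]) auto
qed

text \<open>The sum of all coideals contained in the kernel of \<open>f\<close> is factored out.\<close>

lemma separated_quotient:
 fixes D :: "('k::field,'d) coalg" and V :: "('k,'q,'z) msch"
 assumes D: "precoalg D" and V: "vspace V" and f: "lin D V f"
 obtains M :: "('k,'d set) coalg" and pr phi where "precoalg M" "chom D M pr" "pr ` car D = car M"
 "lin M V phi" "!!x. x .: D ==> phi (pr x) = f x" "separated M {m:car M. phi m = 0.[V]}"
proof -
 note v = preD(1)[OF D]
 let ?ker = "{x:car D. f x = 0.[V]}"
 note kD = submD[OF v submodule_kernel[OF v V f]]
 \<comment> \<open>A plain union is already a submodule, because two coideals inside the kernel have
   their sum inside the kernel as well.\<close>
 define K where "K = \<Union>{S. coideal D S & S <= ?ker}"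
 have sub: "submodule S ground D" if "coideal D S" for S using that by (simp add:coideal_def)
 have Kker: "K <= ?ker" by (auto simp:K_def)
 have Ksub: "submodule K ground D"
 proof (rule submI[OF v])
 show "K <= car D" using Kker by auto
 show "0.[D] : K" using coideal_zero[OF D] kD(2) unfolding K_def by blast
 fix x y assume "x:K" "y:K"
 then obtain S R where *: "coideal D S" "S <= ?ker" "x:S" "coideal D R" "R <= ?ker" "y:R" unfolding K_def by blast
 have "{s +[D] r | s r. s:S & r:R} <= ?ker" using *(2,5) kD(3) by blast
 then show "x +[D] y:K" using coideal_sum[OF D *(1,4)] *(3,6) unfolding K_def by blast
 next
 fix c x assume "x:K"
 then show "c *.[D] x:K" unfolding K_def using submD(4)[OF v sub] by blast
 qed
 have K: "coideal D K"
 proof (rule coidealI[OF D Ksub])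
 fix s assume "s:K"
 then obtain S where S: "coideal D S" "S <= ?ker" "s:S" unfolding K_def by blast
 then show "counit D s = 0" by (simp add:coideal_def)
 have "S <= K" using S by (auto simp:K_def)
 then show "sw D (tensor [quot D K,quot D K]) (%a b. tens [quot D K,quot D K][K +>[D] a,K +>[D] b]) s
 = 0.[tensor [quot D K,quot D K]]" by (rule coideal_mono_kill[OF D S(1) _ Ksub S(3)])
 qed
 let ?pr = "%x. K +>[D] x"
 obtain M :: "('k,'d set) coalg" where M: "precoalg M" "chom D M ?pr" "car M = ?pr ` car D" "0.[M] = K"
 "add M = add (quot D K)" "smult M = smult (quot D K)"
 by (rule quot_coalg[OF D K])
 have MQ: "lin M W g = lin (quot D K) W g" for W g
 using M by (simp add:klinear_def quot_carrier[OF v Ksub])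
 obtain phi' where "lin (quot D K) V phi'" "!!x. x .: D ==> phi' (?pr x) = f x"
 using lin_desc_ex[OF v Ksub V f] Kker by blast
 then obtain phi where p: "lin M V phi" "!!x. x .: D ==> phi (?pr x) = f x"
 using M by (auto simp:klinear_def quot_carrier[OF v Ksub])
 note vM = preD(1)[OF M(1)]
 have lp: "lin D M ?pr" using M(2) by (simp add:coalg_hom_def)
 have "separated M {m:car M. phi m = 0.[V]}"
 unfolding separated_def
 proof (intro conjI M(1) submodule_kernel[OF vM V p(1)] allI impI subsetI)
 fix S m assume S: "coideal M S & S <= {m:car M. phi m = 0.[V]}" and m: "m:S"
 note SD = submD[OF vM] 
 have Ssub: "submodule S ground M" using S by (simp add:coideal_def)
 note SD = submD[OF vM Ssub]
 \<comment> \<open>The preimage of a coideal of the quotient is a coideal of \<open>D\<close> inside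
   the kernel of \<open>f\<close>. It is therefore part of \<open>K\<close>, and its image
   \<open>S\<close> is zero.\<close>
 let ?S = "{x:car D. ?pr x:S}"
 have S': "submodule ?S ground D"
 by (rule submI[OF v]) (use v SD linD[OF lp] lin_zero[OF lp v vM] in auto)
 note q = vspace_quot[OF v S']
 let ?Q = "quot D ?S" and ?B = "%a b. tens [quot D ?S,quot D ?S][?S +>[D] a,?S +>[D] b]"
 note TT = tensor2[OF q q] and tz = tens_coset_zero[OF v S']
 have KS: "K <= ?S"
 proof
 fix x assume x: "x:K"
 then have "?pr x = 0.[M]" using coset_zero[OF v Ksub, of x] Kker M(4) by auto
 then show "x : ?S" using SD(2) x Kker by auto
 qed
 \<comment> \<open>Since \<open>K\<close> is contained in \<open>?S\<close>, the pairing into the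
   tensor square of the quotient by \<open>?S\<close> factors through the quotient by
   \<open>K\<close>, where the hypothesis that \<open>S\<close> is a coideal of \<open>M\<close> can
   be applied.\<close>
 have "EX B'. bilin (quot D K) (quot D K) (tensor [?Q,?Q]) B' & (ALL a:car D. ALL b:car D. B' (?pr a) (?pr b) = ?B a b)"
 proof (rule bilin_desc[OF v Ksub TT(1) bilin_tens_coset[OF v S']])
 fix B' assume "bilin (quot D K) (quot D K) (tensor [?Q,?Q]) B'" "!!a b. a .: D ==> b .: D ==> B' (?pr a) (?pr b) = ?B a b"
 then show ?thesis by blast
 qed (use tz KS in auto)
 then obtain B' where B': "bilin (quot D K) (quot D K) (tensor [?Q,?Q]) B'" "!!a b. a .: D ==> b .: D ==> B' (?pr a) (?pr b) = ?B a b"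
 by blast
 have BM: "bilin M M (tensor [?Q,?Q]) B'" using B'(1) M(3) by (simp add:bilin_def MQ quot_carrier[OF v Ksub])
 have SM: "s:S ==> EX x:?S. s = ?pr x" for s using SD(1) M(3) by auto
 have mM: "s .: M ==> EX x:car D. s = ?pr x" for s using M(3) by auto
 have "coideal D ?S"
 proof (rule coidealI[OF D S'])
 fix x assume x: "x : ?S"
 have "counit M (?pr x) = 0" using S x by (simp add:coideal_def)
 then show "counit D x = 0" using M(2) x by (simp add:coalg_hom_def)
 have "sw D (tensor [?Q,?Q]) ?B x = sw D (tensor [?Q,?Q]) (%a b. B' (?pr a) (?pr b)) x"
 by (rule sw_cong[OF D TT(1)]) (use x B' bilinD(3)[OF bilin_tens_coset[OF v S']] in auto)
 also have "... = sw M (tensor [?Q,?Q]) B' (?pr x)"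
 by (rule sw_hom[symmetric, OF D M(1,2) TT(1) BM]) (use x in auto)
 also have "... = 0.[tensor [?Q,?Q]]"
 proof (rule coideal_kill[OF M(1) conjunct1[OF S] TT(1) BM])
 show "B' a b = 0.[tensor [?Q,?Q]]" if "a:S" "b .: M" for a b
 using SM[OF that(1)] mM[OF that(2)] B'(2) tz(1) by auto
 show "B' a b = 0.[tensor [?Q,?Q]]" if "a .: M" "b:S" for a b
 using SM[OF that(2)] mM[OF that(1)] B'(2) tz(2) by auto
 qed (use x in auto)
 finally show "sw D (tensor [?Q,?Q]) ?B x = 0.[tensor [?Q,?Q]]" .
 qed
 moreover have "?S <= ?ker" using S p(2) by force
 ultimately have SK: "?S <= K" unfolding K_def by blast
 obtain x where "x : ?S" "m = ?pr x" using SM[OF m] by blast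
 then show "m : {0.[M]}" using SK coset_zero[OF v Ksub, of x] M(4) by auto
 qed
 then show ?thesis using that[OF M(1,2) _ p] M(3) by auto
qed

lemma spans_image:
 assumes "spans D Y" "vspace D" "vspace M" "lin D M f" "f ` car D = car M" "Y <= car D"
 shows "spans M (f ` Y)"
 unfolding spans_def
proof (intro allI impI)
 fix N assume N: "submodule N ground M & f ` Y <= N"
 note ND = submD[OF assms(3) conjunct1[OF N]]
 have "submodule {x:car D. f x:N} ground D"
 by (rule submI[OF assms(2)]) (use assms(2) ND linD[OF assms(4)] lin_zero[OF assms(4,2,3)] in auto)
 moreover have "Y <= {x:car D. f x:N}" using N assms(6) by auto
 ultimately have "car D <= {x:car D. f x:N}" using assms(1) unfolding spans_def by blast
 then show "car M <= N" unfolding assms(5)[symmetric] by auto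
qed

text \<open>The test family is its own index set, which determines the type of the result and
  matches \<open>meas_univ\<close>. Coproduct and counit of the direct sum are given summand by
  summand; the quotient is spanned by the images of the summands and inherits the coalgebra laws
  from them.\<close>

lemma universal_coalgebra:
 fixes J :: "(('k::field,'c) coalg \<times> ('c=>'q)) set" and V :: "('k,'q,'z) msch"
 assumes V: "vspace V" and J: "!!C psi. (C,psi):J ==> ccoalg C & lin C V psi"
 shows "EX (M :: ('k,(('k,'c) coalg \<times> ('c=>'q)=>'c) set) coalg) phi inc. ccoalg M & lin M V phi &
 separated M {m:car M. phi m = 0.[V]} &
 (ALL C psi. (C,psi):J --> chom C M (inc (C,psi)) & (ALL x:car C. phi (inc (C,psi) x) = psi x)) &
 spans M (UN j:J. inc j ` car (fst j))"
proof -
 let ?C = "fst :: ('k,'c) coalg \<times> ('c=>'q)=>('k,'c) coalg"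
 have Jc: "j:J ==> ccoalg (?C j)" "j:J ==> lin (?C j) V (snd j)" for j using J[of "fst j" "snd j"] by auto
 have vC: "j:J ==> vspace (?C j)" and PC: "j:J ==> precoalg (?C j)" for j
 using cc_vs[OF Jc(1)] cc_pre[OF Jc(1)] by auto
 let ?D = "dsum J ?C" and ?i = "dinj J ?C"
 have v: "vspace ?D" by (rule vspace_dsum) (rule vC)
 have li: "lin (?C j) ?D (?i j)" if "j:J" for j by (rule dinj[OF vC that])
 have sp: "spans ?D (UN j:J. ?i j ` car (?C j))" by (rule spans_dsum) (rule vC)
 note TT = tensor2[OF v v]
 have h: "j:J ==> lin (?C j) (tensor [?D,?D]) (sw (?C j) (tensor [?D,?D]) (%a b. tens [?D,?D][?i j a,?i j b]))" for j
 by (rule lin_sw[OF PC TT(1) bilin_comp[OF TT(2) li li]])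
 obtain de where d: "lin ?D (tensor [?D,?D]) de"
 "!!j x. j:J ==> x .: (?C j) ==> de (?i j x) = sw (?C j) (tensor [?D,?D]) (%a b. tens [?D,?D][?i j a,?i j b]) x"
 by (rule dsum_ext[where I = J and C = ?C, OF vC TT(1) h]) auto
 obtain e where e: "lin ?D ground e" "!!j x. j:J ==> x .: (?C j) ==> e (?i j x) = counit (?C j) x"
 by (rule dsum_ext[where I = J and C = ?C, OF vC vspace_ground preD(3)[OF PC]]) auto
 obtain f where f: "lin ?D V f" "!!j x. j:J ==> x .: (?C j) ==> f (?i j x) = snd j x"
 by (rule dsum_ext[where I = J and C = ?C, OF vC V Jc(2)]) auto
 let ?M = "mk_coalg ?D de e"
 have P: "precoalg ?M" by (rule precoalg_mk_coalg[OF v d(1) e(1)])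
 have hi: "chom (?C j) ?M (?i j)" if "j:J" for j
 by (rule coalg_homI[OF PC[OF that] vspace_mk_coalg[OF v]])
 (insert that li[OF that] d(2) e(2), simp_all add: lin_mk_coalg mk_coalg_tensor)
 obtain M :: "('k,(('k,'c) coalg \<times> ('c=>'q)=>'c) set) coalg" and pr phi where
 M: "precoalg M" "chom ?M M pr" "pr ` car ?M = car M"
 "lin M V phi" "!!x. x .: ?M ==> phi (pr x) = f x" "separated M {m:car M. phi m = 0.[V]}"
 by (rule separated_quotient[OF P V, of f]) (simp add:lin_mk_coalg f(1), blast)
 note vM = preD(1)[OF M(1)]
 have lp: "lin ?M M pr" using M(2) by (simp add:coalg_hom_def)
 have hom: "chom (?C j) M (%x. pr (?i j x))" if j: "j:J" for j
 proof (rule coalg_homI[OF PC[OF j] vM])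
 have lj: "lin (?C j) ?M (?i j)" using li[OF j] by (simp add:lin_mk_coalg)
 show "lin (?C j) M (%x. pr (?i j x))" by (rule linc[OF lj lp])
 fix x assume x: "x .: (?C j)"
 note ix = linD(1)[OF lj x]
 show "counit M (pr (?i j x)) = counit (?C j) x"
 using M(2) hi[OF j] x ix by (simp add:coalg_hom_def)
 note b = bilin_comp[OF tensor2(2)[OF vM vM] lp lp]
 show "comult M (pr (?i j x)) = sw (?C j) (tensor [M,M]) (%a b. tens [M,M][pr (?i j a),pr (?i j b)]) x"
 unfolding coalg_hom_comult[OF P vM M(2) ix] by (rule sw_hom[OF PC[OF j] P hi[OF j] tensor2(1)[OF vM vM] b x])
 qed
 have "spans M (pr ` (UN j:J. ?i j ` car (?C j)))"
 by (rule spans_image[OF sp v vM]) (insert lp M(3) lin1[OF li], auto simp:lin_mk_coalg)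
 then have spM: "spans M (UN j:J. (%x. pr (?i j x)) ` car (?C j))" by (simp add:image_UN image_image)
 have "phi (pr (?i (C,psi) x)) = psi x" if "(C,psi):J" "x .: C" for C psi x
 using f(2)[OF that(1), of x] M(5)[of "?i (C,psi) x"] lin1[OF li[OF that(1)], of x] that by simp
 moreover have "chom C M (%x. pr (?i (C,psi) x))" if "(C,psi):J" for C psi using hom[OF that] by simp
 ultimately show ?thesis
 by (intro exI[of _ M] exI[of _ phi] exI[of _ "%j x. pr (?i j x)"] conjI coalg_cover[OF M(1) spM Jc(1) hom] M(4,6) spM) auto
qed

section \<open>Countably generated subcoalgebras\<close>

lemma left_inverse_ex:
 assumes "vspace E" "vspace C" "lin E C j" "!!e. e .: E ==> j e = 0.[C] ==> e = 0.[E]"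
 shows "EX r. lin C E r & (ALL e:car E. r (j e) = e)"
proof (rule left_inverse[OF assms(1-3)])
 fix r assume "lin C E r" "!!e. e .: E ==> r (j e) = e"
 then show ?thesis by blast
qed (rule assms(4))

lemma submodule_image:
 assumes "vspace V" "vspace W" "lin V W f"
 shows "submodule (f ` car V) ground W"
proof (rule submI[OF assms(2)])
 note D = linD[OF assms(3)]
 show "f ` car V <= car W" using D(1) by auto
 show "0.[W] : f ` car V" using lin_zero[OF assms(3,1,2)] vs_closed(1)[OF assms(1)] by (metis imageI)
 show "x +[W] y:f ` car V" if "x:f ` car V" "y:f ` car V" for x y
 using that D(2)[symmetric] vs_closed(2)[OF assms(1)] by auto
 show "c *.[W] x:f ` car V" if "x:f ` car V" for c x
 using that D(3)[symmetric] vs_closed(3)[OF assms(1)] by auto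
qed

lemma lspan_range:
 fixes s :: "'i=>'v" and C :: "('k::field,'v,'z) msch"
 assumes C: "vspace C" and s: "range s <= car C"
 shows "ev C s ` car (free_space UNIV) = lspan C (range s)"
proof
 have sp: "s:UNIV \<rightarrow> car C" using s by auto
 note k = lin_ev_free[OF C sp] and ls = lspan[OF C s]
 note LD = submD[OF C ls(1)]
 have "ev C s p:lspan C (range s)" for p
 proof -
 have "keys p <= UNIV" by simp
 then show ?thesis
 proof (induction p rule:poly_mapping_span_induct)
 case (single x c)
 have "ev C s (single x c) = c *.[C] s x" by (rule ev_single[OF C]) (use s in auto)
 moreover have "s x:lspan C (range s)" using ls(2) by blast
 ultimately show ?case using LD(4) by simp
 next
 case (add p q)
 have "ev C s (p + q) = ev C s p +[C] ev C s q" by (rule ev_add[OF C]) (use s in auto)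
 then show ?case using LD(3) add by simp
 qed (use C LD(2) in simp)
 qed
 then show "ev C s ` car (free_space UNIV) <= lspan C (range s)" by auto
 show "lspan C (range s) <= ev C s ` car (free_space UNIV)"
 proof (rule ls(4)[OF submodule_image[OF vspace_free C k]], rule image_subsetI)
 fix i
 have "ev C s (basis_elt i) = s i" using ev_single[OF C, of s i 1] s C by auto
 then show "s i:ev C s ` car (free_space UNIV)" by (metis UNIV_I imageI free_space_simps(1) mem_Collect_eq subset_UNIV)
 qed
qed

text \<open>The span has to be realised on functions from \<open>nat\<close> to the field. A
  complement of the kernel of the evaluation map on finitely supported sequences is carried
  isomorphically onto the span, and its members are stored as functions by
  \<open>lookup\<close>.\<close>

lemma countable_subspace:
 fixes s :: "nat=>'v" and C :: "('k::field,'v,'z) msch"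
 assumes C: "vspace C" and s: "range s <= car C"
 obtains E :: "('k,nat=>'k) module" and j where "vspace E" "lin E C j" "j ` car E = lspan C (range s)"
 "!!e. e .: E ==> j e = 0.[C] ==> e = 0.[E]"
proof -
 let ?F = "free_space UNIV :: ('k,nat \<Rightarrow>\<^sub>0 'k) module" and ?J = "ev C s"
 have sp: "s:UNIV \<rightarrow> car C" using s by auto
 note F = vspace_free[of "UNIV :: nat set"] and k = lin_ev_free[OF C sp]
 let ?N = "{p:car ?F. ?J p = 0.[C]}"
 have N: "submodule ?N ground ?F" by (rule submodule_kernel[OF F C k])
 note vN = vspace_restrict[OF F N]
 have kN: "lin (?F\<lparr>carrier := ?N\<rparr>) ?F (%p. p)" by (rule linI) auto
 have "EX r. lin ?F (?F\<lparr>carrier := ?N\<rparr>) r & (ALL p:?N. r p = p)"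
 using left_inverse_ex[OF vN F kN] by simp
 then obtain rh where "lin ?F (?F\<lparr>carrier := ?N\<rparr>) rh" and rid: "!!p. p : ?N ==> rh p = p" by blast
 then have r: "lin ?F ?F rh" and rN: "!!p. rh p : ?N" by (auto simp:klinear_def Pi_def)
 \<comment> \<open>The kernel of a retraction onto \<open>?N\<close> is a complement of
   \<open>?N\<close>.\<close>
 let ?E0 = "{p:car ?F. rh p = 0.[?F]}"
 have E0: "submodule ?E0 ground ?F" by (rule submodule_kernel[OF F F r])
 note ED = submD[OF F E0]
 let ?l = "lookup :: (nat \<Rightarrow>\<^sub>0 'k)=>nat=>'k"
 define E :: "('k,nat=>'k) module" where "E = \<lparr>carrier = ?l ` ?E0,monoid.mult = undefined,one = undefined,zero = (%n. 0),
 add = (%f g n. f n + g n),smult = (%c f n. c * f n)\<rparr>"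
 have l: "?l p +[E] ?l q = ?l (p + q)" "c *.[E] ?l p = ?l (Poly_Mapping.map ((*) c) p)" "0.[E] = ?l 0" for p q c
 by (auto simp:E_def fun_eq_iff lookup_add)
 have cE: "car E = ?l ` ?E0" by (simp add:E_def)
 define j where "j f = ?J (Abs_poly_mapping f)" for f
 have jl: "j (?l p) = ?J p" for p by (simp add:j_def)
 have E0c: "p + q : ?E0" "Poly_Mapping.map ((*) c) p : ?E0" if "p : ?E0" "q : ?E0" for p q c
 using ED(3)[OF that] ED(4)[OF that(1), of c] by simp_all
 show ?thesis
 proof (rule that)
 show "vspace E"
 proof (rule vspaceI)
 show "0.[E] .: E" unfolding l(3) cE using ED(2) by (intro imageI) simp
 show "x +[E] y .: E" if "x .: E" "y .: E" for x y
 using that E0c(1) unfolding cE by (elim imageE) (simp only:l imageI)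
 show "c *.[E] x .: E" if "x .: E" for c x
 using that E0c(2) unfolding cE by (elim imageE) (simp only:l imageI)
 qed (auto simp:E_def fun_eq_iff algebra_simps)
 show "lin E C j"
 by (rule linI; unfold cE; elim imageE) (insert linD[OF k], simp_all add: l jl)
 show "j ` car E = lspan C (range s)"
 proof -
 have "?J p : ?J ` ?E0" for p
 proof -
 have "p - rh p : ?E0"
 using linD(2)[OF r, of "p - rh p" "rh p"] rid[OF rN, of p] by simp
 moreover have "?J (p - rh p) = ?J p"
 using linD(2)[OF k, of "p - rh p" "rh p"] rN[of p] lin1[OF k, of "p - rh p"] C by simp
 ultimately show ?thesis by (intro image_eqI[where x = "p - rh p"]) simp_all
 qed
 then have "?J ` ?E0 = ?J ` car ?F" by auto
 then show ?thesis unfolding cE image_image jl using lspan_range[OF C s] by simp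
 qed
 show "e = 0.[E]" if e: "e .: E" "j e = 0.[C]" for e
 proof -
 obtain p where p: "p : ?E0" "e = ?l p" using e(1) cE by auto
 then have "p : ?N" using e(2) by (simp add:jl)
 then show ?thesis using rid[of p] p l(3) by simp
 qed
 qed
qed

text \<open>A countable form of the finiteness theorem for coalgebras: \<open>S\<close> is closed
  under the entries of the chosen representatives of coproducts, of which each element has finitely
  many. The retraction \<open>r\<close> then brings the coproduct of \<open>C\<close> back to the
  copy \<open>E\<close> of the span.\<close>

lemma countable_subcoalgebra:
 fixes C :: "('k::field,'c) coalg"
 assumes C: "ccoalg C" and S0: "countable S0" "S0 <= car C"
 obtains E :: "('k,nat=>'k) coalg" and j r S where "ccoalg E" "chom E C j" "lin C E r"
 "!!e. e .: E ==> r (j e) = e" "countable S" "S0 <= S" "S <= car C" "j ` car E = lspan C S"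
proof -
 note co = cc_coalg[OF C]
 note P = coalg_pre[OF co] and v = coalg_vs[OF co]
 let ?st = "%X. X \<union> (UN x:X. UN xs:keys (crep C x). {xs ! 0,xs ! 1})"
 \<comment> \<open>The zero vector keeps \<open>S\<close> nonempty when \<open>S0\<close> is empty,
   so that \<open>S\<close> can be enumerated by natural numbers.\<close>
 define S where "S = (\<Union>n. (?st ^^ n) (insert 0.[C] S0))"
 have st: "countable ((?st ^^ n) (insert 0.[C] S0)) & (?st ^^ n) (insert 0.[C] S0) <= car C" for n
 proof (induction n)
 case (Suc n)
 then have "xs ! 0 .: C & xs ! 1 .: C" if "x:(?st ^^ n) (insert 0.[C] S0)" "xs:keys (crep C x)" for x xs
 using crep(2)[OF P _ that(2)] that(1) by blast
 then show ?case using Suc by (auto intro!:countable_UN countable_finite[OF finite_keys])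
 qed (use S0 v in auto)
 have Sc: "countable S" "S <= car C" using st by (auto simp:S_def)
 have S0S: "insert 0.[C] S0 <= S" using UN_upper[of 0 UNIV "%n. (?st ^^ n) (insert 0.[C] S0)"] by (simp add:S_def)
 have Scl: "xs ! 0:S & xs ! 1:S" if "x:S" "xs:keys (crep C x)" for x xs
 proof -
 from that(1) have "EX n. x:(?st ^^ n) (insert 0.[C] S0)" unfolding S_def by blast
 then obtain n where "x:(?st ^^ n) (insert 0.[C] S0)" ..
 then have "{xs ! 0,xs ! 1} <= (?st ^^ Suc n) (insert 0.[C] S0)" using that(2) by auto
 then show ?thesis unfolding S_def by blast
 qed
 define s where "s = from_nat_into S"
 have rs: "range s = S" unfolding s_def by (rule range_from_nat_into) (use S0S Sc in auto)
 obtain E0 :: "('k,nat=>'k) module" and j where E0: "vspace E0" "lin E0 C j" "j ` car E0 = lspan C S"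
 "!!e. e .: E0 ==> j e = 0.[C] ==> e = 0.[E0]"
 using countable_subspace[OF v, of s] Sc(2) unfolding rs by blast
 obtain r where r: "lin C E0 r" "!!e. e .: E0 ==> r (j e) = e" using left_inverse_ex[OF E0(1) v E0(2,4)] by blast
 note ls = lspan[OF v Sc(2)]
 note jc = linD(1)[OF E0(2)] and rc = linD(1)[OF r(1)]
 have jr: "j (r x) = x" if "x:lspan C S" for x using that E0(3) r(2) by (metis imageE)
 have ljr: "lin C C (%x. j (r x))" by (rule linc[OF r(1) E0(2)])
 \<comment> \<open>On the span of \<open>S\<close> both legs may be projected by \<open>j\<close>
   after \<open>r\<close> without changing a bilinear sum. For elements of \<open>S\<close> the
   chosen legs lie in \<open>S\<close>, where the projection is the identity; the rest follows by
   linearity.\<close>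
 have cl: "sw C W (%a b. B (j (r a)) (j (r b))) x = sw C W B x"
 if W: "vspace W" and B: "bilin C C W B" and x: "x:lspan C S" for W :: "('k,'w,'z) msch" and B x
 proof -
 have "S <= {x:car C. sw C W (%a b. B (j (r a)) (j (r b))) x = sw C W B x}"
 proof (rule subsetI, rule CollectI, intro conjI)
 fix x assume x: "x:S"
 then show xC: "x .: C" using Sc by auto
 show "sw C W (%a b. B (j (r a)) (j (r b))) x = sw C W B x"
 unfolding sw_def
 proof (rule ev_cong[OF W])
 fix xs assume "xs:keys (crep C x)"
 from Scl[OF x this] have m: "xs ! 0:S" "xs ! 1:S" by auto
 then show "B (j (r (xs ! 0))) (j (r (xs ! 1))) = B (xs ! 0) (xs ! 1)"
 using jr[OF subsetD[OF ls(2) m(1)]] jr[OF subsetD[OF ls(2) m(2)]] by simp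
 show "B (xs ! 0) (xs ! 1) .: W" using bilinD(3)[OF B] m Sc(2) by blast
 qed
 qed
 from ls(4)[OF submodule_equalizer[OF v W lin_sw[OF P W bilin_comp[OF B ljr ljr]] lin_sw[OF P W B]] this]
 show ?thesis using x by auto
 qed
 note TT = tensor2[OF E0(1) E0(1)] and e = linD[OF preD(3)[OF P]]
 let ?T = "tensor [E0,E0]"
 define de where "de x = sw C ?T (%a b. tens [E0,E0][r a,r b]) (j x)" for x
 let ?E = "mk_coalg E0 de (%x. counit C (j x))"
 note br = bilin_comp[OF _ r(1) r(1)]
 have PE: "precoalg ?E"
 proof (rule precoalg_mk_coalg[OF E0(1)])
 show "lin E0 ?T de" unfolding de_def[abs_def] by (rule linc[OF E0(2) lin_sw[OF P TT(1) br[OF TT(2)]]])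
 show "lin E0 ground (%x. counit C (j x))" by (rule linc[OF E0(2) preD(3)[OF P]])
 qed
 note vE = preD(1)[OF PE]
 have biE: "bilin ?E ?E W B = bilin E0 E0 W B" for W :: "('k,'w,'z) msch" and B by (simp add:bilin_def lin_mk_coalg)
 have swE: "sw ?E W B x = sw C W (%a b. B (r a) (r b)) (j x)"
 if W: "vspace W" and B: "bilin E0 E0 W B" and x: "x .: E0" for W :: "('k,'w,'z) msch" and B x
 proof -
 note F = sweedler_bilin[OF E0(1) E0(1) W B]
 have "sw ?E W B x = sweedler W B (de x)" using sweedler_sw[OF PE W, of B x] B x by (simp add:biE)
 also have "... = sw C W (%a b. sweedler W B (tens [E0,E0][r a,r b])) (j x)"
 unfolding de_def by (rule sw_push[OF P F(1) TT(1) W jc[OF x]]) (use TT(3) rc in auto)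
 also have "... = sw C W (%a b. B (r a) (r b)) (j x)"
 by (rule sw_cong[OF P W jc[OF x]]) (use F(2) rc bilinD(3)[OF B] in auto)
 finally show ?thesis .
 qed
 have jl: "x .: E0 ==> j x:lspan C S" for x using E0(3) by auto
 have hom: "chom ?E C j"
 proof (rule coalg_homI[OF PE v])
 show "lin ?E C j" using E0(2) by (simp add:lin_mk_coalg)
 fix x assume "x .: ?E"
 then have x: "x .: E0" by simp
 note T2 = tensor2[OF v v]
 have "comult C (j x) = sw C (tensor [C,C]) (%a b. tens [C,C][j (r a),j (r b)]) (j x)"
 using cl[OF T2(1,2) jl[OF x]] comult_sw[OF P jc[OF x]] by simp
 also have "... = sw ?E (tensor [C,C]) (%a b. tens [C,C][j a,j b]) x"
 using swE[OF T2(1) bilin_comp[OF T2(2) E0(2) E0(2)] x] by simp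
 finally show "comult C (j x) = sw ?E (tensor [C,C]) (%a b. tens [C,C][j a,j b]) x" .
 qed simp
 have homE: "sw C W B (j x) = sw ?E W (%a b. B (j a) (j b)) x" if "vspace W" "bilin C C W B" "x .: E0"
 for W :: "('k,'w,'z) msch" and B x by (rule sw_hom[OF PE P hom that(1,2)]) (use that in simp)
 have lr: "lin C ?E r" using r(1) by (simp add:lin_mk_coalg)
 have "ccoalg ?E"
 proof (rule cocommI[OF PE])
 fix x assume "x .: ?E"
 then have x: "x .: E0" by simp
 note T3 = tensor3[OF vE vE vE]
 let ?W = "tensor [?E,?E,?E]" and ?t = "%a b c. tens [?E,?E,?E][a,b,c]"
 note tr = trilin_comp[OF T3(2) lr lr lr]
 have rcE: "a .: C ==> r a .: ?E" for a using rc by simp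
 have W1: "sw ?E ?W (%a b. sw ?E ?W (%y z. ?t y z b) a) x = sw C ?W (%a b. sw C ?W (%y z. ?t (r y) (r z) (r b)) a) (j x)"
 proof -
 have "sw C ?W (%a b. sw C ?W (%y z. ?t (r y) (r z) (r b)) a) (j x) = sw ?E ?W (%a b. sw C ?W (%y z. ?t (r y) (r z) (r (j b))) (j a)) x"
 by (rule homE[OF T3(1) bilin_sw_left(1)[OF P T3(1) tr] x])
 also have "... = sw ?E ?W (%a b. sw ?E ?W (%y z. ?t y z b) a) x"
 proof (rule sw_cong[OF PE T3(1)])
 fix a b assume ab: "a .: ?E" "b .: ?E"
 then show "sw C ?W (%y z. ?t (r y) (r z) (r (j b))) (j a) = sw ?E ?W (%y z. ?t y z b) a"
 using swE[OF T3(1), of "%y z. ?t y z b" a] trilin_parts(1)[OF T3(2) ab(2)] r(2)[of b] by (simp add:biE)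
 qed (insert x T3, auto intro!:sw_closed[OF PE])
 finally show ?thesis by simp
 qed
 have W2: "sw ?E ?W (%a b. sw ?E ?W (%y z. ?t a y z) b) x = sw C ?W (%a b. sw C ?W (%y z. ?t (r a) (r y) (r z)) b) (j x)"
 proof -
 have "sw C ?W (%a b. sw C ?W (%y z. ?t (r a) (r y) (r z)) b) (j x) = sw ?E ?W (%a b. sw C ?W (%y z. ?t (r (j a)) (r y) (r z)) (j b)) x"
 by (rule homE[OF T3(1) bilin_sw_left(2)[OF P T3(1) tr] x])
 also have "... = sw ?E ?W (%a b. sw ?E ?W (%y z. ?t a y z) b) x"
 proof (rule sw_cong[OF PE T3(1)])
 fix a b assume ab: "a .: ?E" "b .: ?E"
 then show "sw C ?W (%y z. ?t (r (j a)) (r y) (r z)) (j b) = sw ?E ?W (%y z. ?t a y z) b"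
 using swE[OF T3(1), of "%y z. ?t a y z" b] trilin_parts(2)[OF T3(2) ab(1)] r(2)[of a] by (simp add:biE)
 qed (insert x T3, auto intro!:sw_closed[OF PE])
 finally show ?thesis by simp
 qed
 show "sw ?E ?W (%a b. sw ?E ?W (%y z. ?t y z b) a) x = sw ?E ?W (%a b. sw ?E ?W (%y z. ?t a y z) b) x"
 unfolding W1 W2 by (rule sw_coassoc[OF co T3(1) tr jc[OF x]])
 have bcC: "bilin C C ?E (%a b. counit C a *.[?E] r b)"
 by (intro bilinI linI; use e linD[OF lr] vE E0(1) in \<open>simp add:vs_smult vs_smultC\<close>)+
 show "sw ?E ?E (%a b. counit ?E a *.[?E] b) x = x"
 using homE[OF vE bcC x] sw_counit(1)[OF co vE lr jc[OF x]] sw_cong[OF PE vE, of x "%a b. counit C (j a) *.[?E] r (j b)" "%a b. counit ?E a *.[?E] b"] r(2) x vE E0(1)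
 by simp
 show "sw ?E (tensor [?E,?E]) (%a b. tens [?E,?E][b,a]) x = comult ?E x"
 unfolding mk_coalg_tensor swE[OF TT(1) bilin_flip[OF TT(2)] x] 
 using sw_cocomm[OF C TT(1) br[OF TT(2)] jc[OF x]] by (simp add:de_def)
 qed
 then show ?thesis
 by (rule that[of ?E j r S]) (use hom lr r(2) Sc S0S E0(3) in auto)
qed

section \<open>Existence of final families\<close>

lemma coalg_hom_comp:
 assumes C: "precoalg C" and D: "precoalg D" and E: "precoalg E" and f: "chom C D f" and g: "chom D E g"
 shows "chom C E (%x. g (f x))"
proof (rule coalg_homI[OF C preD(1)[OF E]])
 note v = preD(1)[OF E]
 have l: "lin C D f" "lin D E g" using f g by (auto simp:coalg_hom_def)
 show "lin C E (%x. g (f x))" by (rule linc[OF l])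
 fix x assume x: "x .: C"
 note fx = linD(1)[OF l(1) x]
 show "counit E (g (f x)) = counit C x" using f g x fx by (simp add:coalg_hom_def)
 show "comult E (g (f x)) = sw C (tensor [E,E]) (%a b. tens [E,E][g (f a),g (f b)]) x"
 unfolding coalg_hom_comult[OF D v g fx]
 by (rule sw_hom[OF C D f tensor2(1)[OF v v] bilin_comp[OF tensor2(2)[OF v v] l(2) l(2)] x])
qed

lemma coalg_hom_cong:
 assumes C: "precoalg C" and D: "precoalg D" and f: "chom C D f" and fg: "!!x. x .: C ==> g x = f x"
 shows "chom C D g"
proof (rule coalg_homI[OF C preD(1)[OF D]])
 note v = preD(1)[OF D]
 have l: "lin C D f" using f by (simp add:coalg_hom_def)
 show "lin C D g" using lin_cong[OF preD(1)[OF C], of g f D] fg l by simp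
 fix x assume x: "x .: C"
 show "counit D (g x) = counit C x" using f x fg by (simp add:coalg_hom_def)
 show "comult D (g x) = sw C (tensor [D,D]) (%a b. tens [D,D][g a,g b]) x"
 unfolding fg[OF x] coalg_hom_comult[OF C v f x]
 by (rule sw_cong[OF C tensor2(1)[OF v v] x]) (use fg linD(1)[OF l] tensor2(3)[OF v v] in auto)
qed

lemma kernel_diff:
 assumes "vspace M" "vspace V" "lin M V phi" "x .: M" "y .: M" "phi x = phi y"
 shows "x +[M] (- 1) *.[M] y : {m:car M. phi m = 0.[V]}"
 using assms linD[OF assms(3)] vs_neg[OF assms(2), of "phi y"] by simp

text \<open>Countable-dimensional subcoalgebras of \<open>C\<close> form a directed cover, because
  the union of two countable sets is countable. Each has a copy in \<open>J\<close> and so a map to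
  \<open>M\<close>; separatedness makes these maps agree on overlaps, and they glue.\<close>

lemma universal_map:
 fixes C :: "('k::field,'c) coalg" and M :: "('k,'m) coalg" and V :: "('k,'q,'z) msch"
 and J :: "(('k,nat=>'k) coalg \<times> ((nat=>'k)=>'q)) set"
 assumes V: "vspace V" and M: "separated M {m:car M. phi m = 0.[V]}" and p: "lin M V phi"
 and inc: "!!E psi. (E,psi):J ==> chom E M (inc (E,psi))"
 and pinc: "!!E psi x. (E,psi):J ==> x .: E ==> phi (inc (E,psi) x) = psi x"
 and C: "ccoalg C" and pull: "!!E j. ccoalg E ==> chom E C j ==> (E,%e. psi (j e)):J"
 shows "EX f. chom C M f & (ALL x:car C. phi (f x) = psi x)"
proof -
 note P = cc_pre[OF C]
 note v = preD(1)[OF P]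
 have PM: "precoalg M" using M by (simp add:separated_def)
 note vM = preD(1)[OF PM]
 define sub where "sub = (%(E :: ('k,nat=>'k) coalg,j,r,S). ccoalg E & chom E C j & lin C E r &
 (ALL e:car E. r (j e) = e) & countable S & S <= car C & j ` car E = lspan C S)"
 define ic where "ic = (%(E,j,r,S :: 'c set) e. inc (E,%e. psi (j e)) e)"
 have ex: "EX E j r S. sub (E,j,r,S) & S0 <= S" if "countable S0" "S0 <= car C" for S0
 proof (rule countable_subcoalgebra[OF C that])
 fix E :: "('k,nat=>'k) coalg" and j r S
 assume a: "ccoalg E" "chom E C j" "lin C E r" "!!e. e .: E ==> r (j e) = e"
 "countable S" "S0 <= S" "S <= car C" "j ` car E = lspan C S"
 then have "sub (E,j,r,S)" by (simp add:sub_def)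
 with a(6) show ?thesis by blast
 qed
 have subr: "r x .: E & j (r x) = x" if s: "sub (E,j,r,S)" and x: "x:lspan C S" for E j r S x
 proof -
 have e: "lspan C S = j ` car E" and rj: "ALL e:car E. r (j e) = e" using s by (auto simp:sub_def)
 show ?thesis using x rj unfolding e by auto
 qed
 \<comment> \<open>For \<open>S1\<close> inside \<open>S2\<close> the inclusion is realised by
   \<open>r2\<close> after \<open>j1\<close>. It is a coalgebra map, and both resulting maps to
   \<open>M\<close> agree after \<open>phi\<close>, so separatedness identifies them.\<close>
 have emb: "inc (E1,%e. psi (j1 e)) e = inc (E2,%e. psi (j2 e)) (r2 (j1 e))"
 if s1: "sub (E1,j1,r1,S1)" and s2: "sub (E2,j2,r2,S2)" and le: "S1 <= S2" and e: "e .: E1" for E1 j1 r1 S1 E2 j2 r2 S2 e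
 proof -
 have h: "ccoalg E1" "chom E1 C j1" "ccoalg E2" "chom E2 C j2" "lin C E2 r2"
 and rj: "!!e. e .: E2 ==> r2 (j2 e) = e" and im: "j1 ` car E1 = lspan C S1" "j2 ` car E2 = lspan C S2" "S1 <= car C" "S2 <= car C"
 using s1 s2 by (auto simp:sub_def)
 note P1 = cc_pre[OF h(1)] and P2 = cc_pre[OF h(3)]
 note v2 = preD(1)[OF P2]
 have l1: "lin E1 C j1" and l2: "lin E2 C j2" using h by (auto simp:coalg_hom_def)
 have "lspan C S1 <= lspan C S2"
 using lspan(4)[OF v im(3) lspan(1)[OF v im(4)]] lspan(2)[OF v im(4)] le by blast
 then have jk: "j2 (r2 (j1 e)) = j1 e" if "e .: E1" for e
 using that im rj by (metis (no_types, lifting) imageE imageI subsetD)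
 let ?k = "%e. r2 (j1 e)"
 have lk: "lin E1 E2 ?k" by (rule linc[OF l1 h(5)])
 have k: "chom E1 E2 ?k"
 proof (rule coalg_homI[OF P1 v2 lk])
 fix e assume e: "e .: E1"
 note ke = linD(1)[OF lk e]
 have "counit E2 (?k e) = counit C (j2 (?k e))" using h(4) ke by (simp add:coalg_hom_def)
 then show "counit E2 (?k e) = counit E1 e" using h(2) e jk by (simp add:coalg_hom_def)
 note T2 = tensor2[OF v2 v2]
 note b = bilin_comp[OF T2(2) h(5) h(5)]
 have "comult E2 (?k e) = sw E2 (tensor [E2,E2]) (%a b. tens [E2,E2][a,b]) (?k e)" by (rule comult_sw[OF P2 ke])
 also have "... = sw E2 (tensor [E2,E2]) (%a b. tens [E2,E2][r2 (j2 a),r2 (j2 b)]) (?k e)"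
 by (rule sw_cong[OF P2 T2(1) ke]) (use rj T2(3) in auto)
 also have "... = sw C (tensor [E2,E2]) (%a b. tens [E2,E2][r2 a,r2 b]) (j2 (?k e))"
 by (rule sw_hom[symmetric, OF P2 P h(4) T2(1) b ke])
 also have "... = sw E1 (tensor [E2,E2]) (%a b. tens [E2,E2][?k a,?k b]) e"
 unfolding jk[OF e] by (rule sw_hom[OF P1 P h(2) T2(1) b e])
 finally show "comult E2 (?k e) = sw E1 (tensor [E2,E2]) (%a b. tens [E2,E2][?k a,?k b]) e" .
 qed
 note J1 = pull[OF h(1,2)] and J2 = pull[OF h(3,4)]
 note i1 = inc[OF J1] and i2 = coalg_hom_comp[OF P1 P2 PM k inc[OF J2]]
 have li: "lin E1 M (inc (E1,%e. psi (j1 e)))" "lin E1 M (%e. inc (E2,%e. psi (j2 e)) (?k e))"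
 using i1 i2 by (auto simp:coalg_hom_def)
 show ?thesis
 by (rule separated_hom_eq[OF M P1 i1 i2 kernel_diff[OF vM V p] e])
 (use linD(1)[OF li(1)] lin1[OF li(2)] pinc[OF J1] pinc[OF J2] lin1[OF lk] jk in auto)
 qed
 \<comment> \<open>Two subcoalgebras are compared through a third one that contains both generating
   sets.\<close>
 have eq: "inc (E1,%e. psi (j1 e)) (r1 x) = inc (E2,%e. psi (j2 e)) (r2 x)"
 if s1: "sub (E1,j1,r1,S1)" and s2: "sub (E2,j2,r2,S2)" and x: "x:lspan C S1" "x:lspan C S2" for E1 j1 r1 S1 E2 j2 r2 S2 x
 proof -
 have "countable (S1 \<union> S2)" "S1 \<union> S2 <= car C" using s1 s2 by (auto simp:sub_def)
 from ex[OF this] obtain E j r S where s: "sub (E,j,r,S)" "S1 \<union> S2 <= S" by blast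
 show ?thesis using subr[OF s1 x(1)] subr[OF s2 x(2)] emb[OF s1 s(1), of "r1 x"] emb[OF s2 s(1), of "r2 x"] s(2) by simp
 qed
 have "ALL x:car C. EX q. sub q & x:lspan C (snd (snd (snd q)))"
 proof
 fix x assume "x .: C"
 then obtain E j r S where s: "sub (E,j,r,S)" "{x} <= S" using ex[of "{x}"] by auto
 then have "S <= lspan C S" using lspan(2)[OF v] by (auto simp:sub_def)
 then show "EX q. sub q & x:lspan C (snd (snd (snd q)))" using s by (intro exI[of _ "(E,j,r,S)"]) auto
 qed
 then obtain t where t: "ALL x:car C. sub (t x) & x:lspan C (snd (snd (snd (t x))))" by (rule bchoice[THEN exE])
 define f where "f x = (case t x of (E,j,r,S)=>inc (E,%e. psi (j e)) (r x))" for x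
 have fe: "f x = inc (E,%e. psi (j e)) (r x)" if s: "sub (E,j,r,S)" and x: "x:lspan C S" for E j r S x
 proof -
 have "x .: C" using lspan(3)[OF v] s x by (auto simp:sub_def)
 moreover obtain E' j' r' S' where "t x = (E',j',r',S')" by (cases "t x")
 ultimately show ?thesis using eq[OF _ s _ x, of E' j' r' S'] t by (auto simp:f_def)
 qed
 have subD: "ccoalg E" "chom E C j" "lin C E r" "lin E M (inc (E,%e. psi (j e)))"
 "x:lspan C S ==> r x .: E & j (r x) = x" "e .: E ==> r (j e) = e & j e:lspan C S" "submodule (lspan C S) ground C"
 if s: "sub (E,j,r,S)" for E j r S x e
 proof -
 show *: "ccoalg E" "chom E C j" "lin C E r" using s by (auto simp:sub_def)
 show "lin E M (inc (E,%e. psi (j e)))" using inc[OF pull[OF *(1,2)]] by (simp add:coalg_hom_def)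
 show "x:lspan C S ==> r x .: E & j (r x) = x" "e .: E ==> r (j e) = e & j e:lspan C S"
 using subr[OF s] s by (auto simp:sub_def)
 show "submodule (lspan C S) ground C" using lspan(1)[OF v] s by (auto simp:sub_def)
 qed
 have both: "EX E j r S. sub (E,j,r,S) & x:lspan C S & y:lspan C S" if "x .: C" "y .: C" for x y
 proof -
 obtain E j r S where s: "sub (E,j,r,S)" "{x,y} <= S" using ex[of "{x,y}"] \<open>x .: C\<close> \<open>y .: C\<close> by auto
 then have "S <= lspan C S" using lspan(2)[OF v] by (auto simp:sub_def)
 then show ?thesis using s by blast
 qed
 have lf: "lin C M f"
 proof (rule linI)
 fix x y c assume x: "x .: C"
 obtain E j r S where s: "sub (E,j,r,S)" "x:lspan C S" using both[OF x x] by blast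
 note D = subD[OF s(1)] and N = submD[OF v subD(7)[OF s(1)]]
 show "f x .: M" using fe[OF s] lin1[OF D(4)] D(5)[OF s(2)] by simp
 show "f (c *.[C] x) = c *.[M] f x"
 using fe[OF s(1) N(4)[OF s(2)]] fe[OF s] lin3[OF D(4)] D(5)[OF s(2)] lin3[OF D(3) x] by simp
 assume y: "y .: C"
 obtain E j r S where s: "sub (E,j,r,S)" "x:lspan C S" "y:lspan C S" using both[OF x y] by blast
 note D = subD[OF s(1)] and N = submD[OF v subD(7)[OF s(1)]]
 show "f (x +[C] y) = f x +[M] f y"
 using fe[OF s(1) N(3)[OF s(2,3)]] fe[OF s(1,2)] fe[OF s(1,3)] lin2[OF D(4)] D(5)[OF s(2)] D(5)[OF s(3)] lin2[OF D(3) x y] by simp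
 qed
 have fx: "counit M (f x) = counit C x & phi (f x) = psi x & comult M (f x) = sw C (tensor [M,M]) (%a b. tens [M,M][f a,f b]) x"
 if x: "x .: C" for x
 proof -
 obtain E j r S where s: "sub (E,j,r,S)" "x:lspan C S" using both[OF x x] by blast
 note D = subD[OF s(1)]
 note PE = cc_pre[OF D(1)] and J' = pull[OF D(1,2)] and rx = D(5)[OF s(2)]
 note i = inc[OF J'] and T2 = tensor2[OF vM vM]
 have "counit M (f x) = counit C x" using i D(2) rx fe[OF s] by (auto simp:coalg_hom_def)
 moreover have "phi (f x) = psi x" using pinc[OF J', of "r x"] rx fe[OF s] by simp
 moreover have "comult M (f x) = sw E (tensor [M,M]) (%a b. tens [M,M][inc (E,%e. psi (j e)) a,inc (E,%e. psi (j e)) b]) (r x)"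
 unfolding fe[OF s] by (rule coalg_hom_comult[OF PE vM i]) (use rx in simp)
 moreover have "... = sw E (tensor [M,M]) (%a b. tens [M,M][f (j a),f (j b)]) (r x)"
 by (rule sw_cong[OF PE T2(1)]) (use rx D(6) fe[OF s(1)] lin1[OF D(4)] T2(3) in auto)
 moreover have "... = sw C (tensor [M,M]) (%a b. tens [M,M][f a,f b]) (j (r x))"
 by (rule sw_hom[symmetric, OF PE P D(2) T2(1) bilin_comp[OF T2(2) lf lf]]) (use rx in simp)
 ultimately show ?thesis using rx by simp
 qed
 then have "chom C M f" by (intro coalg_homI[OF P vM lf]) auto
 then show ?thesis using fx by blast
qed

text \<open>Extensionality normalises the values outside the carrier; uniqueness inside it is
  separatedness.\<close>

lemma separated_ex1:
 assumes V: "vspace V" and M: "separated M {m:car M. phi m = 0.[V]}" and p: "lin M V phi" and C: "precoalg C"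
 and ex: "EX f. chom C M f & (ALL x:car C. phi (f x) = psi x)"
 shows "EX! f. f:extensional (car C) & chom C M f & (ALL x:car C. phi (f x) = psi x)"
proof -
 have PM: "precoalg M" using M by (simp add:separated_def)
 note vM = preD(1)[OF PM]
 obtain f where f: "chom C M f" "!!x. x .: C ==> phi (f x) = psi x" using ex by blast
 show ?thesis
 proof (rule ex1I[of _ "restrict f (car C)"])
 show "restrict f (car C):extensional (car C) & chom C M (restrict f (car C)) & (ALL x:car C. phi (restrict f (car C) x) = psi x)"
 using coalg_hom_cong[OF C PM f(1), of "restrict f (car C)"] f(2) by simp
 fix g assume g: "g:extensional (car C) & chom C M g & (ALL x:car C. phi (g x) = psi x)"
 have l: "lin C M f" "lin C M g" using f(1) g by (auto simp:coalg_hom_def)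
 show "g = restrict f (car C)"
 proof (rule extensionalityI[of _ "car C"])
 fix x assume "x .: C"
 then show "g x = restrict f (car C) x"
 using separated_hom_eq[OF M C _ f(1) kernel_diff[OF vM V p], of g x] g f(2) lin1[OF l(1)] lin1[OF l(2)] by simp
 qed (use g in auto)
 qed
qed

text \<open>The image of a coideal under a coalgebra map is again a coideal, and injectivity
  transfers its vanishing back to \<open>M\<close>.\<close>

lemma separated_pullback:
 assumes M0: "separated M0 K0" and M: "precoalg M" and K: "submodule K ground M" and g: "chom M M0 g"
 and inj: "!!x. x .: M ==> g x = 0.[M0] ==> x = 0.[M]" and gK: "g ` K <= K0"
 shows "separated M K"
 unfolding separated_def
proof (intro conjI M K allI impI)
 have P0: "precoalg M0" using M0 by (simp add:separated_def)
 note v0 = preD(1)[OF P0] and v = preD(1)[OF M]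
 have lg: "lin M M0 g" using g by (simp add:coalg_hom_def)
 fix S assume S: "coideal M S & S <= K"
 then have sub: "submodule S ground M" by (simp add:coideal_def)
 note SD = submD[OF v sub]
 have "lin (M\<lparr>carrier := S\<rparr>) M0 g" by (rule linI) (insert linD[OF lg] SD(1), simp_all add: subset_iff)
 from submodule_image[OF vspace_restrict[OF v sub] v0 this] have sub0: "submodule (g ` S) ground M0" by simp
 note q = vspace_quot[OF v0 sub0]
 note TT = tensor2[OF q q] and b = bilin_tens_coset[OF v0 sub0] and tz = tens_coset_zero[OF v0 sub0]
 have "coideal M0 (g ` S)"
 proof (rule coidealI[OF P0 sub0])
 fix s assume "s:g ` S"
 then obtain x where x: "x:S" "s = g x" by blast
 then have xM: "x .: M" using SD(1) by auto
 show "counit M0 s = 0" using g S x xM by (simp add:coalg_hom_def coideal_def)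
 show "sw M0 (tensor [quot M0 (g ` S),quot M0 (g ` S)])
 (%a b. tens [quot M0 (g ` S),quot M0 (g ` S)][(g ` S) +>[M0] a,(g ` S) +>[M0] b]) s = 0.[tensor [quot M0 (g ` S),quot M0 (g ` S)]]"
 unfolding x(2) sw_hom[OF M P0 g TT(1) b xM]
 by (rule coideal_kill[OF M conjunct1[OF S] TT(1) bilin_comp[OF b lg lg] _ _ x(1)]) (use tz linD(1)[OF lg] in auto)
 qed
 moreover have "g ` S <= K0" using S gK by blast
 ultimately have "g ` S <= {0.[M0]}" using M0 by (simp add:separated_def)
 then show "S <= {0.[M]}" using inj SD(1) by blast
qed

text \<open>Finality on the universe type alone makes a family separated, since it is then isomorphic to the constructed one.\<close>

lemma separated_transfer:
 assumes V: "vspace V" and M0: "separated M0 {m:car M0. phi0 m = 0.[V]}" and M: "precoalg M" and p: "lin M V phi"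
 and f0: "chom M0 M f0" "!!x. x .: M0 ==> phi (f0 x) = phi0 x"
 and g0: "chom M M0 g0" "!!x. x .: M ==> phi0 (g0 x) = phi x"
 and uniq: "!!u. chom M M u ==> (!!x. x .: M ==> phi (u x) = phi x) ==> (ALL x:car M. u x = x)"
 shows "separated M {m:car M. phi m = 0.[V]}"
proof -
 have P0: "precoalg M0" using M0 by (simp add:separated_def)
 note v = preD(1)[OF M] and v0 = preD(1)[OF P0]
 have l: "lin M0 M f0" "lin M M0 g0" using f0 g0 by (auto simp:coalg_hom_def)
 have id: "f0 (g0 x) = x" if "x .: M" for x
 using uniq[OF coalg_hom_comp[OF M P0 M g0(1) f0(1)]] f0(2) g0(2) lin1[OF l(2)] that by simp
 show ?thesis
 proof (rule separated_pullback[OF M0 M submodule_kernel[OF v V p] g0(1)])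
 show "x = 0.[M]" if "x .: M" "g0 x = 0.[M0]" for x
 using id[OF that(1)] that(2) lin_zero[OF l(1) v0 v] by simp
 show "g0 ` {m:car M. phi m = 0.[V]} <= {m:car M0. phi0 m = 0.[V]}"
 using g0(2) lin1[OF l(2)] by auto
 qed
qed

section \<open>Measurings of algebras\<close>

lemma coalg_homD:
 assumes "chom C D f"
 shows "lin C D f" "x .: C ==> f x .: D" "x .: C ==> counit D (f x) = counit C x"
 using assms linD(1)[of C D f x] by (auto simp:coalg_hom_def)

text \<open>Turns a family of linear maps into one linear map from the coalgebra into a vector space
  (\<open>linear_family_lin_space\<close>), which is the setting of separatedness. Extensional
  functions make equality in this space the same as agreement on \<open>V\<close>.\<close>

definition lin_space :: "('k::field,'v) module=>('k,'w) module=>('k,'v=>'w) module" where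
 "lin_space V W = \<lparr>carrier = {f:extensional (car V). lin V W f},monoid.mult = undefined,one = undefined,
 zero = (\<lambda>v\<in>car V. 0.[W]),add = (%f g. \<lambda>v\<in>car V. f v +[W] g v),smult = (%c f. \<lambda>v\<in>car V. c *.[W] f v)\<rparr>"

lemma lin_space_simps:
 "f .: lin_space V W <-> f:extensional (car V) & lin V W f" "0.[lin_space V W] = (\<lambda>v\<in>car V. 0.[W])"
 "f +[lin_space V W] g = (\<lambda>v\<in>car V. f v +[W] g v)" "c *.[lin_space V W] f = (\<lambda>v\<in>car V. c *.[W] f v)"
 by (simp_all add: lin_space_def)

lemma lin_restrict [simp]: "vspace V ==> lin V W (restrict f (car V)) = lin V W f"
 by (rule lin_cong) auto

lemma vspace_lin_space:
 assumes V: "vspace V" and W: "vspace W"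
 shows "vspace (lin_space V W)"
proof -
 have a: "lin V W (%v. f v +[W] g v)" if "lin V W f" "lin V W g" for f g
 by (rule linI) (insert that W, simp_all add: klinear_def Pi_def vs_smult vs_add_ac[OF W])
 have c: "lin V W (%v. c *.[W] f v)" if "lin V W f" for c f
 by (rule linI) (insert that W, simp_all add: klinear_def Pi_def vs_smult vs_smultC)
 have z: "lin V W (%v. 0.[W])" by (rule linI) (use W in auto)
 have cl: "!!f v. lin V W f ==> v .: V ==> f v .: W" by (rule linD(1))
 show ?thesis
 by (rule vspaceI)
 (insert V W a c z cl, auto simp:lin_space_simps fun_eq_iff restrict_def extensional_def vs_smult vs_neg vs_add_ac[OF W] simp del: lin_restrict
 intro: lin_restrict[unfolded restrict_def, THEN iffD2])
qed

lemma linear_family_lin_space: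
 assumes C: "vspace C" and V: "vspace V" and W: "vspace W"
 shows "linear_family C V W psi <-> lin C (lin_space V W) (%x. restrict (psi x) (car V))"
proof
 assume "linear_family C V W psi"
 then have *: "!!x. x .: C ==> lin V W (psi x)" "!!v. v .: V ==> lin C W (%x. psi x v)" by (auto simp:linear_family_def)
 show "lin C (lin_space V W) (%x. restrict (psi x) (car V))"
 by (rule linI) (insert V * linD(2,3)[OF *(2)], auto simp:lin_space_simps fun_eq_iff)
next
 assume k: "lin C (lin_space V W) (%x. restrict (psi x) (car V))"
 have l: "lin V W (psi x)" if "x .: C" for x using linD(1)[OF k that] V by (simp add:lin_space_simps)
 have "lin C W (%x. psi x v)" if v: "v .: V" for v
 proof (rule linI)
 show "psi x v .: W" if "x .: C" for x by (rule linD(1)[OF l[OF that] v])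
 show "psi (x +[C] y) v = psi x v +[W] psi y v" if "x .: C" "y .: C" for x y
 using fun_cong[OF linD(2)[OF k that], of v] v by (simp add:lin_space_simps)
 show "psi (c *.[C] x) v = c *.[W] psi x v" if "x .: C" for x c
 using fun_cong[OF linD(3)[OF k that, of c], of v] v by (simp add:lin_space_simps)
 qed
 then show "linear_family C V W psi" using l by (simp add:linear_family_def)
qed

lemma lfD:
 assumes "linear_family C V W psi"
 shows "x .: C ==> lin V W (psi x)" "v .: V ==> lin C W (%x. psi x v)"
 "x .: C ==> v .: V ==> psi x v .: W"
 using assms by (auto simp:linear_family_def intro: lin1)

lemma linear_family_cong:
 assumes "vspace C" "vspace V" "!!x v. x .: C ==> v .: V ==> psi x v = psi' x v"
 shows "linear_family C V W psi <-> linear_family C V W psi'"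
 unfolding linear_family_def
 using lin_cong[OF assms(2), of "psi x" "psi' x" W for x] lin_cong[OF assms(1), of "%x. psi x v" "%x. psi' x v" W for v] assms(3)
 by (intro arg_cong2[where f = "(&)"] ball_cong refl) auto

text \<open>A bilinear product with a distinguished element is the structure to which
  \<open>alg_measuring\<close> refers; in this form homology with its shuffle product can enter
  directly.\<close>

definition walg :: "('k::field,'r) module=>bool" where
 "walg R <-> vspace R & bilin R R R (%a b. a **[R] b) & 1.[R] .: R"

lemma walgD:
 assumes "walg R"
 shows "vspace R" "bilin R R R (%a b. a **[R] b)" "1.[R] .: R"
 "a .: R ==> b .: R ==> a **[R] b .: R"
 using assms bilinD(3)[of R R R "%a b. a **[R] b" a b] by (auto simp:walg_def)

lemma bilin_family:
 assumes "linear_family C V W psi" "bilin W W X B" "a .: V" "b .: V"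
 shows "bilin C C X (%x y. B (psi x a) (psi y b))"
 by (rule bilin_comp[OF assms(2) lfD(2)[OF assms(1,3)] lfD(2)[OF assms(1,4)]])

lemma alg_measuring_iff:
 assumes C: "precoalg C" and R': "walg R'"
 shows "ameas R R' C psi <-> linear_family C R R' psi &
 (ALL x:car C. ALL a:car R. ALL b:car R. psi x (a **[R] b) = sw C R' (%x1 x2. psi x1 a **[R'] psi x2 b) x) &
 (ALL x:car C. psi x 1.[R] = counit C x *.[R'] 1.[R'])"
proof (cases "linear_family C R R' psi")
 case True
 show ?thesis
 unfolding alg_measuring_def
 using sweedler_sw[OF C walgD(1)[OF R'] bilin_family[OF True walgD(2)[OF R']]] by (simp cong: ball_cong)
qed (simp add:alg_measuring_def)

lemma ameasD:
 assumes "ameas R R' C psi" "precoalg C" "walg R'"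
 shows "linear_family C R R' psi"
 "x .: C ==> a .: R ==> b .: R ==> psi x (a **[R] b) = sw C R' (%x1 x2. psi x1 a **[R'] psi x2 b) x"
 "x .: C ==> psi x 1.[R] = counit C x *.[R'] 1.[R']"
 using assms(1)[unfolded alg_measuring_iff[OF assms(2,3)]] by auto

lemma alg_measuring_cong:
 assumes C: "precoalg C" and R: "walg R" and R': "walg R'" and m: "ameas R R' C psi"
 and eq: "!!x a. x .: C ==> a .: R ==> psi' x a = psi x a"
 shows "ameas R R' C psi'"
proof -
 note D = ameasD[OF m C R'] and v = preD(1)[OF C]
 have "linear_family C R R' psi'" using linear_family_cong[OF v walgD(1)[OF R], of psi' psi R'] eq D(1) by simp
 moreover have "sw C R' (%x1 x2. psi' x1 a **[R'] psi' x2 b) x = sw C R' (%x1 x2. psi x1 a **[R'] psi x2 b) x"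
 if "x .: C" "a .: R" "b .: R" for x a b
 by (rule sw_cong[OF C walgD(1)[OF R'] that(1)]) (use that eq lfD(3)[OF D(1)] walgD(4)[OF R'] in auto)
 ultimately show ?thesis using D eq walgD[OF R] by (auto simp:alg_measuring_iff[OF C R'])
qed

lemma linear_family_pull:
 assumes "linear_family C V W psi" "lin E C j"
 shows "linear_family E V W (%e. psi (j e))"
 using assms lfD(1)[OF assms(1)] linc[OF assms(2) lfD(2)[OF assms(1)]] lin1[OF assms(2)]
 by (auto simp:linear_family_def)

lemma alg_measuring_pull:
 assumes C: "precoalg C" and E: "precoalg E" and R': "walg R'" and m: "ameas R R' C psi" and j: "chom E C j"
 shows "ameas R R' E (%e. psi (j e))"
proof -
 note D = ameasD[OF m C R']
 have lj: "lin E C j" using j by (simp add:coalg_hom_def)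
 show ?thesis
 unfolding alg_measuring_iff[OF E R']
 using linear_family_pull[OF D(1) lj] D(2,3) lin1[OF lj] j sw_hom[OF E C j walgD(1)[OF R'] bilin_family[OF D(1) walgD(2)[OF R']]]
 by (auto simp:coalg_hom_def)
qed

text \<open>Both measuring laws are linear in the coalgebra element and compatible with coalgebra
  maps, so they can be checked on a spanning family of images.\<close>

lemma alg_measuring_cover:
 assumes M: "precoalg M" and R: "walg R" and R': "walg R'" and lf: "linear_family M R R' phi"
 and sp: "spans M (UN j:J. f j ` car (Cj j))" and C: "!!j. j:J ==> precoalg (Cj j)" and f: "!!j. j:J ==> chom (Cj j) M (f j)"
 and m: "!!j. j:J ==> ameas R R' (Cj j) (%x. phi (f j x))"
 shows "ameas R R' M phi"
proof -
 note v = preD(1)[OF M] and v' = walgD(1)[OF R']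
 have fc: "(UN j:J. f j ` car (Cj j)) <= car M" using coalg_homD(2)[OF f] by auto
 have eqI: "F x = G x" if "lin M R' F" "lin M R' G" "!!j y. j:J ==> y .: Cj j ==> F (f j y) = G (f j y)" "x .: M" for F G x
 by (rule spans_eqI[OF sp v v' that(1,2) fc _ that(4)]) (use that(3) in auto)
 note b = bilin_family[OF lf walgD(2)[OF R']]
 have "phi x (a **[R] b) = sw M R' (%x1 x2. phi x1 a **[R'] phi x2 b) x"
 if "x .: M" "a .: R" "b .: R" for x a b
 proof (rule eqI[OF lfD(2)[OF lf walgD(4)[OF R that(2,3)]] lin_sw[OF M v' b[OF that(2,3)]] _ that(1)])
 fix j y assume j: "j:J" and y: "y .: Cj j"
 show "phi (f j y) (a **[R] b) = sw M R' (%x1 x2. phi x1 a **[R'] phi x2 b) (f j y)"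
 using ameasD(2)[OF m[OF j] C[OF j] R' y that(2,3)] sw_hom[OF C[OF j] M f[OF j] v' b[OF that(2,3)] y] by simp
 qed
 moreover have "phi x 1.[R] = counit M x *.[R'] 1.[R']" if "x .: M" for x
 proof (rule eqI[OF lfD(2)[OF lf walgD(3)[OF R]] _ _ that])
 show "lin M R' (%x. counit M x *.[R'] 1.[R'])"
 by (rule linI) (insert linD[OF preD(3)[OF M]] v' walgD(3)[OF R'], simp_all add: vs_smult)
 fix j y assume j: "j:J" and y: "y .: Cj j"
 show "phi (f j y) 1.[R] = counit M (f j y) *.[R'] 1.[R']"
 using ameasD(3)[OF m[OF j] C[OF j] R' y] f[OF j] y by (simp add:coalg_hom_def)
 qed
 ultimately show ?thesis using lf by (simp add:alg_measuring_iff[OF M R'])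
qed

lemma bilin_comp_family:
 assumes C: "vspace C" and D: "vspace D" and lf: "linear_family C V W psi" and lg: "linear_family D W X chi" and a: "a .: V"
 shows "bilin C D X (%x y. chi y (psi x a))"
proof (rule bilinI)
 show "lin C X (%x. chi y (psi x a))" if "y .: D" for y
 by (rule linc[OF lfD(2)[OF lf a] lfD(1)[OF lg that]])
 show "lin D X (%y. chi y (psi x a))" if "x .: C" for x
 by (rule lfD(2)[OF lg lfD(3)[OF lf that a]])
qed

text \<open>For a fixed general tensor, linearity in \<open>a\<close> is an identity between linear
  functions of the tensor, and is therefore compared on elementary tensors.\<close>

lemma linear_family_comp:
 assumes C: "ccoalg C" and D: "ccoalg D" and V: "vspace V" and X: "vspace X"
 and lf: "linear_family C V W psi" and lg: "linear_family D W X chi"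
 shows "linear_family (tensor_coalg C D) V X (%t a. sweedler X (%x x'. chi x' (psi x a)) t)"
 "x .: C ==> y .: D ==> a .: V ==> sweedler X (%x x'. chi x' (psi x a)) (tens [C,D][x,y]) = chi y (psi x a)"
proof -
 note vC = cc_vs[OF C] and vD = cc_vs[OF D]
 note b = bilin_comp_family[OF vC vD lf lg]
 note S = sweedler_bilin[OF vC vD X b]
 let ?T = "tensor [C,D]" and ?s = "%t a. sweedler X (%x x'. chi x' (psi x a)) t"
 show *: "x .: C ==> y .: D ==> a .: V ==> ?s (tens [C,D][x,y]) a = chi y (psi x a)" for x y a by (rule S(2))
 have k: "lin C ?T (%x. tens [C,D][x,y])" if "y .: D" for y by (rule bilinD(1)[OF tensor2(2)[OF vC vD] that])
 have "lin V X (?s t)" if t: "t .: ?T" for t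
 proof (rule linI)
 note c = linD[OF S(1)]
 show "?s t a .: X" if "a .: V" for a by (rule c(1)[OF that t])
 have l: "lin V X (%a. chi y (psi x a))" if "x .: C" "y .: D" for x y
 by (rule linc[OF lfD(1)[OF lf that(1)] lfD(1)[OF lg that(2)]])
 note T = tensor2(1)[OF vC vD]
 show "?s t (a +[V] b) = ?s t a +[X] ?s t b" if a: "a .: V" and b: "b .: V" for a b
 proof (rule tensor2_eqI[OF vC vD X S(1)[OF vs_closed(2)[OF V a b]] _ t])
 show "lin ?T X (%t. ?s t a +[X] ?s t b)"
 by (rule linI) (insert c[OF a] c[OF b] X, simp_all add: vs_smult vs_add_ac[OF X])
 qed (insert a b V linD(2)[OF l], simp add:*)
 show "?s t (e *.[V] a) = e *.[X] ?s t a" if a: "a .: V" for e a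
 proof (rule tensor2_eqI[OF vC vD X S(1)[OF vs_closed(3)[OF V a]] _ t])
 show "lin ?T X (%t. e *.[X] ?s t a)"
 by (rule linI) (insert c[OF a] X, simp_all add: vs_smult vs_smultC)
 qed (insert a V linD(3)[OF l], simp add:*)
 qed
 then show "linear_family (tensor_coalg C D) V X ?s"
 using S(1) by (simp add:linear_family_def TC_simps[OF C D] lin_TC[OF C D])
qed

lemma tensor_coalg_eqI:
 assumes C: "ccoalg C" and D: "ccoalg D" and "vspace W" "lin (tensor_coalg C D) W f" "lin (tensor_coalg C D) W g"
 "!!x y. x .: C ==> y .: D ==> f (tens [C,D][x,y]) = g (tens [C,D][x,y])" "t .: tensor_coalg C D"
 shows "f t = g t"
 by (rule tensor2_eqI[OF cc_vs[OF C] cc_vs[OF D] assms(3)])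
 (insert assms, simp_all add: TC_simps[OF C D] lin_TC[OF C D])

text \<open>Expanding first along \<open>x\<close> and then along \<open>y\<close> yields the legs
  of both in the interleaved order of the tensor coalgebra. Both laws are linear in the tensor, so
  elementary tensors suffice.\<close>

lemma alg_measuring_comp:
 assumes C: "ccoalg C" and D: "ccoalg D" and R: "walg R" and R': "walg R'" and R'': "walg R''"
 and m: "ameas R R' C psi" and n: "ameas R' R'' D chi"
 shows "ameas R R'' (tensor_coalg C D) (%t a. sweedler R'' (%x x'. chi x' (psi x a)) t)" (is "ameas _ _ ?T ?s")
proof -
 note PC = cc_pre[OF C] and PD = cc_pre[OF D] and PT = precoalg_TC[OF C D]
 note vC = preD(1)[OF PC] and vD = preD(1)[OF PD]
 note mD = ameasD[OF m PC R'] and nD = ameasD[OF n PD R''] and X = walgD(1)[OF R'']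
 note lf = linear_family_comp[OF C D walgD(1)[OF R] X mD(1) nD(1)]
 note k = lfD[OF lf(1)] and b = bilin_family[OF lf(1) walgD(2)[OF R'']]
 have c: "chi y (psi x a) .: R''" if "x .: C" "y .: D" "a .: R" for x y a
 using lfD(3)[OF nD(1)] lfD(3)[OF mD(1)] that by blast
 have "?s t (a **[R] b) = sw ?T R'' (%x1 x2. ?s x1 a **[R''] ?s x2 b) t"
 if t: "t .: ?T" and ab: "a .: R" "b .: R" for t a b
 proof (rule tensor_coalg_eqI[OF C D X k(2)[OF walgD(4)[OF R ab]] lin_sw[OF PT X b[OF ab]] _ t])
 fix x y assume x: "x .: C" and y: "y .: D"
 note c' = lfD(3)[OF mD(1)]
 have "?s (tens [C,D][x,y]) (a **[R] b) = chi y (sw C R' (%x1 x2. psi x1 a **[R'] psi x2 b) x)"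
 using lf(2)[OF x y walgD(4)[OF R ab]] mD(2)[OF x ab] by simp
 also have "... = sw C R'' (%x1 x2. chi y (psi x1 a **[R'] psi x2 b)) x"
 by (rule sw_push[OF PC lfD(1)[OF nD(1) y] walgD(1)[OF R'] X x]) (use ab c' walgD(4)[OF R'] in auto)
 also have "... = sw C R'' (%x1 x2. sw D R'' (%y1 y2. chi y1 (psi x1 a) **[R''] chi y2 (psi x2 b)) y) x"
 by (rule sw_cong[OF PC X x]) (insert ab c' nD(2)[OF y] c walgD(4)[OF R''] y, auto intro!:sw_closed[OF PD X])
 also have "... = sw C R'' (%x1 x2. sw D R'' (%y1 y2. ?s (tens [C,D][x1,y1]) a **[R''] ?s (tens [C,D][x2,y2]) b) y) x"
 by (intro sw_cong[OF PC X x] sw_cong[OF PD X y] sw_closed[OF PD X y] arg_cong2[where f = "%a b. a **[R''] b"])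
 (insert ab c walgD(4)[OF R''], simp_all add: lf(2))
 also have "... = sw ?T R'' (%x1 x2. ?s x1 a **[R''] ?s x2 b) (tens [C,D][x,y])"
 by (rule sw_TC[symmetric, OF C D X _ x y]) (insert b[OF ab], simp add:bilin_TC[OF C D])
 finally show "?s (tens [C,D][x,y]) (a **[R] b) = sw ?T R'' (%x1 x2. ?s x1 a **[R''] ?s x2 b) (tens [C,D][x,y])" .
 qed
 moreover have "?s t 1.[R] = counit ?T t *.[R''] 1.[R'']" if t: "t .: ?T" for t
 proof (rule tensor_coalg_eqI[OF C D X k(2)[OF walgD(3)[OF R]] _ _ t])
 show "lin ?T R'' (%t. counit ?T t *.[R''] 1.[R''])"
 by (rule linI) (insert linD[OF preD(3)[OF PT]] X walgD(3)[OF R''], simp_all add: vs_smult)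
 fix x y assume x: "x .: C" and y: "y .: D"
 have "?s (tens [C,D][x,y]) 1.[R] = chi y (counit C x *.[R'] 1.[R'])"
 using lf(2)[OF x y walgD(3)[OF R]] mD(3)[OF x] by simp
 also have "... = (counit C x * counit D y) *.[R''] 1.[R'']"
 using linD(3)[OF lfD(1)[OF nD(1) y] walgD(3)[OF R']] nD(3)[OF y] X walgD(3)[OF R''] by (simp add:vs_smult(3))
 finally show "?s (tens [C,D][x,y]) 1.[R] = counit ?T (tens [C,D][x,y]) *.[R''] 1.[R'']"
 using counit_TC_tens(2)[OF C D x y] by simp
 qed
 ultimately show ?thesis using lf(1) by (simp add:alg_measuring_iff[OF PT R''])
qed

lemma linear_family_unit: "vspace V ==> linear_family unit_coalg V V (%c a. c *.[V] a)"
 by (auto simp:linear_family_def klinear_def unit_simps vs_smult vs_smultC Pi_def)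

lemma alg_measuring_unit:
 assumes R: "walg R"
 shows "ameas R R unit_coalg (%c a. c *.[R] a)"
proof -
 note v = walgD(1)[OF R] and lf = linear_family_unit[OF walgD(1)[OF R]]
 show ?thesis
 unfolding alg_measuring_iff[OF cc_pre[OF cocomm_unit_coalg] R]
 proof (intro conjI ballI lf)
 fix c a b assume ab: "a .: R" "b .: R"
 show "c *.[R] (a **[R] b) = sw unit_coalg R (%x1 x2. (x1 *.[R] a) **[R] (x2 *.[R] b)) c"
 unfolding sw_unit_coalg[OF v bilin_family[OF lf walgD(2)[OF R] ab]]
 using linD(3)[OF bilinD(1)[OF walgD(2)[OF R] ab(2)] ab(1)] v ab by simp
 qed (simp add:unit_simps(6))
qed

section \<open>The universal measuring of algebras\<close>

text \<open>Common output of the construction for algebras and for Hopf algebroids: \<open>J\<close>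
  is the small test family, \<open>V\<close> the space of parametrised maps, and \<open>inc\<close>
  gives the maps from the members of \<open>J\<close> into \<open>M\<close>.\<close>

definition univ_data :: "('k::field,'q) module=>(('k,nat=>'k) coalg \<times> ((nat=>'k)=>'q)) set=>('k,'m) coalg=>('m=>'q) =>
 (('k,nat=>'k) coalg \<times> ((nat=>'k)=>'q)=>(nat=>'k)=>'m)=>bool" where
 "univ_data V J M phi inc <-> vspace V & ccoalg M & lin M V phi & separated M {m:car M. phi m = 0.[V]} &
 (ALL E psi. (E,psi):J --> chom E M (inc (E,psi)) & (ALL x:car E. phi (inc (E,psi) x) = psi x)) &
 spans M (UN j:J. inc j ` car (fst j))"

lemma univ_data_ex:
 fixes V :: "('k::field,'q) module" and J :: "(('k,nat=>'k) coalg \<times> ((nat=>'k)=>'q)) set"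
 assumes V: "vspace V" and J: "!!E psi. (E,psi):J ==> ccoalg E & lin E V psi"
 shows "EX (M :: ('k,('k,'q) meas_univ) coalg) phi inc. univ_data V J M phi inc"
 using universal_coalgebra[where J = J, OF V J] V by (simp add:univ_data_def)

lemma univ_data_map:
 assumes "univ_data V J M phi inc" "ccoalg C"
 "!!E j. ccoalg E ==> chom E C j ==> (E,%e. psi (j e)):J"
 shows "EX f. chom C M f & (ALL x:car C. phi (f x) = psi x)"
 using assms unfolding univ_data_def by (intro universal_map[where inc = inc and J = J and V = V]) auto

text \<open>Here \<open>M\<close> is the object picked by \<open>SOME\<close>. Its finality on the
  universe type provides \<open>f0\<close> and \<open>uniq\<close>, gluing provides a map back to
  \<open>M0\<close>, and the composite on \<open>M\<close> is the identity; hence \<open>M\<close>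
  is a retract of a separated object.\<close>

lemma univ_data_chosen:
 fixes M0 :: "('k::field,'m) coalg" and M :: "('k,'m) coalg"
 assumes U: "univ_data V J M0 phi0 inc" and M: "ccoalg M" and p: "lin M V phi"
 and pull: "!!E j. ccoalg E ==> chom E M j ==> (E,%e. phi (j e)):J"
 and f0: "EX f0. chom M0 M f0 & (ALL x:car M0. phi (f0 x) = phi0 x)"
 and uniq: "!!u. chom M M u ==> (!!x. x .: M ==> phi (u x) = phi x) ==> (ALL x:car M. u x = x)"
 shows "separated M {m:car M. phi m = 0.[V]}"
proof -
 note P = cc_pre[OF M]
 have V: "vspace V" "separated M0 {m:car M0. phi0 m = 0.[V]}" using U by (auto simp:univ_data_def)
 obtain f0 where f: "chom M0 M f0" "!!x. x .: M0 ==> phi (f0 x) = phi0 x" using f0 by blast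
 obtain g0 where g: "chom M M0 g0" "!!x. x .: M ==> phi0 (g0 x) = phi x"
 using univ_data_map[OF U M, of phi] pull by blast
 show ?thesis by (rule separated_transfer[OF V P p f g uniq])
qed

text \<open>The small test family: measurings by coalgebras whose elements are functions on
  \<open>nat\<close>, with extensional values so that they lie in \<open>lin_space\<close>.\<close>

definition alg_fam :: "('k::field,'r) module=>('k,'s) module=>(('k,nat=>'k) coalg \<times> ((nat=>'k)=>'r=>'s)) set" where
 "alg_fam R R' = {(E,psi). ccoalg E & lin E (lin_space R R') psi & ameas R R' E psi}"

lemma lin_lin_space_restrict:
 assumes "lin C (lin_space V W) psi" "x .: C"
 shows "restrict (psi x) (car V) = psi x"
 using linD(1)[OF assms] by (simp add:lin_space_simps extensional_restrict)

lemma alg_fam_pull: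
 assumes R: "walg R" and R': "walg R'" and C: "ccoalg C" and m: "ameas R R' C psi" and E: "ccoalg E" and j: "chom E C j"
 shows "(E,%e. restrict (psi (j e)) (car R)):alg_fam R R'"
proof -
 note PC = cc_pre[OF C] and PE = cc_pre[OF E]
 note m' = alg_measuring_pull[OF PC PE R' m j]
 have "lin E (lin_space R R') (%e. restrict (psi (j e)) (car R))"
 using linear_family_lin_space[OF preD(1)[OF PE] walgD(1)[OF R] walgD(1)[OF R'], of "%e. psi (j e)"] ameasD(1)[OF m' PE R'] by simp
 then show ?thesis using E alg_measuring_cong[OF PE R R' m'] by (auto simp:alg_fam_def)
qed

lemma univ_data_measuring:
 assumes R: "walg R" and R': "walg R'" and U: "univ_data (lin_space R R') (alg_fam R R') M phi inc"
 shows "ameas R R' M phi"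
proof -
 have M: "ccoalg M" and k: "lin M (lin_space R R') phi" and sp: "spans M (UN j:alg_fam R R'. inc j ` car (fst j))"
 and inc: "!!j. j:alg_fam R R' ==> chom (fst j) M (inc j)" "!!j x. j:alg_fam R R' ==> x .: fst j ==> phi (inc j x) = snd j x"
 using U by (auto simp:univ_data_def)
 note P = cc_pre[OF M]
 have PE: "precoalg (fst j)" if "j:alg_fam R R'" for j
 by (rule coalg_pre[OF cc_coalg]) (insert that, auto simp:alg_fam_def)
 have "lin M (lin_space R R') (%x. restrict (phi x) (car R))"
 using lin_cong[OF preD(1)[OF P], of "%x. restrict (phi x) (car R)" phi "lin_space R R'"] lin_lin_space_restrict[OF k] k by simp
 then have lf: "linear_family M R R' phi"
 using linear_family_lin_space[OF preD(1)[OF P] walgD(1)[OF R] walgD(1)[OF R']] by blast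
 have m: "ameas R R' (fst j) (%x. phi (inc j x))" if j: "j:alg_fam R R'" for j
 by (rule alg_measuring_cong[OF PE[OF j] R R', of "snd j"]) (insert j inc(2)[OF j], auto simp:alg_fam_def)
 show ?thesis by (rule alg_measuring_cover[OF P R R' lf sp PE inc(1) m])
qed

definition alg_univ :: "('k::field,'r) module=>('k,'s) module=>('k,'m) coalg=>('m=>'r=>'s)=>bool" where
 "alg_univ R R' M phi <-> ccoalg M & ameas R R' M phi &
 separated M {m:car M. restrict (phi m) (car R) = 0.[lin_space R R']}"

lemma restrict_eq_iff: "restrict f A = restrict g A <-> (ALL a:A. f a = g a)"
 by (auto simp:restrict_def fun_eq_iff)

lemma univ_alg_map:
 assumes R: "walg R" and R': "walg R'" and U: "univ_data (lin_space R R') (alg_fam R R') M phi inc"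
 and C: "ccoalg C" and m: "ameas R R' C psi"
 shows "EX f. chom C M f & (ALL x:car C. phi (f x) = restrict (psi x) (car R))"
 by (rule univ_data_map[OF U C]) (rule alg_fam_pull[OF R R' C m])

lemma lin_restricted:
 assumes "precoalg C" "walg R" "walg R'" "ameas R R' C psi"
 shows "lin C (lin_space R R') (%x. restrict (psi x) (car R))"
 using linear_family_lin_space[OF preD(1)[OF assms(1)] walgD(1)[OF assms(2)] walgD(1)[OF assms(3)]] ameasD(1)[OF assms(4,1,3)] by blast

lemma alg_univ_final:
 fixes C :: "('k::field,'c) coalg"
 assumes R: "walg R" and R': "walg R'" and M: "alg_univ R R' M phi" and C: "precoalg C"
 and ex: "EX f. chom C M f & (ALL x:car C. ALL a:car R. phi (f x) a = psi x a)"
 shows "EX! f. f:extensional (car C) & chom C M f & (ALL x:car C. ALL a:car R. phi (f x) a = psi x a)"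
 using separated_ex1[OF vspace_lin_space[OF walgD(1)[OF R] walgD(1)[OF R']], of M "%m. restrict (phi m) (car R)" C "%x. restrict (psi x) (car R)"]
 M C ex lin_restricted[OF _ R R', of M phi]
 by (auto simp:alg_univ_def restrict_eq_iff separated_def)

lemma univ_data_alg_univ:
 assumes R: "walg R" and R': "walg R'" and U: "univ_data (lin_space R R') (alg_fam R R') M phi inc"
 shows "alg_univ R R' M phi"
proof -
 have k: "lin M (lin_space R R') phi" and s: "ccoalg M" "separated M {m:car M. phi m = 0.[lin_space R R']}"
 using U by (auto simp:univ_data_def)
 have "{m:car M. phi m = 0.[lin_space R R']} = {m:car M. restrict (phi m) (car R) = 0.[lin_space R R']}"
 by (intro Collect_cong conj_cong refl) (simp add:lin_lin_space_restrict[OF k])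
 then show ?thesis using s univ_data_measuring[OF R R' U] by (simp add:alg_univ_def)
qed

text \<open>The constructed object shows that the description under \<open>SOME\<close> is
  satisfiable, and so the chosen pair has the finality promised by it.\<close>

lemma Mc_is_final:
 assumes R: "walg (R :: ('k,'r) module)" and R': "walg (R' :: ('k::field,'s) module)"
 shows "final_alg_measuring TYPE(('k,'r=>'s) meas_univ) R R' (Mc R R') (phi_c R R')"
proof -
 let ?P = "%(M,phi). final_alg_measuring TYPE(('k,'r=>'s) meas_univ) R R' M phi"
 obtain M :: "('k,('k,'r=>'s) meas_univ) coalg" and phi inc where U: "univ_data (lin_space R R') (alg_fam R R') M phi inc"
 using univ_data_ex[OF vspace_lin_space[OF walgD(1)[OF R] walgD(1)[OF R']], of "alg_fam R R'"] by (auto simp:alg_fam_def)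
 note au = univ_data_alg_univ[OF R R' U]
 have "?P (M,phi)"
 unfolding final_alg_measuring_def prod.case
 proof (intro conjI allI impI)
 show "ccoalg M" "ameas R R' M phi" using au by (auto simp:alg_univ_def)
 fix C :: "('k,('k,'r=>'s) meas_univ) coalg" and psi assume C: "ccoalg C & ameas R R' C psi"
 then have "EX f. chom C M f & (ALL x:car C. phi (f x) = restrict (psi x) (car R))" using univ_alg_map[OF R R' U] by blast
 then show "EX! f. f:extensional (car C) & chom C M f & (ALL x:car C. ALL a:car R. phi (f x) a = psi x a)"
 by (intro alg_univ_final[OF R R' au coalg_pre[OF cc_coalg]] conjunct1[OF C]) auto
 qed
 then have "?P (Mc_phi R R')" unfolding Mc_phi_def by (rule someI[of ?P])
 then show ?thesis by (simp add:Mc_def phi_c_def split_beta)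
qed

lemma final_algD:
 assumes "final_alg_measuring TYPE('c) R R' M phi" "ccoalg C" "ameas R R' (C :: ('k::field,'c) coalg) psi"
 shows "EX! f. f:extensional (car C) & chom C M f & (ALL x:car C. ALL a:car R. phi (f x) a = psi x a)"
 using assms by (simp add:final_alg_measuring_def)

lemma ex1_same: "EX! f. P f ==> P f ==> P g ==> f = g"
 by blast

lemma coalg_hom_id: "precoalg C ==> chom C C (%x. x)"
 by (rule coalg_homI) (auto simp:lin_id comult_sw preD(1))

text \<open>Finality is applied to the chosen object itself: an endomorphism compatible with the
  measuring must be the identity, which is the uniqueness asked for by
  \<open>univ_data_chosen\<close>.\<close>

lemma Mc_alg_univ:
 assumes R: "walg (R :: ('k,'r) module)" and R': "walg (R' :: ('k::field,'s) module)"
 shows "alg_univ R R' (Mc R R') (phi_c R R')"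
proof -
 let ?M = "Mc R R'" and ?p = "%x. restrict (phi_c R R' x) (car R)"
 note fin = Mc_is_final[OF R R']
 have M: "ccoalg ?M" "ameas R R' ?M (phi_c R R')" using fin by (auto simp:final_alg_measuring_def)
 note P = cc_pre[OF M(1)]
 obtain M0 :: "('k,('k,'r=>'s) meas_univ) coalg" and phi0 inc where U: "univ_data (lin_space R R') (alg_fam R R') M0 phi0 inc"
 using univ_data_ex[OF vspace_lin_space[OF walgD(1)[OF R] walgD(1)[OF R']], of "alg_fam R R'"] by (auto simp:alg_fam_def)
 have M0: "ccoalg M0" "ameas R R' M0 phi0" "lin M0 (lin_space R R') phi0"
 using univ_data_alg_univ[OF R R' U] U by (auto simp:alg_univ_def univ_data_def)
 have "separated ?M {m:car ?M. ?p m = 0.[lin_space R R']}"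
 proof (rule univ_data_chosen[OF U M(1) lin_restricted[OF P R R' M(2)]])
 show "(E,%e. ?p (j e)):alg_fam R R'" if "ccoalg E" "chom E ?M j" for E j
 by (rule alg_fam_pull[OF R R' M that])
 obtain f where f: "chom M0 ?M f" "!!x a. x .: M0 ==> a .: R ==> phi_c R R' (f x) a = phi0 x a"
 using ex1_implies_ex[OF final_algD[OF fin M0(1,2)]] by blast
 then have "?p (f x) = phi0 x" if "x .: M0" for x
 using lin_lin_space_restrict[OF M0(3) that] restrict_eq_iff[of "phi_c R R' (f x)" "car R" "phi0 x"] that by simp
 then show "EX f0. chom M0 ?M f0 & (ALL x:car M0. ?p (f0 x) = phi0 x)" using f(1) by blast
 fix u assume u: "chom ?M ?M u" "!!x. x .: ?M ==> ?p (u x) = ?p x"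
 have ex1: "EX! f. f:extensional (car ?M) & chom ?M ?M f & (ALL x:car ?M. ALL a:car R. phi_c R R' (f x) a = phi_c R R' x a)"
 by (rule final_algD[OF fin M])
 have "restrict u (car ?M) = restrict (%x. x) (car ?M)"
 by (rule ex1_same[OF ex1])
 (insert u coalg_hom_cong[OF P P u(1)] coalg_hom_cong[OF P P coalg_hom_id[OF P]], auto simp:restrict_eq_iff)
 then show "ALL x:car ?M. u x = x" by (simp add:restrict_eq_iff)
 qed
 then show ?thesis using M by (simp add:alg_univ_def)
qed

text \<open>For a test coalgebra of any type, a map is obtained by gluing into the constructed
  object and continuing to the chosen one; uniqueness comes from separatedness of the
  latter.\<close>

lemma Mc_final:
 assumes R: "walg (R :: ('k,'r) module)" and R': "walg (R' :: ('k::field,'s) module)"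
 shows "final_alg_measuring TYPE('c) R R' (Mc R R') (phi_c R R')"
 unfolding final_alg_measuring_def
proof (intro conjI allI impI)
 let ?M = "Mc R R'"
 note fin = Mc_is_final[OF R R'] and au = Mc_alg_univ[OF R R']
 have M: "ccoalg ?M" using fin by (auto simp:final_alg_measuring_def)
 then show "ccoalg ?M" "ameas R R' ?M (phi_c R R')" using fin by (auto simp:final_alg_measuring_def)
 fix C :: "('k,'c) coalg" and psi assume C: "ccoalg C & ameas R R' C psi"
 obtain M0 :: "('k,('k,'r=>'s) meas_univ) coalg" and phi0 inc where U: "univ_data (lin_space R R') (alg_fam R R') M0 phi0 inc"
 using univ_data_ex[OF vspace_lin_space[OF walgD(1)[OF R] walgD(1)[OF R']], of "alg_fam R R'"] by (auto simp:alg_fam_def)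
 have M0: "ccoalg M0" "ameas R R' M0 phi0" "lin M0 (lin_space R R') phi0"
 using univ_data_alg_univ[OF R R' U] U by (auto simp:alg_univ_def univ_data_def)
 obtain f where f: "chom M0 ?M f" "!!x a. x .: M0 ==> a .: R ==> phi_c R R' (f x) a = phi0 x a"
 using ex1_implies_ex[OF final_algD[OF fin M0(1,2)]] by blast
 obtain g where g: "chom C M0 g" "!!x. x .: C ==> phi0 (g x) = restrict (psi x) (car R)"
 using univ_alg_map[OF R R' U conjunct1[OF C] conjunct2[OF C]] by blast
 note PC = cc_pre[OF conjunct1[OF C]]
 have gc: "x .: C ==> g x .: M0" for x by (rule coalg_homD(2)[OF g(1)])
 show "EX! f. f:extensional (car C) & chom C ?M f & (ALL x:car C. ALL a:car R. phi_c R R' (f x) a = psi x a)"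
 by (rule alg_univ_final[OF R R' au PC],
 rule exI[of _ "%x. f (g x)"], intro conjI coalg_hom_comp[OF PC cc_pre[OF M0(1)] cc_pre[OF M] g(1) f(1)])
 (simp add:f(2) g(2) gc)
qed

lemma Mc_induced:
 assumes R: "walg R" and R': "walg R'" and C: "ccoalg C" and m: "ameas R R' C psi"
 shows "chom C (Mc R R') (Mc_induced R R' C psi)"
 "x .: C ==> a .: R ==> phi_c R R' (Mc_induced R R' C psi x) a = psi x a"
proof -
 have "EX! f. f:extensional (car C) & chom C (Mc R R') f & (ALL x:car C. ALL a:car R. phi_c R R' (f x) a = psi x a)"
 by (rule final_algD[OF Mc_final[OF R R'] C m])
 from theI'[OF this, folded Mc_induced_def]
 show "chom C (Mc R R') (Mc_induced R R' C psi)"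
 "x .: C ==> a .: R ==> phi_c R R' (Mc_induced R R' C psi x) a = psi x a" by auto
qed

section \<open>Measurings of Hopf algebroids\<close>

definition hopf_ok :: "('k::field,'u,'a) halg=>bool" where
 "hopf_ok H <-> walg (total H) & walg (base H) & lin (base H) (total H) (src H) & lin (base H) (total H) (tgt H) &
 lin (total H) (tensorL H 2) (cop H) & lin (total H) (base H) (coun H) & lin (total H) (total H) (antip H)"

lemma k_algebra_walg:
 assumes "k_algebra R"
 shows "walg R"
proof -
 have R: "vspace R" "ring R" using assms by (auto simp:k_algebra_def)
 interpret ring R by (rule R(2))
 have "bilin R R R (%a b. a **[R] b)"
 by (intro bilinI linI) (insert assms, auto simp:k_algebra_def l_distr r_distr)
 then show ?thesis using R(1) by (simp add:walg_def)
qed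

lemma hopf_algebroid_ok:
 assumes "is_hopf_algebroid H"
 shows "hopf_ok H"
proof -
 have *: "lin (op_alg R) W f = lin R W f" "lin W (op_alg R) g = lin W R g" for R :: "('x::field,'y) module" and W :: "('x,'z) module" and f g
 by (simp_all add: klinear_def op_alg_def)
 show ?thesis
 using assms by (auto simp:is_hopf_algebroid_def left_bialgebroid_def Let_def hopf_ok_def alg_hom_def * intro: k_algebra_walg)
qed

lemma lin_ev_param:
 assumes "vspace C" "vspace W" "!!y. y:keys q ==> lin C W (%x. g x y)"
 shows "lin C W (%x. ev W (g x) q)"
proof (rule linI)
 note D = linD[OF assms(3)]
 show "ev W (g x) q .: W" if "x .: C" for x using D(1) that assms(2) by auto
 show "ev W (g (x +[C] y)) q = ev W (g x) q +[W] ev W (g y) q" if "x .: C" "y .: C" for x y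
 using D that assms(2) by (subst ev_fun_add[symmetric]) (auto intro!:ev_cong)
 show "ev W (g (c *.[C] x)) q = c *.[W] ev W (g x) q" if "x .: C" for x c
 using D that assms(2) by (subst ev_fun_smult[symmetric]) (auto intro!:ev_cong)
qed

context
 fixes H :: "('k::field,'u,'a) halg"
 assumes H: "hopf_ok H"
begin

lemma hopf_okD:
 "walg (total H)" "walg (base H)" "lin (base H) (total H) (src H)" "lin (base H) (total H) (tgt H)"
 "lin (total H) (tensorL H 2) (cop H)" "lin (total H) (base H) (coun H)" "lin (total H) (total H) (antip H)"
 "vspace (total H)" "vspace (base H)"
 using H by (auto simp:hopf_ok_def walg_def)

private abbreviation (input) "U == total H"
private abbreviation (input) "A == base H"
private abbreviation (input) "ract == %u a. tgt H a **[total H] u"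
private abbreviation (input) "lact == %a u. src H a **[total H] u"

lemma tensorL_2: "replicate 2 U = [U,U]" "tensorL_rels H 2 = multilin_rels (%us. us) [U,U] \<union> balanced_rels (%us. us) (car A) ract lact [U,U]"
 by (simp_all add: tensorL_rels_def numeral_2_eq_2)

lemma tens_pair_gens: "xs @ [x,y] @ ys:tgens [U,U] <-> xs = [] & ys = [] & x .: U & y .: U"
 by (auto simp:tgens_2 append_eq_Cons_conv)

lemma tensorL_closed:
 assumes "a .: A" "xs @ [x,y] @ ys:tgens [U,U]"
 shows "xs @ [ract x a,y] @ ys:tgens [U,U] & xs @ [x,lact a y] @ ys:tgens [U,U]"
 using assms walgD(4)[OF hopf_okD(1)] lin1[OF hopf_okD(3)] lin1[OF hopf_okD(4)] unfolding tens_pair_gens by auto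

lemma tensorL_rels_free: "tensorL_rels H 2 <= car (free_space (tgens [U,U]))"
 unfolding tensorL_2 Un_subset_iff
 by (intro conjI multilin_rels_free balanced_rels_free tensorL_closed) (auto simp:hopf_okD(8))

lemma tensorL_pres: "tensorL H 2 = pres (tgens [U,U]) (tensorL_rels H 2)" "tensL H [u,v] = pgen (tgens [U,U]) (tensorL_rels H 2) [u,v]"
 using tensorL_2(1) by (simp_all add: tensorL_def tensL_def flip: numeral_2_eq_2)

lemma vspace_tensorL: "vspace (tensorL H 2)"
 unfolding tensorL_pres by (rule vspace_pres[OF tensorL_rels_free])

lemma ev_tensorL_rels:
 assumes W: "vspace W" and g: "!!u v. u .: U ==> v .: U ==> g [u,v] .: W"
 shows "(ALL r:tensorL_rels H 2. ev W g r = 0.[W]) <-> mlin [U,U] W g &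
 (ALL a:car A. ALL u:car U. ALL v:car U. g [ract u a,v] = g [u,lact a v])"
proof -
 have g': "!!xs. xs:tgens [U,U] ==> g xs .: W" using g by (auto simp:tgens_2)
 have "(ALL r:multilin_rels (%us. us) [U,U]. ev W g r = 0.[W]) <-> mlin [U,U] W g"
 using ev_multilin_rels[where g = g and io = "%xs. xs" and Ms = "[U,U]", OF W _ g'] hopf_okD(8) by auto
 moreover have "(ALL r:balanced_rels (%us. us) (car A) ract lact [U,U]. ev W g r = 0.[W]) <-> balanced (car A) ract lact [U,U] g"
 using ev_balanced_rels[where g = g and io = "%xs. xs" and Ms = "[U,U]" and A = "car A" and ract = ract and lact = lact, OF W] tensorL_closed g' by blast
 moreover have "balanced (car A) ract lact [U,U] g <-> (ALL a:car A. ALL u:car U. ALL v:car U. g [ract u a,v] = g [u,lact a v])"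
 unfolding balanced_def tens_pair_gens by auto
 ultimately show ?thesis unfolding tensorL_2 ball_Un by simp
qed

lemma tensL:
 "u .: U ==> v .: U ==> tensL H [u,v] .: tensorL H 2"
 "bilin U U (tensorL H 2) (%u v. tensL H [u,v])"
 "a .: A ==> u .: U ==> v .: U ==> tensL H [ract u a,v] = tensL H [u,lact a v]"
proof -
 let ?g = "pgen (tgens [U,U]) (tensorL_rels H 2)"
 have c: "u .: U ==> v .: U ==> ?g [u,v] .: tensorL H 2" for u v
 unfolding tensorL_pres by (rule pgen_closed[OF tensorL_rels_free]) (simp add:tgens_2)
 then show "u .: U ==> v .: U ==> tensL H [u,v] .: tensorL H 2" by (simp add:tensorL_pres(2))
 have "ALL r:tensorL_rels H 2. ev (tensorL H 2) ?g r = 0.[tensorL H 2]" unfolding tensorL_pres using pgen_rel[OF tensorL_rels_free] by blast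
 then have *: "mlin [U,U] (tensorL H 2) ?g" "ALL a:car A. ALL u:car U. ALL v:car U. ?g [ract u a,v] = ?g [u,lact a v]"
 using ev_tensorL_rels[where g = ?g, OF vspace_tensorL c] by auto
 show "bilin U U (tensorL H 2) (%u v. tensL H [u,v])" unfolding tensorL_pres(2) by (rule bilin_mlin[OF hopf_okD(8,8) *(1) c])
 show "a .: A ==> u .: U ==> v .: U ==> tensL H [ract u a,v] = tensL H [u,lact a v]"
 using *(2) by (simp add:tensorL_pres(2))
qed

lemma tensorL_ext:
 assumes W: "vspace W" and f: "bilin U U W f"
 and b: "!!a u v. a .: A ==> u .: U ==> v .: U ==> f (ract u a) v = f u (lact a v)"
 shows "lin (tensorL H 2) W (sweedler W f)" "u .: U ==> v .: U ==> sweedler W f (tensL H [u,v]) = f u v"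
 "w .: tensorL H 2 ==> p:w ==> ev W (%us. f (us ! 0) (us ! 1)) p = sweedler W f w"
proof -
 let ?g = "%us. f (us ! 0) (us ! 1)"
 have "ALL r:tensorL_rels H 2. ev W ?g r = 0.[W]"
 by (subst ev_tensorL_rels[OF W]) (use bilinD(3)[OF f] mlin_bilin[OF f] b in auto)
 then have r: "!!r. r:tensorL_rels H 2 ==> ev W ?g r = 0.[W]" by blast
 have g: "us:tgens [U,U] ==> ?g us .: W" for us using bilinD(3)[OF f] by (auto simp:tgens_2)
 note E = lin_ext_klinear[OF tensorL_rels_free W g r]
 show k: "lin (tensorL H 2) W (sweedler W f)" unfolding tensorL_pres by (rule E(1))
 show "u .: U ==> v .: U ==> sweedler W f (tensL H [u,v]) = f u v" unfolding tensorL_pres by (subst E(2)) (simp_all add: tgens_2)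
 show "w .: tensorL H 2 ==> p:w ==> ev W ?g p = sweedler W f w"
 using lin_ext_eq(2)[OF tensorL_rels_free W k[unfolded tensorL_pres], of ?g w p] E(2) by (simp add:tensorL_pres)
qed

lemma tensorL_eqI:
 assumes "vspace W" "lin (tensorL H 2) W f" "lin (tensorL H 2) W g" "w .: tensorL H 2"
 "!!u v. u .: U ==> v .: U ==> f (tensL H [u,v]) = g (tensL H [u,v])"
 shows "f w = g w"
 by (rule lin_eqI[OF tensorL_rels_free assms(1-3)[unfolded tensorL_pres] _ assms(4)[unfolded tensorL_pres]])
 (insert assms(5), auto simp:tgens_2 tensorL_pres(2))

lemma tensorL_rep:
 assumes "w .: tensorL H 2"
 shows "w ~= {}" "p:w ==> us:keys p ==> us ! 0 .: U & us ! 1 .: U"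
proof -
 have w: "w .: (pres (tgens [U,U]) (tensorL_rels H 2))" using assms by (simp add:tensorL_pres)
 obtain p' where "p':w" by (rule pres_rep[OF tensorL_rels_free w])
 then show "w ~= {}" by auto
 assume "p:w" "us:keys p"
 then have "us:tgens [U,U]" using pres_mem(1)[OF tensorL_rels_free w] by blast
 then show "us ! 0 .: U & us ! 1 .: U" by (auto simp:tgens_2)
qed

end

text \<open>Everything in \<open>hopf_measuring\<close> except compatibility with coproducts. It is
  separated off because the right-hand side of that last condition is shown to be well defined by
  means of the compatibility with source and target maps.\<close>

definition hopf_compat :: "('k::field,'u,'a) halg=>('k,'v,'b) halg=>('k,'c) coalg =>
 ('c=>'u=>'v)=>('c=>'a=>'b)=>bool" where
 "hopf_compat H H' C Psi psi <-> ameas (total H) (total H') C Psi & ameas (base H) (base H') C psi &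
 (ALL x:car C.
 (ALL a:car (base H). Psi x (src H a) = src H' (psi x a) & Psi x (tgt H a) = tgt H' (psi x a)) &
 (ALL u:car (total H). Psi x (antip H u) = antip H' (Psi x u) & psi x (coun H u) = coun H' (Psi x u)))"

text \<open>The map \<open>u \<otimes> v \<mapsto> x\<^sub>(\<^sub>1\<^sub>)(u) \<otimes> x\<^sub>(\<^sub>2\<^sub>)(v)\<close>; it is balanced only after summation, by cocommutativity.\<close>

abbreviation tens_meas :: "('k::field,'v,'b) halg=>('k,'c) coalg=>('c=>'u=>'v)=>'c=>'u=>'u=>('v list \<Rightarrow>\<^sub>0 'k) set" where
 "tens_meas H' C Psi x u v == sw C (tensorL H' 2) (%x1 x2. tensL H' [Psi x1 u,Psi x2 v]) x"

context
 fixes H :: "('k::field,'u,'a) halg" and H' :: "('k,'v,'b) halg" and C :: "('k,'c) coalg" and Psi psi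
 assumes H: "hopf_ok H" and H': "hopf_ok H'" and C: "ccoalg C" and m: "hopf_compat H H' C Psi psi"
begin

private abbreviation (input) "W' == tensorL H' 2"
private lemmas P = cc_pre[OF C]
private lemmas vC = preD(1)[OF P]
private lemmas TW = vspace_tensorL[OF H'] and TL = tensL[OF H']

lemma compatD:
 "ameas (total H) (total H') C Psi" "ameas (base H) (base H') C psi"
 "linear_family C (total H) (total H') Psi" "linear_family C (base H) (base H') psi"
 "x .: C ==> a .: base H ==> Psi x (src H a) = src H' (psi x a)"
 "x .: C ==> a .: base H ==> Psi x (tgt H a) = tgt H' (psi x a)"
 "x .: C ==> u .: total H ==> Psi x (antip H u) = antip H' (Psi x u)"
 "x .: C ==> u .: total H ==> psi x (coun H u) = coun H' (Psi x u)"
 "x .: C ==> u .: total H ==> Psi x u .: total H'"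
 "x .: C ==> a .: base H ==> psi x a .: base H'"
proof -
 show 1: "ameas (total H) (total H') C Psi" "ameas (base H) (base H') C psi" using m by (auto simp:hopf_compat_def)
 show 2: "linear_family C (total H) (total H') Psi" "linear_family C (base H) (base H') psi" using 1 by (auto simp:alg_measuring_def)
 show "x .: C ==> u .: total H ==> Psi x u .: total H'" "x .: C ==> a .: base H ==> psi x a .: base H'"
 using lfD(3)[OF 2(1)] lfD(3)[OF 2(2)] by auto
qed (insert m, auto simp:hopf_compat_def)

lemma family_act:
 assumes x: "x .: C" and a: "a .: base H" and u: "u .: total H"
 shows "Psi x (tgt H a **[total H] u) = sw C (total H') (%x1 x2. tgt H' (psi x1 a) **[total H'] Psi x2 u) x"
 "Psi x (src H a **[total H] u) = sw C (total H') (%x1 x2. src H' (psi x1 a) **[total H'] Psi x2 u) x"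
proof -
 note h = hopf_okD[OF H] and h' = hopf_okD[OF H']
 note c = walgD(4)[OF h'(1)] compatD(9,10) lin1[OF h'(3)] lin1[OF h'(4)]
 show "Psi x (tgt H a **[total H] u) = sw C (total H') (%x1 x2. tgt H' (psi x1 a) **[total H'] Psi x2 u) x"
 unfolding ameasD(2)[OF compatD(1) P h'(1) x linD(1)[OF h(4) a] u]
 by (rule sw_cong[OF P h'(8) x]) (use a u c compatD(6) in auto)
 show "Psi x (src H a **[total H] u) = sw C (total H') (%x1 x2. src H' (psi x1 a) **[total H'] Psi x2 u) x"
 unfolding ameasD(2)[OF compatD(1) P h'(1) x linD(1)[OF h(3) a] u]
 by (rule sw_cong[OF P h'(8) x]) (use a u c compatD(5) in auto)
qed

lemma bilin_tens_meas:
 assumes x: "x .: C"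
 shows "bilin (total H) (total H) W' (tens_meas H' C Psi x)"
proof (rule bilinI)
 note l = lfD(1)[OF compatD(3)] and h = hopf_okD[OF H]
 show "lin (total H) W' (%u. tens_meas H' C Psi x u v)" if "v .: total H" for v
 by (rule lin_sw_fun[OF P h(8) TW x], rule linc[OF l bilinD(1)[OF TL(2)]]) (use that compatD(9) in auto)
 show "lin (total H) W' (%v. tens_meas H' C Psi x u v)" if "u .: total H" for u
 by (rule lin_sw_fun[OF P h(8) TW x], rule linc[OF l bilinD(2)[OF TL(2)]]) (use that compatD(9) in auto)
qed

text \<open>Written with three legs, the left side is t'(x1 a)(x2 u) \<otimes> x3 v. Cocommutativity
  exchanges the legs acting on \<open>a\<close> and \<open>u\<close>, coassociativity regroups them,
  and the balancing relation of the target moves the base element to the second factor.\<close>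

lemma balanced_tens_meas:
 assumes x: "x .: C" and a: "a .: base H" and u: "u .: total H" and v: "v .: total H"
 shows "tens_meas H' C Psi x (tgt H a **[total H] u) v = tens_meas H' C Psi x u (src H a **[total H] v)"
proof -
 let ?U = "total H'"
 note h = hopf_okD[OF H] and h' = hopf_okD[OF H']
 note c = walgD(4)[OF h'(1)] compatD(9,10) lin1[OF h'(3)] lin1[OF h'(4)]
 note kt = linc[OF lfD(2)[OF compatD(4) a] h'(4)] and ks = linc[OF lfD(2)[OF compatD(4) a] h'(3)]
 note ku = lfD(2)[OF compatD(3)]
 let ?F = "%x1 x2 x3. tensL H' [tgt H' (psi x1 a) **[?U] Psi x2 u,Psi x3 v]"
 let ?G = "%x1 x2 x3. tensL H' [Psi x1 u,src H' (psi x2 a) **[?U] Psi x3 v]"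
 have F: "trilin C C C W' ?F"
 by (intro trilinI linc[OF _ bilinD(1)[OF TL(2)]] linc[OF _ bilinD(2)[OF TL(2)]] ku[OF v] ku[OF u]
 linc[OF kt bilinD(1)[OF walgD(2)[OF h'(1)]]] linc[OF ku[OF u] bl2[OF walgD(2)[OF h'(1)]]])
 (use c a u v in auto)
 have "tens_meas H' C Psi x (tgt H a **[total H] u) v = sw C W' (%x1 x2. sw C W' (%y z. ?F y z x2) x1) x"
 proof (rule sw_cong[OF P TW x])
 fix x1 x2 assume xs: "x1 .: C" "x2 .: C"
 show "tensL H' [Psi x1 (tgt H a **[total H] u),Psi x2 v] = sw C W' (%y z. ?F y z x2) x1"
 unfolding family_act(1)[OF xs(1) a u]
 by (rule sw_push[OF P bilinD(1)[OF TL(2) compatD(9)[OF xs(2) v]] h'(8) TW xs(1)]) (use c a u in auto)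
 show "sw C W' (%y z. ?F y z x2) x1 .: W'" by (rule sw_closed[OF P TW xs(1)]) (use c TL(1) a u v xs in auto)
 qed
 also have "... = sw C W' (%x1 x2. sw C W' (%y z. ?F z y x2) x1) x"
 by (rule sw_cong[OF P TW x], rule sw_cocomm[symmetric, OF C TW trilin_parts(1)[OF F]])
 (insert c TL(1) a u v, auto intro!:sw_closed[OF P TW])
 also have "... = sw C W' (%x1 x2. sw C W' (%y z. ?F y x1 z) x2) x"
 proof -
 have F': "trilin C C C W' (%x1 x2 x3. ?F x2 x1 x3)" using F by (auto simp:trilin_def)
 show ?thesis by (rule sw_coassoc[OF cc_coalg[OF C] TW F' x])
 qed
 also have "... = sw C W' (%x1 x2. sw C W' (%y z. ?G x1 y z) x2) x"
 by (intro sw_cong[OF P TW x] sw_cong[OF P TW] TL(3) sw_closed[OF P TW] TL(1)) (use c a u v in auto)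
 also have "... = tens_meas H' C Psi x u (src H a **[total H] v)"
 proof (rule sw_cong[OF P TW x, symmetric])
 fix x1 x2 assume xs: "x1 .: C" "x2 .: C"
 show "tensL H' [Psi x1 u,Psi x2 (src H a **[total H] v)] = sw C W' (%y z. ?G x1 y z) x2"
 unfolding family_act(2)[OF xs(2) a v]
 by (rule sw_push[OF P bilinD(2)[OF TL(2) compatD(9)[OF xs(1) u]] h'(8) TW xs(2)]) (use c a v in auto)
 show "sw C W' (%y z. ?G x1 y z) x2 .: W'" by (rule sw_closed[OF P TW xs(2)]) (use c TL(1) a u v xs in auto)
 qed
 finally show ?thesis .
qed

lemma tens_meas_ext:
 assumes x: "x .: C"
 shows "lin (tensorL H 2) W' (sweedler W' (tens_meas H' C Psi x))"
 "u .: total H ==> v .: total H ==> sweedler W' (tens_meas H' C Psi x) (tensL H [u,v]) = tens_meas H' C Psi x u v"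
 "w .: tensorL H 2 ==> p:w ==> ev W' (%us. tens_meas H' C Psi x (us ! 0) (us ! 1)) p = sweedler W' (tens_meas H' C Psi x) w"
 by (rule tensorL_ext[OF H TW bilin_tens_meas[OF x] balanced_tens_meas[OF x]]; assumption)+

text \<open>For linearity in \<open>x\<close> one representative of \<open>w\<close> is held fixed,
  and each summand is a Sweedler sum, linear in \<open>x\<close>.\<close>

lemma lin_tens_meas:
 assumes w: "w .: tensorL H 2"
 shows "lin C W' (%x. sweedler W' (tens_meas H' C Psi x) w)"
proof -
 obtain p where p: "p:w" using tensorL_rep(1)[OF H w] by blast
 note k = tensorL_rep(2)[OF H w p]
 have "lin C W' (%x. ev W' (%us. tens_meas H' C Psi x (us ! 0) (us ! 1)) p)"
 by (rule lin_ev_param[OF vC TW], rule lin_sw[OF P TW], rule bilin_family[OF compatD(3) TL(2)]) (use k in auto)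
 then show ?thesis
 using lin_cong[OF vC, of "%x. sweedler W' (tens_meas H' C Psi x) w" "%x. ev W' (%us. tens_meas H' C Psi x (us ! 0) (us ! 1)) p" W']
 tens_meas_ext(3)[OF _ w p] by simp
qed

text \<open>The summations are exchanged so that the one over the coproduct of \<open>x\<close> is
  performed first; its value is balanced, and so the remaining sum no longer depends on the
  representative of \<open>w\<close>.\<close>

lemma sweedler2_tens_meas:
 assumes x: "x .: C" and w: "w .: tensorL H 2"
 shows "sweedler2 W' (%x1 x2 u1 u2. tensL H' [Psi x1 u1,Psi x2 u2]) (comult C x) w = sweedler W' (tens_meas H' C Psi x) w"
proof (rule lin_ext2_const[OF TW tensor2_rep(1)[OF vC vC preD(4)[OF P x]] tensorL_rep(1)[OF H w]])
 fix p q assume p: "p:comult C x" and q: "q:w"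
 note kp = tensor2_rep(2)[OF vC vC preD(4)[OF P x] p] and kq = tensorL_rep(2)[OF H w q]
 show cl: "tensL H' [Psi (xs ! 0) (us ! 0),Psi (xs ! 1) (us ! 1)] .: W'"
 if "xs:keys p" "us:keys q" for xs us
 using kp[OF that(1)] kq[OF that(2)] TL(1) compatD(9) by auto
 have "ev W' (%xs. ev W' (%us. tensL H' [Psi (xs ! 0) (us ! 0),Psi (xs ! 1) (us ! 1)]) q) p
 = ev W' (%us. ev W' (%xs. tensL H' [Psi (xs ! 0) (us ! 0),Psi (xs ! 1) (us ! 1)]) p) q"
 by (rule ev_swap[OF TW cl])
 also have "... = ev W' (%us. tens_meas H' C Psi x (us ! 0) (us ! 1)) q"
 proof (rule ev_cong[OF TW])
 fix us assume "us:keys q"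
 then have u: "us ! 0 .: total H" "us ! 1 .: total H" using kq by auto
 note b = bilin_family[OF compatD(3) TL(2) u]
 show "ev W' (%xs. tensL H' [Psi (xs ! 0) (us ! 0),Psi (xs ! 1) (us ! 1)]) p = tens_meas H' C Psi x (us ! 0) (us ! 1)"
 using sweedler_bilin(3)[OF vC vC TW b preD(4)[OF P x] p] sweedler_sw[OF P TW b x] by simp
 show "tens_meas H' C Psi x (us ! 0) (us ! 1) .: W'" by (rule bilinD(3)[OF bilin_tens_meas[OF x] u])
 qed
 also have "... = sweedler W' (tens_meas H' C Psi x) w" by (rule tens_meas_ext(3)[OF x w q])
 finally show "ev W' (%xs. ev W' (%us. tensL H' [Psi (xs ! 0) (us ! 0),Psi (xs ! 1) (us ! 1)]) q) p = sweedler W' (tens_meas H' C Psi x) w" .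
qed

end

lemma hopf_measuring_iff:
 assumes H: "hopf_ok H" and H': "hopf_ok H'" and C: "ccoalg C"
 shows "hmeas H H' C Psi psi <-> hopf_compat H H' C Psi psi &
 (ALL x:car C. ALL u:car (total H). cop H' (Psi x u) = sweedler (tensorL H' 2) (tens_meas H' C Psi x) (cop H u))"
proof (cases "hopf_compat H H' C Psi psi")
 case True
 then show ?thesis
 using sweedler2_tens_meas[OF H H' C True] lin1[OF hopf_okD(5)[OF H]]
 unfolding hopf_measuring_def hopf_compat_def by auto
qed (auto simp:hopf_measuring_def hopf_compat_def)

lemma tens_meas_eq:
 assumes H: "hopf_ok H" and H': "hopf_ok H'" and C: "ccoalg C" and D: "ccoalg D"
 and m: "hopf_compat H H' C Psi psi" and n: "hopf_compat H H' D Psi' psi'" and x: "x .: C" and y: "y .: D"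
 and eq: "!!u v. u .: total H ==> v .: total H ==> tens_meas H' C Psi x u v = tens_meas H' D Psi' y u v"
 and w: "w .: tensorL H 2"
 shows "sweedler (tensorL H' 2) (tens_meas H' C Psi x) w = sweedler (tensorL H' 2) (tens_meas H' D Psi' y) w"
 by (rule tensorL_eqI[OF H vspace_tensorL[OF H'] tens_meas_ext(1)[OF H H' C m x] tens_meas_ext(1)[OF H H' D n y] w])
 (simp add:tens_meas_ext(2)[OF H H' C m x] tens_meas_ext(2)[OF H H' D n y] eq)

lemma hopf_measuringD:
 assumes H: "hopf_ok H" and H': "hopf_ok H'" and C: "ccoalg C" and m: "hmeas H H' C Psi psi"
 shows "hopf_compat H H' C Psi psi"
 "x .: C ==> u .: total H ==> cop H' (Psi x u) = sweedler (tensorL H' 2) (tens_meas H' C Psi x) (cop H u)"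
 using m[unfolded hopf_measuring_iff[OF H H' C]] by auto

lemma hopf_measuring_pull:
 assumes H: "hopf_ok H" and H': "hopf_ok H'" and C: "ccoalg C" and E: "ccoalg E"
 and m: "hmeas H H' C Psi psi" and j: "chom E C j"
 and eq: "!!e u. e .: E ==> u .: total H ==> Psi' e u = Psi (j e) u" "!!e a. e .: E ==> a .: base H ==> psi' e a = psi (j e) a"
 shows "hmeas H H' E Psi' psi'"
proof -
 note PC = cc_pre[OF C] and PE = cc_pre[OF E]
 note h = hopf_okD[OF H] and h' = hopf_okD[OF H'] and jc = coalg_homD(2)[OF j]
 note cm = hopf_measuringD(1)[OF H H' C m]
 note D = compatD[OF H H' C cm]
 have cE: "hopf_compat H H' E Psi' psi'"
 unfolding hopf_compat_def
 using alg_measuring_cong[OF PE h(1) h'(1) alg_measuring_pull[OF PC PE h'(1) D(1) j] eq(1)]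
 alg_measuring_cong[OF PE h(2) h'(2) alg_measuring_pull[OF PC PE h'(2) D(2) j] eq(2)]
 D(5-8)[OF jc] lin1[OF h(3)] lin1[OF h(4)] lin1[OF h(6)] lin1[OF h(7)] by (simp add:eq)
 note T = vspace_tensorL[OF H'] and TL = tensL[OF H']
 have "cop H' (Psi' e u) = sweedler (tensorL H' 2) (tens_meas H' E Psi' e) (cop H u)" if e: "e .: E" and u: "u .: total H" for e u
 unfolding eq(1)[OF e u] hopf_measuringD(2)[OF H H' C m jc[OF e] u]
 proof (rule tens_meas_eq[OF H H' C E cm cE jc[OF e] e _ linD(1)[OF h(5) u]])
 fix u v assume uv: "u .: total H" "v .: total H"
 show "tens_meas H' C Psi (j e) u v = tens_meas H' E Psi' e u v"
 unfolding sw_hom[OF PE PC j T bilin_family[OF D(3) TL(2) uv] e]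
 by (rule sw_cong[OF PE T e]) (use uv eq(1) TL(1) compatD(9)[OF H H' E cE] in simp_all)
 qed
 then show ?thesis using cE by (simp add:hopf_measuring_iff[OF H H' E])
qed

text \<open>Compatibility with coproducts is linear in the coalgebra element by
  \<open>lin_tens_meas\<close>, as are the other laws, so all of them extend from a spanning family
  of images.\<close>

lemma hopf_measuring_cover:
 assumes H: "hopf_ok H" and H': "hopf_ok H'" and M: "ccoalg M"
 and lf: "linear_family M (total H) (total H') Phi" "linear_family M (base H) (base H') phi"
 and sp: "spans M (UN j:J. f j ` car (Cj j))" and C: "!!j. j:J ==> ccoalg (Cj j)" and f: "!!j. j:J ==> chom (Cj j) M (f j)"
 and m: "!!j. j:J ==> hmeas H H' (Cj j) (%x. Phi (f j x)) (%x. phi (f j x))"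
 shows "hmeas H H' M Phi phi"
proof -
 note P = cc_pre[OF M]
 note PC = cc_pre[OF C]
 note h = hopf_okD[OF H] and h' = hopf_okD[OF H'] and v = preD(1)[OF P]
 note cm = hopf_measuringD(1)[OF H H' C m]
 note D = compatD[OF H H' C cm]
 have fc: "(UN j:J. f j ` car (Cj j)) <= car M" using coalg_homD(2)[OF f] by auto
 have eqI: "F x = G x" if "vspace W" "lin M W F" "lin M W G" "!!j y. j:J ==> y .: Cj j ==> F (f j y) = G (f j y)" "x .: M"
 for F G x and W :: "('a,'w,'z) msch"
 by (rule spans_eqI[OF sp v that(1-3) fc _ that(5)]) (use that(4) in auto)
 note k = lfD(2)[OF lf(1)] lfD(2)[OF lf(2)]
 note c = linD(1)[OF h(3)] lin1[OF h(4)] lin1[OF h(6)] lin1[OF h(7)]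
 have cM: "hopf_compat H H' M Phi phi"
 unfolding hopf_compat_def
 proof (intro conjI ballI)
 show "ameas (total H) (total H') M Phi" by (rule alg_measuring_cover[OF P h(1) h'(1) lf(1) sp PC f D(1)])
 show "ameas (base H) (base H') M phi" by (rule alg_measuring_cover[OF P h(2) h'(2) lf(2) sp PC f D(2)])
 fix x assume x: "x .: M"
 show "Phi x (src H a) = src H' (phi x a)" "Phi x (tgt H a) = tgt H' (phi x a)" if a: "a .: base H" for a
 using a D(5,6) by (auto intro!:eqI[OF h'(8) k(1)[OF c(1)] linc[OF k(2) h'(3)] _ x] eqI[OF h'(8) k(1)[OF c(2)] linc[OF k(2) h'(4)] _ x])
 show "Phi x (antip H u) = antip H' (Phi x u)" "phi x (coun H u) = coun H' (Phi x u)" if u: "u .: total H" for u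
 using u D(7,8) by (auto intro!:eqI[OF h'(8) k(1)[OF c(4)] linc[OF k(1) h'(7)] _ x] eqI[OF h'(9) k(2)[OF c(3)] linc[OF k(1) h'(6)] _ x])
 qed
 note T = vspace_tensorL[OF H'] and TL = tensL[OF H']
 have "cop H' (Phi x u) = sweedler (tensorL H' 2) (tens_meas H' M Phi x) (cop H u)" if x: "x .: M" and u: "u .: total H" for x u
 proof (rule eqI[OF T linc[OF k(1)[OF u] h'(5)] lin_tens_meas[OF H H' M cM linD(1)[OF h(5) u]] _ x])
 fix j y assume j: "j:J" and y: "y .: Cj j"
 show "cop H' (Phi (f j y) u) = sweedler (tensorL H' 2) (tens_meas H' M Phi (f j y)) (cop H u)"
 unfolding hopf_measuringD(2)[OF H H' C[OF j] m[OF j] y u]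
 proof (rule tens_meas_eq[OF H H' C[OF j] M cm[OF j] cM y coalg_homD(2)[OF f[OF j] y] _ linD(1)[OF h(5) u]])
 fix u v assume uv: "u .: total H" "v .: total H"
 show "tens_meas H' (Cj j) (%x. Phi (f j x)) y u v = tens_meas H' M Phi (f j y) u v"
 by (rule sw_hom[symmetric, OF PC[OF j] P f[OF j] T bilin_family[OF lf(1) TL(2) uv] y])
 qed (rule j)
 qed
 then show ?thesis using cM by (simp add:hopf_measuring_iff[OF H H' M])
qed

text \<open>Coproducts are preserved by applying the condition for \<open>y\<close> to
  \<open>Psi x u\<close> and then that for \<open>x\<close> to \<open>u\<close>; on elementary
  tensors the two nested sums form the Sweedler sum over the tensor coalgebra.\<close>

lemma hopf_measuring_comp:
 assumes H: "hopf_ok H" and H': "hopf_ok H'" and H'': "hopf_ok H''" and C: "ccoalg C" and D: "ccoalg D"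
 and m: "hmeas H H' C Psi psi" and n: "hmeas H' H'' D X chi"
 shows "hmeas H H'' (tensor_coalg C D) (%t u. sweedler (total H'') (%x x'. X x' (Psi x u)) t) (%t a. sweedler (base H'') (%x x'. chi x' (psi x a)) t)"
 (is "hmeas _ _ ?T ?S ?s")
proof -
 note PC = cc_pre[OF C] and PD = cc_pre[OF D] and PT = precoalg_TC[OF C D] and cT = cocomm_TC[OF C D]
 note h = hopf_okD[OF H] and h' = hopf_okD[OF H'] and h'' = hopf_okD[OF H'']
 note cm = hopf_measuringD(1)[OF H H' C m] and cn = hopf_measuringD(1)[OF H' H'' D n]
 note mD = compatD[OF H H' C cm] and nD = compatD[OF H' H'' D cn]
 note L = linear_family_comp[OF C D h(8) h''(8) mD(3) nD(3)] and l = linear_family_comp[OF C D h(9) h''(9) mD(4) nD(4)]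
 note k = lfD(2)[OF L(1)] lfD(2)[OF l(1)]
 note c = linD(1)[OF h(3)] lin1[OF h(4)] lin1[OF h(6)] lin1[OF h(7)]
 have cc: "hopf_compat H H'' ?T ?S ?s"
 unfolding hopf_compat_def
 proof (intro conjI ballI)
 show "ameas (total H) (total H'') ?T ?S" by (rule alg_measuring_comp[OF C D h(1) h'(1) h''(1) mD(1) nD(1)])
 show "ameas (base H) (base H'') ?T ?s" by (rule alg_measuring_comp[OF C D h(2) h'(2) h''(2) mD(2) nD(2)])
 fix t assume t: "t .: ?T"
 show "?S t (src H a) = src H'' (?s t a)" "?S t (tgt H a) = tgt H'' (?s t a)" if a: "a .: base H" for a
 by (rule tensor_coalg_eqI[OF C D h''(8) k(1)[OF c(1)[OF a]] linc[OF k(2)[OF a] h''(3)] _ t]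
 tensor_coalg_eqI[OF C D h''(8) k(1)[OF c(2)[OF a]] linc[OF k(2)[OF a] h''(4)] _ t];
 use a c mD nD in \<open>simp add:L(2) l(2)\<close>)+
 show "?S t (antip H u) = antip H'' (?S t u)" "?s t (coun H u) = coun H'' (?S t u)" if u: "u .: total H" for u
 by (rule tensor_coalg_eqI[OF C D h''(8) k(1)[OF c(4)[OF u]] linc[OF k(1)[OF u] h''(7)] _ t]
 tensor_coalg_eqI[OF C D h''(9) k(2)[OF c(3)[OF u]] linc[OF k(1)[OF u] h''(6)] _ t];
 use u c mD nD in \<open>simp add:L(2) l(2)\<close>)+
 qed
 let ?W = "tensorL H'' 2" and ?W' = "tensorL H' 2"
 note T = vspace_tensorL[OF H''] and T' = vspace_tensorL[OF H'] and TL = tensL[OF H''] and TL' = tensL[OF H']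
 have "cop H'' (?S t u) = sweedler ?W (tens_meas H'' ?T ?S t) (cop H u)" if t: "t .: ?T" and u: "u .: total H" for t u
 proof (rule tensor_coalg_eqI[OF C D T linc[OF k(1)[OF u] h''(5)] lin_tens_meas[OF H H'' cT cc linD(1)[OF h(5) u]] _ t])
 fix x y assume x: "x .: C" and y: "y .: D"
 have xy: "tens [C,D][x,y] .: ?T" using tensor2(3)[OF preD(1)[OF PC] pre1[OF PD] x y] by (simp add:TC_simps[OF C D])
 note ex = tens_meas_ext[OF H H' C cm x] and ey = tens_meas_ext[OF H' H'' D cn y] and exy = tens_meas_ext[OF H H'' cT cc xy]
 have "cop H'' (?S (tens [C,D][x,y]) u) = sweedler ?W (tens_meas H'' D X y) (sweedler ?W' (tens_meas H' C Psi x) (cop H u))"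
 using L(2)[OF x y u] hopf_measuringD(2)[OF H' H'' D n y mD(9)[OF x u]] hopf_measuringD(2)[OF H H' C m x u] by simp
 also have "... = sweedler ?W (tens_meas H'' ?T ?S (tens [C,D][x,y])) (cop H u)"
 proof (rule tensorL_eqI[OF H T linc[OF ex(1) ey(1)] exy(1) lin1[OF h(5) u]])
 fix u v assume u: "u .: total H" and v: "v .: total H"
 have "sweedler ?W (tens_meas H'' D X y) (sweedler ?W' (tens_meas H' C Psi x) (tensL H [u,v]))
 = sw C ?W (%x1 x2. sweedler ?W (tens_meas H'' D X y) (tensL H' [Psi x1 u,Psi x2 v])) x"
 unfolding ex(2)[OF u v] by (rule sw_push[OF PC ey(1) T' T x]) (use TL'(1) mD(9) u v in simp)
 also have "... = sw C ?W (%x1 x2. sw D ?W (%y1 y2. tensL H'' [?S (tens [C,D][x1,y1]) u,?S (tens [C,D][x2,y2]) v]) y) x"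
 proof (rule sw_cong[OF PC T x])
 fix x1 x2 assume xs: "x1 .: C" "x2 .: C"
 show "sweedler ?W (tens_meas H'' D X y) (tensL H' [Psi x1 u,Psi x2 v]) = sw D ?W (%y1 y2. tensL H'' [?S (tens [C,D][x1,y1]) u,?S (tens [C,D][x2,y2]) v]) y"
 unfolding ey(2)[OF mD(9)[OF xs(1) u] mD(9)[OF xs(2) v]]
 by (rule sw_cong[OF PD T y]) (use xs u v L(2) TL(1) mD(9) nD(9) in simp_all)
 show "sw D ?W (%y1 y2. tensL H'' [?S (tens [C,D][x1,y1]) u,?S (tens [C,D][x2,y2]) v]) y .: ?W"
 by (rule sw_closed[OF PD T y]) (use xs u v L(2) TL(1) mD(9) nD(9) in simp_all)
 qed
 also have "... = tens_meas H'' ?T ?S (tens [C,D][x,y]) u v"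
 by (rule sw_TC[symmetric, OF C D T _ x y]) (insert bilin_family[OF L(1) TL(2) u v], simp add:bilin_TC[OF C D])
 finally show "sweedler ?W (tens_meas H'' D X y) (sweedler ?W' (tens_meas H' C Psi x) (tensL H [u,v]))
 = sweedler ?W (tens_meas H'' ?T ?S (tens [C,D][x,y])) (tensL H [u,v])" using exy(2)[OF u v] by simp
 qed
 finally show "cop H'' (?S (tens [C,D][x,y]) u) = sweedler ?W (tens_meas H'' ?T ?S (tens [C,D][x,y])) (cop H u)" .
 qed
 then show ?thesis using cc by (simp add:hopf_measuring_iff[OF H H'' cT])
qed

lemma hopf_measuring_unit:
 assumes H: "hopf_ok H"
 shows "hmeas H H unit_coalg (%c u. c *.[total H] u) (%c a. c *.[base H] a)"
proof -
 note h = hopf_okD[OF H] and cU = cocomm_unit_coalg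
 have cc: "hopf_compat H H unit_coalg (%c u. c *.[total H] u) (%c a. c *.[base H] a)"
 unfolding hopf_compat_def
 using alg_measuring_unit[OF h(1)] alg_measuring_unit[OF h(2)] lin3[OF h(3)] lin3[OF h(4)] lin3[OF h(6)] lin3[OF h(7)] by simp
 note T = vspace_tensorL[OF H] and TL = tensL[OF H]
 have "cop H (c *.[total H] u) = sweedler (tensorL H 2) (tens_meas H unit_coalg (%c u. c *.[total H] u) c) (cop H u)"
 if u: "u .: total H" for c u
 proof -
 have c: "c .: unit_coalg" by (simp add:unit_simps)
 note e = tens_meas_ext[OF H H cU cc c]
 have "c *.[tensorL H 2] cop H u = sweedler (tensorL H 2) (tens_meas H unit_coalg (%c u. c *.[total H] u) c) (cop H u)"
 proof (rule tensorL_eqI[OF H T _ e(1) lin1[OF h(5) u]])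
 show "lin (tensorL H 2) (tensorL H 2) (%w. c *.[tensorL H 2] w)" by (rule linI) (insert T, simp_all add: vs_smult vs_smultC)
 fix u v assume uv: "u .: total H" "v .: total H"
 show "c *.[tensorL H 2] tensL H [u,v] = sweedler (tensorL H 2) (tens_meas H unit_coalg (%c u. c *.[total H] u) c) (tensL H [u,v])"
 unfolding e(2)[OF uv] sw_unit_coalg[OF T bilin_family[OF linear_family_unit[OF h(8)] TL(2) uv]]
 using linD(3)[OF bilinD(1)[OF TL(2) uv(2)] uv(1)] h(8) uv by simp
 qed
 then show ?thesis using linD(3)[OF h(5) u] by simp
 qed
 then show ?thesis using cc by (simp add:hopf_measuring_iff[OF H H cU])
qed

section \<open>The universal measuring of Hopf algebroids\<close>

text \<open>A pair of measurings is treated as one linear map into a product of spaces of linear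
  maps, so that the universal construction applies without change.\<close>

definition vprod :: "('k::field,'v) module=>('k,'w) module=>('k,'v \<times> 'w) module" where
 "vprod V W = \<lparr>carrier = car V \<times> car W,monoid.mult = undefined,one = undefined,zero = (0.[V],0.[W]),
 add = (%(a,b) (c,d). (a +[V] c,b +[W] d)),smult = (%c (a,b). (c *.[V] a,c *.[W] b))\<rparr>"

lemma vspace_vprod: "vspace V ==> vspace W ==> vspace (vprod V W)"
 by (rule vspaceI) (auto simp:vprod_def vs_smult vs_neg vs_add_ac)

lemma lin_vprod: "lin C (vprod V W) f <-> lin C V (%x. fst (f x)) & lin C W (%x. snd (f x))"
 by (auto simp:klinear_def vprod_def Pi_def mem_Times_iff prod_eq_iff split_beta)

definition hopf_space :: "('k::field,'u,'a) halg=>('k,'v,'b) halg=>('k,('u=>'v) \<times> ('a=>'b)) module" where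
 "hopf_space H H' = vprod (lin_space (total H) (total H')) (lin_space (base H) (base H'))"

definition hopf_res :: "('k::field,'u,'a) halg=>('c=>'u=>'v)=>('c=>'a=>'b)=>'c=>('u=>'v) \<times> ('a=>'b)" where
 "hopf_res H Phi phi x = (restrict (Phi x) (car (total H)),restrict (phi x) (car (base H)))"

definition hopf_fam :: "('k::field,'u,'a) halg=>('k,'v,'b) halg=>(('k,nat=>'k) coalg \<times> ((nat=>'k)=>('u=>'v) \<times> ('a=>'b))) set" where
 "hopf_fam H H' = {(E,psi). ccoalg E & lin E (hopf_space H H') psi & hmeas H H' E (%x. fst (psi x)) (%x. snd (psi x))}"

definition hopf_univ :: "('k::field,'u,'a) halg=>('k,'v,'b) halg=>('k,'m) coalg=>('m=>'u=>'v)=>('m=>'a=>'b)=>bool" where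
 "hopf_univ H H' M Phi phi <-> ccoalg M & hmeas H H' M Phi phi & separated M {m:car M. hopf_res H Phi phi m = 0.[hopf_space H H']}"

lemma hopf_res_eq: "hopf_res H Phi phi x = hopf_res H Phi' phi' y <-> (ALL u:car (total H). Phi x u = Phi' y u) & (ALL a:car (base H). phi x a = phi' y a)"
 by (simp add:hopf_res_def restrict_eq_iff)

lemma vspace_hopf_space: "hopf_ok H ==> hopf_ok H' ==> vspace (hopf_space H H')"
 unfolding hopf_space_def by (intro vspace_vprod vspace_lin_space hopf_okD)

lemma lin_hopf_res:
 assumes "hopf_ok H" "hopf_ok H'" "ccoalg C" "hmeas H H' C Psi psi"
 shows "lin C (hopf_space H H') (hopf_res H Psi psi)"
 using compatD(1,2)[OF assms(1-3) hopf_measuringD(1)[OF assms]] hopf_okD[OF assms(1)] hopf_okD[OF assms(2)]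
 by (simp add:hopf_space_def lin_vprod hopf_res_def lin_restricted[OF cc_pre[OF assms(3)]])

lemma hopf_res_id:
 assumes "lin C (hopf_space H H') psi" "x .: C"
 shows "hopf_res H (%x. fst (psi x)) (%x. snd (psi x)) x = psi x"
proof -
 note k = assms(1)[unfolded hopf_space_def lin_vprod]
 show ?thesis
 using lin_lin_space_restrict[OF conjunct1[OF k] assms(2)] lin_lin_space_restrict[OF conjunct2[OF k] assms(2)]
 by (simp add:hopf_res_def prod_eq_iff)
qed

lemma hopf_fam_pull:
 assumes H: "hopf_ok H" and H': "hopf_ok H'" and C: "ccoalg C" and m: "hmeas H H' C Psi psi" and E: "ccoalg E" and j: "chom E C j"
 shows "(E,%e. hopf_res H Psi psi (j e)):hopf_fam H H'"
proof -
 have m': "hmeas H H' E (%x. fst (hopf_res H Psi psi (j x))) (%x. snd (hopf_res H Psi psi (j x)))"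
 by (rule hopf_measuring_pull[OF H H' C E m j]) (auto simp:hopf_res_def)
 moreover have "lin E (hopf_space H H') (%e. hopf_res H Psi psi (j e))"
 by (rule linc[OF coalg_homD(1)[OF j] lin_hopf_res[OF H H' C m]])
 ultimately show ?thesis using E by (simp add:hopf_fam_def)
qed

lemma hopf_univ_data:
 assumes H: "hopf_ok H" and H': "hopf_ok H'" and U: "univ_data (hopf_space H H') (hopf_fam H H') M phi inc"
 shows "hopf_univ H H' M (%x. fst (phi x)) (%x. snd (phi x))"
proof -
 have M: "ccoalg M" and k: "lin M (hopf_space H H') phi" and sp: "spans M (UN j:hopf_fam H H'. inc j ` car (fst j))"
 and s: "separated M {m:car M. phi m = 0.[hopf_space H H']}"
 and inc: "!!j. j:hopf_fam H H' ==> chom (fst j) M (inc j)" "!!j x. j:hopf_fam H H' ==> x .: fst j ==> phi (inc j x) = snd j x"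
 using U by (auto simp:univ_data_def)
 note P = cc_pre[OF M] and h = hopf_okD[OF H] and h' = hopf_okD[OF H']
 note v = preD(1)[OF P]
 have E: "ccoalg (fst j)" "hmeas H H' (fst j) (%x. fst (snd j x)) (%x. snd (snd j x))" if "j:hopf_fam H H'" for j
 using that by (auto simp:hopf_fam_def)
 note r = hopf_res_id[OF k, unfolded hopf_res_def prod_eq_iff fst_conv snd_conv]
 have "lin M (lin_space (total H) (total H')) (%x. restrict (fst (phi x)) (car (total H)))" "lin M (lin_space (base H) (base H')) (%x. restrict (snd (phi x)) (car (base H)))"
 using k r lin_cong[OF v, of "%x. restrict (fst (phi x)) (car (total H))" "%x. fst (phi x)" "lin_space (total H) (total H')"]
 lin_cong[OF v, of "%x. restrict (snd (phi x)) (car (base H))" "%x. snd (phi x)" "lin_space (base H) (base H')"]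
 by (simp_all add: hopf_space_def lin_vprod)
 then have lf: "linear_family M (total H) (total H') (%x. fst (phi x))" "linear_family M (base H) (base H') (%x. snd (phi x))"
 by (simp_all add: linear_family_lin_space[OF v h(8) h'(8)] linear_family_lin_space[OF v h(9) h'(9)])
 have "hmeas H H' M (%x. fst (phi x)) (%x. snd (phi x))"
 proof (rule hopf_measuring_cover[OF H H' M lf sp E(1) inc(1)])
 fix j assume j: "j:hopf_fam H H'"
 note pE = cc_pre[OF E(1)[OF j]]
 show "hmeas H H' (fst j) (%x. fst (phi (inc j x))) (%x. snd (phi (inc j x)))"
 by (rule hopf_measuring_pull[OF H H' E(1)[OF j] E(1)[OF j] E(2)[OF j] coalg_hom_id[OF pE]]) (simp_all add: inc(2)[OF j])
 qed
 moreover have "{m:car M. phi m = 0.[hopf_space H H']} = {m:car M. hopf_res H (%x. fst (phi x)) (%x. snd (phi x)) m = 0.[hopf_space H H']}"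
 by (intro Collect_cong conj_cong refl) (simp add:hopf_res_id[OF k])
 ultimately show ?thesis using M s by (simp add:hopf_univ_def)
qed

lemma hopf_univ_final:
 fixes C :: "('k::field,'c) coalg"
 assumes H: "hopf_ok H" and H': "hopf_ok H'" and M: "hopf_univ H H' M Phi phi" and C: "precoalg C"
 and ex: "EX f. chom C M f & (ALL x:car C. hopf_res H Phi phi (f x) = hopf_res H Psi psi x)"
 shows "EX! f. f:extensional (car C) & chom C M f &
 (ALL x:car C. (ALL u:car (total H). Phi (f x) u = Psi x u) & (ALL a:car (base H). phi (f x) a = psi x a))"
 using separated_ex1[OF vspace_hopf_space[OF H H'], of M "hopf_res H Phi phi" C "hopf_res H Psi psi"] M C ex lin_hopf_res[OF H H', of M Phi phi]
 by (simp add:hopf_univ_def hopf_res_eq)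

lemma final_hopfD:
 assumes "final_hopf_measuring TYPE('c) H H' M Phi phi" "ccoalg C" "hmeas H H' (C :: ('k::field,'c) coalg) Psi psi"
 shows "EX! f. f:extensional (car C) & chom C M f &
 (ALL x:car C. (ALL u:car (total H). Phi (f x) u = Psi x u) & (ALL a:car (base H). phi (f x) a = psi x a))"
 using assms by (simp add:final_hopf_measuring_def)

lemma hopf_univ_data_ex:
 assumes H: "hopf_ok (H :: ('k::field,'u,'a) halg)" and H': "hopf_ok (H' :: ('k,'v,'b) halg)"
 shows "EX (M :: ('k,('k,'u,'a,'v,'b) hopf_univ) coalg) phi inc. univ_data (hopf_space H H') (hopf_fam H H') M phi inc"
 using univ_data_ex[OF vspace_hopf_space[OF H H'], of "hopf_fam H H'"] by (auto simp:hopf_fam_def)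

lemma hopf_map:
 assumes H: "hopf_ok H" and H': "hopf_ok H'" and U: "univ_data (hopf_space H H') (hopf_fam H H') M phi inc"
 and C: "ccoalg C" and m: "hmeas H H' C Psi psi"
 shows "EX f. chom C M f & (ALL x:car C. phi (f x) = hopf_res H Psi psi x)"
 by (rule univ_data_map[OF U C]) (rule hopf_fam_pull[OF H H' C m])

lemma HMc_is_final:
 assumes H: "hopf_ok (H :: ('k::field,'u,'a) halg)" and H': "hopf_ok (H' :: ('k,'v,'b) halg)"
 shows "final_hopf_measuring TYPE(('k,'u,'a,'v,'b) hopf_univ) H H' (HMc H H') (Phi_tot H H') (phi_base H H')"
proof -
 let ?P = "%(M,Phi,phi). final_hopf_measuring TYPE(('k,'u,'a,'v,'b) hopf_univ) H H' M Phi phi"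
 obtain M :: "('k,('k,'u,'a,'v,'b) hopf_univ) coalg" and phi inc where U: "univ_data (hopf_space H H') (hopf_fam H H') M phi inc"
 using hopf_univ_data_ex[OF H H'] by blast
 note hu = hopf_univ_data[OF H H' U]
 have k: "lin M (hopf_space H H') phi" using U by (simp add:univ_data_def)
 have "?P (M,%x. fst (phi x),%x. snd (phi x))"
 unfolding final_hopf_measuring_def prod.case
 proof (intro conjI allI impI)
 show "ccoalg M" "hmeas H H' M (%x. fst (phi x)) (%x. snd (phi x))" using hu by (auto simp:hopf_univ_def)
 fix C :: "('k,('k,'u,'a,'v,'b) hopf_univ) coalg" and Psi psi assume C: "ccoalg C & hmeas H H' C Psi psi"
 then obtain f where f: "chom C M f" "ALL x:car C. phi (f x) = hopf_res H Psi psi x" using hopf_map[OF H H' U] by blast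
 show "EX! f. f:extensional (car C) & chom C M f &
 (ALL x:car C. (ALL u:car (total H). fst (phi (f x)) u = Psi x u) & (ALL a:car (base H). snd (phi (f x)) a = psi x a))"
 by (rule hopf_univ_final[OF H H' hu cc_pre[OF conjunct1[OF C]]])
 (use f hopf_res_id[OF k coalg_homD(2)[OF f(1)]] in auto)
 qed
 then have "?P (HMc_phi H H')" unfolding HMc_phi_def by (rule someI[of ?P])
 then show ?thesis by (simp add:HMc_def Phi_tot_def phi_base_def split_beta)
qed

lemma HMc_from_data:
 assumes H: "hopf_ok (H :: ('k::field,'u,'a) halg)" and H': "hopf_ok (H' :: ('k,'v,'b) halg)"
 and U: "univ_data (hopf_space H H') (hopf_fam H H') (M0 :: ('k,('k,'u,'a,'v,'b) hopf_univ) coalg) phi0 inc"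
 obtains f where "chom M0 (HMc H H') f" "!!x. x .: M0 ==> hopf_res H (Phi_tot H H') (phi_base H H') (f x) = phi0 x"
proof -
 note hu = hopf_univ_data[OF H H' U]
 have M0: "ccoalg M0" "hmeas H H' M0 (%x. fst (phi0 x)) (%x. snd (phi0 x))" and k: "lin M0 (hopf_space H H') phi0"
 using hu U by (auto simp:hopf_univ_def univ_data_def)
 from ex1_implies_ex[OF final_hopfD[OF HMc_is_final[OF H H'] M0]] obtain f where "chom M0 (HMc H H') f"
 "ALL x:car M0. hopf_res H (Phi_tot H H') (phi_base H H') (f x) = hopf_res H (%x. fst (phi0 x)) (%x. snd (phi0 x)) x"
 by (auto simp:hopf_res_eq)
 then show ?thesis using that hopf_res_id[OF k] by simp
qed

lemma HMc_hopf_univ: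
 assumes H: "hopf_ok (H :: ('k::field,'u,'a) halg)" and H': "hopf_ok (H' :: ('k,'v,'b) halg)"
 shows "hopf_univ H H' (HMc H H') (Phi_tot H H') (phi_base H H')"
proof -
 let ?M = "HMc H H'" and ?p = "hopf_res H (Phi_tot H H') (phi_base H H')"
 note fin = HMc_is_final[OF H H']
 have M: "ccoalg ?M" "hmeas H H' ?M (Phi_tot H H') (phi_base H H')" using fin by (auto simp:final_hopf_measuring_def)
 note P = cc_pre[OF M(1)]
 obtain M0 :: "('k,('k,'u,'a,'v,'b) hopf_univ) coalg" and phi0 inc where U: "univ_data (hopf_space H H') (hopf_fam H H') M0 phi0 inc"
 using hopf_univ_data_ex[OF H H'] by blast
 have "separated ?M {m:car ?M. ?p m = 0.[hopf_space H H']}"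
 proof (rule univ_data_chosen[OF U M(1) lin_hopf_res[OF H H' M]])
 show "(E,%e. ?p (j e)):hopf_fam H H'" if "ccoalg E" "chom E ?M j" for E j
 by (rule hopf_fam_pull[OF H H' M that])
 show "EX f0. chom M0 ?M f0 & (ALL x:car M0. ?p (f0 x) = phi0 x)" by (rule HMc_from_data[OF H H' U]) blast
 fix u assume u: "chom ?M ?M u" "!!x. x .: ?M ==> ?p (u x) = ?p x"
 have "restrict u (car ?M) = restrict (%x. x) (car ?M)"
 by (rule ex1_same[OF final_hopfD[OF fin M]])
 (insert u(2) coalg_hom_cong[OF P P u(1)] coalg_hom_cong[OF P P coalg_hom_id[OF P]], auto simp:hopf_res_eq)
 then show "ALL x:car ?M. u x = x" by (simp add:restrict_eq_iff)
 qed
 then show ?thesis using M by (simp add:hopf_univ_def)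
qed

lemma HMc_final:
 assumes H: "hopf_ok (H :: ('k::field,'u,'a) halg)" and H': "hopf_ok (H' :: ('k,'v,'b) halg)"
 shows "final_hopf_measuring TYPE('c) H H' (HMc H H') (Phi_tot H H') (phi_base H H')"
 unfolding final_hopf_measuring_def
proof (intro conjI allI impI)
 let ?M = "HMc H H'" and ?p = "hopf_res H (Phi_tot H H') (phi_base H H')"
 note hu = HMc_hopf_univ[OF H H']
 show M: "ccoalg ?M" "hmeas H H' ?M (Phi_tot H H') (phi_base H H')" using hu by (auto simp:hopf_univ_def)
 fix C :: "('k,'c) coalg" and Psi psi assume C: "ccoalg C & hmeas H H' C Psi psi"
 obtain M0 :: "('k,('k,'u,'a,'v,'b) hopf_univ) coalg" and phi0 inc where U: "univ_data (hopf_space H H') (hopf_fam H H') M0 phi0 inc"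
 using hopf_univ_data_ex[OF H H'] by blast
 then have P0: "precoalg M0" by (auto simp:univ_data_def intro: coalg_pre cc_coalg)
 obtain f where f: "chom M0 ?M f" "!!x. x .: M0 ==> ?p (f x) = phi0 x" by (rule HMc_from_data[OF H H' U]) blast
 obtain g where g: "chom C M0 g" "!!x. x .: C ==> phi0 (g x) = hopf_res H Psi psi x"
 using hopf_map[OF H H' U conjunct1[OF C] conjunct2[OF C]] by blast
 note PC = cc_pre[OF conjunct1[OF C]] and PM = cc_pre[OF M(1)]
 show "EX! f. f:extensional (car C) & chom C ?M f &
 (ALL x:car C. (ALL u:car (total H). Phi_tot H H' (f x) u = Psi x u) & (ALL a:car (base H). phi_base H H' (f x) a = psi x a))"
 by (rule hopf_univ_final[OF H H' hu PC], rule exI[of _ "%x. f (g x)"])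
 (use coalg_hom_comp[OF PC P0 PM g(1) f(1)] f(2) g(2) coalg_homD(2)[OF g(1)] in simp)
qed

lemma HMc_induced:
 assumes H: "hopf_ok H" and H': "hopf_ok H'" and C: "ccoalg C" and m: "hmeas H H' C Psi psi"
 shows "chom C (HMc H H') (HMc_induced H H' C Psi psi)"
 "x .: C ==> u .: total H ==> Phi_tot H H' (HMc_induced H H' C Psi psi x) u = Psi x u"
 "x .: C ==> a .: base H ==> phi_base H H' (HMc_induced H H' C Psi psi x) a = psi x a"
 using theI'[OF final_hopfD[OF HMc_final[OF H H'] C m], folded HMc_induced_def] by auto

section \<open>The chain complex\<close>

text \<open>In the commutative case the antipode is multiplicative and carries target to source, so
  both counits become multiplicative and linear over the base acting through the target. These
  properties make the faces base-linear and compatible with products.\<close>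

lemma comm_hopfD:
 assumes "chopf H"
 shows "hopf_ok H" "cring (total H)" "cring (base H)"
 "a .: base H ==> b .: base H ==> tgt H (a **[base H] b) = tgt H a **[total H] tgt H b"
 "tgt H 1.[base H] = 1.[total H]"
 "lin (total H) (base H) (counR H)" "u .: total H ==> counR H (antip H u) = coun H u"
 "a .: base H ==> u .: total H ==> counR H (tgt H a **[total H] u) = a **[base H] counR H u"
 "a .: base H ==> u .: total H ==> coun H (tgt H a **[total H] u) = a **[base H] coun H u"
 "u .: total H ==> v .: total H ==> counR H (u **[total H] v) = counR H u **[base H] counR H v"
 "u .: total H ==> v .: total H ==> coun H (u **[total H] v) = coun H u **[base H] coun H v"
proof -
 let ?U = "total H" and ?A = "base H"
 have h: "is_hopf_algebroid H" and U: "cring ?U" and A: "cring ?A" using assms by (auto simp:comm_hopf_algebroid_def)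
 show ok: "hopf_ok H" "cring ?U" "cring ?A" using hopf_algebroid_ok[OF h] U A by auto
 note k = hopf_okD[OF ok(1)]
 note c = linD(1)[OF k(3)] lin1[OF k(4)] lin1[OF k(6)] lin1[OF k(7)]
 interpret U: cring ?U by (rule U)
 interpret A: cring ?A by (rule A)
 have t: "tgt H:ring_hom (op_alg ?A) ?U" and s: "src H:ring_hom ?A ?U" and S: "antip H:ring_hom ?U (op_alg ?U)"
 and eps: "!!a b u. a .: ?A ==> b .: ?A ==> u .: ?U ==> coun H (src H a **[?U] tgt H b **[?U] u) = a **[?A] coun H u **[?A] b"
 and epm: "!!u v. u .: ?U ==> v .: ?U ==> coun H (u **[?U] v) = coun H (u **[?U] tgt H (coun H v))"
 and SS: "!!u. u .: ?U ==> antip H (antip H u) = u" and St: "!!a. a .: ?A ==> antip H (tgt H a) = src H a"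
 using h by (auto simp:is_hopf_algebroid_def left_bialgebroid_def Let_def alg_hom_def)
 have t1: "tgt H 1.[?A] = 1.[?U]" and s1: "src H 1.[?A] = 1.[?U]" using t s by (auto simp:ring_hom_def op_alg_def)
 show "tgt H 1.[?A] = 1.[?U]" by (rule t1)
 have Sm: "antip H (u **[?U] v) = antip H u **[?U] antip H v" if "u .: ?U" "v .: ?U" for u v
 using S that c U.m_comm by (auto simp:ring_hom_def op_alg_def)
 show "a .: ?A ==> b .: ?A ==> tgt H (a **[?A] b) = tgt H a **[?U] tgt H b"
 using t A.m_comm by (auto simp:ring_hom_def op_alg_def)
 show "lin ?U ?A (counR H)" unfolding counR_def[abs_def] by (rule linc[OF k(7,6)])
 show "u .: ?U ==> counR H (antip H u) = coun H u" by (simp add:counR_def SS)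
 show et: "coun H (tgt H a **[?U] u) = a **[?A] coun H u" if "a .: ?A" "u .: ?U" for a u
 using eps[of "1.[?A]" a u] that c s1 A.m_comm by simp
 have es: "coun H (src H a **[?U] u) = a **[?A] coun H u" if "a .: ?A" "u .: ?U" for a u
 using eps[of a "1.[?A]" u] that c t1 by simp
 show "counR H (tgt H a **[?U] u) = a **[?A] counR H u" if "a .: ?A" "u .: ?U"
 using that c by (simp add:counR_def Sm St es)
 \<comment> \<open>The bialgebroid axiom replaces \<open>v\<close> by the target of its counit, and
   linearity over the base extracts it.\<close>
 show em: "coun H (u **[?U] v) = coun H u **[?A] coun H v" if "u .: ?U" "v .: ?U" for u v
 using epm[OF that] et[of "coun H v" u] that c U.m_comm A.m_comm by simp
 show "counR H (u **[?U] v) = counR H u **[?A] counR H v" if "u .: ?U" "v .: ?U"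
 using that c em by (simp add:counR_def Sm)
qed

text \<open>The empty word stands for the unit of \<open>A = C\<^sub>0(U)\<close>.\<close>

definition cw :: "('k::field,'u,'a) halg=>'u list=>(('u,'a) word \<Rightarrow>\<^sub>0 'k) set" where
 "cw H us = (if us = [] then chain H (Base 1.[base H]) else chain H (Tens us))"

text \<open>In positive degree the base acts through the target map on the first factor; by
  \<open>chain_move\<close> any other factor would give the same result.\<close>

definition cact :: "('k::field,'u,'a) halg=>'a=>(('u,'a) word \<Rightarrow>\<^sub>0 'k) set=>(('u,'a) word \<Rightarrow>\<^sub>0 'k) set" where
 "cact H a = lin_ext (chains H) (%w. case w of Base b=>chain H (Base (a **[base H] b))
 | Tens us=>chain H (Tens ((tgt H a **[total H] hd us) # tl us)))"

definition amod :: "('k::field,'u,'a) halg=>('k,'t,'z) msch=>('a=>'t=>'t)=>bool" where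
 "amod H T act <-> vspace T & bilin (base H) T T act & (ALL x:car T. act 1.[base H] x = x &
 (ALL a:car (base H). ALL b:car (base H). act (a **[base H] b) x = act a (act b x)))"

text \<open>Since an element of the base has the same effect in every slot, such a function is
  automatically balanced, and since scalars come from the base it is multilinear over the field. One
  notion thus covers the relations in every length.\<close>

definition alin :: "('k::field,'u,'a) halg=>('k,'t,'z) msch=>('a=>'t=>'t)=>('u list=>'t)=>bool" where
 "alin H T act F <-> (ALL us:lists (car (total H)). F us .: T) &
 (ALL xs:lists (car (total H)). ALL ys:lists (car (total H)). ALL x:car (total H).
 (ALL y:car (total H). F (xs @ (x +[total H] y) # ys) = F (xs @ x # ys) +[T] F (xs @ y # ys)) &
 (ALL a:car (base H). F (xs @ (tgt H a **[total H] x) # ys) = act a (F (xs @ x # ys))))"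

text \<open>A base element is a multiple of the empty word, which dictates the value in degree
  zero.\<close>

definition chop :: "('k::field,'t,'z) msch=>('a=>'t=>'t)=>('u list=>'t)=>(('u,'a) word \<Rightarrow>\<^sub>0 'k) set=>'t" where
 "chop T act F = lin_ext T (%w. case w of Base a=>act a (F []) | Tens us=>F us)"

text \<open>Tensoring with \<open>u\<close> on the left. In degree zero the tensor of
  \<open>u\<close> with a base element a means the element t(a)u of degree one.\<close>

definition ccons :: "('k::field,'u,'a) halg=>'u=>(('u,'a) word \<Rightarrow>\<^sub>0 'k) set=>(('u,'a) word \<Rightarrow>\<^sub>0 'k) set" where
 "ccons H u = chop (chains H) (cact H) (%us. cw H (u # us))"

definition chain_op :: "('k::field,'u,'a) halg=>('k,'t,'z) msch=>('a=>'t=>'t)=>((('u,'a) word \<Rightarrow>\<^sub>0 'k) set=>'t)=>bool" where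
 "chain_op H T act f <-> lin (chains H) T f & (ALL a:car (base H). ALL x:car (chains H). f (cact H a x) = act a (f x))"

lemma alinI:
 assumes "!!us. us:lists (car (total H)) ==> F us .: T"
 "!!xs ys x y. xs:lists (car (total H)) ==> ys:lists (car (total H)) ==> x .: total H ==> y .: total H ==>
 F (xs @ (x +[total H] y) # ys) = F (xs @ x # ys) +[T] F (xs @ y # ys)"
 "!!xs ys x a. xs:lists (car (total H)) ==> ys:lists (car (total H)) ==> x .: total H ==> a .: base H ==>
 F (xs @ (tgt H a **[total H] x) # ys) = act a (F (xs @ x # ys))"
 shows "alin H T act F"
 using assms by (auto simp:alin_def)

lemma alinD:
 assumes "alin H T act F"
 shows "us:lists (car (total H)) ==> F us .: T"
 "xs:lists (car (total H)) ==> ys:lists (car (total H)) ==> x .: total H ==> y .: total H ==>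
 F (xs @ (x +[total H] y) # ys) = F (xs @ x # ys) +[T] F (xs @ y # ys)"
 "xs:lists (car (total H)) ==> ys:lists (car (total H)) ==> x .: total H ==> a .: base H ==>
 F (xs @ (tgt H a **[total H] x) # ys) = act a (F (xs @ x # ys))"
 using assms by (auto simp:alin_def)

lemma amodD:
 assumes "amod H T act"
 shows "vspace T" "bilin (base H) T T act" "x .: T ==> act 1.[base H] x = x"
 "x .: T ==> a .: base H ==> b .: base H ==> act (a **[base H] b) x = act a (act b x)"
 "x .: T ==> a .: base H ==> act a x .: T"
 using assms bilinD(3) by (auto simp:amod_def)

declare in_listsD [rule del] in_listsI [rule del]

locale comm_hopf =
 fixes H :: "('k::field,'u,'a) halg"
 assumes H: "chopf H"
begin

abbreviation (input) "cn == ccons H"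
abbreviation (input) "ca == cact H"

abbreviation (input) "U == total H"
abbreviation (input) "A == base H"
abbreviation (input) "Ch == chains H"
abbreviation (input) "LU == lists (car (total H))"
abbreviation (input) "X == \<Union>n. chain_gens H n"
abbreviation (input) "R == \<Union>n. chain_rels H n"
abbreviation (input) "ract == %u a. u **[total H] tgt H a"
abbreviation (input) "lact == %a u. tgt H a **[total H] u"

sublocale U: cring U by (rule comm_hopfD(2)[OF H])
sublocale A: cring A by (rule comm_hopfD(3)[OF H])

lemmas h = hopf_okD[OF comm_hopfD(1)[OF H]]
lemmas tc = linD(1)[OF h(4)]

lemma smult_mult: "u .: U ==> v .: U ==> (c *.[U] u) **[U] v = c *.[U] (u **[U] v)"
 using linD(3)[OF bilinD(1)[OF walgD(2)[OF h(1)]]] by blast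

lemma gens_replicate: "us:tgens (replicate n U) <-> length us = n & us:LU"
 by (simp add:tensor_gens_def list_all2_conv_all_nth in_lists_conv_set all_set_conv_all_nth) auto

lemma cgens_iff: "w:X <-> (case w of Base a=>a .: A | Tens us=>us ~= [] & us:LU)"
proof (cases w)
 case (Tens us)
 have "Tens us:chain_gens H n <-> n = length us & us ~= [] & us:LU" for n
 by (auto simp:chain_gens_def gens_replicate)
 then show ?thesis using Tens by auto
qed (auto simp:chain_gens_def split: if_splits)

lemma gens_single: "as:tgens [A] <-> (EX a:car A. as = [a])"
 by (auto simp:tensor_gens_def list_all2_Cons2)

lemma chain_rels_free: "R <= car (free_space X)"
proof -
 have X: "!!a. a .: A ==> Base a:X" "!!us. us ~= [] ==> us:LU ==> Tens us:X" unfolding cgens_iff by auto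
 have "multilin_rels (%as. Base (hd as)) [A] <= car (free_space X)"
 by (rule multilin_rels_free) (insert h(9) X(1), auto simp:gens_single)
 moreover have "multilin_rels Tens (replicate n U) <= car (free_space X)" if "n ~= 0" for n
 by (rule multilin_rels_free) (insert h(8) X(2) that, auto simp:gens_replicate)
 moreover have "balanced_rels Tens (car A) ract lact (replicate n U) <= car (free_space X)" for n
 by (rule balanced_rels_free) (insert X(2) tc, auto simp:gens_replicate simp del: UN_iff intro!:X(2))
 ultimately have "chain_rels H n <= car (free_space X)" for n unfolding chain_rels_def by auto
 then show ?thesis by (rule UN_least)
qed

lemma vCh: "vspace Ch"
 unfolding chains_def by (rule vspace_pres[OF chain_rels_free])

lemma chain_closed: "w:X ==> chain H w .: Ch"
 unfolding chains_def chain_def by (rule pgen_closed[OF chain_rels_free])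

lemma ev_chain_rels:
 assumes W: "vspace W" and g: "!!w. w:X ==> g w .: W"
 shows "(ALL r:R. ev W g r = 0.[W]) <-> mlin [A] W (%as. g (Base (hd as))) &
 (ALL n. mlin (replicate (Suc n) U) W (%us. g (Tens us)) & balanced (car A) ract lact (replicate (Suc n) U) (%us. g (Tens us)))"
proof -
 have gB: "!!a. a .: A ==> g (Base a) .: W" and gT: "!!us. us ~= [] ==> us:LU ==> g (Tens us) .: W"
 using g unfolding cgens_iff by (auto split: word.splits)
 have gr: "g (Tens us) .: W" if "us:tgens (replicate (Suc n) U)" for us n using that gT[of us] unfolding gens_replicate by fastforce
 have 1: "(ALL r:multilin_rels (%as. Base (hd as)) [A]. ev W g r = 0.[W]) <-> mlin [A] W (%as. g (Base (hd as)))"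
 by (rule ev_multilin_rels[OF W]) (insert h(9) gB, auto simp:gens_single)
 have 2: "(ALL r:multilin_rels Tens (replicate (Suc n) U). ev W g r = 0.[W]) <-> mlin (replicate (Suc n) U) W (%us. g (Tens us))" for n
 by (rule ev_multilin_rels[OF W]) (insert h(8) gr, auto simp del: replicate_Suc)
 have 3: "(ALL r:balanced_rels Tens (car A) ract lact (replicate (Suc n) U). ev W g r = 0.[W])
 <-> balanced (car A) ract lact (replicate (Suc n) U) (%us. g (Tens us))" for n
 by (rule ev_balanced_rels[OF W]) (insert tc, auto simp:gens_replicate simp del: replicate_Suc intro!:gT)
 have "(ALL r:R. ev W g r = 0.[W]) <-> (ALL r:chain_rels H 0. ev W g r = 0.[W]) & (ALL n. ALL r:chain_rels H (Suc n). ev W g r = 0.[W])"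
 by (simp only:UN_ball_bex_simps(2) ball_simps) (metis UNIV_I not0_implies_Suc)
 then show ?thesis using 1 2 3 by (simp add:chain_rels_def ball_Un del: replicate_Suc)
qed

lemma chain_rules:
 "a .: A ==> b .: A ==> chain H (Base (a +[A] b)) = chain H (Base a) +[Ch] chain H (Base b)"
 "a .: A ==> chain H (Base (c *.[A] a)) = c *.[Ch] chain H (Base a)"
 "xs:LU ==> ys:LU ==> x .: U ==> y .: U ==>
 chain H (Tens (xs @ (x +[U] y) # ys)) = chain H (Tens (xs @ x # ys)) +[Ch] chain H (Tens (xs @ y # ys))"
 "xs:LU ==> ys:LU ==> x .: U ==> chain H (Tens (xs @ (c *.[U] x) # ys)) = c *.[Ch] chain H (Tens (xs @ x # ys))"
 "xs:LU ==> ys:LU ==> x .: U ==> y .: U ==> a .: A ==>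
 chain H (Tens (xs @ ract x a # y # ys)) = chain H (Tens (xs @ x # lact a y # ys))"
proof -
 have "ALL r:R. ev Ch (chain H) r = 0.[Ch]"
 unfolding chains_def chain_def[abs_def] using pgen_rel[OF chain_rels_free] by blast
 then have m0: "mlin [A] Ch (%as. chain H (Base (hd as)))" and m: "!!n. mlin (replicate (Suc n) U) Ch (%us. chain H (Tens us))"
 and b: "!!n. balanced (car A) ract lact (replicate (Suc n) U) (%us. chain H (Tens us))"
 using ev_chain_rels[OF vCh chain_closed] by auto
 show "a .: A ==> b .: A ==> chain H (Base (a +[A] b)) = chain H (Base a) +[Ch] chain H (Base b)"
 using m0[unfolded mlin_def, THEN conjunct1, rule_format, of "[]" a "[]" b] by (simp add:gens_single)
 show "a .: A ==> chain H (Base (c *.[A] a)) = c *.[Ch] chain H (Base a)"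
 using m0[unfolded mlin_def, THEN conjunct2, rule_format, of "[]" a "[]" c] by (simp add:gens_single)
 have n: "replicate (Suc (length xs + length ys)) U ! length xs = U" for xs ys :: "'u list" by (simp del: replicate_Suc)
 show "xs:LU ==> ys:LU ==> x .: U ==> y .: U ==>
 chain H (Tens (xs @ (x +[U] y) # ys)) = chain H (Tens (xs @ x # ys)) +[Ch] chain H (Tens (xs @ y # ys))"
 using m[unfolded mlin_def, THEN conjunct1, rule_format, of xs x ys "length xs + length ys" y] by (simp add:gens_replicate n del: replicate_Suc)
 show "xs:LU ==> ys:LU ==> x .: U ==> chain H (Tens (xs @ (c *.[U] x) # ys)) = c *.[Ch] chain H (Tens (xs @ x # ys))"
 using m[unfolded mlin_def, THEN conjunct2, rule_format, of xs x ys "length xs + length ys" c] by (simp add:gens_replicate n del: replicate_Suc)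
 show "xs:LU ==> ys:LU ==> x .: U ==> y .: U ==> a .: A ==>
 chain H (Tens (xs @ ract x a # y # ys)) = chain H (Tens (xs @ x # lact a y # ys))"
 using b[unfolded balanced_def, rule_format, of a xs x y ys "Suc (length xs + length ys)"] by (simp add:gens_replicate del: replicate_Suc)
qed

text \<open>Commutativity turns multiplication by a target element from the left into multiplication
  from the right, and balancing hands it to the preceding factor; repetition carries it to the
  head.\<close>

lemma chain_move:
 "xs:LU ==> ys:LU ==> x .: U ==> a .: A ==>
 chain H (Tens (xs @ lact a x # ys)) = chain H (Tens (lact a (hd (xs @ [x])) # tl (xs @ x # ys)))"
proof (induction xs arbitrary:x ys rule:rev_induct)
 case (snoc z xs)
 then have "chain H (Tens ((xs @ [z]) @ lact a x # ys)) = chain H (Tens (xs @ lact a z # x # ys))"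
 using chain_rules(5)[of xs ys z x a] tc by (simp add:U.m_comm)
 also have "... = chain H (Tens (lact a (hd (xs @ [z])) # tl (xs @ z # x # ys)))" using snoc by auto
 finally show ?case by (cases xs) auto
qed simp

lemma lin_ext_chains:
 assumes W: "vspace W" and B: "lin A W (%a. g (Base a))" and c: "!!us. us ~= [] ==> us:LU ==> g (Tens us) .: W"
 and a: "!!xs ys x y. xs:LU ==> ys:LU ==> x .: U ==> y .: U ==> g (Tens (xs @ (x +[U] y) # ys)) = g (Tens (xs @ x # ys)) +[W] g (Tens (xs @ y # ys))"
 and s: "!!xs ys x c. xs:LU ==> ys:LU ==> x .: U ==> g (Tens (xs @ (c *.[U] x) # ys)) = c *.[W] g (Tens (xs @ x # ys))"
 and b: "!!xs ys x y a. xs:LU ==> ys:LU ==> x .: U ==> y .: U ==> a .: A ==> g (Tens (xs @ ract x a # y # ys)) = g (Tens (xs @ x # lact a y # ys))"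
 shows "lin Ch W (lin_ext W g)" "w:X ==> lin_ext W g (chain H w) = g w"
proof -
 have g: "w:X ==> g w .: W" for w unfolding cgens_iff using c linD(1)[OF B] by (auto split: word.splits)
 have m0: "mlin [A] W (%as. g (Base (hd as)))" unfolding mlin_def gens_single using linD(2,3)[OF B] by (auto simp:append_eq_Cons_conv)
 have m: "mlin (replicate (Suc n) U) W (%us. g (Tens us))" for n unfolding mlin_def gens_replicate using a s by (auto simp del: replicate_Suc)
 have bb: "balanced (car A) ract lact (replicate (Suc n) U) (%us. g (Tens us))" for n unfolding balanced_def gens_replicate using b by auto
 have "ALL r:R. ev W g r = 0.[W]" by (subst ev_chain_rels[OF W g]) (use m0 m bb in auto)
 then have r: "!!r. r:R ==> ev W g r = 0.[W]" by blast
 show "lin Ch W (lin_ext W g)" "w:X ==> lin_ext W g (chain H w) = g w"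
 unfolding chains_def chain_def by (rule lin_ext_klinear[OF chain_rels_free W g r]; simp)+
qed

lemma chains_eqI:
 assumes "vspace W" "lin Ch W f" "lin Ch W g" "!!w. w:X ==> f (chain H w) = g (chain H w)" "t .: Ch"
 shows "f t = g t"
 by (rule lin_eqI[OF chain_rels_free assms(1-3)[unfolded chains_def]]) (insert assms(4,5), simp_all add: chains_def chain_def)

lemma chains_lin_ext_eq:
 assumes "vspace W" "lin Ch W f" "!!w. w:X ==> g w = f (chain H w)" "t .: Ch"
 shows "lin_ext W g t = f t" "p:t ==> ev W g p = f t" "p:t ==> keys p <= X" "t ~= {}"
proof -
 have t: "t .: pres X R" using assms(4) by (simp add:chains_def)
 show "lin_ext W g t = f t" "p:t ==> ev W g p = f t"
 using lin_ext_eq[OF chain_rels_free assms(1), where F = f and g = g and t = t] assms(2,3) t by (simp_all add: chains_def chain_def)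
 show "p:t ==> keys p <= X" by (rule pres_mem(1)[OF chain_rels_free t])
 show "t ~= {}" using pres_rep[OF chain_rels_free t] by blast
qed

lemma X_mem: "a .: A ==> Base a:X" "us ~= [] ==> us:LU ==> Tens us:X"
 unfolding cgens_iff by auto

lemma cact:
 assumes a: "a .: A"
 shows "lin Ch Ch (ca a)" "b .: A ==> ca a (chain H (Base b)) = chain H (Base (a **[A] b))"
 "us ~= [] ==> us:LU ==> ca a (chain H (Tens us)) = chain H (Tens (lact a (hd us) # tl us))"
proof -
 let ?g = "%w. case w of Base b=>chain H (Base (a **[A] b)) | Tens us=>chain H (Tens (lact a (hd us) # tl us))"
 have B: "lin A Ch (%b. ?g (Base b))"
 by (rule linI) (use a chain_closed X_mem(1) chain_rules(1,2) linD[OF bilinD(2)[OF walgD(2)[OF h(2)] a]] in auto)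
 have c: "?g (Tens us) .: Ch" if "us ~= []" "us:LU" for us
 using that a tc by (cases us) (auto intro!:chain_closed X_mem(2))
 have ad: "?g (Tens (xs @ (x +[U] y) # ys)) = ?g (Tens (xs @ x # ys)) +[Ch] ?g (Tens (xs @ y # ys))"
 if "xs:LU" "ys:LU" "x .: U" "y .: U" for xs ys x y
 using that a tc chain_rules(3)[of "[]" ys "lact a x" "lact a y"] chain_rules(3)[of "lact a (hd xs) # tl xs" ys x y] by (cases xs) (auto simp:U.r_distr)
 have sm: "?g (Tens (xs @ (c *.[U] x) # ys)) = c *.[Ch] ?g (Tens (xs @ x # ys))" if "xs:LU" "ys:LU" "x .: U" for xs ys x c
 using that a tc chain_rules(4)[of "[]" ys "lact a x" c] chain_rules(4)[of "lact a (hd xs) # tl xs" ys x c] lin3[OF bilinD(2)[OF walgD(2)[OF h(1)]]]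
 by (cases xs) auto
 have bal: "?g (Tens (xs @ ract x b # y # ys)) = ?g (Tens (xs @ x # lact b y # ys))"
 if "xs:LU" "ys:LU" "x .: U" "y .: U" "b .: A" for xs ys x y b
 using that a tc chain_rules(5)[of "[]" ys "lact a x" y b] chain_rules(5)[of "lact a (hd xs) # tl xs" ys x y b] by (cases xs) (auto simp:U.m_assoc)
 note E = lin_ext_chains[where g = ?g, OF vCh B, folded cact_def]
 show "lin Ch Ch (ca a)" by (rule E(1); (rule c ad sm bal)?; assumption)
 have e: "w:X ==> ca a (chain H w) = ?g w" for w by (rule E(2); (rule c ad sm bal)?; assumption)
 show "b .: A ==> ca a (chain H (Base b)) = chain H (Base (a **[A] b))"
 "us ~= [] ==> us:LU ==> ca a (chain H (Tens us)) = chain H (Tens (lact a (hd us) # tl us))"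
 using e[OF X_mem(1)] e[OF X_mem(2)] by simp_all
qed

lemma lin_lin2:
 assumes "vspace V" "vspace W" "lin V W f" "lin V W g"
 shows "lin V W (%x. f x +[W] g x)" "lin V W (%x. c *.[W] f x)"
 by (rule linI; use assms linD[OF assms(3)] linD[OF assms(4)] in \<open>simp add:vs_smult vs_smultC vs_add_ac[OF assms(2)]\<close>)+

lemma amodC: "amod H Ch ca"
proof -
 note v = vCh
 have c: "ca a x .: Ch" if "a .: A" "x .: Ch" for a x using linD(1)[OF cact(1)] that by blast
 have w: "!!P. (!!a. a .: A ==> P (Base a)) ==> (!!u us. u .: U ==> us:LU ==> P (Tens (u # us))) ==> (!!w. w:X ==> P w)"
 proof -
 fix P w assume "!!a. a .: A ==> P (Base a)" "!!u us. u .: U ==> us:LU ==> P (Tens (u # us))" "w:X"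
 then show "P w" unfolding cgens_iff by (cases w) (auto simp:neq_Nil_conv)
 qed
 have "lin A Ch (%a. ca a x)" if x: "x .: Ch" for x
 proof (rule linI)
 fix a b e assume a: "a .: A"
 show "ca a x .: Ch" using a x c by blast
 have "ca (e *.[A] a) (chain H w) = e *.[Ch] ca a (chain H w)" if "w:X" for w
 using that
 proof (rule w[rotated 2])
 fix u us assume u: "u .: U" "us:LU"
 then show "ca (e *.[A] a) (chain H (Tens (u # us))) = e *.[Ch] ca a (chain H (Tens (u # us)))"
 using a h(9) tc chain_rules(4)[of "[]" us "lact a u" e] by (simp add:cact linD(3)[OF h(4)] smult_mult)
 qed (insert a h(9) lin3[OF bilinD(1)[OF walgD(2)[OF h(2)]]], simp add:cact chain_rules(2))
 then show "ca (e *.[A] a) x = e *.[Ch] ca a x"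
 by (intro chains_eqI[OF v cact(1) lin_lin2(2)[OF v v cact(1) cact(1)] _ x]) (use a h(9) in auto)
 assume b: "b .: A"
 have "ca (a +[A] b) (chain H w) = ca a (chain H w) +[Ch] ca b (chain H w)" if "w:X" for w
 using that
 proof (rule w[rotated 2])
 fix u us assume u: "u .: U" "us:LU"
 then show "ca (a +[A] b) (chain H (Tens (u # us))) = ca a (chain H (Tens (u # us))) +[Ch] ca b (chain H (Tens (u # us)))"
 using a b tc chain_rules(3)[of "[]" us "lact a u" "lact b u"] by (simp add:cact linD(2)[OF h(4)] U.l_distr)
 qed (insert a b, simp add:cact chain_rules(1) A.l_distr)
 then show "ca (a +[A] b) x = ca a x +[Ch] ca b x"
 by (intro chains_eqI[OF v cact(1) lin_lin2(1)[OF v v cact(1) cact(1)] _ x]) (use a b in auto)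
 qed
 moreover have "ca 1.[A] x = x" if x: "x .: Ch" for x
 proof (rule chains_eqI[OF v cact(1)[OF A.one_closed] lin_id _ x])
 show "z:X ==> ca 1.[A] (chain H z) = chain H z" for z
 by (erule w[rotated 2]) (simp_all add: cact comm_hopfD(5)[OF H])
 qed
 moreover have "ca (a **[A] b) x = ca a (ca b x)" if x: "x .: Ch" and a: "a .: A" "b .: A" for a b x
 proof (rule chains_eqI[OF v cact(1)[OF A.m_closed[OF a]] linc[OF cact(1)[OF a(2)] cact(1)[OF a(1)]] _ x])
 show "z:X ==> ca (a **[A] b) (chain H z) = ca a (ca b (chain H z))" for z
 by (erule w[rotated 2]) (insert a tc, simp_all add: cact comm_hopfD(4)[OF H] U.m_assoc A.m_assoc)
 qed
 ultimately show ?thesis using v cact(1) by (auto simp:amod_def intro!:bilinI)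
qed

lemma cw_closed: "us:LU ==> cw H us .: Ch"
 unfolding cw_def using chain_closed X_mem by simp

lemma alin_cw: "alin H Ch ca (cw H)"
proof (rule alinI)
 fix xs ys x a assume *: "xs:LU" "ys:LU" "x .: U" "a .: A"
 show "cw H (xs @ lact a x # ys) = ca a (cw H (xs @ x # ys))"
 using * chain_move[OF *] cact(3)[OF *(4), of "xs @ x # ys"] by (cases xs) (auto simp:cw_def)
qed (insert cw_closed chain_rules(3), auto simp:cw_def)

context
 fixes T :: "('k,'t,'z) msch" and act
 assumes T: "amod H T act"
begin

text \<open>Multiplication by a scalar c is multiplication by the target of c times the unit, so
  linearity over the field follows from linearity over the base. A balancing relation holds because
  both of its sides are the same base multiple.\<close>

lemma chop_op:
 assumes F: "alin H T act F"
 shows "chain_op H T act (chop T act F)" "us:LU ==> chop T act F (cw H us) = F us"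
proof -
 note D = alinD[OF F] and v = amodD(1)[OF T] and ab = amodD(2)[OF T]
 let ?g = "%w. case w of Base a=>act a (F []) | Tens us=>F us"
 have B: "lin A T (%a. ?g (Base a))" using bilinD(1)[OF ab, of "F []"] D(1)[of "[]"] by simp
 have s: "F (xs @ (c *.[U] x) # ys) = c *.[T] F (xs @ x # ys)" if "xs:LU" "ys:LU" "x .: U" for xs ys x c
 proof -
 have "c *.[U] x = lact (c *.[A] 1.[A]) x" using that comm_hopfD(5)[OF H] lin3[OF h(4)] by (simp add:smult_mult)
 then show ?thesis
 using D(3)[OF that, of "c *.[A] 1.[A]"] D(1)[of "xs @ x # ys"] that h(9) lin3[OF bilinD(1)[OF ab], of _ "1.[A]" c] amodD(3)[OF T] by simp
 qed
 have b: "F (xs @ ract x a # y # ys) = F (xs @ x # lact a y # ys)" if "xs:LU" "ys:LU" "x .: U" "y .: U" "a .: A" for xs ys x y a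
 using D(3)[of xs "y # ys" x a] D(3)[of "xs @ [x]" ys y a] that tc by (simp add:U.m_comm)
 note E = lin_ext_chains[where g = ?g, OF v B, folded chop_def]
 have k: "lin Ch T (chop T act F)" and e: "w:X ==> chop T act F (chain H w) = ?g w" for w
 by (rule E; use D(1,2) s b in simp)+
 show cw: "chop T act F (cw H us) = F us" if "us:LU" for us
 using that e[OF X_mem(1)] e[OF X_mem(2)] amodD(3)[OF T] D(1)[of "[]"] by (simp add:cw_def)
 have "chop T act F (ca a x) = act a (chop T act F x)" if a: "a .: A" and x: "x .: Ch" for a x
 proof (rule chains_eqI[OF v linc[OF cact(1)[OF a] k] linc[OF k bilinD(2)[OF ab a]] _ x])
 fix w assume w: "w:X"
 show "chop T act F (ca a (chain H w)) = act a (chop T act F (chain H w))"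
 proof (cases w)
 case (Base b)
 then show ?thesis using w a e[OF X_mem(1)] amodD(4)[OF T] D(1)[of "[]"] unfolding cgens_iff by (simp add:cact)
 next
 case (Tens us)
 then obtain u vs where us: "us = u # vs" "u .: U" "vs:LU" using w unfolding cgens_iff by (cases us) auto
 then show ?thesis using w a tc e[OF X_mem(2)] D(3)[of "[]" vs u a] Tens by (simp add:cact)
 qed
 qed
 then show "chain_op H T act (chop T act F)" using k by (simp add:chain_op_def)
qed

text \<open>Degree zero is covered by base-linearity, because its generators are multiples of the
  empty word.\<close>

lemma chain_op_eqI:
 assumes f: "chain_op H T act f" and g: "chain_op H T act g" and eq: "!!us. us:LU ==> f (cw H us) = g (cw H us)" and x: "x .: Ch"
 shows "f x = g x"
proof (rule chains_eqI[OF amodD(1)[OF T] _ _ _ x])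
 show k: "lin Ch T f" "lin Ch T g" using f g by (auto simp:chain_op_def)
 fix w assume w: "w:X"
 show "f (chain H w) = g (chain H w)"
 proof (cases w)
 case (Base a)
 then have a: "a .: A" using w unfolding cgens_iff by simp
 then have "chain H w = ca a (cw H [])" using Base by (simp add:cw_def cact)
 then show ?thesis using f g eq[of "[]"] a cw_closed[of "[]"] by (simp add:chain_op_def)
 next
 case (Tens us)
 then show ?thesis using w eq[of us] unfolding cgens_iff by (simp add:cw_def)
 qed
qed

lemma chain_opD:
 assumes "chain_op H T act f"
 shows "lin Ch T f" "a .: A ==> x .: Ch ==> f (ca a x) = act a (f x)" "x .: Ch ==> f x .: T"
 using assms linD(1)[of Ch T f x] by (auto simp:chain_op_def)

lemma chain_op_add:
 assumes "chain_op H T act f" "chain_op H T act g"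
 shows "chain_op H T act (%x. f x +[T] g x)"
 using lin_lin2(1)[OF vCh amodD(1)[OF T] chain_opD(1)[OF assms(1)] chain_opD(1)[OF assms(2)]] chain_opD(2,3)[OF assms(1)] chain_opD(2,3)[OF assms(2)]
 lin2[OF bilinD(2)[OF amodD(2)[OF T]]] by (simp add:chain_op_def)

lemma chain_op_smult:
 assumes "chain_op H T act f"
 shows "chain_op H T act (%x. c *.[T] f x)"
 using lin_lin2(2)[OF vCh amodD(1)[OF T] chain_opD(1)[OF assms] chain_opD(1)[OF assms]] chain_opD(2,3)[OF assms]
 lin3[OF bilinD(2)[OF amodD(2)[OF T]]] by (simp add:chain_op_def)

lemma chain_op_act:
 assumes "chain_op H T act f" "b .: A"
 shows "chain_op H T act (%x. act b (f x))"
 using linc[OF chain_opD(1)[OF assms(1)] bl2[OF amodD(2)[OF T] assms(2)]] chain_opD(2,3)[OF assms(1)] amodD(4)[OF T] assms(2) A.m_comm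
 by (simp add:chain_op_def) metis

lemma chain_op_comp: "chain_op H T act f ==> chain_op H Ch ca g ==> chain_op H T act (%x. f (g x))"
 using linc[of Ch Ch g T f] lin1[of Ch Ch g] by (simp add:chain_op_def)

text \<open>Recursion on the head of the word. Additivity and equivariance of \<open>G\<close> are
  required jointly in the tail and in the recursive value, since a change in a later slot alters
  both at once.\<close>

lemma alin_rec:
 assumes F: "F [] .: T" "!!u us. u .: U ==> us:LU ==> F (u # us) = G u (cw H us) (F us)"
 and c: "!!u w f. u .: U ==> w .: Ch ==> f .: T ==> G u w f .: T"
 and a: "!!u v w f. u .: U ==> v .: U ==> w .: Ch ==> f .: T ==> G (u +[U] v) w f = G u w f +[T] G v w f"
 "!!u w w' f f'. u .: U ==> w .: Ch ==> w' .: Ch ==> f .: T ==> f' .: T ==> G u (w +[Ch] w') (f +[T] f') = G u w f +[T] G u w' f'"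
 and t: "!!u a w f. u .: U ==> a .: A ==> w .: Ch ==> f .: T ==> G (lact a u) w f = act a (G u w f)"
 "!!u a w f. u .: U ==> a .: A ==> w .: Ch ==> f .: T ==> G u (ca a w) (act a f) = act a (G u w f)"
 shows "alin H T act F"
proof (rule alinI)
 note w = alinD[OF alin_cw]
 show cl: "F us .: T" if "us:LU" for us using that by (induction us) (use F c w(1) in auto)
 show "F (xs @ (x +[U] y) # ys) = F (xs @ x # ys) +[T] F (xs @ y # ys)" if "xs:LU" "ys:LU" "x .: U" "y .: U" for xs ys x y
 using that by (induction xs) (use F(2) a w(1,2) cl in auto)
 show "F (xs @ lact b x # ys) = act b (F (xs @ x # ys))" if "xs:LU" "ys:LU" "x .: U" "b .: A" for xs ys x b
 using that by (induction xs) (use F(2) t w(1,3) cl tc in auto)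
qed

end

lemma alin_shift: "u .: U ==> alin H Ch ca (%us. cw H (u # us))"
 by (rule alinI) (use alinD[OF alin_cw] alinD(2,3)[OF alin_cw, of "u # xs" for xs] in auto)

lemma ccons:
 shows "u .: U ==> chain_op H Ch ca (cn u)"
 "u .: U ==> us:LU ==> cn u (cw H us) = cw H (u # us)"
 "bilin U Ch Ch (cn)" "u .: U ==> a .: A ==> x .: Ch ==> cn (lact a u) x = ca a (cn u x)"
proof -
 show op: "chain_op H Ch ca (cn u)" and e: "us:LU ==> cn u (cw H us) = cw H (u # us)" if "u .: U" for u us
 unfolding ccons_def using chop_op[OF amodC alin_shift[OF that]] by auto
 note eqI = chain_op_eqI[OF amodC] and w = alinD[OF alin_cw]
 show ta: "cn (lact a u) x = ca a (cn u x)" if "u .: U" "a .: A" "x .: Ch" for u a x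
 by (rule eqI[OF op chain_op_act[OF amodC op that(2)] _ that(3)]) (use that tc e w(3)[of "[]"] in auto)
 show "bilin U Ch Ch (cn)"
 proof (rule bilinI)
 show "lin Ch Ch (%y. cn u y)" if "u .: U" for u using chain_opD(1)[OF amodC op[OF that]] .
 show "lin U Ch (%u. cn u x)" if x: "x .: Ch" for x
 proof (rule linI)
 fix u v c assume u: "u .: U"
 show "cn u x .: Ch" using chain_opD(3)[OF amodC op[OF u] x] .
 have "c *.[U] u = lact (c *.[A] 1.[A]) u" using u comm_hopfD(5)[OF H] lin3[OF h(4)] by (simp add:smult_mult)
 then show "cn (c *.[U] u) x = c *.[Ch] cn u x"
 using ta[OF u _ x, of "c *.[A] 1.[A]"] h(9) lin3[OF bilinD(1)[OF amodD(2)[OF amodC]], of "cn u x" "1.[A]" c]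
 amodD(3)[OF amodC] chain_opD(3)[OF amodC op[OF u] x] by simp
 assume v: "v .: U"
 show "cn (u +[U] v) x = cn u x +[Ch] cn v x"
 by (rule eqI[OF op chain_op_add[OF amodC op op] _ x]) (use u v e w(2)[of "[]"] in auto)
 qed
 qed
qed

end

section \<open>The differential\<close>

context comm_hopf
begin

lemma LU_simps:
 assumes "us:LU"
 shows "k < length us ==> us ! k .: U" "take k us:LU" "drop k us:LU"
 using assms by (auto simp:in_lists_conv_set dest: in_set_takeD in_set_dropD)

abbreviation (input) "endo == chain_op H (chains H) ca"

declare vCh [simp]

context
 fixes T :: "('k,'t,'z) msch" and act
 assumes T: "amod H T act"
begin

lemma smult_act: "x .: T ==> c *.[T] x = act (c *.[A] 1.[A]) x"
 using linD(3)[OF bilinD(1)[OF amodD(2)[OF T]], of x "1.[A]" c] amodD(3)[OF T] by simp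

lemma chain_opI:
 assumes "!!x. x .: Ch ==> f x .: T" "!!x y. x .: Ch ==> y .: Ch ==> f (x +[Ch] y) = f x +[T] f y"
 "!!a x. a .: A ==> x .: Ch ==> f (ca a x) = act a (f x)"
 shows "chain_op H T act f"
proof -
 have "f (c *.[Ch] x) = c *.[T] f x" if "x .: Ch" for c x
 using assms(3)[of "c *.[A] 1.[A]" x] that assms(1)[OF that] h(9) smult_act[of "f x" c]
 lin3[OF bilinD(1)[OF amodD(2)[OF amodC]], of x "1.[A]" c] amodD(3)[OF amodC] by simp
 then show ?thesis using assms by (auto simp:chain_op_def intro!:linI)
qed

lemma chain_op_induct:
 assumes f: "chain_op H T act f" and g: "chain_op H T act g" and z: "f (cw H []) = g (cw H [])"
 and s: "!!u y. u .: U ==> y .: Ch ==> f y = g y ==> f (cn u y) = g (cn u y)" and x: "x .: Ch"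
 shows "f x = g x"
proof (rule chain_op_eqI[OF T f g _ x])
 fix us assume "us:LU"
 then show "f (cw H us) = g (cw H us)"
 proof (induction us)
 case (Cons u us)
 then show ?case using s[of u "cw H us"] cw_closed[of us] ccons(2)[of u us] by simp
 qed (rule z)
qed

text \<open>The recursion principle for chains: an operator is introduced by its value on the empty
  word and by a rule for \<open>ccons u x\<close>, where \<open>x\<close> may be any chain. The rule
  passes from words to chains because both sides are base-linear in \<open>x\<close>.\<close>

lemma chain_op_rec:
 assumes z: "z .: T"
 and c: "!!u w f. u .: U ==> w .: Ch ==> f .: T ==> G u w f .: T"
 and a: "!!u v w f. u .: U ==> v .: U ==> w .: Ch ==> f .: T ==> G (u +[U] v) w f = G u w f +[T] G v w f"
 "!!u w w' f f'. u .: U ==> w .: Ch ==> w' .: Ch ==> f .: T ==> f' .: T ==> G u (w +[Ch] w') (f +[T] f') = G u w f +[T] G u w' f'"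
 and t: "!!u a w f. u .: U ==> a .: A ==> w .: Ch ==> f .: T ==> G (lact a u) w f = act a (G u w f)"
 "!!u a w f. u .: U ==> a .: A ==> w .: Ch ==> f .: T ==> G u (ca a w) (act a f) = act a (G u w f)"
 defines "f == chop T act (rec_list z (%u us y. G u (cw H us) y))"
 shows "chain_op H T act f" "f (cw H []) = z" "u .: U ==> x .: Ch ==> f (cn u x) = G u x (f x)"
proof -
 let ?F = "rec_list z (%u us y. G u (cw H us) y)"
 have "alin H T act ?F" by (rule alin_rec[OF T, where G = G]) (use assms in auto)
 note C = chop_op[OF T this, folded f_def]
 show f: "chain_op H T act f" "f (cw H []) = z" using C by auto
 note fD = chain_opD[OF T f(1)] and k = linD[OF chain_opD(1)[OF T f(1)]]
 show "f (cn u x) = G u x (f x)" if u: "u .: U" and x: "x .: Ch" for u x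
 proof (rule chain_op_eqI[OF T chain_op_comp[OF T f(1) ccons(1)[OF u]] chain_opI _ x])
 show "f (cn u (cw H us)) = G u (cw H us) (f (cw H us))" if "us:LU" for us
 using that u C(2)[of "u # us"] C(2)[of us] ccons(2) by simp
 qed (use u c a(2) t(2) fD k in auto)
qed

end

lemma endo_simps:
 assumes "endo f"
 shows "x .: Ch ==> f x .: Ch" "x .: Ch ==> y .: Ch ==> f (x +[Ch] y) = f x +[Ch] f y"
 "x .: Ch ==> f (c *.[Ch] x) = c *.[Ch] f x" "a .: A ==> x .: Ch ==> f (ca a x) = ca a (f x)"
 "f 0.[Ch] = 0.[Ch]"
 using chain_opD[OF amodC assms] linD[OF chain_opD(1)[OF amodC assms]] lin_zero[OF chain_opD(1)[OF amodC assms]] by auto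

lemma endo_id: "endo (%x. x)"
 by (simp add:chain_op_def lin_id)

lemmas endo_add = chain_op_add[OF amodC]
lemmas endo_smult = chain_op_smult[OF amodC]
lemmas endo_act = chain_op_act[OF amodC]
lemmas endo_comp = chain_op_comp[OF amodC]
lemmas endo_ind = chain_op_induct[OF amodC]

lemmas cact_simps [simp] = endo_simps(1-3,5)[OF endo_act[OF endo_id]]

lemma cact_commute: "a .: A ==> b .: A ==> x .: Ch ==> ca a (ca b x) = ca b (ca a x)"
 by (rule endo_simps(4)[OF endo_act[OF endo_id]])

lemma cact_linear [simp]:
 "x .: Ch ==> ca 1.[A] x = x" "a .: A ==> b .: A ==> x .: Ch ==> ca (a **[A] b) x = ca a (ca b x)"
 "a .: A ==> b .: A ==> x .: Ch ==> ca (a +[A] b) x = ca a x +[Ch] ca b x"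
 using amodD(3,4)[OF amodC] lin2[OF bilinD(1)[OF amodD(2)[OF amodC]]] by auto

lemmas ccons_simps [simp] = endo_simps[OF ccons(1)] ccons(2,4)

lemma ccons_add [simp]: "u .: U ==> v .: U ==> x .: Ch ==> cn (u +[U] v) x = cn u x +[Ch] cn v x"
 by (rule linD(2)[OF bilinD(1)[OF ccons(3)]])

lemma counits [simp]:
 "u .: U ==> coun H u .: A" "u .: U ==> counR H u .: A"
 "u .: U ==> v .: U ==> coun H (u +[U] v) = coun H u +[A] coun H v"
 "u .: U ==> v .: U ==> counR H (u +[U] v) = counR H u +[A] counR H v"
 using linD[OF comm_hopfD(6)[OF H]] linD[OF h(6)] by auto

lemmas hopf_simps [simp] = comm_hopfD(8,9)[OF H] tc cw_closed
lemmas counit_mult = comm_hopfD(10,11)[OF H]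

text \<open>\<open>mop u\<close> multiplies the first tensor factor by \<open>u\<close>, \<open>sop\<close> is \<open>(- 1)^n\<close> in degree \<open>n\<close>, \<open>D0\<close> is the face \<open>d\<^sub>0\<close>,
 and \<open>D1\<close> is the alternating sum of the remaining faces.\<close>

definition "mop u = chop Ch ca (rec_list (ca (coun H u) (cw H [])) (%v us y. cn (u **[U] v) (cw H us)))"
definition "D0 = chop Ch ca (rec_list 0.[Ch] (%u us y. ca (counR H u) (cw H us)))"
definition "sop = chop Ch ca (rec_list (cw H []) (%u us y. (- 1) *.[Ch] cn u y))"
definition "D1 = chop Ch ca (rec_list 0.[Ch] (%u us y. (- 1) *.[Ch] (mop u (cw H us) +[Ch] cn u y)))"

lemma mop:
 assumes u: "u .: U"
 shows "endo (mop u)" "mop u (cw H []) = ca (coun H u) (cw H [])"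
 "v .: U ==> x .: Ch ==> mop u (cn v x) = cn (u **[U] v) x"
 unfolding mop_def
 by (rule chain_op_rec[OF amodC, where G = "%v w y. cn (u **[U] v) w"];
 use u in \<open>simp add:U.r_distr U.m_lcomm[of u "tgt H a" v for a v]\<close>)+

lemma D0: "endo D0" "D0 (cw H []) = 0.[Ch]" "u .: U ==> x .: Ch ==> D0 (cn u x) = ca (counR H u) x"
 unfolding D0_def
 by (rule chain_op_rec[OF amodC, where G = "%u w y. ca (counR H u) w"]; simp add:cact_commute)+

lemma sop: "endo sop" "sop (cw H []) = cw H []" "u .: U ==> x .: Ch ==> sop (cn u x) = (- 1) *.[Ch] cn u (sop x)"
 unfolding sop_def
 by (rule chain_op_rec[OF amodC, where G = "%u w y. (- 1) *.[Ch] cn u y"]; simp add:vs_smult)+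

lemmas mop_simps [simp] = endo_simps[OF mop(1)] mop(2,3)
lemmas D0_simps [simp] = endo_simps[OF D0(1)] D0(2,3)
lemmas sop_simps [simp] = endo_simps[OF sop(1)] sop(2,3)

lemma mop_linear:
 assumes "u .: U" "v .: U" "x .: Ch"
 shows "mop (u +[U] v) x = mop u x +[Ch] mop v x"
 "a .: A ==> mop (lact a u) x = ca a (mop u x)"
proof -
 show "mop (u +[U] v) x = mop u x +[Ch] mop v x"
 by (rule endo_ind[OF mop(1) endo_add[OF mop(1) mop(1)] _ _ assms(3)]) (insert assms, simp_all add: U.l_distr)
 show "mop (lact a u) x = ca a (mop u x)" if "a .: A"
 by (rule endo_ind[OF mop(1) endo_act[OF mop(1)] _ _ assms(3)]) (insert assms that, simp_all add: U.m_assoc)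
qed

text \<open>On the empty word this is multiplicativity of the counit, on longer words associativity
  in the head.\<close>

lemma mop_mult:
 assumes "u .: U" "v .: U" "x .: Ch"
 shows "mop (u **[U] v) x = mop u (mop v x)"
 by (rule endo_ind[OF mop(1) endo_comp[OF mop(1) mop(1)] _ _ assms(3)]) (insert assms, simp_all add: U.m_assoc cact_commute counit_mult)

text \<open>The face d_1 multiplies \<open>u\<close> into the next factor, and every higher face is
  a face of the tail with its index raised by one, whence the common sign. On a word of length one
  the last face is the counit, which is the value of \<open>mop\<close> on the empty word.\<close>

lemma D1: "endo D1" "D1 (cw H []) = 0.[Ch]"
 "u .: U ==> x .: Ch ==> D1 (cn u x) = (- 1) *.[Ch] (mop u x +[Ch] cn u (D1 x))"
 unfolding D1_def
 by (rule chain_op_rec[OF amodC, where G = "%u w y. (- 1) *.[Ch] (mop u w +[Ch] cn u y)"];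
 simp add:mop_linear vs_smult(2) vs_add_ac)+

lemmas D1_simps [simp] = endo_simps[OF D1(1)] D1(2,3)

lemma mop_commutes:
 assumes u: "u .: U" and x: "x .: Ch"
 shows "D0 (mop u x) = ca (counR H u) (D0 x)" "D1 (mop u x) = mop u (D1 x)" "sop (mop u x) = mop u (sop x)"
proof -
 show "D0 (mop u x) = ca (counR H u) (D0 x)"
 by (rule endo_ind[OF endo_comp[OF D0(1) mop(1)] endo_act[OF D0(1)] _ _ x]) (insert u, simp_all add: counit_mult)
 show "D1 (mop u x) = mop u (D1 x)"
 by (rule endo_ind[OF endo_comp[OF D1(1) mop(1)] endo_comp[OF mop(1) D1(1)] _ _ x]) (insert u, simp_all add: mop_mult)
 show "sop (mop u x) = mop u (sop x)"
 by (rule endo_ind[OF endo_comp[OF sop(1) mop(1)] endo_comp[OF mop(1) sop(1)] _ _ x]) (use u in simp_all)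
qed

lemma sop_sop: "x .: Ch ==> sop (sop x) = x"
 by (rule endo_ind[OF endo_comp[OF sop(1) sop(1)] endo_id]) (simp_all add: vs_smult(3)[symmetric])

text \<open>\<open>D0\<close> and \<open>D1\<close> lower the degree by one, which changes the sign
  recorded by \<open>sop\<close>.\<close>

lemma sop_anticommutes:
 assumes x: "x .: Ch"
 shows "D0 (sop x) = (- 1) *.[Ch] sop (D0 x)" "D1 (sop x) = (- 1) *.[Ch] sop (D1 x)"
proof -
 show "D0 (sop x) = (- 1) *.[Ch] sop (D0 x)"
 by (rule endo_ind[OF endo_comp[OF D0(1) sop(1)] endo_smult[OF endo_comp[OF sop(1) D0(1)]] _ _ x]) simp_all
 show "D1 (sop x) = (- 1) *.[Ch] sop (D1 x)"
 proof (rule endo_ind[OF endo_comp[OF D1(1) sop(1)] endo_smult[OF endo_comp[OF sop(1) D1(1)]] _ _ x])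
 fix u y assume *: "u .: U" "y .: Ch" "D1 (sop y) = (- 1) *.[Ch] sop (D1 y)"
 show "D1 (sop (cn u y)) = (- 1) *.[Ch] sop (D1 (cn u y))"
 by (rule vs_eqI[OF vCh]) (insert *(1,2), simp_all add: *(3) mop_commutes algebra_simps)
 qed simp
qed

lemma D1_D1: "x .: Ch ==> D1 (D1 x) = 0.[Ch]"
proof (rule endo_ind[OF endo_comp[OF D1(1) D1(1)], of "%x. 0.[Ch]"])
 show "endo (%x. 0.[Ch])" by (rule chain_opI[OF amodC]) auto
 fix u y assume *: "u .: U" "y .: Ch" "D1 (D1 y) = 0.[Ch]"
 show "D1 (D1 (cn u y)) = 0.[Ch]"
 by (rule vs_eqI[OF vCh]) (insert *(1,2), simp_all add: *(3) mop_commutes algebra_simps)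
qed simp_all

text \<open>Together with the vanishing of D1 D1 this is the vanishing of the square of the
  differential. The term d_0 d_0 cancels against the summand -d_0 d_1 of D0 D1, as the counit of a
  product is the product of counits; the other summands cancel against D1 D0.\<close>

lemma D0_D0:
 assumes x: "x .: Ch"
 shows "D0 (D0 x) +[Ch] (D0 (D1 x) +[Ch] D1 (D0 x)) = 0.[Ch]"
proof (rule endo_ind[OF endo_add[OF endo_comp[OF D0(1) D0(1)] endo_add[OF endo_comp[OF D0(1) D1(1)] endo_comp[OF D1(1) D0(1)]]], of "%x. 0.[Ch]"])
 show "endo (%x. 0.[Ch])" by (rule chain_opI[OF amodC]) auto
 fix u y assume *: "u .: U" "y .: Ch"
 show "D0 (D0 (cn u y)) +[Ch] (D0 (D1 (cn u y)) +[Ch] D1 (D0 (cn u y))) = 0.[Ch]"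
 by (rule vs_eqI[OF vCh]) (insert *, simp_all add: mop_commutes algebra_simps)
qed (use x in simp_all)

section \<open>Comparison with the alternating sum of faces\<close>

lemma face_Cons:
 assumes us: "us:LU" "us ~= []" and u: "u .: U" and i: "i : {1..length us}"
 shows "chain H (face H (Suc i) (u # us)) = cn u (chain H (face H i us))"
proof (cases "length us = 1")
 case True
 then obtain v where v: "us = [v]" "v .: U" "i = 1" using us i by (auto simp:length_Suc_conv One_nat_def)
 \<comment> \<open>The last face of a one-letter tail lies in degree zero; \<open>ccons\<close>
   turns it into multiplication of \<open>u\<close> by a target element, as the last face of the
   two-letter word prescribes.\<close>
 have "chain H (Base (coun H v)) = ca (coun H v) (cw H [])" using v by (simp add:cw_def cact)
 then have "cn u (chain H (Base (coun H v))) = ca (coun H v) (cw H [u])" using v u by simp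
 also have "... = chain H (Tens [lact (coun H v) u])" using v u by (simp add:cw_def cact)
 finally show ?thesis using v u comm_hopfD(7)[OF H] by (simp add:face_def Let_def U.m_comm)
next
 case False
 then obtain v w ws where us': "us = v # w # ws" using us(2) by (cases us; cases "tl us") (auto simp:One_nat_def)
 have c: "cn u (chain H (Tens vs)) = chain H (Tens (u # vs))" if "vs:LU" "vs ~= []" for vs
 using ccons(2)[OF u that(1)] that(2) by (simp add:cw_def)
 obtain j where j: "i = Suc j" using i by (cases i) auto
 have n: "us ! k .: U" if "k < length us" for k using LU_simps(1)[OF us(1) that] .
 show ?thesis
 proof (cases "i < length us")
 case True
 then have e: "face H i us = Tens (take j us @ (us ! j **[U] us ! i) # drop (i + 1) us)" using False j by (simp add:face_def Let_def)
 have "take j us @ (us ! j **[U] us ! i) # drop (i + 1) us:LU"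
 using us n[of j] n[of i] True j by (simp add:LU_simps)
 then show ?thesis unfolding e using True j us(2) by (subst c) (auto simp:face_def Let_def One_nat_def)
 next
 case eq: False
 then have k: "i = length us" using i by simp
 define m where "m = length ws"
 have e: "face H i us = Tens (take m us @ [us ! m **[U] tgt H (counR H (antip H (us ! Suc m)))])"
 using k us' m_def by (simp add:face_def Let_def One_nat_def)
 have "take m us @ [us ! m **[U] tgt H (counR H (antip H (us ! Suc m)))] : LU"
 using n[of m] n[of "Suc m"] LU_simps(2)[OF us(1), of m] us' m_def comm_hopfD(7)[OF H] by simp
 then show ?thesis unfolding e using k us' m_def by (subst c) (auto simp:face_def Let_def One_nat_def)
 qed
qed

text \<open>The functional \<open>L\<close> is arbitrary in the induction, because the step applies
  the hypothesis to \<open>L\<close> composed with tensoring by the head.\<close>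

lemma faces_D1:
 assumes "us:LU" "us ~= []" "lin Ch ground L"
 shows "(SUM i:{1..length us}. (- 1) ^ i * L (chain H (face H i us))) = L (D1 (cw H us))"
 using assms(2,1,3)
proof (induction us arbitrary:L)
 case (Cons u us)
 have L: "x .: Ch ==> y .: Ch ==> L (x +[Ch] y) = L x + L y" "x .: Ch ==> L (c *.[Ch] x) = c * L x" for x y c
 using linD[OF Cons.prems(3)] by simp_all
 have u: "u .: U" and us: "us:LU" using Cons.prems by auto
 have D: "L (D1 (cw H (u # us))) = - L (mop u (cw H us)) - L (cn u (D1 (cw H us)))"
 using u us L by (simp add:ccons(2)[OF u us, symmetric] algebra_simps del: ccons_simps(6))
 show ?case
 proof (cases us)
 case Nil
 have "mop u (cw H []) = chain H (Base (coun H u))" using u by (simp, simp add:cw_def cact)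
 then show ?thesis using u D Nil comm_hopfD(7)[OF H u] lin_zero[OF Cons.prems(3) vCh vspace_ground]
 by (simp add:face_def Let_def One_nat_def del: mop_simps(6))
 next
 case v: (Cons v ws)
 have 1: "chain H (face H 1 (u # us)) = mop u (cw H us)"
 proof -
 have "chain H (face H 1 (u # us)) = cw H ((u **[U] v) # ws)" using v by (simp add:face_def Let_def One_nat_def cw_def)
 then show ?thesis using u us v mop(3)[OF u, of v "cw H ws"] by simp
 qed
 have k: "lin Ch ground (%x. L (cn u x))"
 by (rule linc[OF _ Cons.prems(3)]) (insert ccons(1)[OF u], simp add:chain_op_def)
 have "(SUM i:{1..length (u # us)}. (- 1) ^ i * L (chain H (face H i (u # us))))
 = - L (chain H (face H 1 (u # us))) + (SUM i:{Suc 1..Suc (length us)}. (- 1) ^ i * L (chain H (face H i (u # us))))"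
 by (subst sum.atLeast_Suc_atMost) auto
 also have "(SUM i:{Suc 1..Suc (length us)}. (- 1) ^ i * L (chain H (face H i (u # us)))) = (SUM i:{1..length us}. (- 1) ^ Suc i * L (chain H (face H (Suc i) (u # us))))"
 by (rule sum.shift_bounds_cl_Suc_ivl)
 also have "... = - (SUM i:{1..length us}. (- 1) ^ i * L (cn u (chain H (face H i us))))"
 unfolding sum_negf[symmetric] by (rule sum.cong) (use face_Cons[OF us _ u] v in auto)
 also have "... = - L (cn u (D1 (cw H us)))" using Cons.IH[OF _ us k] v by simp
 finally show ?thesis using D 1 by simp
 qed
qed simp

lemma face_gens:
 assumes "us:LU" "us ~= []" "i <= length us"
 shows "face H i us:X"
proof -
 have n: "us ! k .: U" if "k < length us" for k using LU_simps(1)[OF assms(1) that] .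
 have "1 < length us" if "length us ~= 1" using that assms(2) by (cases us) (auto simp:One_nat_def)
 then show ?thesis
 unfolding cgens_iff using assms n[of 0] n[of "i - 1"] n[of i] n[of 1] n[of "length us - 2"] n[of "length us - 1"] comm_hopfD(7)[OF H]
 by (auto simp:face_def Let_def One_nat_def LU_simps)
qed

lemma differential:
 assumes t: "t .: Ch"
 shows "differential H t = D0 t +[Ch] D1 t"
proof -
 have k: "lin Ch Ch (%t. D0 t +[Ch] D1 t)" using endo_add[OF D0(1) D1(1)] by (simp add:chain_op_def)
 show ?thesis unfolding differential_def
 proof (rule chains_lin_ext_eq(1)[OF vCh k _ t])
 fix w assume w: "w:X"
 show "(case w of Base a=>0.[Ch] | Tens us=>\<Oplus>\<^bsub>Ch\<^esub>i\<in>{..length us}. (- 1) ^ i *.[Ch] chain H (face H i us))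
 = D0 (chain H w) +[Ch] D1 (chain H w)"
 proof (cases w)
 case (Base a)
 then have a: "a .: A" using w unfolding cgens_iff by simp
 then have "chain H w = ca a (cw H [])" using Base by (simp add:cw_def cact)
 then show ?thesis using Base a by simp
 next
 case (Tens us)
 then have us: "us:LU" "us ~= []" using w unfolding cgens_iff by auto
 then obtain u vs where v: "us = u # vs" "u .: U" "vs:LU" by (cases us) auto
 have cl: "(%i. (- 1) ^ i *.[Ch] chain H (face H i us)) : {..length us} \<rightarrow> car Ch"
 using chain_closed[OF face_gens[OF us]] by auto
 have f0: "chain H (face H 0 us) = D0 (cw H us)"
 proof -
 have "chain H (face H 0 us) = ca (counR H u) (cw H vs)"
 using v by (cases vs) (auto simp:face_def Let_def One_nat_def cw_def cact)
 then show ?thesis using v D0(3)[of u "cw H vs"] by simp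
 qed
 have w': "chain H w = cw H us" using Tens us by (simp add:cw_def)
 have "(\<Oplus>\<^bsub>Ch\<^esub>i\<in>{..length us}. (- 1) ^ i *.[Ch] chain H (face H i us)) = D0 (cw H us) +[Ch] D1 (cw H us)"
 proof (rule vs_eqI[OF vCh])
 fix L :: "(('u,'a) word \<Rightarrow>\<^sub>0 'k) set=>'k"
 assume L: "lin Ch ground L" "!!u v. u .: Ch ==> v .: Ch ==> L (u +[Ch] v) = L u + L v" "!!c u. u .: Ch ==> L (c *.[Ch] u) = c * L u"
 have "L (\<Oplus>\<^bsub>Ch\<^esub>i\<in>{..length us}. (- 1) ^ i *.[Ch] chain H (face H i us)) = (SUM i:{..length us}. (- 1) ^ i * L (chain H (face H i us)))"
 unfolding L_finsum[OF L(1) vCh cl] using chain_closed[OF face_gens[OF us]] L(3) by simp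
 also have "... = L (chain H (face H 0 us)) + (SUM i:{1..length us}. (- 1) ^ i * L (chain H (face H i us)))"
 by (simp add:sum.atMost_shift sum.atLeast1_atMost_eq One_nat_def lessThan_atLeast0)
 finally show "L (\<Oplus>\<^bsub>Ch\<^esub>i\<in>{..length us}. (- 1) ^ i *.[Ch] chain H (face H i us)) = L (D0 (cw H us) +[Ch] D1 (cw H us))"
 using faces_D1[OF us L(1)] L(2) us f0 by simp
 qed (use us vs_finsum_closed[OF vCh cl] in simp_all)
 then show ?thesis using Tens w' by simp
 qed
 qed
qed

lemma differential_sop: "x .: Ch ==> differential H (sop x) = (- 1) *.[Ch] sop (differential H x)"
 by (simp add:differential sop_anticommutes vs_smult(2))

lemma endo_differential: "lin Ch Ch (differential H)"
 by (subst lin_cong[OF vCh, of "differential H" "%t. D0 t +[Ch] D1 t"])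
 (insert endo_add[OF D0(1) D1(1)] differential, auto simp:chain_op_def)

lemma differential_differential:
 assumes x: "x .: Ch"
 shows "differential H (differential H x) = 0.[Ch]"
proof -
 have "D0 (D0 x) +[Ch] D0 (D1 x) +[Ch] (D1 (D0 x) +[Ch] D1 (D1 x)) = D0 (D0 x) +[Ch] (D0 (D1 x) +[Ch] D1 (D0 x))"
 using x D1_D1[OF x] by (simp add:vs_add_ac)
 then show ?thesis using x D0_D0[OF x] by (simp add:differential)
qed

end

section \<open>The shuffle product\<close>

context comm_hopf
begin

text \<open>Two nested recursions, because each step of the shuffle shortens only one argument: the
  outer one runs over the left word, the inner one, through \<open>chop\<close>, over the right
  chain. The sign is that of moving \<open>v\<close> past all letters of the left word.\<close>

primrec lsh :: "'u list=>(('u,'a) word \<Rightarrow>\<^sub>0 'k) set=>(('u,'a) word \<Rightarrow>\<^sub>0 'k) set" where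
 "lsh [] = (%y. y)"
| "lsh (u # us) = chop Ch ca (rec_list (cw H (u # us)) (%v vs y.
 cn u (lsh us (cn v (cw H vs))) +[Ch] (- 1) ^ length (u # us) *.[Ch] cn v y))"

lemma lsh:
 assumes "us:LU"
 shows "endo (lsh us)" "lsh us (cw H []) = cw H us"
 "us = u # us' ==> v .: U ==> y .: Ch ==>
 lsh us (cn v y) = cn u (lsh us' (cn v y)) +[Ch] (- 1) ^ length us *.[Ch] cn v (lsh us y)"
proof -
 have "endo (lsh us) & lsh us (cw H []) = cw H us & (ALL u us' v y. us = u # us' --> v .: U --> y .: Ch -->
 lsh us (cn v y) = cn u (lsh us' (cn v y)) +[Ch] (- 1) ^ length us *.[Ch] cn v (lsh us y))"
 using assms
 proof (induction us)
 case (Cons u us)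
 then have u: "u .: U" "us:LU" and IH: "endo (lsh us)" by auto
 note [simp] = endo_simps[OF IH]
 note C = chain_op_rec[OF amodC, where G = "%v w y. cn u (lsh us (cn v w)) +[Ch] (- 1) ^ length (u # us) *.[Ch] cn v y"
 and z = "cw H (u # us)", folded lsh.simps(2)]
 have "endo (lsh (u # us))" "lsh (u # us) (cw H []) = cw H (u # us)"
 "!!v y. v .: U ==> y .: Ch ==>
 lsh (u # us) (cn v y) = cn u (lsh us (cn v y)) +[Ch] (- 1) ^ length (u # us) *.[Ch] cn v (lsh (u # us) y)"
 by (rule C; use u in \<open>simp add:vs_smult(2) vs_add_ac\<close>)+
 then show ?case by blast
 qed (auto simp:endo_id)
 then show "endo (lsh us)" "lsh us (cw H []) = cw H us"
 "us = u # us' ==> v .: U ==> y .: Ch ==>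
 lsh us (cn v y) = cn u (lsh us' (cn v y)) +[Ch] (- 1) ^ length us *.[Ch] cn v (lsh us y)"
 by auto
qed

text \<open>Linearity in the slots of the left word is what allows that word to be replaced by a
  chain. The right argument is generalised, since the recursion evaluates shorter left words on
  other chains.\<close>

lemma alin_lsh: "y .: Ch ==> alin H Ch ca (%us. lsh us y)"
proof (rule alinI)
 note w = alinD[OF alin_cw]
 show "us:LU ==> lsh us y .: Ch" if "y .: Ch" for us using that by (rule endo_simps(1)[OF lsh(1), rotated])
 show "lsh (xs @ (x +[U] z) # ys) y = lsh (xs @ x # ys) y +[Ch] lsh (xs @ z # ys) y"
 if "y .: Ch" and *: "xs:LU" "ys:LU" "x .: U" "z .: U" for xs ys x z
 using that(1) *(1)
 proof (induction xs arbitrary:y)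
 case Nil
 note E = lsh[of "(x +[U] z) # ys"] lsh[of "x # ys"] lsh[of "z # ys"] endo_simps[OF lsh(1)]
 show ?case
 by (rule endo_ind[OF _ endo_add _ _ Nil(1)]) (insert * E w(2)[of "[]" ys x z], auto simp:vs_smult(2) vs_add_ac simp del: lsh.simps)
 next
 case (Cons u xs)
 then have u: "u .: U" "xs:LU" by auto
 note E = lsh[of "u # xs @ (x +[U] z) # ys"] lsh[of "u # xs @ x # ys"] lsh[of "u # xs @ z # ys"] endo_simps[OF lsh(1)]
 show ?case
 by (rule endo_ind[OF _ endo_add _ _ Cons.prems(1)])
 (insert * u E w(2)[of "u # xs" ys x z] Cons.IH, auto simp:vs_smult(2) vs_add_ac simp del: lsh.simps)
 qed
 show "lsh (xs @ lact a x # ys) y = ca a (lsh (xs @ x # ys) y)"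
 if "y .: Ch" and *: "xs:LU" "ys:LU" "x .: U" "a .: A" for xs ys x a
 using that(1) *(1)
 proof (induction xs arbitrary:y)
 case Nil
 note E = lsh[of "lact a x # ys"] lsh[of "x # ys"] endo_simps[OF lsh(1)]
 show ?case
 by (rule endo_ind[OF _ endo_act _ _ Nil(1)]) (insert * E w(3)[of "[]" ys x a], auto simp del: lsh.simps)
 next
 case (Cons u xs)
 then have u: "u .: U" "xs:LU" by auto
 note E = lsh[of "u # xs @ lact a x # ys"] lsh[of "u # xs @ x # ys"] endo_simps[OF lsh(1)]
 show ?case
 by (rule endo_ind[OF _ endo_act _ _ Cons.prems(1)]) (insert * u E w(3)[of "u # xs" ys x a] Cons.IH, auto simp del: lsh.simps)
 qed
qed

definition "sh x y = chop Ch ca (%us. lsh us y) x"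

lemma sh_left:
 assumes "y .: Ch"
 shows "endo (%x. sh x y)" "us:LU ==> sh (cw H us) y = lsh us y"
 unfolding sh_def using chop_op[OF amodC alin_lsh[OF assms]] by auto

lemmas sh_left_simps [simp] = endo_simps[OF sh_left(1)]

lemma sh_right: "x .: Ch ==> endo (sh x)"
proof (rule chain_opI[OF amodC])
 fix y assume x: "x .: Ch" and y: "y .: Ch"
 note s = sh_left(2) endo_simps[OF lsh(1)]
 show "sh x y .: Ch" using x y by simp
 show "sh x (y +[Ch] y') = sh x y +[Ch] sh x y'" if y': "y' .: Ch" for y'
 by (rule chain_op_eqI[OF amodC sh_left(1) endo_add[OF sh_left(1) sh_left(1)] _ x]) (use y y' s in auto)
 show "sh x (ca a y) = ca a (sh x y)" if a: "a .: A" for a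
 by (rule chain_op_eqI[OF amodC sh_left(1) endo_act[OF sh_left(1)] _ x]) (use y a s in auto)
qed

lemmas sh_right_simps [simp] = endo_simps[OF sh_right]

lemma sh_unit [simp]: "y .: Ch ==> sh (cw H []) y = y" "x .: Ch ==> sh x (cw H []) = x"
proof -
 show "y .: Ch ==> sh (cw H []) y = y" using sh_left(2)[of y "[]"] by simp
 show "x .: Ch ==> sh x (cw H []) = x"
 by (rule chain_op_eqI[OF amodC sh_left(1) endo_id]) (use sh_left(2) lsh(2) in auto)
qed

lemma sop_cw: "us:LU ==> sop (cw H us) = (- 1) ^ length us *.[Ch] cw H us"
proof (induction us)
 case (Cons u us)
 then show ?case using sop(3)[of u "cw H us"] vs_smult(3)[OF vCh, of "cw H (u # us)" "-1" "(-1) ^ length us"] by simp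
qed simp

text \<open>Writing the degree sign as \<open>sop\<close> frees the recursion from word lengths, so
  that it holds for arbitrary chains in both arguments.\<close>

lemma sh_cons [simp]:
 assumes u: "u .: U" and v: "v .: U" and x: "x .: Ch" and y: "y .: Ch"
 shows "sh (cn u x) (cn v y) = cn u (sh x (cn v y)) +[Ch] cn v (sh (sop (cn u x)) y)"
proof (rule chain_op_eqI[OF amodC _ _ _ x])
 fix us assume us: "us:LU"
 then have l: "u # us:LU" using u by simp
 show "sh (cn u (cw H us)) (cn v y) = cn u (sh (cw H us) (cn v y)) +[Ch] cn v (sh (sop (cn u (cw H us))) y)"
 unfolding ccons(2)[OF u us] sop_cw[OF l] using lsh(3)[OF l _ v y] sh_left(2)[OF _ l] sh_left(2)[OF _ us] l v y endo_simps(1)[OF lsh(1)[OF l] y] by (simp del: lsh.simps)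
qed (insert u v y, auto intro!:chain_opI[OF amodC] simp:vs_smult vs_add_ac)

text \<open>\<open>mop\<close> multiplies into whichever letter comes first in a shuffle. Compared
  with multiplying into one fixed argument, the terms headed by the letter of the other argument
  have to be replaced by terms headed by the product; these product terms cancel in
  \<open>D1_sh\<close>.\<close>

lemma mop_sh:
 assumes u: "u .: U" and v: "v .: U" and x: "x .: Ch" and y: "y .: Ch"
 shows "mop u (sh x (cn v y)) = sh (mop u x) (cn v y) +[Ch]
 (cn (u **[U] v) (sh (sop x) y) +[Ch] (- 1) *.[Ch] cn v (sh (sop (mop u x)) y))"
 "mop v (sh (cn u x) y) = sh (cn u x) (mop v y) +[Ch]
 (cn (u **[U] v) (sh x y) +[Ch] (- 1) *.[Ch] cn u (sh x (mop v y)))"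
proof -
 show "mop u (sh x (cn v y)) = sh (mop u x) (cn v y) +[Ch]
 (cn (u **[U] v) (sh (sop x) y) +[Ch] (- 1) *.[Ch] cn v (sh (sop (mop u x)) y))"
 proof (rule endo_ind[OF _ _ _ _ x])
 fix w x' assume "w .: U" "x' .: Ch"
 then show "mop u (sh (cn w x') (cn v y)) = sh (mop u (cn w x')) (cn v y) +[Ch]
 (cn (u **[U] v) (sh (sop (cn w x')) y) +[Ch] (- 1) *.[Ch] cn v (sh (sop (mop u (cn w x'))) y))"
 by (intro vs_eqI[OF vCh]) (insert u v y, simp_all add: algebra_simps)
 next
 show "mop u (sh (cw H []) (cn v y)) = sh (mop u (cw H [])) (cn v y) +[Ch]
 (cn (u **[U] v) (sh (sop (cw H [])) y) +[Ch] (- 1) *.[Ch] cn v (sh (sop (mop u (cw H []))) y))"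
 by (rule vs_eqI[OF vCh]) (use u v y in simp_all)
 qed (rule chain_opI[OF amodC]; use u v y in \<open>simp add:vs_smult(2) vs_add_ac\<close>)+
 show "mop v (sh (cn u x) y) = sh (cn u x) (mop v y) +[Ch]
 (cn (u **[U] v) (sh x y) +[Ch] (- 1) *.[Ch] cn u (sh x (mop v y)))"
 proof (rule endo_ind[OF _ _ _ _ y])
 fix w y' assume "w .: U" "y' .: Ch"
 then show "mop v (sh (cn u x) (cn w y')) = sh (cn u x) (mop v (cn w y')) +[Ch]
 (cn (u **[U] v) (sh x (cn w y')) +[Ch] (- 1) *.[Ch] cn u (sh x (mop v (cn w y'))))"
 by (intro vs_eqI[OF vCh]) (insert u v x, simp_all add: algebra_simps U.m_comm[of v u])
 next
 show "mop v (sh (cn u x) (cw H [])) = sh (cn u x) (mop v (cw H [])) +[Ch]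
 (cn (u **[U] v) (sh x (cw H [])) +[Ch] (- 1) *.[Ch] cn u (sh x (mop v (cw H []))))"
 by (rule vs_eqI[OF vCh]) (insert u v x, simp_all add: U.m_comm[of v u])
 qed (rule chain_opI[OF amodC]; use u v x in \<open>simp add:vs_smult(2) vs_add_ac\<close>)+
qed

text \<open>The first letter of a shuffle is the first letter of one of the two arguments; removing
  it by the counit gives the two terms.\<close>

lemma D0_sh:
 assumes x: "x .: Ch" and y: "y .: Ch"
 shows "D0 (sh x y) = sh (D0 x) y +[Ch] sh (sop x) (D0 y)"
proof (rule endo_ind[OF _ _ _ _ x])
 fix u x' assume u: "u .: U" "x' .: Ch"
 show "D0 (sh (cn u x') y) = sh (D0 (cn u x')) y +[Ch] sh (sop (cn u x')) (D0 y)"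
 proof (rule endo_ind[OF _ _ _ _ y])
 qed (rule chain_opI[OF amodC]; use u in \<open>simp add:vs_smult(2) vs_add_ac\<close> | use u in simp)+
qed (rule chain_opI[OF amodC]; use y in \<open>simp add:vs_smult(2) vs_add_ac\<close> | use y in simp)+

text \<open>Induction on the left word and, inside it, on the right chain. Left arguments are words
  so that \<open>sop\<close> acts on them by a scalar, and the product terms coming from the two
  parts of \<open>mop_sh\<close> then occur with opposite signs.\<close>

lemma D1_sh:
 assumes x: "x .: Ch" and y: "y .: Ch"
 shows "D1 (sh x y) = sh (D1 x) y +[Ch] sh (sop x) (D1 y)"
proof (rule chain_op_eqI[OF amodC _ _ _ x])
 fix us assume us: "us:LU"
 show "D1 (sh (cw H us) y) = sh (D1 (cw H us)) y +[Ch] sh (sop (cw H us)) (D1 y)"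
 using y us
 proof (induction us arbitrary:y)
 case (Cons u us)
 \<comment> \<open>\<open>c\<close> is the sign of the degree of the tensor of \<open>u\<close> with
   \<open>x\<close>. On \<open>x\<close> and on \<open>mop u x\<close>, one degree lower,
   \<open>sop\<close> acts by -c, and on \<open>D1 x\<close>, two degrees lower, again by
   \<open>c\<close>.\<close>
 define x c where "x = cw H us" and "c = (- 1 :: 'k) ^ length (u # us)"
 have u: "u .: U" and x: "x .: Ch" and cu: "cw H (u # us) = cn u x" using Cons.prems x_def by auto
 have c: "c * c = 1" by (simp add:c_def)
 have s: "sop (cn u x) = c *.[Ch] cn u x" "sop x = (- c) *.[Ch] x"
 unfolding cu[symmetric] c_def x_def using sop_cw[of "u # us"] sop_cw[of us] Cons.prems(2) by simp_all
 have sD: "sop (D1 x) = c *.[Ch] D1 x" "sop (mop u x) = (- c) *.[Ch] mop u x"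
 proof -
 have "(- 1) *.[Ch] sop (D1 x) = (- c) *.[Ch] D1 x" using sop_anticommutes(2)[OF x] x s by simp
 then have "(- 1) *.[Ch] ((- 1) *.[Ch] sop (D1 x)) = (- 1) *.[Ch] ((- c) *.[Ch] D1 x)" by simp
 then show "sop (D1 x) = c *.[Ch] D1 x" using x by (simp only:vs_smult(3)[symmetric] vCh D1_simps sop_simps) simp
 show "sop (mop u x) = (- c) *.[Ch] mop u x" using mop_commutes(3)[OF u x] u x s by simp
 qed
 have IH: "D1 (sh x y) = sh (D1 x) y +[Ch] (- c) *.[Ch] sh x (D1 y)" if "y .: Ch" for y
 using Cons.IH[OF that] Cons.prems x that by (simp add:x_def[symmetric] s)
 show ?case unfolding cu
 proof (rule endo_ind[OF _ _ _ _ Cons.prems(1)])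
 fix v y assume v: "v .: U" "y .: Ch"
 and I: "D1 (sh (cn u x) y) = sh (D1 (cn u x)) y +[Ch] sh (sop (cn u x)) (D1 y)"
 note sim = s sD IH mop_sh(1)[OF u v(1) x v(2)] mop_sh(2)[OF u v(1) x v(2)]
 have I': "D1 (sh (cn u x) y) = (- 1) *.[Ch] (sh (mop u x) y +[Ch] sh (cn u (D1 x)) y) +[Ch] c *.[Ch] sh (cn u x) (D1 y)"
 using I u x v by (simp add:s del: sop_simps(7))
 show "D1 (sh (cn u x) (cn v y)) = sh (D1 (cn u x)) (cn v y) +[Ch] sh (sop (cn u x)) (D1 (cn v y))"
 proof (rule vs_eqI[OF vCh])
 fix L :: "(('u,'a) word \<Rightarrow>\<^sub>0 'k) set=>'k"
 assume L: "!!u v. u .: Ch ==> v .: Ch ==> L (u +[Ch] v) = L u + L v" "!!c u. u .: Ch ==> L (c *.[Ch] u) = c * L u"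
 have cc: "c * (c * z) = z" for z using c by (simp add:mult.assoc[symmetric])
 have so: "sop (cn u (D1 x)) = (- c) *.[Ch] cn u (D1 x)" using u x by (simp add:sD vs_smult(3)[symmetric])
 have sc: "sh (cn u z) (cn v z') = cn u (sh z (cn v z')) +[Ch] cn v (sh (sop (cn u z)) z')" if "z .: Ch" "z' .: Ch" for z z'
 using sh_cons[OF u v(1) that] .
 show "L (D1 (sh (cn u x) (cn v y))) = L (sh (D1 (cn u x)) (cn v y) +[Ch] sh (sop (cn u x)) (D1 (cn v y)))"
 using u x v L by (simp add:sim I' so sc cc algebra_simps del: sop_simps(7) sh_cons)
 qed (use u x v in simp_all)
 qed (rule chain_opI[OF amodC]; use u x in \<open>simp add:vs_smult(2) vs_add_ac\<close> | use u x in simp)+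
 qed simp
qed (rule chain_opI[OF amodC]; use y in \<open>simp add:vs_smult(2) vs_add_ac\<close>)+

lemma differential_sh:
 "x .: Ch ==> y .: Ch ==> differential H (sh x y) = sh (differential H x) y +[Ch] sh (sop x) (differential H y)"
 by (simp add:differential D0_sh D1_sh vs_add_ac)

end

section \<open>Shuffle permutations\<close>

abbreviation (input) "finv == inv_into UNIV"

definition lift :: "(nat=>nat)=>nat=>nat" where
 "lift ta i = (case i of 0=>0 | Suc j=>Suc (ta j))"

text \<open>The cycle that sends position m to 0 and shifts the earlier positions up. Followed by a
  lifted shuffle, it gives the shuffles that place the first letter of the second word in
  front.\<close>

definition cyc :: "nat=>nat=>nat" where
 "cyc m i = (if i < m then Suc i else if i = m then 0 else i)"

definition uncyc :: "nat=>nat=>nat" where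
 "uncyc m i = (if i = 0 then m else if i <= m then i - 1 else i)"

lemma lift_simps [simp]: "lift ta 0 = 0" "lift ta (Suc i) = Suc (ta i)"
 by (simp_all add: lift_def)

lemma lift_comp: "lift (sg \<circ> ta) = lift sg \<circ> lift ta" "lift id = id"
 by (auto simp:lift_def fun_eq_iff split: nat.splits)

lemma inv_lift:
 assumes "bij ta"
 shows "bij (lift ta) & finv (lift ta) = lift (finv ta)"
proof -
 have "lift ta \<circ> lift (finv ta) = id" "lift (finv ta) \<circ> lift ta = id"
 by (metis assms lift_comp bij_is_surj surj_iff, metis assms lift_comp bij_is_inj inj_iff)
 then show ?thesis using o_bij inv_unique_comp by blast
qed

lemma inv_cyc: "bij (cyc m)" "finv (cyc m) = uncyc m"
proof -
 have "cyc m \<circ> uncyc m = id" "uncyc m \<circ> cyc m = id" by (auto simp:cyc_def uncyc_def fun_eq_iff)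
 then show "bij (cyc m)" "finv (cyc m) = uncyc m" using o_bij inv_unique_comp by blast+
qed

lemma permutes_bij_iff: "p permutes S <-> bij p & (ALL x. x \<notin> S --> p x = x)"
 by (auto simp:permutes_def bij_iff)

lemma lift_permutes: "ta permutes {..<n} ==> lift ta permutes {..<Suc n}"
 using inv_lift by (auto simp:permutes_bij_iff lift_def split: nat.splits)

lemma cyc_permutes: "m < n ==> cyc m permutes {..<n}"
 using inv_cyc(1) by (auto simp:permutes_bij_iff cyc_def)

lemma permutes_lift:
 assumes "sg permutes {..<Suc n}" "sg 0 = 0"
 obtains ta where "ta permutes {..<n}" "sg = lift ta"
proof
 have b: "bij sg" and o: "!!x. x >= Suc n ==> sg x = x" using assms(1) by (auto simp:permutes_bij_iff)
 have nz: "sg (Suc i) ~= 0" "finv sg (Suc i) ~= 0" for i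
 using assms(2) bij_is_inj[OF b] b by (metis inj_eq nat.distinct(1), metis bij_inv_eq_iff nat.distinct(1))
 let ?t = "%i. sg (Suc i) - 1"
 show e: "sg = lift ?t" using assms(2) nz(1) by (auto simp:lift_def fun_eq_iff split: nat.splits)
 have "(%i. finv sg (Suc i) - 1) \<circ> ?t = id" "?t \<circ> (%i. finv sg (Suc i) - 1) = id"
 using nz b by (auto simp:fun_eq_iff bij_inv_eq_iff inv_f_f[OF bij_is_inj] surj_f_inv_f[OF bij_is_surj])
 then show "?t permutes {..<n}" using o_bij o by (auto simp:permutes_bij_iff)
qed

text \<open>Lifting respects composition and takes transpositions to transpositions.\<close>

lemma sign_lift:
 assumes "ta permutes {..<n}"
 shows "sign (lift ta) = sign ta"
 using assms finite_lessThan
proof (induction rule:permutes_induct)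
 case (swap a b p)
 have P: "permutation p" "permutation (lift p)"
 using permutes_imp_permutation[OF _ \<open>p permutes {..<n}\<close>] permutes_imp_permutation[OF _ lift_permutes[OF \<open>p permutes {..<n}\<close>]] by auto
 have l: "lift (transpose a b) = transpose (Suc a) (Suc b)"
 by (auto simp:lift_def fun_eq_iff transpose_def split: nat.splits)
 show ?case
 by (simp only:lift_comp(1) l sign_compose[OF permutation_swap_id P(1)] sign_compose[OF permutation_swap_id P(2)] sign_swap_id
 \<open>sign (lift p) = sign p\<close> nat.inject)
qed (simp_all only: lift_comp)

lemma sign_cyc: "sign (cyc m) = (- 1) ^ m"
proof (induction m)
 case 0
 have "cyc 0 = id" by (auto simp:cyc_def)
 then show ?case by simp
next
 case (Suc m)
 have e: "cyc (Suc m) = cyc m \<circ> transpose m (Suc m)" by (auto simp:cyc_def fun_eq_iff transpose_def)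
 have "permutation (cyc m)" using permutes_imp_permutation[OF _ cyc_permutes[of m "Suc m"]] by simp
 then show ?case unfolding e using sign_compose[OF _ permutation_swap_id, of "cyc m" m "Suc m"] by (simp only:sign_swap_id Suc) simp
qed

text \<open>An increasing permutation of an initial segment fixes 0, and removing 0 allows
  induction.\<close>

lemma Sh_zero: "Sh 0 q = {id}" "Sh p 0 = {id}"
proof -
 have id: "sg = id" if s: "sg permutes {..<n}" and m: "strict_mono_on {..<n} sg" for sg :: "nat=>nat" and n
 using s m
 proof (induction n arbitrary:sg)
 case (Suc n)
 have "sg 0 = 0"
 proof (rule ccontr)
 assume "sg 0 ~= 0"
 obtain i where i: "i : {..<Suc n}" "sg i = 0" using permutes_image[OF Suc(2)] by (metis image_iff lessThan_iff zero_less_Suc)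
 then have "sg 0 < sg i" using \<open>sg 0 ~= 0\<close> by (intro strict_mono_onD[OF Suc(3)]) (auto intro: gr0I)
 then show False using i by simp
 qed
 then obtain ta where t: "ta permutes {..<n}" "sg = lift ta" using permutes_lift[OF Suc(2)] by blast
 have "strict_mono_on {..<n} ta"
 by (rule strict_mono_onI) (use strict_mono_onD[OF Suc(3), of "Suc r" "Suc s" for r s] t(2) in auto)
 then have "ta = id" using Suc.IH[OF t(1)] by blast
 then show ?case using t(2) lift_comp(2) by metis
 qed simp
 show "Sh 0 q = {id}" "Sh p 0 = {id}" using id by (auto simp:Sh_def permutes_id strict_mono_on_def lessThan_atLeast0)
qed

text \<open>A shuffle is increasing on both blocks, so the position sent to 0 is the first of one of
  them. The two possibilities give the two families on the right.\<close>

lemma Sh_Suc_Suc: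
 "Sh (Suc p) (Suc q) = lift ` Sh p (Suc q) \<union> (%ta. lift ta \<circ> cyc (Suc p)) ` Sh (Suc p) q"
proof (intro equalityI subsetI)
 let ?n = "Suc (p + q)"
 fix sg assume "sg:Sh (Suc p) (Suc q)"
 then have s: "sg permutes {..<Suc ?n}" and m1: "strict_mono_on {..<Suc p} sg" and m2: "strict_mono_on {Suc p..<Suc ?n} sg" by (auto simp:Sh_def)
 obtain i where i: "i : {..<Suc ?n}" "sg i = 0" using permutes_image[OF s] by (metis image_iff lessThan_iff zero_less_Suc)
 have "i = 0" if "i < Suc p"
 proof (rule ccontr)
 assume "i ~= 0"
 then have "sg 0 < sg i" using that by (intro strict_mono_onD[OF m1]) auto
 then show False using i by simp
 qed
 moreover have "i = Suc p" if "~ i < Suc p"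
 proof (rule ccontr)
 assume "i ~= Suc p"
 then have "sg (Suc p) < sg i" using that i(1) by (intro strict_mono_onD[OF m2]) auto
 then show False using i by simp
 qed
 ultimately consider "sg 0 = 0" | "sg (Suc p) = 0" by (metis i(2))
 then show "sg:lift ` Sh p (Suc q) \<union> (%ta. lift ta \<circ> cyc (Suc p)) ` Sh (Suc p) q"
 proof cases
 case 1
 then obtain ta where t: "ta permutes {..<?n}" "sg = lift ta" using permutes_lift[OF s] by blast
 have "strict_mono_on {..<p} ta" "strict_mono_on {p..<?n} ta"
 using strict_mono_onD[OF m1, of "Suc r" "Suc s" for r s] strict_mono_onD[OF m2, of "Suc r" "Suc s" for r s] t(2)
 by (auto intro!:strict_mono_onI)
 then show ?thesis using t by (auto simp:Sh_def)
 next
 case 2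
 \<comment> \<open>Composing with the inverse cycle produces a permutation fixing 0, which is a
   lift.\<close>
 have c: "cyc (Suc p) permutes {..<Suc ?n}" by (rule cyc_permutes) simp
 have "sg \<circ> uncyc (Suc p) permutes {..<Suc ?n}"
 using permutes_compose[OF permutes_inv[OF c] s] inv_cyc by simp
 moreover have "(sg \<circ> uncyc (Suc p)) 0 = 0" using 2 by (simp add:uncyc_def)
 ultimately obtain ta where t: "ta permutes {..<?n}" "sg \<circ> uncyc (Suc p) = lift ta" using permutes_lift by blast
 have "uncyc (Suc p) \<circ> cyc (Suc p) = id" using inv_cyc bij_is_inj[of "cyc (Suc p)"] inv_o_cancel[of "cyc (Suc p)"] by simp
 then have e: "sg = lift ta \<circ> cyc (Suc p)" unfolding t(2)[symmetric] comp_assoc by simp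
 have "ta r < ta s" if "r < s" "s < Suc p" for r s
 using strict_mono_onD[OF m1, of r s] that unfolding e by (simp add:cyc_def)
 moreover have "ta r < ta s" if "Suc p <= r" "r < s" "s < ?n" for r s
 using strict_mono_onD[OF m2, of "Suc r" "Suc s"] that unfolding e by (simp add:cyc_def)
 ultimately have "strict_mono_on {..<Suc p} ta" "strict_mono_on {Suc p..<?n} ta" by (auto intro!:strict_mono_onI)
 then show ?thesis using t e by (auto simp:Sh_def)
 qed
next
 let ?n = "Suc (p + q)"
 fix sg assume "sg:lift ` Sh p (Suc q) \<union> (%ta. lift ta \<circ> cyc (Suc p)) ` Sh (Suc p) q"
 then show "sg:Sh (Suc p) (Suc q)"
 proof
 assume "sg:lift ` Sh p (Suc q)"
 then obtain ta where t: "sg = lift ta" "ta permutes {..<?n}" "strict_mono_on {..<p} ta" "strict_mono_on {p..<?n} ta" by (auto simp:Sh_def)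
 have "strict_mono_on {..<Suc p} sg" "strict_mono_on {Suc p..<Suc ?n} sg"
 unfolding t(1) using strict_mono_onD[OF t(3)] strict_mono_onD[OF t(4)] by (auto simp:lift_def intro!:strict_mono_onI split: nat.splits)
 then show ?thesis using t(1) lift_permutes[OF t(2)] by (simp add:Sh_def)
 next
 assume "sg:(%ta. lift ta \<circ> cyc (Suc p)) ` Sh (Suc p) q"
 then obtain ta where t: "sg = lift ta \<circ> cyc (Suc p)" "ta permutes {..<?n}" "strict_mono_on {..<Suc p} ta" "strict_mono_on {Suc p..<?n} ta" by (auto simp:Sh_def)
 have "strict_mono_on {..<Suc p} sg" "strict_mono_on {Suc p..<Suc ?n} sg"
 unfolding t(1) using strict_mono_onD[OF t(3)] strict_mono_onD[OF t(4)]
 by (auto simp:lift_def cyc_def intro!:strict_mono_onI split: nat.splits)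
 then show ?thesis using t(1) permutes_compose[OF cyc_permutes lift_permutes[OF t(2)], of "Suc p"] by (simp add:Sh_def)
 qed
qed

text \<open>The signed sum over shuffles, seen through a scalar function of the shuffled word. With
  \<open>F\<close> arbitrary, a leading letter can be absorbed into it in the recursion.\<close>

definition shsum :: "'x list=>'x list=>('x list=>'k::field)=>'k" where
 "shsum us vs F = (SUM sg:Sh (length us) (length vs).
 of_int (sign sg) * F (map (%i. (us @ vs) ! inv_into UNIV sg i) [0..<length us + length vs]))"

lemma finite_Sh: "finite (Sh p q)"
 by (rule finite_subset[OF _ finite_permutations[of "{..<p + q}"]]) (auto simp:Sh_def)

text \<open>The sign of the second summand is that of the cycle moving the first letter of the right
  word past the whole left word.\<close>

lemma shsum_simps:
 "shsum [] vs F = F vs" "shsum us [] F = F us"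
 "shsum (u # us) (v # vs) F = shsum us (v # vs) (%xs. F (u # xs)) + (- 1) ^ Suc (length us) * shsum (u # us) vs (%xs. F (v # xs))"
proof -
 show "shsum [] vs F = F vs" "shsum us [] F = F us" by (simp_all add: shsum_def Sh_zero map_nth)
 let ?p = "length us" and ?q = "length vs"
 let ?m = "%sg zs. map (%i. zs ! inv_into UNIV sg i)"
 let ?h = "%sg. of_int (sign sg) * F (?m sg ((u # us) @ v # vs) [0..<Suc (Suc (?p + ?q))])"
 let ?f = "%ta. lift ta \<circ> cyc (Suc ?p)"
 have d: "lift ` Sh ?p (Suc ?q) \<inter> ?f ` Sh (Suc ?p) ?q = {}"
 proof -
 have "lift ta ~= ?f ta'" for ta ta'
 proof
 assume "lift ta = ?f ta'"
 then have "lift ta 0 = ?f ta' 0" by (rule fun_cong)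
 then show False by (simp add:cyc_def)
 qed
 then show ?thesis by blast
 qed
 have i1: "inj_on lift (Sh ?p (Suc ?q))" by (rule inj_onI) (metis lift_simps(2) ext nat.inject)
 have i2: "inj_on ?f (Sh (Suc ?p) ?q)"
 proof (rule inj_onI)
 fix ta ta' assume "?f ta = ?f ta'"
 then have "lift ta = lift ta'" using inv_cyc(1)[of "Suc ?p"] by (metis bij_is_surj fun.map_comp surj_iff comp_assoc comp_id)
 then show "ta = ta'" by (metis lift_simps(2) ext nat.inject)
 qed
 have "shsum (u # us) (v # vs) F = (SUM sg:Sh (Suc ?p) (Suc ?q). ?h sg)" by (simp add:shsum_def)
 also have "... = (SUM ta:Sh ?p (Suc ?q). ?h (lift ta)) + (SUM ta:Sh (Suc ?p) ?q. ?h (?f ta))"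
 unfolding Sh_Suc_Suc sum.union_disjoint[OF finite_imageI[OF finite_Sh] finite_imageI[OF finite_Sh] d] sum.reindex[OF i1] sum.reindex[OF i2]
 by (simp only:comp_def)
 also have "(SUM ta:Sh ?p (Suc ?q). ?h (lift ta)) = shsum us (v # vs) (%xs. F (u # xs))"
 unfolding shsum_def
 proof (rule sum.cong)
 fix ta assume "ta:Sh ?p (length (v # vs))"
 then have t: "ta permutes {..<Suc (?p + ?q)}" by (simp add:Sh_def)
 have "?m (lift ta) ((u # us) @ v # vs) [0..<Suc (Suc (?p + ?q))] = u # ?m ta (us @ v # vs) [0..<Suc (?p + ?q)]"
 using inv_lift[OF permutes_bij[OF t]] by (simp add:map_upt_Suc del: upt_Suc)
 then show "?h (lift ta) = of_int (sign ta) * F (u # ?m ta (us @ v # vs) [0..<length us + length (v # vs)])"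
 using sign_lift[OF t] by (simp del: upt_Suc)
 qed simp
 also have "(SUM ta:Sh (Suc ?p) ?q. ?h (?f ta)) = (- 1) ^ Suc ?p * shsum (u # us) vs (%xs. F (v # xs))"
 unfolding shsum_def sum_distrib_left
 proof (rule sum.cong)
 fix ta assume "ta:Sh (length (u # us)) ?q"
 then have t: "ta permutes {..<Suc (?p + ?q)}" by (simp add:Sh_def)
 note l = inv_lift[OF permutes_bij[OF t]]
 have "finv (?f ta) = uncyc (Suc ?p) \<circ> lift (finv ta)" using o_inv_distrib[of "lift ta" "cyc (Suc ?p)"] l inv_cyc by simp
 then have "?m (?f ta) ((u # us) @ v # vs) [0..<Suc (Suc (?p + ?q))] = v # ?m ta ((u # us) @ vs) [0..<Suc (?p + ?q)]"
 by (simp add:map_upt_Suc uncyc_def nth_append nth_Cons' del: upt_Suc) (auto simp:Suc_diff_le add.commute)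
 moreover have "sign (?f ta) = sign ta * (- 1) ^ Suc ?p"
 using permutes_imp_permutation[OF _ lift_permutes[OF t]] permutes_imp_permutation[OF _ cyc_permutes[of "Suc ?p" "Suc (Suc ?p)"]]
 by (simp add:sign_compose sign_lift[OF t] sign_cyc)
 ultimately show "?h (?f ta) = (- 1) ^ Suc ?p * (of_int (sign ta) * F (v # ?m ta ((u # us) @ vs) [0..<length (u # us) + ?q]))"
 by (simp add:mult_ac del: upt_Suc)
 qed simp
 finally show "shsum (u # us) (v # vs) F = shsum us (v # vs) (%xs. F (u # xs)) + (- 1) ^ Suc ?p * shsum (u # us) vs (%xs. F (v # xs))" .
qed

lemma Sh_word_mem:
 assumes "us:lists S" "vs:lists S" "sg:Sh (length us) (length vs)"
 shows "map (%i. (us @ vs) ! inv_into UNIV sg i) [0..<length us + length vs] : lists S"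
proof -
 have "finv sg i < length (us @ vs)" if "i < length us + length vs" for i
 using permutes_in_image[OF permutes_inv, of sg "{..<length us + length vs}" i] assms(3) that by (auto simp:Sh_def)
 then have "(us @ vs) ! finv sg i:S" if "i < length us + length vs" for i
 using that assms(1,2) nth_mem[of "finv sg i" "us @ vs"] by (auto simp:in_lists_conv_set simp del: nth_mem)
 then show ?thesis by (auto simp:in_lists_conv_set)
qed

context comm_hopf
begin

text \<open>Both sides obey the same recursion in the first letter, with the leading letter absorbed
  into the functional; each branch drops one letter, so the total length decreases.\<close>

lemma shsum_lsh:
 assumes "lin Ch ground L" "us:LU" "vs:LU"
 shows "shsum us vs (%xs. L (cw H xs)) = L (lsh us (cw H vs))"
 using assms
proof (induction "length us + length vs" arbitrary:us vs L rule:less_induct)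
 case less
 show ?case
 proof (cases "us = [] | vs = []")
 case True
 then show ?thesis using lsh(2)[OF less.prems(2)] by (auto simp:shsum_simps)
 next
 case False
 then obtain u us' v vs' where e: "us = u # us'" "vs = v # vs'" by (auto simp:neq_Nil_conv)
 then have c: "u .: U" "v .: U" "us':LU" "vs':LU" using less.prems by auto
 have L: "x .: Ch ==> y .: Ch ==> L (x +[Ch] y) = L x + L y" "x .: Ch ==> L (c *.[Ch] x) = c * L x" for x y c
 using linD[OF less.prems(1)] by simp_all
 have k: "lin Ch ground (%x. L (cn w x))" if "w .: U" for w
 by (rule linc[OF _ less.prems(1)]) (insert ccons(1)[OF that], simp add:chain_op_def)
 have cg: "shsum xs ys (%zs. L (cw H (w # zs))) = shsum xs ys (%zs. L (cn w (cw H zs)))" if "xs:LU" "ys:LU" "w .: U" for xs ys w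
 unfolding shsum_def by (rule sum.cong) (use Sh_word_mem[OF that(1,2)] that(3) ccons(2) in auto)
 have "shsum us vs (%xs. L (cw H xs)) = L (cn u (lsh us' (cw H vs))) + (- 1) ^ length us * L (cn v (lsh us (cw H vs')))"
 using less.hyps[of us' vs "%x. L (cn u x)"] less.hyps[of us vs' "%x. L (cn v x)"] k c less.prems e
 by (simp add:shsum_simps cg del: lsh.simps)
 also have "... = L (lsh us (cw H vs))"
 using lsh(3)[OF less.prems(2) e(1) c(2), of "cw H vs'"] c e less.prems endo_simps(1)[OF lsh(1)] L by (simp del: lsh.simps)
 finally show ?thesis .
 qed
qed

lemma chain_cact: "a .: A ==> chain H (Base a) = ca a (cw H [])"
 by (simp add:cw_def cact)

lemma shuffle_gens:
 assumes v: "v:X" and w: "w:X"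
 shows "(case (v,w) of
 (Base a,Base b)=>chain H (Base (a **[A] b))
 | (Tens us,Base a)=>chain H (Tens ((tgt H a **[U] hd us) # tl us))
 | (Base a,Tens us)=>chain H (Tens (butlast us @ [last us **[U] tgt H a]))
 | (Tens us,Tens vs)=>(\<Oplus>\<^bsub>Ch\<^esub>sg\<in>Sh (length us) (length vs). of_int (sign sg) *.[Ch]
 chain H (Tens (map (%i. (us @ vs) ! inv_into UNIV sg i) [0..<length us + length vs])))) = sh (chain H v) (chain H w)"
proof -
 have T: "chain H (Tens us) = cw H us" if "us ~= []" for us using that by (simp add:cw_def)
 show ?thesis
 proof (cases v; cases w)
 fix a b assume e: "v = Base a" "w = Base b"
 then have "a .: A" "b .: A" using v w unfolding cgens_iff by auto
 then show ?thesis using e by (simp add:chain_cact cact_commute)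
 next
 fix us a assume e: "v = Tens us" "w = Base a"
 then have *: "us ~= []" "us:LU" "a .: A" using v w unfolding cgens_iff by auto
 then show ?thesis using e cact(3)[of a us] by (simp add:chain_cact T)
 next
 fix us a assume e: "v = Base a" "w = Tens us"
 then have *: "us ~= []" "us:LU" "a .: A" using v w unfolding cgens_iff by auto
 \<comment> \<open>Here the base element is applied to the last factor; by linearity in each slot
   this agrees with the action on the first.\<close>
 then obtain xs x where x: "us = xs @ [x]" by (metis rev_exhaust)
 then show ?thesis using e * alinD(3)[OF alin_cw, of xs "[]" x a] by (simp add:chain_cact T U.m_comm)
 next
 fix us vs assume e: "v = Tens us" "w = Tens vs"
 then have *: "us ~= []" "us:LU" "vs ~= []" "vs:LU" using v w unfolding cgens_iff by auto
 let ?m = "%sg. map (%i. (us @ vs) ! inv_into UNIV sg i) [0..<length us + length vs]"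
 have m: "?m sg ~= []" for sg using * by auto
 have c: "(%sg. of_int (sign sg) *.[Ch] chain H (Tens (?m sg))):Sh (length us) (length vs) \<rightarrow> car Ch"
 using Sh_word_mem[OF *(2,4)] by (simp add:T[OF m])
 have "(\<Oplus>\<^bsub>Ch\<^esub>sg\<in>Sh (length us) (length vs). of_int (sign sg) *.[Ch] chain H (Tens (?m sg))) = sh (cw H us) (cw H vs)"
 proof (rule vs_eqI[OF vCh])
 fix L :: "(('u,'a) word \<Rightarrow>\<^sub>0 'k) set=>'k"
 assume L: "lin Ch ground L" "!!c u. u .: Ch ==> L (c *.[Ch] u) = c * L u"
 have "L (\<Oplus>\<^bsub>Ch\<^esub>sg\<in>Sh (length us) (length vs). of_int (sign sg) *.[Ch] chain H (Tens (?m sg))) = shsum us vs (%xs. L (cw H xs))"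
 unfolding L_finsum[OF L(1) vCh c] shsum_def
 by (rule sum.cong) (insert Sh_word_mem[OF *(2,4)] L(2), simp_all add: T[OF m])
 then show "L (\<Oplus>\<^bsub>Ch\<^esub>sg\<in>Sh (length us) (length vs). of_int (sign sg) *.[Ch] chain H (Tens (?m sg))) = L (sh (cw H us) (cw H vs))"
 using shsum_lsh[OF L(1) *(2,4)] sh_left(2)[OF cw_closed[OF *(4)] *(2)] by simp
 qed (use * vs_finsum_closed[OF vCh c] in simp_all)
 then show ?thesis using e * by (simp add:T)
 qed
qed

lemma shuffle:
 assumes x: "x .: Ch" and y: "y .: Ch"
 shows "shuffle H x y = sh x y"
proof -
 note k = chain_opD(1)[OF amodC]
 note X = chains_lin_ext_eq[OF vCh lin_id refl]
 have c: "chain H v .: Ch" if "v:X" for v using chain_closed that .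
 show ?thesis
 unfolding shuffle_def
 proof (rule lin_ext2_const[OF vCh X(4)[OF x] X(4)[OF y]])
 fix p q assume p: "p:x" and q: "q:y"
 note px = X(3)[OF x p] and qy = X(3)[OF y q]
 let ?g = "%v w. case (v,w) of
 (Base a,Base b)=>chain H (Base (a **[A] b))
 | (Tens us,Base a)=>chain H (Tens ((tgt H a **[U] hd us) # tl us))
 | (Base a,Tens us)=>chain H (Tens (butlast us @ [last us **[U] tgt H a]))
 | (Tens us,Tens vs)=>(\<Oplus>\<^bsub>Ch\<^esub>sg\<in>Sh (length us) (length vs). of_int (sign sg) *.[Ch]
 chain H (Tens (map (%i. (us @ vs) ! inv_into UNIV sg i) [0..<length us + length vs])))"
 show "?g v w .: Ch" if "v:keys p" "w:keys q" for v w
 proof -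
 have "v:X" "w:X" using that px qy by blast+
 then show ?thesis unfolding shuffle_gens[OF \<open>v : X\<close> \<open>w : X\<close>] using c by simp
 qed
 have E: "ev Ch (?g v) q = sh (chain H v) y" if "v:X" for v
 by (rule chains_lin_ext_eq(2)[OF vCh k[OF sh_right[OF c[OF that]]] shuffle_gens[OF that] y q])
 have "ev Ch (%v. ev Ch (?g v) q) p = ev Ch (%v. sh (chain H v) y) p"
 proof (rule ev_cong[OF vCh])
 show "ev Ch (?g v) q = sh (chain H v) y" if "v:keys p" for v using E that px by blast
 show "sh (chain H v) y .: Ch" if "v:keys p" for v by (rule sh_left_simps(1)[OF y c]) (use that px in blast)
 qed
 also have "... = sh x y" by (rule chains_lin_ext_eq(2)[OF vCh k[OF sh_left(1)[OF y]] refl x p])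
 finally show "ev Ch (%v. ev Ch (?g v) q) p = sh x y" .
 qed
qed

end

section \<open>Hochschild homology as an algebra\<close>

lemma vspace_update: "vspace V ==> vspace (V\<lparr>monoid.mult := m,one := e\<rparr>)"
 by (rule vspaceI) (simp_all add: vs_add_ac vs_smult vs_neg)

context comm_hopf
begin

abbreviation (input) "Z == cycles H"
abbreviation (input) "B == boundaries H"
abbreviation (input) "CZ == chains H\<lparr>carrier := cycles H\<rparr>"

definition "klass x = B +>[Ch] x"

lemma cyclesD: "x:Z ==> x .: Ch" "x:Z ==> differential H x = 0.[Ch]"
 by (auto simp:cycles_def)

lemma boundaries_cycles: "x:B ==> x:Z"
 using linD(1)[OF endo_differential] differential_differential by (auto simp:boundaries_def cycles_def)

lemma vspace_CZ: "vspace CZ" and submodule_B: "submodule B ground CZ" "submodule B ground Ch" and submodule_Z: "submodule Z ground Ch"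
proof -
 note k = linD[OF endo_differential]
 show Z: "submodule Z ground Ch" unfolding cycles_def by (rule submodule_kernel[OF vCh vCh endo_differential])
 show v: "vspace CZ" by (rule vspace_restrict[OF vCh Z])
 have z: "0.[Ch] : B"
 using lin_zero[OF endo_differential vCh vCh] by (auto simp:boundaries_def intro!:image_eqI[of _ _ "0.[Ch]"])
 have c: "x +[Ch] y:B" "c *.[Ch] x:B" if "x:B" "y:B" for x y c
 using that k(2,3)[symmetric] by (auto simp:boundaries_def)
 show "submodule B ground CZ" by (rule submI[OF v]) (use boundaries_cycles z c in auto)
 show "submodule B ground Ch" by (rule submI[OF vCh]) (use boundaries_cycles cyclesD z c in auto)
qed

lemma klass_CZ: "B +>[CZ] x = klass x"
 by (simp add:klass_def a_r_coset_def r_coset_def)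

lemmas Z_closed = submD[OF vCh submodule_Z]
lemmas klass_eq_iff = coset_eq_iff[OF vspace_CZ submodule_B(1), unfolded klass_CZ, simplified]
lemmas klass_self = coset_self[OF vspace_CZ submodule_B(1), unfolded klass_CZ, simplified]
lemmas klass_rep = coset_rep[OF vspace_CZ submodule_B(1), unfolded klass_CZ, simplified]

lemma sh_cycles:
 assumes "x:Z" "y:Z"
 shows "sh x y:Z" "b:B ==> sh b y:B" "b:B ==> sh x b:B"
proof -
 note x = cyclesD[OF assms(1)] and y = cyclesD[OF assms(2)]
 show "sh x y:Z" using x y by (simp add:cycles_def differential_sh)
 show "sh b y:B" if b: "b:B"
 proof -
 obtain z where z: "z .: Ch" "b = differential H z" using b by (auto simp:boundaries_def)
 then have "sh b y = differential H (sh z y)" using y linD(1)[OF endo_differential] by (simp add:differential_sh)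
 then show ?thesis using z y by (auto simp:boundaries_def)
 qed
 show "sh x b:B" if b: "b:B"
 proof -
 obtain z where z: "z .: Ch" "b = differential H z" using b by (auto simp:boundaries_def)
 \<comment> \<open>Replacing \<open>x\<close> by \<open>sop x\<close>, again a cycle, absorbs the
   sign in the Leibniz rule.\<close>
 then have "sh x b = differential H (sh (sop x) z)" using x linD(1)[OF endo_differential] by (simp add:differential_sh differential_sop sop_sop)
 then show ?thesis using z x by (auto simp:boundaries_def)
 qed
qed

lemma klass_sh:
 assumes "x:Z" "y:Z" "x':klass x" "y':klass y"
 shows "klass (sh x' y') = klass (sh x y)"
proof -
 have Z': "x':Z" "y':Z" "klass x' = klass x" "klass y' = klass y" using klass_rep[OF assms(1,3)] klass_rep[OF assms(2,4)] by simp_all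
 let ?b = "x' +[Ch] (- 1) *.[Ch] x" and ?c = "y' +[Ch] (- 1) *.[Ch] y"
 have b: "?b:B" "?c:B" using klass_eq_iff Z' assms by auto
 note c = cyclesD(1)[OF Z'(1)] cyclesD(1)[OF Z'(2)] cyclesD(1)[OF assms(1)] cyclesD(1)[OF assms(2)]
 have "sh x' y' +[Ch] (- 1) *.[Ch] sh x y = sh ?b y' +[Ch] sh x ?c"
 by (rule vs_eqI[OF vCh]) (insert c, simp_all add: algebra_simps)
 also have "... : B"
 by (rule submD(3)[OF vCh submodule_B(2) sh_cycles(2)[OF assms(1) Z'(2) b(1)] sh_cycles(3)[OF assms(1,2) b(2)]])
 finally show ?thesis using klass_eq_iff sh_cycles(1) Z' assms by simp
qed

text \<open>The product in \<open>HH\<close> is a union over all representatives; it collapses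
  because, by the Leibniz rule, boundaries form an ideal in the cycles.\<close>

lemma HH_simps:
 "car (HH H) = klass ` Z" "1.[HH H] = klass (cw H [])"
 "x:Z ==> y:Z ==> klass x +[HH H] klass y = klass (x +[Ch] y)" "x:Z ==> c *.[HH H] klass x = klass (c *.[Ch] x)"
 "x:Z ==> y:Z ==> klass x **[HH H] klass y = klass (sh x y)"
proof -
 note q = quot_ops[OF vspace_CZ submodule_B(1), unfolded klass_CZ]
 show "car (HH H) = klass ` Z" using quot_carrier[OF vspace_CZ submodule_B(1)] by (simp add:HH_def klass_CZ)
 show "1.[HH H] = klass (cw H [])" by (simp add:HH_def klass_def cw_def)
 show "x:Z ==> y:Z ==> klass x +[HH H] klass y = klass (x +[Ch] y)" "x:Z ==> c *.[HH H] klass x = klass (c *.[Ch] x)"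
 using q[of x] by (simp_all add: HH_def)
 show "klass x **[HH H] klass y = klass (sh x y)" if *: "x:Z" "y:Z"
 proof -
 have c: "B +>[Ch] shuffle H x' y' = klass (sh x y)" if "x':klass x" "y':klass y" for x' y'
 using klass_sh[OF * that] klass_rep[OF *(1) that(1)] klass_rep[OF *(2) that(2)] by (simp add:shuffle[OF cyclesD(1) cyclesD(1)] klass_def)
 have "(\<Union>x'\<in>klass x. \<Union>y'\<in>klass y. B +>[Ch] shuffle H x' y') = klass (sh x y)"
 proof
 show "(\<Union>x'\<in>klass x. \<Union>y'\<in>klass y. B +>[Ch] shuffle H x' y') <= klass (sh x y)" by (intro UN_least) (simp add:c)
 qed (use c[OF klass_self[OF *(1)] klass_self[OF *(2)]] klass_self[OF *(1)] klass_self[OF *(2)] in blast)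
 then show ?thesis by (simp add:HH_def)
 qed
qed

lemma vspace_HH: "vspace (HH H)"
 using vspace_quot[OF vspace_CZ submodule_B(1)] unfolding HH_def by (rule vspace_update)

lemma walg_HH: "walg (HH H)"
proof -
 have "cw H [] : Z" by (simp add:cycles_def differential)
 note [simp] = HH_simps(3-5) Z_closed sh_cycles(1) cyclesD(1)
 have "lin (HH H) (HH H) (%a. a **[HH H] b)" "lin (HH H) (HH H) (%a. b **[HH H] a)" if "b .: HH H" for b
 using that by (auto simp:HH_simps(1) intro!:linI)
 then show ?thesis using \<open>cw H [] : Z\<close> vspace_HH by (auto simp:walg_def HH_simps(1,2) intro!:bilinI)
qed

end

section \<open>Measurings of chain complexes\<close>

context
 fixes C :: "('k::field,'c) coalg"
 assumes C: "ccoalg C"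
begin

private lemmas pC = cc_pre[OF C]

text \<open>Working form of coassociativity for three linear families, combined by two operations in
  either bracketing. The bilinear maps are arbitrary, since the base action, \<open>ccons\<close>,
  \<open>mop\<close> and products in the total algebra are mixed in its uses.\<close>

lemma sw_nest:
 assumes v: "vspace W" "vspace Y" "vspace Y'" and B: "bilin X Y W B" "bilin P Q Y B'" and D: "bilin Y' Q W D" "bilin X P Y' D'"
 and k: "lin C X f" "lin C P g" "lin C Q h" and x: "x .: C"
 and eq: "!!a b c. a .: X ==> b .: P ==> c .: Q ==> B a (B' b c) = D (D' a b) c"
 shows "sw C W (%a b. B (f a) (sw C Y (%c d. B' (g c) (h d)) b)) x = sw C W (%a b. D (sw C Y' (%c d. D' (f c) (g d)) a) (h b)) x"
proof -
 note c = linD(1)[OF k(1)] lin1[OF k(2)] lin1[OF k(3)] and b = bilinD(3)[OF B(1)] bl3[OF B(2)] bl3[OF D(1)] bl3[OF D(2)]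
 have s: "sw C Y (%c d. B' (g c) (h d)) y .: Y" "sw C Y' (%c d. D' (f c) (g d)) y .: Y'" if "y .: C" for y
 using that c b by (auto intro!:sw_closed[OF pC] v)
 have t: "trilin C C C W (%a b c. B (f a) (B' (g b) (h c)))"
 by (rule trilinI; rule linc[OF k(1) bl1[OF B(1)]] linc[OF linc[OF k(2) bl1[OF B(2)]] bl2[OF B(1)]]
 linc[OF linc[OF k(3) bl2[OF B(2)]] bl2[OF B(1)]]) (use c b in auto)
 have "sw C W (%a b. B (f a) (sw C Y (%c d. B' (g c) (h d)) b)) x = sw C W (%a b. sw C W (%c d. B (f a) (B' (g c) (h d))) b) x"
 by (rule sw_cong[OF pC v(1) x]) (insert c b v pC, auto intro!:sw_push[OF pC bilinD(2)[OF B(1)]] sw_closed[OF pC])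
 also have "... = sw C W (%a b. sw C W (%c d. B (f c) (B' (g d) (h b))) a) x"
 by (rule sw_coassoc[OF cc_coalg[OF C] v(1) t x, symmetric])
 also have "... = sw C W (%a b. sw C W (%c d. D (D' (f c) (g d)) (h b)) a) x"
 by (rule sw_cong[OF pC v(1) x]) (insert c b v pC eq, auto intro!:sw_cong[OF pC] sw_closed[OF pC])
 also have "... = sw C W (%a b. D (sw C Y' (%c d. D' (f c) (g d)) a) (h b)) x"
 by (rule sw_cong[OF pC v(1) x]) (insert c b v pC s, auto intro!:sw_push[OF pC bilinD(1)[OF D(1)], symmetric])
 finally show ?thesis .
qed

text \<open>Exchange of the first two of three legs: regroup, use cocommutativity on the first pair,
  and regroup back.\<close>

lemma sw_swap_left:
 assumes W: "vspace W" and t: "trilin C C C W G" and x: "x .: C"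
 shows "sw C W (%a b. sw C W (%c d. G c a d) b) x = sw C W (%a b. sw C W (%c d. G a c d) b) x"
proof -
 have t': "trilin C C C W (%y z w. G z y w)" and b: "!!w. w .: C ==> bilin C C W (%y z. G y z w)"
 and c: "!!a b d. a .: C ==> b .: C ==> d .: C ==> G a b d .: W"
 using t linD(1) by (fastforce simp:trilin_def intro!:bilinI)+
 have "sw C W (%a b. sw C W (%c d. G c a d) b) x = sw C W (%a b. sw C W (%c d. G d c b) a) x"
 by (rule sw_coassoc[OF cc_coalg[OF C] W t' x, symmetric])
 also have "... = sw C W (%a b. sw C W (%c d. G c d b) a) x"
 by (rule sw_cong[OF pC W x]) (insert sw_cocomm[OF C W b] c, auto intro!:sw_closed[OF pC W])
 also have "... = sw C W (%a b. sw C W (%c d. G a c d) b) x"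
 by (rule sw_coassoc[OF cc_coalg[OF C] W t x])
 finally show ?thesis .
qed

end

lemma (in comm_hopf) bilin_ops:
 "bilin A Ch Ch (cact H)" "bilin U Ch Ch (ccons H)" "bilin U Ch Ch mop" "bilin Ch Ch Ch sh"
 "bilin U U U (%u v. u **[U] v)" "bilin A U U lact" "bilin U A U ract"
proof -
 note k = chain_opD(1)[OF amodC]
 have s: "mop (c *.[U] u) x = c *.[Ch] mop u x" if "u .: U" "x .: Ch" for c u x
 proof -
 have "c *.[U] u = lact (c *.[A] 1.[A]) u" using that(1) comm_hopfD(5)[OF H] lin3[OF h(4)] by (simp add:smult_mult)
 then show ?thesis using mop_linear(2)[OF that(1) that(1) that(2), of "c *.[A] 1.[A]"] smult_act[OF amodC, of "mop u x" c] that h(9) by simp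
 qed
 show "bilin A Ch Ch (cact H)" "bilin U Ch Ch (ccons H)" by (rule amodD(2)[OF amodC], rule ccons(3))
 show "bilin U Ch Ch mop" by (rule bilinI) (insert mop_linear(1) s k[OF mop(1)], auto intro!:linI)
 show "bilin Ch Ch Ch sh" by (rule bilinI) (use k[OF sh_left(1)] k[OF sh_right] in auto)
 show u: "bilin U U U (%u v. u **[U] v)" by (rule walgD(2)[OF h(1)])
 show "bilin A U U lact" "bilin U A U ract" by (rule bilin_comp[OF u h(4) lin_id], rule bilin_comp[OF u lin_id h(4)])
qed

text \<open>Equality is proved for the whole family at once, because in the inductive step the legs
  of \<open>x\<close> occur in place of \<open>x\<close>.\<close>

lemma (in comm_hopf) family_eqI:
 assumes W: "vspace W" and f: "!!x. x:I ==> lin (chains H) W (f x)" and g: "!!x. x:I ==> lin (chains H) W (g x)"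
 and b: "!!x a. x:I ==> a .: base H ==> f x (cact H a (cw H [])) = g x (cact H a (cw H []))"
 and s: "!!x u us. x:I ==> u .: total H ==> us:LU ==> (!!x. x:I ==> f x (cw H us) = g x (cw H us)) ==>
 f x (ccons H u (cw H us)) = g x (ccons H u (cw H us))"
 and x: "x:I" and z: "z .: chains H"
 shows "f x z = g x z"
proof (rule chains_eqI[OF W f[OF x] g[OF x] _ z])
 have cw: "us:lists (car (total H)) ==> f x (cw H us) = g x (cw H us)" if "x:I" for x us
 using that
 proof (induction us arbitrary:x)
 case Nil
 then show ?case using b[of x "1.[base H]"] by simp
 next
 case (Cons u us)
 then show ?case using s[of x u us] by simp
 qed
 fix w assume w: "w:X"
 show "f x (chain H w) = g x (chain H w)"
 proof (cases w)
 case (Base a)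
 then show ?thesis using w b[OF x, of a] unfolding cgens_iff by (simp add:chain_cact)
 next
 case (Tens us)
 then show ?thesis using w cw[OF x, of us] unfolding cgens_iff by (simp add:cw_def)
 qed
qed

section \<open>The chain maps attached to a measuring\<close>

locale hopf_meas = H: comm_hopf H + H': comm_hopf H'
 for H :: "('k::field,'u,'a) halg" and H' :: "('k,'v,'b) halg" +
 fixes C :: "('k,'c) coalg" and Psi :: "'c=>'u=>'v" and psi :: "'c=>'a=>'b"
 assumes C: "ccoalg C" and m: "hopf_compat H H' C Psi psi"
begin

abbreviation (input) "cn == ccons H"
abbreviation (input) "ca == cact H"
abbreviation (input) "cn' == ccons H'"
abbreviation (input) "ca' == cact H'"

abbreviation (input) "Dh == chains H'"
lemmas P = cc_pre[OF C]
lemmas vD [simp] = H'.vCh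
lemmas mD = compatD[OF comm_hopfD(1)[OF H.H] comm_hopfD(1)[OF H'.H] C m]
lemmas [simp] = mD(9,10)
lemmas kPsi = lfD(2)[OF mD(3)] and kpsi = lfD(2)[OF mD(4)]
lemmas kU = lfD(1)[OF mD(3)] and kA = lfD(1)[OF mD(4)]
lemmas D_push = sw_push[OF P _ vD vD]

lemma D_cong:
 assumes "x .: C" "!!a b. a .: C ==> b .: C ==> f a b = g a b" "!!a b. a .: C ==> b .: C ==> g a b .: Dh"
 shows "sw C Dh f x = sw C Dh g x"
 by (rule sw_cong[OF P vD]) (use assms in auto)

lemma sw_closed_simps [simp]:
 "x .: C ==> (!!a b. a .: C ==> b .: C ==> f a b .: Dh) ==> sw C Dh f x .: Dh"
 "x .: C ==> (!!a b. a .: C ==> b .: C ==> g a b .: total H') ==> sw C (total H') g x .: total H'"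
 by (rule sw_closed[OF P vD], assumption, blast) (rule sw_closed[OF P H'.h(8)], assumption, blast)

text \<open>The empty word is the unit of the base, so a measuring sends it to its multiple by the
  counit. General elements of degree zero are treated in \<open>th\<close>, where \<open>psi\<close>
  acts on them.\<close>

primrec thl :: "'u list=>'c=>(('v,'b) word \<Rightarrow>\<^sub>0 'k) set" where
 "thl [] x = counit C x *.[Dh] cw H' []"
| "thl (u # us) x = sw C Dh (%a b. cn' (Psi a u) (thl us b)) x"

definition "th x = lin_ext Dh (%w. case w of Base a=>chain H' (Base (psi x a)) | Tens us=>thl us x)"

lemma lin_thl: "us:H.LU ==> lin C Dh (thl us)"
proof (induction us)
 case Nil
 have "lin ground Dh (%c. c *.[Dh] cw H' [])" by (rule linI) (simp_all add: vs_smult)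
 moreover have "thl [] = (%x. counit C x *.[Dh] cw H' [])" by (rule ext) simp
 ultimately show ?case using linc[OF preD(3)[OF P], of Dh "%c. c *.[Dh] cw H' []"] by simp
next
 case (Cons u us)
 moreover have "thl (u # us) = sw C Dh (%a b. cn' (Psi a u) (thl us b))" by (rule ext) simp
 ultimately show ?case using lin_sw[OF P vD bilin_comp[OF H'.bilin_ops(2) kPsi]] by simp
qed

lemma thl_closed [simp]: "us:H.LU ==> x .: C ==> thl us x .: Dh"
 using linD(1)[OF lin_thl] .

lemma lin_thl_slot: "xs:H.LU ==> ys:H.LU ==> x .: C ==> lin (total H) Dh (%u. thl (xs @ u # ys) x)"
proof (induction xs arbitrary:x)
 case Nil
 show ?case unfolding append_Nil thl.simps(2)
 by (rule lin_sw_fun[OF P H.h(8) vD Nil(3)], rule linc[OF kU bilinD(1)[OF H'.bilin_ops(2)]]) (use Nil in auto)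
next
 case (Cons w xs)
 show ?case unfolding append_Cons thl.simps(2)
 by (rule lin_sw_fun[OF P H.h(8) vD Cons.prems(3)], rule linc[OF Cons.IH bilinD(2)[OF H'.bilin_ops(2)]]) (use Cons.prems in auto)
qed

lemma thl_act:
 assumes "a .: base H" "u .: total H" "ys:H.LU" "x .: C"
 shows "thl (H.lact a u # ys) x = sw C Dh (%c d. ca' (psi c a) (thl (u # ys) d)) x"
proof -
 have "sw C Dh (%c d. ca' (psi c a) (thl (u # ys) d)) x = sw C Dh (%c d. cn' (sw C (total H') (%c d. H'.lact (psi c a) (Psi d u)) c) (thl ys d)) x"
 unfolding thl.simps(2)
 by (rule sw_nest[OF C vD vD H'.h(8) H'.bilin_ops(1,2,2,6)]) (use assms kPsi kpsi lin_thl in auto)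
 also have "... = thl (H.lact a u # ys) x" unfolding thl.simps(2)
 by (rule D_cong) (insert assms family_act(1)[OF comm_hopfD(1)[OF H.H] comm_hopfD(1)[OF H'.H] C m], simp_all add: H.U.m_closed H'.U.m_closed)
 finally show ?thesis by simp
qed

text \<open>At the head, both sides become a sum in which \<open>u\<close> and the target of
  \<open>a\<close> have adjacent legs, by \<open>thl_act\<close> on one side and by the measuring
  law on the other. A longer prefix passes unchanged through the recursion.\<close>

lemma thl_balanced:
 assumes "xs:H.LU" "ys:H.LU" "u .: total H" "v .: total H" "a .: base H" "x .: C"
 shows "thl (xs @ H.ract u a # v # ys) x = thl (xs @ u # H.lact a v # ys) x"
 using assms(2-) assms(1)
proof (induction xs arbitrary:x)
 case Nil
 have "thl (u # H.lact a v # ys) x = sw C Dh (%c d. cn' (Psi c u) (sw C Dh (%c d. ca' (psi c a) (thl (v # ys) d)) d)) x"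
 unfolding thl.simps(2)[of u] by (rule D_cong) (insert Nil thl_act[of a v ys], simp_all del: thl.simps)
 also have "... = sw C Dh (%c d. cn' (sw C (total H') (%c d. H'.ract (Psi c u) (psi d a)) c) (thl (v # ys) d)) x"
 by (rule sw_nest[OF C vD vD H'.h(8) H'.bilin_ops(2,1,2,7)]) (insert Nil kPsi kpsi lin_thl[of "v # ys"] H'.U.m_comm[of c "tgt H' d" for c d], simp_all del: thl.simps)
 also have "... = thl (H.ract u a # v # ys) x" unfolding thl.simps(2)[of "H.ract u a"]
 proof (rule D_cong)
 fix c d assume c: "c .: C" "d .: C"
 have "Psi c (H.ract u a) = sw C (total H') (%c d. Psi c u **[total H'] Psi d (tgt H a)) c"
 by (rule ameasD(2)[OF mD(1) P H'.h(1) c(1)]) (use Nil in auto)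
 also have "... = sw C (total H') (%c d. H'.ract (Psi c u) (psi d a)) c"
 by (rule sw_cong[OF P H'.h(8) c(1)]) (use Nil mD(6) in auto)
 finally show "cn' (sw C (total H') (%c d. H'.ract (Psi c u) (psi d a)) c) (thl (v # ys) d) = cn' (Psi c (H.ract u a)) (thl (v # ys) d)" by simp
 qed (insert Nil, auto simp del: thl.simps)
 finally show ?case by simp
next
 case (Cons w xs)
 show ?case unfolding append_Cons thl.simps(2)[of w] by (rule D_cong) (use Cons in auto)
qed

lemma th:
 assumes x: "x .: C"
 shows "lin (chains H) Dh (th x)" "a .: base H ==> th x (ca a (cw H [])) = ca' (psi x a) (cw H' [])"
 "us:H.LU ==> th x (cw H us) = thl us x" "w:H.X ==> th x (chain H w) = (case w of Base a=>chain H' (Base (psi x a)) | Tens us=>thl us x)"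
proof -
 let ?g = "%w. case w of Base a=>chain H' (Base (psi x a)) | Tens us=>thl us x"
 have "lin (base H) Dh (%a. ca' (psi x a) (cw H' []))" by (rule linc[OF kA[OF x] bl1[OF H'.bilin_ops(1)]]) simp
 then have B: "lin (base H) Dh (%a. ?g (Base a))"
 by (rule lin_cong[THEN iffD1, rotated 2]) (use x H.h(9) H'.chain_cact in auto)
 note E = H.lin_ext_chains[where g = ?g, OF vD B, folded th_def]
 note s = linD[OF lin_thl_slot[OF _ _ x]]
 show k: "lin (chains H) Dh (th x)" by (rule E(1)) (use x s thl_balanced in auto)
 show e: "th x (chain H w) = ?g w" if "w:H.X" for w using that by (intro E(2)) (use x s thl_balanced in auto)
 show b: "th x (ca a (cw H [])) = ca' (psi x a) (cw H' [])" if "a .: base H" for a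
 using e[OF H.X_mem(1)[OF that]] that x by (simp add:H.chain_cact H'.chain_cact)
 have "th x (cw H []) = thl [] x"
 using b[OF H.A.one_closed] ameasD(3)[OF mD(2) P H'.h(2) x] lin3[OF bilinD(1)[OF H'.bilin_ops(1)], of "cw H' []" "1.[base H']"] by simp
 then show "us:H.LU ==> th x (cw H us) = thl us x" using e[OF H.X_mem(2)] by (cases "us = []") (auto simp:cw_def)
qed

lemma th_closed [simp]: "x .: C ==> z .: chains H ==> th x z .: Dh"
 using linD(1)[OF th(1)] .

lemma th_lin [simp]:
 assumes "x .: C" "z .: chains H"
 shows "y .: chains H ==> th x (z +[chains H] y) = th x z +[Dh] th x y" "th x (c *.[chains H] z) = c *.[Dh] th x z"
 using linD[OF th(1)] assms by auto

lemmas th_eqI = H.family_eqI[where I = "car C"]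

lemma lin_th:
 assumes z: "z .: chains H"
 shows "lin C Dh (%x. th x z)"
proof (rule linI)
 fix x y c assume x: "x .: C"
 note v = preD(1)[OF P] and e = H.chains_eqI[OF vD _ _ _ z]
 have g: "lin C Dh (%x. th x (chain H w))" if w: "w:H.X" for w
 proof -
 have "EX g. lin C Dh g & (ALL x:car C. th x (chain H w) = g x)"
 proof (cases w)
 case (Base a)
 then have a: "a .: base H" using w unfolding H.cgens_iff by simp
 then have "ALL x:car C. th x (chain H w) = ca' (psi x a) (cw H' [])" using th(2) Base by (simp add:H.chain_cact)
 then show ?thesis using linc[OF kpsi[OF a] bl1[OF H'.bilin_ops(1) H'.cw_closed]] by (metis lists.Nil)
 next
 case (Tens us)
 then show ?thesis using w lin_thl[of us] th(4)[OF _ w] unfolding H.cgens_iff by auto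
 qed
 then show ?thesis using lin_cong[OF v] by metis
 qed
 show "th x z .: Dh" using x z by simp
 show "th (c *.[C] x) z = c *.[Dh] th x z"
 by (rule e[OF th(1) H.lin_lin2(2)[OF _ vD th(1) th(1)]]) (use x v linD(3)[OF g] in auto)
 show "th (x +[C] y) z = th x z +[Dh] th y z" if "y .: C"
 by (rule e[OF th(1) H.lin_lin2(1)[OF _ vD th(1) th(1)]]) (use that x v linD(2)[OF g] in auto)
qed

lemma lin_sw_op:
 assumes B: "bilin V Dh Dh Bf" and f: "!!x. x .: C ==> f x .: V" and x: "x .: C" and g: "H.endo g"
 shows "lin (chains H) Dh (%z. sw C Dh (%a b. Bf (f a) (th b (g z))) x)"
 by (rule lin_sw_fun[OF P H.vCh vD x], rule linc[OF linc[OF H.chain_opD(1)[OF H.amodC g] th(1)] bl2[OF B f]])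

lemma th_act:
 assumes "a .: base H" "x .: C" "z .: chains H"
 shows "th x (ca a z) = sw C Dh (%c d. ca' (psi c a) (th d z)) x"
proof (rule H.chains_eqI[OF vD linc[OF H.cact(1) th(1)] lin_sw_op[OF H'.bilin_ops(1) _ _ H.endo_id] _ assms(3)])
 fix w assume w: "w:H.X"
 show "th x (ca a (chain H w)) = sw C Dh (%c d. ca' (psi c a) (th d (chain H w))) x"
 proof (cases w)
 case (Base b)
 then have b: "b .: base H" using w unfolding H.cgens_iff by simp
 have "th x (ca a (ca b (cw H []))) = ca' (psi x (a **[base H] b)) (cw H' [])" using th(2)[OF assms(2), of "a **[base H] b"] assms b by simp
 also have "... = ca' (sw C (base H') (%c d. psi c a **[base H'] psi d b) x) (cw H' [])"
 using ameasD(2)[OF mD(2) P H'.h(2) assms(2,1) b] by simp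
 also have "... = sw C Dh (%c d. ca' (psi c a **[base H'] psi d b) (cw H' [])) x"
 by (rule sw_push[OF P bilinD(1)[OF H'.bilin_ops(1)]]) (use assms b H'.h(9) in auto)
 also have "... = sw C Dh (%c d. ca' (psi c a) (th d (ca b (cw H [])))) x" by (rule D_cong) (use assms b th(2) in auto)
 finally show ?thesis using Base b by (simp add:H.chain_cact)
 next
 case (Tens us)
 then obtain u vs where us: "us = u # vs" "u .: total H" "vs:H.LU" using w unfolding H.cgens_iff by (cases us) auto
 have "th x (ca a (chain H w)) = th x (cw H (H.lact a u # vs))" using us assms Tens by (simp add:cw_def H.cact)
 also have "... = sw C Dh (%c d. ca' (psi c a) (thl (u # vs) d)) x" using th(3)[OF assms(2)] thl_act[OF assms(1) us(2,3) assms(2)] us assms(1) by (simp del: thl.simps)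
 also have "... = sw C Dh (%c d. ca' (psi c a) (th d (chain H w))) x" by (rule D_cong) (insert assms us th(4)[OF _ w] Tens, auto simp del: thl.simps)
 finally show ?thesis .
 qed
qed (use assms in auto)

text \<open>For words this is the recursion defining \<open>thl\<close>. For a base element a in
  place of \<open>z\<close>, the two sides have the legs acting on a and on \<open>u\<close> in
  opposite order, so cocommutativity is used.\<close>

lemma th_cons:
 assumes "u .: total H" "x .: C" "z .: chains H"
 shows "th x (cn u z) = sw C Dh (%c d. cn' (Psi c u) (th d z)) x"
proof (rule th_eqI[OF vD _ _ _ _ assms(2,3), where f = "%x z. th x (cn u z)" and g = "%x z. sw C Dh (%c d. cn' (Psi c u) (th d z)) x"])
 show "lin (chains H) Dh (%z. th x (cn u z))" if "x .: C" for x
 by (rule linc[OF H.chain_opD(1)[OF H.amodC H.ccons(1)[OF assms(1)]] th(1)[OF that]])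
 show "lin (chains H) Dh (%z. sw C Dh (%c d. cn' (Psi c u) (th d z)) x)" if "x .: C" for x
 by (rule lin_sw_op[OF H'.bilin_ops(2) _ that H.endo_id]) (use assms in simp)
 fix x assume x: "x .: C"
 show "th x (cn u (ca a (cw H []))) = sw C Dh (%c d. cn' (Psi c u) (th d (ca a (cw H [])))) x" if a: "a .: base H" for a
 proof -
 have t: "th x (cw H [u]) = cn' (Psi x u) (cw H' [])" if "x .: C" for x
 proof -
 have "th x (cw H [u]) = sw C Dh (%c d. counit C d *.[Dh] cn' (Psi c u) (cw H' [])) x"
 using th(3)[OF that, of "[u]"] assms by (simp, intro D_cong) (use that assms in auto)
 also have "... = cn' (Psi x u) (cw H' [])"
 by (rule sw_counit(2)[OF cc_coalg[OF C] vD linc[OF kPsi bilinD(1)[OF H'.bilin_ops(2)]] that]) (use assms in auto)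
 finally show ?thesis .
 qed
 have "th x (cn u (ca a (cw H []))) = sw C Dh (%c d. ca' (psi c a) (th d (cw H [u]))) x"
 using assms a th_act[OF a x, of "cw H [u]"] by simp
 also have "... = sw C Dh (%c d. ca' (psi c a) (cn' (Psi d u) (cw H' []))) x" by (rule D_cong[OF x]) (use assms a t in auto)
 also have "... = sw C Dh (%c d. ca' (psi d a) (cn' (Psi c u) (cw H' []))) x"
 by (rule sw_cocomm[OF C vD bilin_comp[OF H'.bilin_ops(1) kpsi linc[OF kPsi bilinD(1)[OF H'.bilin_ops(2)]]] x, symmetric]) (use assms a in auto)
 also have "... = sw C Dh (%c d. cn' (Psi c u) (th d (ca a (cw H [])))) x" by (rule D_cong[OF x]) (use assms a th(2) in auto)
 finally show ?thesis .
 qed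
 fix u' us assume us: "u' .: total H" "us:H.LU"
 then show "th x (cn u (cn u' (cw H us))) = sw C Dh (%c d. cn' (Psi c u) (th d (cn u' (cw H us)))) x"
 using assms x th(3)[OF x, of "u # u' # us"] by (simp, intro D_cong) (use assms x th(3) us in auto)
qed

lemma th_sop: "x .: C ==> z .: chains H ==> th x (H.sop z) = H'.sop (th x z)"
proof (rule th_eqI[OF vD, where f = "%x z. th x (H.sop z)" and g = "%x z. H'.sop (th x z)"])
 note k = H.chain_opD(1)[OF H.amodC] H'.chain_opD(1)[OF H'.amodC]
 show "lin (chains H) Dh (%z. th x (H.sop z))" "lin (chains H) Dh (%z. H'.sop (th x z))" if "x .: C" for x
 by (rule linc[OF k(1)[OF H.sop(1)] th(1)[OF that]], rule linc[OF th(1)[OF that] k(2)[OF H'.sop(1)]])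
 fix x u us assume x: "x .: C" and u: "u .: total H" "us:H.LU" and IH: "!!x. x .: C ==> th x (H.sop (cw H us)) = H'.sop (th x (cw H us))"
 have "H'.sop (th x (cn u (cw H us))) = sw C Dh (%c d. H'.sop (cn' (Psi c u) (th d (cw H us)))) x"
 unfolding th_cons[OF u(1) x H.cw_closed[OF u(2)]] by (rule D_push[OF k(2)[OF H'.sop(1)] x]) (use u in auto)
 also have "... = sw C Dh (%c d. (- 1) *.[Dh] cn' (Psi c u) (th d (H.sop (cw H us)))) x" by (rule D_cong[OF x]) (use u IH in auto)
 also have "... = (- 1) *.[Dh] sw C Dh (%c d. cn' (Psi c u) (th d (H.sop (cw H us)))) x" by (rule sw_fun_smult[OF P vD x]) (use u in auto)
 also have "... = th x (H.sop (cn u (cw H us)))" using u x by (simp add:th_cons del: H.ccons_simps(6))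
 finally show "th x (H.sop (cn u (cw H us))) = H'.sop (th x (cn u (cw H us)))" by simp
qed (use th(2) in auto)

end

context hopf_meas
begin

lemmas Hk = H.chain_opD(1)[OF H.amodC] and Dk = H'.chain_opD(1)[OF H'.amodC]

lemma th_zero [simp]: "x .: C ==> th x 0.[chains H] = 0.[Dh]"
 by (rule lin_zero[OF th(1) H.vCh vD])

lemma th_D0: "x .: C ==> z .: chains H ==> th x (H.D0 z) = H'.D0 (th x z)"
proof (rule th_eqI[OF vD, where f = "%x z. th x (H.D0 z)" and g = "%x z. H'.D0 (th x z)"])
 show "lin (chains H) Dh (%z. th x (H.D0 z))" "lin (chains H) Dh (%z. H'.D0 (th x z))" if "x .: C" for x
 by (rule linc[OF Hk[OF H.D0(1)] th(1)[OF that]], rule linc[OF th(1)[OF that] Dk[OF H'.D0(1)]])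
 fix x u us assume x: "x .: C" and u: "u .: total H" "us:H.LU"
 have R: "psi x (counR H u) = counR H' (Psi x u)" if "x .: C" for x
 using mD(7,8) that u linD(1)[OF H.h(7)] by (simp add:counR_def)
 have "H'.D0 (th x (cn u (cw H us))) = sw C Dh (%c d. H'.D0 (cn' (Psi c u) (th d (cw H us)))) x"
 unfolding th_cons[OF u(1) x H.cw_closed[OF u(2)]] by (rule D_push[OF Dk[OF H'.D0(1)] x]) (use u in auto)
 also have "... = sw C Dh (%c d. ca' (psi c (counR H u)) (th d (cw H us))) x" by (rule D_cong[OF x]) (use u R in auto)
 also have "... = th x (H.D0 (cn u (cw H us)))" using u x by (simp add:th_act del: H.ccons_simps(6))
 finally show "th x (H.D0 (cn u (cw H us))) = H'.D0 (th x (cn u (cw H us)))" by simp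
qed (use th(2) in auto)

text \<open>On the empty word \<open>mop v\<close> is the counit, and compatibility of the measuring
  with counits enters; on longer words it is the measuring law for the product of \<open>v\<close>
  with the head.\<close>

lemma th_mop:
 assumes v: "v .: total H" and x: "x .: C" and z: "z .: chains H"
 shows "th x (H.mop v z) = sw C Dh (%c d. H'.mop (Psi c v) (th d z)) x"
proof (rule th_eqI[OF vD _ _ _ _ x z, where f = "%x z. th x (H.mop v z)" and g = "%x z. sw C Dh (%c d. H'.mop (Psi c v) (th d z)) x"])
 show "lin (chains H) Dh (%z. th x (H.mop v z))" if "x .: C" for x
 by (rule linc[OF Hk[OF H.mop(1)[OF v]] th(1)[OF that]])
 show "lin (chains H) Dh (%z. sw C Dh (%c d. H'.mop (Psi c v) (th d z)) x)" if "x .: C" for x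
 by (rule lin_sw_op[OF H'.bilin_ops(3) _ that H.endo_id]) (use v in simp)
 fix x assume x: "x .: C"
 show "th x (H.mop v (ca a (cw H []))) = sw C Dh (%c d. H'.mop (Psi c v) (th d (ca a (cw H [])))) x" if a: "a .: base H" for a
 proof -
 have "th x (H.mop v (ca a (cw H []))) = th x (ca (coun H v) (ca a (cw H [])))"
 using v a H.cact_commute[of a "coun H v" "cw H []"] by simp
 also have "... = sw C Dh (%c d. ca' (psi c (coun H v)) (th d (ca a (cw H [])))) x" by (rule th_act) (use v a x in auto)
 also have "... = sw C Dh (%c d. H'.mop (Psi c v) (th d (ca a (cw H [])))) x"
 by (rule D_cong[OF x]) (use v a th(2) mD(8) H'.cact_commute in auto)
 finally show ?thesis .
 qed
 fix u us assume u: "u .: total H" "us:H.LU"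
 have "sw C Dh (%c d. H'.mop (Psi c v) (th d (cn u (cw H us)))) x = sw C Dh (%c d. H'.mop (Psi c v) (sw C Dh (%c d. cn' (Psi c u) (th d (cw H us))) d)) x"
 by (rule D_cong[OF x]) (insert u v, auto simp:th_cons simp del: H.ccons_simps(6) intro!:sw_closed[OF P])
 also have "... = sw C Dh (%c d. cn' (sw C (total H') (%c d. Psi c v **[total H'] Psi d u) c) (th d (cw H us))) x"
 by (rule sw_nest[OF C vD vD H'.h(8) H'.bilin_ops(3,2,2,5)]) (use u v x kPsi lin_th in auto)
 also have "... = sw C Dh (%c d. cn' (Psi c (v **[total H] u)) (th d (cw H us))) x"
 by (rule D_cong[OF x]) (use u v ameasD(2)[OF mD(1) P H'.h(1)] in auto)
 also have "... = th x (H.mop v (cn u (cw H us)))" using u v x by (simp add:th_cons del: H.ccons_simps(6))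
 finally show "th x (H.mop v (cn u (cw H us))) = sw C Dh (%c d. H'.mop (Psi c v) (th d (cn u (cw H us)))) x" by simp
qed

lemma th_D1: "x .: C ==> z .: chains H ==> th x (H.D1 z) = H'.D1 (th x z)"
proof (rule th_eqI[OF vD, where f = "%x z. th x (H.D1 z)" and g = "%x z. H'.D1 (th x z)"])
 show "lin (chains H) Dh (%z. th x (H.D1 z))" "lin (chains H) Dh (%z. H'.D1 (th x z))" if "x .: C" for x
 by (rule linc[OF Hk[OF H.D1(1)] th(1)[OF that]], rule linc[OF th(1)[OF that] Dk[OF H'.D1(1)]])
 fix x u us assume x: "x .: C" and u: "u .: total H" "us:H.LU" and IH: "!!x. x .: C ==> th x (H.D1 (cw H us)) = H'.D1 (th x (cw H us))"
 let ?m = "%c d. H'.mop (Psi c u) (th d (cw H us))" and ?c = "%c d. cn' (Psi c u) (th d (H.D1 (cw H us)))"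
 have "H'.D1 (th x (cn u (cw H us))) = sw C Dh (%c d. H'.D1 (cn' (Psi c u) (th d (cw H us)))) x"
 unfolding th_cons[OF u(1) x H.cw_closed[OF u(2)]] by (rule D_push[OF Dk[OF H'.D1(1)] x]) (use u in auto)
 also have "... = sw C Dh (%c d. (- 1) *.[Dh] (?m c d +[Dh] ?c c d)) x" by (rule D_cong[OF x]) (use u IH in auto)
 also have "... = (- 1) *.[Dh] sw C Dh (%c d. ?m c d +[Dh] ?c c d) x" by (rule sw_fun_smult[OF P vD x]) (use u in auto)
 also have "sw C Dh (%c d. ?m c d +[Dh] ?c c d) x = sw C Dh ?m x +[Dh] sw C Dh ?c x" by (rule sw_fun_add[OF P vD x]) (use u in auto)
 also have "(- 1) *.[Dh] (sw C Dh ?m x +[Dh] sw C Dh ?c x) = th x (H.D1 (cn u (cw H us)))"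
 using u x by (simp add:th_cons th_mop del: H.ccons_simps(6))
 finally show "th x (H.D1 (cn u (cw H us))) = H'.D1 (th x (cn u (cw H us)))" by simp
qed (use th(2) in auto)

lemma th_differential: "x .: C ==> z .: chains H ==> th x (differential H z) = differential H' (th x z)"
 by (simp add:H.differential H'.differential th_D0 th_D1)

text \<open>Both arguments are Sweedler sums headed by one letter each. The recursion of
  \<open>sh\<close> is applied under the double sum, and in each of its two terms the sum over the
  argument kept whole is folded back.\<close>

lemma sh_sw_cons:
 assumes a: "a .: C" and b: "b .: C"
 and f: "!!c. c .: C ==> f c .: total H'" "!!c. c .: C ==> f' c .: total H'"
 "!!c. c .: C ==> g c .: Dh" "!!c. c .: C ==> g' c .: Dh"
 defines "p == sw C Dh (%c d. cn' (f c) (g d)) a" and "q == sw C Dh (%c d. cn' (f' c) (g' d)) b"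
 shows "H'.sh p q = sw C Dh (%c d. cn' (f c) (H'.sh (g d) q)) a +[Dh] sw C Dh (%c d. cn' (f' c) (H'.sh (H'.sop p) (g' d))) b"
proof -
 note [simp] = f
 have pq: "p .: Dh" "q .: Dh" unfolding p_def q_def using a b by (auto intro!:sw_closed[OF P])
 let ?L = "%c d. cn' (f c) (H'.sh (g d) q)" and ?R = "%e h. cn' (f' e) (H'.sh (H'.sop p) (g' h))"
 have "H'.sh p q = sw C Dh (%c d. H'.sh (cn' (f c) (g d)) q) a"
 unfolding p_def by (rule D_push[OF Dk[OF H'.sh_left(1)[OF pq(2)]] a]) auto
 also have "... = sw C Dh (%c d. ?L c d +[Dh] sw C Dh (%e h. cn' (f' e) (H'.sh (H'.sop (cn' (f c) (g d))) (g' h))) b) a"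
 proof (rule D_cong[OF a])
 fix c d assume c: "c .: C" "d .: C"
 let ?r = "%e h. cn' (f' e) (H'.sh (H'.sop (cn' (f c) (g d))) (g' h))"
 have "H'.sh (cn' (f c) (g d)) q = sw C Dh (%e h. H'.sh (cn' (f c) (g d)) (cn' (f' e) (g' h))) b"
 unfolding q_def by (rule D_push[OF Dk[OF H'.sh_right] b]) (use c in auto)
 also have "... = sw C Dh (%e h. cn' (f c) (H'.sh (g d) (cn' (f' e) (g' h))) +[Dh] ?r e h) b"
 by (rule D_cong[OF b]) (use c in auto)
 also have "... = sw C Dh (%e h. cn' (f c) (H'.sh (g d) (cn' (f' e) (g' h)))) b +[Dh] sw C Dh ?r b"
 by (rule sw_fun_add[OF P vD b]) (use c in auto)
 also have "sw C Dh (%e h. cn' (f c) (H'.sh (g d) (cn' (f' e) (g' h)))) b = ?L c d"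
 unfolding q_def by (rule D_push[OF linc[OF Dk[OF H'.sh_right] Dk[OF H'.ccons(1)]] b, symmetric]) (use c in auto)
 finally show "H'.sh (cn' (f c) (g d)) q = ?L c d +[Dh] sw C Dh ?r b" .
 qed (insert pq b, auto intro!:sw_closed[OF P] simp del: H'.sop_simps(7))
 also have "... = sw C Dh ?L a +[Dh] sw C Dh (%c d. sw C Dh (%e h. cn' (f' e) (H'.sh (H'.sop (cn' (f c) (g d))) (g' h))) b) a"
 by (rule sw_fun_add[OF P vD a]) (insert pq b, auto intro!:sw_closed[OF P] simp del: H'.sop_simps(7))
 also have "sw C Dh (%c d. sw C Dh (%e h. cn' (f' e) (H'.sh (H'.sop (cn' (f c) (g d))) (g' h))) b) a
 = sw C Dh (%e h. sw C Dh (%c d. cn' (f' e) (H'.sh (H'.sop (cn' (f c) (g d))) (g' h))) a) b"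
 by (rule sw_swap[OF P P vD a b]) (auto simp del: H'.sop_simps(7))
 also have "... = sw C Dh ?R b"
 proof (rule D_cong[OF b])
 fix e h assume e: "e .: C" "h .: C"
 show "sw C Dh (%c d. cn' (f' e) (H'.sh (H'.sop (cn' (f c) (g d))) (g' h))) a = ?R e h"
 unfolding p_def
 by (rule D_push[OF linc[OF Dk[OF H'.sop(1)] linc[OF Dk[OF H'.sh_left(1)] Dk[OF H'.ccons(1)]]] a, symmetric]) (use e in auto)
 qed (use pq in auto)
 finally show ?thesis .
qed

text \<open>Induction on the left word and, inside it, on the right chain. Terms headed by the left
  letter keep the order of the three legs and need coassociativity; terms headed by the right letter
  take their first leg from the second argument, which is allowed by
  \<open>sw_swap_left\<close>.\<close>

lemma th_sh_cw:
 assumes us: "us:H.LU"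
 shows "x .: C ==> y .: chains H ==> th x (H.sh (cw H us) y) = sw C Dh (%a b. H'.sh (th a (cw H us)) (th b y)) x"
 using us
proof (induction us arbitrary:x y)
 case Nil
 have "th x (H.sh (cw H []) y) = sw C Dh (%a b. counit C a *.[Dh] th b y) x"
 using Nil sw_counit(1)[OF cc_coalg[OF C] vD lin_th Nil(1)] by simp
 also have "... = sw C Dh (%a b. H'.sh (th a (cw H [])) (th b y)) x" by (rule D_cong) (use Nil th(3)[of _ "[]"] in auto)
 finally show ?case .
next
 case (Cons u us)
 define z where "z = cw H us"
 let ?c = "(- 1 :: 'k) ^ length (u # us)"
 have u: "u .: total H" "us:H.LU" and z: "z .: chains H" and cu: "cw H (u # us) = cn u z" using Cons.hyps z_def by auto
 have s: "H.sop (cn u z) = ?c *.[chains H] cn u z" unfolding cu[symmetric] by (rule H.sop_cw) (use u in simp)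
 note uz [simp] = H.ccons_simps(1)[OF u(1) z]
 have k1: "lin (chains H) Dh (%y. th x (H.sh (cn u z) y))" if "x .: C" for x
 by (rule linc[OF Hk[OF H.sh_right[OF uz]] th(1)[OF that]])
 show ?case unfolding cu
 proof (rule th_eqI[OF vD k1 _ _ _ Cons.prems(1,2), where g = "%x y. sw C Dh (%a b. H'.sh (th a (cn u z)) (th b y)) x"])
 show "lin (chains H) Dh (%y. sw C Dh (%a b. H'.sh (th a (cn u z)) (th b y)) x)" if "x .: C" for x
 by (rule lin_sw_op[OF H'.bilin_ops(4) _ that H.endo_id]) simp
 fix x assume x: "x .: C"
 show "th x (H.sh (cn u z) (ca b (cw H []))) = sw C Dh (%c d. H'.sh (th c (cn u z)) (th d (ca b (cw H [])))) x" if b: "b .: base H" for b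
 proof -
 have "th x (H.sh (cn u z) (ca b (cw H []))) = sw C Dh (%c d. ca' (psi c b) (th d (cn u z))) x"
 using th_act[OF b x uz] b by simp
 also have "... = sw C Dh (%c d. ca' (psi d b) (th c (cn u z))) x"
 by (rule sw_cocomm[OF C vD bilin_comp[OF H'.bilin_ops(1) kpsi lin_th] x, symmetric]) (use b in auto)
 also have "... = sw C Dh (%c d. H'.sh (th c (cn u z)) (th d (ca b (cw H [])))) x" by (rule D_cong[OF x]) (use b th(2) in auto)
 finally show ?thesis .
 qed
 fix v vs assume v: "v .: total H" "vs:H.LU"
 and I: "!!x. x .: C ==> th x (H.sh (cn u z) (cw H vs)) = sw C Dh (%a b. H'.sh (th a (cn u z)) (th b (cw H vs))) x"
 define y where "y = cw H vs"
 have y: "y .: chains H" using v y_def by simp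
 note vy [simp] = H.ccons_simps(1)[OF v(1) y]
 note I = I[folded y_def]
 have b: "!!x. x .: C ==> th x (H.sh z (cn v y)) = sw C Dh (%a b. H'.sh (th a z) (th b (cn v y))) x"
 using Cons.IH[OF _ vy] by (simp add:z_def)
 let ?G = "%a b c. cn' (Psi a u) (H'.sh (th b z) (th c (cn v y)))"
 let ?K = "%a b c. cn' (Psi a v) (H'.sh (H'.sop (th b (cn u z))) (th c y))"
 have tG: "trilin C C C Dh ?G" and tK: "trilin C C C Dh ?K"
 by (rule trilinI; rule linc[OF kPsi bilinD(1)[OF H'.bilin_ops(2)]]
 linc[OF linc[OF linc[OF lin_th Dk[OF H'.sop(1)]] bl1[OF H'.bilin_ops(4)]] bl2[OF H'.bilin_ops(2)]]
 linc[OF linc[OF lin_th bilinD(1)[OF H'.bilin_ops(4)]] bl2[OF H'.bilin_ops(2)]]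
 linc[OF linc[OF lin_th bilinD(2)[OF H'.bilin_ops(4)]] bl2[OF H'.bilin_ops(2)]]; use u v z y in simp)+
 have cG: "?G a b c .: Dh" "?K a b c .: Dh" if "a .: C" "b .: C" "c .: C" for a b c
 using that u v z y by simp_all
 note cl = sw_closed[OF P vD]
 have "sw C Dh (%a b. H'.sh (th a (cn u z)) (th b (cn v y))) x
 = sw C Dh (%a b. sw C Dh (%c d. ?G c d b) a +[Dh] sw C Dh (%c d. ?K c a d) b) x"
 proof (rule D_cong[OF x])
 fix a b assume ab: "a .: C" "b .: C"
 show "H'.sh (th a (cn u z)) (th b (cn v y)) = sw C Dh (%c d. ?G c d b) a +[Dh] sw C Dh (%c d. ?K c a d) b"
 unfolding th_cons[OF u(1) ab(1) z] th_cons[OF v(1) ab(2) y]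
 by (rule sh_sw_cons[OF ab]) (use u v z y in auto)
 qed (use cG cl in auto)
 also have "... = sw C Dh (%a b. sw C Dh (%c d. ?G c d b) a) x +[Dh] sw C Dh (%a b. sw C Dh (%c d. ?K c a d) b) x"
 by (rule sw_fun_add[OF P vD x]) (use cG cl in auto)
 also have "sw C Dh (%a b. sw C Dh (%c d. ?G c d b) a) x = sw C Dh (%a b. sw C Dh (%c d. ?G a c d) b) x"
 by (rule sw_coassoc[OF cc_coalg[OF C] vD tG x])
 also have "... = sw C Dh (%a b. cn' (Psi a u) (th b (H.sh z (cn v y)))) x"
 proof (rule D_cong[OF x])
 fix a e assume ae: "a .: C" "e .: C"
 show "sw C Dh (%c d. ?G a c d) e = cn' (Psi a u) (th e (H.sh z (cn v y)))"
 unfolding b[OF ae(2)] by (rule D_push[OF bilinD(2)[OF H'.bilin_ops(2)] ae(2), symmetric]) (use ae u z in auto)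
 qed (use u z in auto)
 also have "... = th x (cn u (H.sh z (cn v y)))" by (rule th_cons[OF u(1) x, symmetric]) (use z in auto)
 also have "sw C Dh (%a b. sw C Dh (%c d. ?K c a d) b) x = sw C Dh (%a b. sw C Dh (%c d. ?K a c d) b) x"
 by (rule sw_swap_left[OF C vD tK x])
 also have "... = sw C Dh (%a b. cn' (Psi a v) (th b (H.sh (H.sop (cn u z)) y))) x"
 proof (rule D_cong[OF x])
 fix a e assume ae: "a .: C" "e .: C"
 have "th e (H.sh (H.sop (cn u z)) y) = ?c *.[Dh] th e (H.sh (cn u z) y)" unfolding s using ae y by simp
 also have "... = sw C Dh (%a b. ?c *.[Dh] H'.sh (th a (cn u z)) (th b y)) e"
 unfolding I[OF ae(2)] by (rule sw_fun_smult[OF P vD ae(2), symmetric]) (use y in auto)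
 also have "... = sw C Dh (%a b. H'.sh (H'.sop (th a (cn u z))) (th b y)) e"
 proof (rule D_cong[OF ae(2)])
 fix a b assume ab: "a .: C" "b .: C"
 have "H'.sop (th a (cn u z)) = ?c *.[Dh] th a (cn u z)" using th_sop[OF ab(1) uz] ab unfolding s by simp
 then show "?c *.[Dh] H'.sh (th a (cn u z)) (th b y) = H'.sh (H'.sop (th a (cn u z))) (th b y)" using ab y by simp
 qed (use y in auto)
 finally show "sw C Dh (%c d. ?K a c d) e = cn' (Psi a v) (th e (H.sh (H.sop (cn u z)) y))"
 by (simp, intro D_push[OF bilinD(2)[OF H'.bilin_ops(2)] ae(2), symmetric]) (use ae v y in auto)
 qed (insert v y, auto simp del: H.sop_simps(7))
 also have "... = th x (cn v (H.sh (H.sop (cn u z)) y))" by (rule th_cons[OF v(1) x, symmetric]) (insert y, auto simp del: H.sop_simps(7))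
 also have "th x (cn u (H.sh z (cn v y))) +[Dh] th x (cn v (H.sh (H.sop (cn u z)) y)) = th x (H.sh (cn u z) (cn v y))"
 using u v x y z by (simp del: H.sop_simps(7))
 finally show "th x (H.sh (cn u z) (cn v (cw H vs))) = sw C Dh (%a b. H'.sh (th a (cn u z)) (th b (cn v (cw H vs)))) x"
 by (simp add:y_def)
 qed
qed

lemma th_sh:
 assumes x: "x .: C" and z: "z .: chains H" and y: "y .: chains H"
 shows "th x (H.sh z y) = sw C Dh (%a b. H'.sh (th a z) (th b y)) x"
proof (rule th_eqI[OF vD _ _ _ _ x z, where f = "%x z. th x (H.sh z y)" and g = "%x z. sw C Dh (%a b. H'.sh (th a z) (th b y)) x"])
 show "lin (chains H) Dh (%z. th x (H.sh z y))" if "x .: C" for x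
 by (rule linc[OF Hk[OF H.sh_left(1)[OF y]] th(1)[OF that]])
 show "lin (chains H) Dh (%z. sw C Dh (%a b. H'.sh (th a z) (th b y)) x)" if "x .: C" for x
 by (rule lin_sw_fun[OF P H.vCh vD that], rule linc[OF th(1) bl1[OF H'.bilin_ops(4)]]) (use y in auto)
 fix x assume x: "x .: C"
 show "th x (H.sh (ca a (cw H [])) y) = sw C Dh (%c d. H'.sh (th c (ca a (cw H []))) (th d y)) x" if a: "a .: base H" for a
 using a y th_act[OF a x y] by (simp, intro D_cong[OF x]) (use th(2) in auto)
 show "th x (H.sh (cn u (cw H us)) y) = sw C Dh (%a b. H'.sh (th a (cn u (cw H us))) (th b y)) x" if "u .: total H" "us:H.LU" for u us
 using th_sh_cw[of "u # us" x y] x y that by simp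
qed

end

section \<open>Iterated coproducts and the induced measuring on homology\<close>

lemma tgens_rep: "xs:tgens (replicate n C) <-> length xs = n & xs:lists (car C)"
 by (simp add:tensor_gens_def list_all2_conv_all_nth in_lists_conv_set all_set_conv_all_nth) auto

lemma lin_ext_tensor_cong:
 assumes v: "!!M. M:set Ms ==> vspace M" and W: "vspace W" and t: "t .: tensor Ms"
 and eq: "!!xs. xs:tgens Ms ==> g xs = g' xs" "!!xs. xs:tgens Ms ==> g' xs .: W"
 shows "lin_ext W g t = lin_ext W g' t"
proof -
 have "ev W g p = ev W g' p" if "p:t" for p
 proof -
 have "keys p <= tgens Ms"
 by (rule pres_mem(1)[OF tensor_rels_free[OF v]]) (insert t that, simp_all add: tensor_def)
 then show ?thesis using eq by (intro ev_cong[OF W]) auto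
 qed
 then show ?thesis unfolding lin_ext_def ev_def[symmetric] by (metis (no_types, lifting) image_cong)
qed

lemma mlin_Cons:
 assumes "mlin (replicate (Suc n) C) W g" "x .: C"
 shows "mlin (replicate n C) W (%xs. g (x # xs))"
proof -
 have t: "(x # xs) @ y # ys:tgens (replicate (Suc n) C)" if "xs @ y # ys:tgens (replicate n C)" for xs y ys
 using that assms(2) unfolding tgens_rep by auto
 show ?thesis
 unfolding mlin_def using assms(1)[unfolded mlin_def, THEN conjunct1, rule_format, OF t t] assms(1)[unfolded mlin_def, THEN conjunct2, rule_format, OF t]
 by simp
qed

context hopf_meas
begin

abbreviation (input) "Tn n == tensor (replicate n C)"
abbreviation (input) "pre n x == lin_ext (tensor (replicate (Suc n) C)) (%xs. tens (replicate (Suc n) C) (x # xs))"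

lemma rep_vs: "M:set (replicate n C) ==> vspace M"
 using preD(1)[OF P] by (auto split: if_splits)

lemma Tn:
 shows vTn: "vspace (Tn n)" and Tn_closed: "xs:tgens (replicate n C) ==> tens (replicate n C) xs .: Tn n"
 and Tn_mlin: "mlin (replicate n C) (Tn n) (tens (replicate n C))"
 by (rule vspace_tensor tens_closed mlin_tens; (rule rep_vs)?; assumption)+

lemma Tn_ext:
 assumes "vspace W" "!!xs. xs:tgens (replicate n C) ==> g xs .: W" "mlin (replicate n C) W g"
 shows "lin (Tn n) W (lin_ext W g)" "xs:tgens (replicate n C) ==> lin_ext W g (tens (replicate n C) xs) = g xs"
 by (rule tensor_ext; (rule rep_vs assms)?; assumption)+

lemma Tn_eqI:
 assumes "vspace W" "lin (Tn n) W f" "lin (Tn n) W g" "t .: Tn n"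
 "!!xs. xs:tgens (replicate n C) ==> f (tens (replicate n C) xs) = g (tens (replicate n C) xs)"
 shows "f t = g t"
 by (rule tensor_eqI[where f = f and g = g and Ms = "replicate n C"]; (rule rep_vs assms)?; assumption)

lemma pre:
 assumes "x .: C"
 shows "lin (Tn n) (Tn (Suc n)) (pre n x)"
 "xs:tgens (replicate n C) ==> pre n x (tens (replicate n C) xs) = tens (replicate (Suc n) C) (x # xs)"
proof -
 have c: "tens (replicate (Suc n) C) (x # xs) .: (Tn (Suc n))" if "xs:tgens (replicate n C)" for xs
 by (rule Tn_closed) (insert that assms, unfold tgens_rep, simp)
 note E = Tn_ext[OF vTn c mlin_Cons[OF Tn_mlin assms]]
 show "lin (Tn n) (Tn (Suc n)) (pre n x)"
 "xs:tgens (replicate n C) ==> pre n x (tens (replicate n C) xs) = tens (replicate (Suc n) C) (x # xs)"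
 using E(1,2) by blast+
qed

lemma bilin_pre: "bilin C (Tn n) (Tn (Suc n)) (pre n)"
proof (rule bilinI)
 show "lin (Tn n) (Tn (Suc n)) (pre n x)" if "x .: C" for x by (rule pre(1)[OF that])
 fix t assume t: "t .: Tn n"
 note v = preD(1)[OF P] and e = Tn_eqI[OF vTn _ _ t]
 note ml = Tn_mlin[of "Suc n", unfolded mlin_def]
 have g: "[x] @ xs:tgens (replicate (Suc n) C)" if "x .: C" "xs:tgens (replicate n C)" for x xs
 using that by (simp add:tgens_rep del: replicate_Suc)
 show "lin C (Tn (Suc n)) (%x. pre n x t)"
 proof (rule linI)
 fix x y c assume x: "x .: C"
 show "pre n x t .: (Tn (Suc n))" by (rule linD(1)[OF pre(1)[OF x] t])
 show "pre n (c *.[C] x) t = c *.[Tn (Suc n)] pre n x t"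
 proof (rule e[OF pre(1) H.lin_lin2(2)[OF vTn vTn pre(1)[OF x] pre(1)[OF x]]])
 show "pre n (c *.[C] x) (tens (replicate n C) xs) = c *.[Tn (Suc n)] pre n x (tens (replicate n C) xs)" if "xs:tgens (replicate n C)" for xs
 unfolding pre(2)[OF x that] pre(2)[OF vs_closed(3)[OF v x] that] using ml[THEN conjunct2, rule_format, of "[]" x xs c] g[OF x that] by simp
 qed (use x v in simp)
 show "pre n (x +[C] y) t = pre n x t +[Tn (Suc n)] pre n y t" if y: "y .: C"
 proof (rule e[OF pre(1) H.lin_lin2(1)[OF vTn vTn pre(1)[OF x] pre(1)[OF y]]])
 show "pre n (x +[C] y) (tens (replicate n C) xs) = pre n x (tens (replicate n C) xs) +[Tn (Suc n)] pre n y (tens (replicate n C) xs)"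
 if "xs:tgens (replicate n C)" for xs
 unfolding pre(2)[OF x that] pre(2)[OF y that] pre(2)[OF vs_closed(2)[OF v x y] that]
 using ml[THEN conjunct1, rule_format, of "[]" x xs y] g[OF x that] g[OF y that] by simp
 qed (use x y v in simp)
 qed
qed

lemma lin_iter: "lin C (Tn n) (iter_comult C n)"
proof (induction n)
 case 0
 have t: "tens (replicate 0 C) [] .: Tn 0" by (rule Tn_closed) (unfold tgens_rep, simp)
 have "lin ground (Tn 0) (%c. c *.[Tn 0] tens (replicate 0 C) [])"
 using t vTn[of 0] by (intro linI) (simp_all add: vs_smult)
 from linc[OF preD(3)[OF P] this]
 show ?case by (simp add:iter_comult.simps(1)[abs_def])
next
 case (Suc n)
 note b = bilin_comp[OF bilin_pre lin_id Suc]
 have "iter_comult C (Suc n) x = sw C (Tn (Suc n)) (%a b. pre n a (iter_comult C n b)) x" if "x .: C" for x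
 unfolding iter_comult.simps(2) by (rule sweedler_sw[OF P vTn b that])
 then show ?case using lin_sw[OF P vTn b] lin_cong[OF preD(1)[OF P], of "iter_comult C (Suc n)"] by blast
qed

lemma mlin_word:
 assumes "us:H.LU"
 shows "mlin (replicate (length us) C) Dh (%xs. cw H' (map2 Psi xs us))" "xs:tgens (replicate (length us) C) ==> map2 Psi xs us:H'.LU"
proof -
 have l: "map2 Psi xs us:H'.LU" if "xs:lists (car C)" "us:H.LU" for xs us
 using that by (induction xs us rule:list_induct2') auto
 then show "xs:tgens (replicate (length us) C) ==> map2 Psi xs us:H'.LU" using assms by (simp add:tgens_rep)
 have s: "EX us1 u us2. us1:H.LU & u .: total H & us2:H.LU & (ALL x. map2 Psi (xs @ x # ys) us = map2 Psi xs us1 @ Psi x u # map2 Psi ys us2)"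
 if n: "length (xs @ x # ys) = length us" for xs ys :: "'c list" and x
 proof -
 have i: "length xs < length us" using n by simp
 have "us = take (length xs) us @ us ! length xs # drop (Suc (length xs)) us" by (rule id_take_nth_drop[OF i])
 then obtain us1 u us2 where us: "us = us1 @ u # us2" "length us1 = length xs" using i by (metis length_take min.absorb4)
 then show ?thesis using assms n by (intro exI[of _ us1] exI[of _ u] exI[of _ us2]) auto
 qed
 have n: "replicate (length us) C ! length xs = C" if "xs @ x # ys:tgens (replicate (length us) C)" for xs x ys
 using that by (auto simp:tgens_rep)
 have ne: "cw H' (as @ a # bs) = chain H' (Tens (as @ a # bs))" for as a bs by (simp add:cw_def)
 show "mlin (replicate (length us) C) Dh (%xs. cw H' (map2 Psi xs us))"
 unfolding mlin_def
 proof (intro conjI allI impI)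
 fix xs x y ys assume *: "xs @ x # ys:tgens (replicate (length us) C)" "xs @ y # ys:tgens (replicate (length us) C)"
 then have c: "xs:lists (car C)" "ys:lists (car C)" "x .: C" "y .: C" by (auto simp:tgens_rep)
 obtain us1 u us2 where u: "us1:H.LU" "u .: total H" "us2:H.LU" "!!x. map2 Psi (xs @ x # ys) us = map2 Psi xs us1 @ Psi x u # map2 Psi ys us2"
 using s[of xs x ys] * by (auto simp:tgens_rep)
 show "cw H' (map2 Psi (xs @ (x +[replicate (length us) C ! length xs] y) # ys) us) = cw H' (map2 Psi (xs @ x # ys) us) +[Dh] cw H' (map2 Psi (xs @ y # ys) us)"
 unfolding n[OF *(1)] u(4) ne using c u(1-3) lin2[OF kPsi] l H'.chain_rules(3) by simp
 next
 fix xs c x ys assume *: "xs @ x # ys:tgens (replicate (length us) C)"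
 then have c: "xs:lists (car C)" "ys:lists (car C)" "x .: C" by (auto simp:tgens_rep)
 obtain us1 u us2 where u: "us1:H.LU" "u .: total H" "us2:H.LU" "!!x. map2 Psi (xs @ x # ys) us = map2 Psi xs us1 @ Psi x u # map2 Psi ys us2"
 using s[of xs x ys] * by (auto simp:tgens_rep)
 show "cw H' (map2 Psi (xs @ (c *.[replicate (length us) C ! length xs] x) # ys) us) = c *.[Dh] cw H' (map2 Psi (xs @ x # ys) us)"
 unfolding n[OF *] u(4) ne using c u(1-3) lin3[OF kPsi] l H'.chain_rules(4) by simp
 qed
qed

lemma word_ext:
 assumes "us:H.LU"
 shows "lin (Tn (length us)) Dh (lin_ext Dh (%xs. cw H' (map2 Psi xs us)))"
 "xs:tgens (replicate (length us) C) ==> lin_ext Dh (%xs. cw H' (map2 Psi xs us)) (tens (replicate (length us) C) xs) = cw H' (map2 Psi xs us)"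
 by (rule Tn_ext[OF vD _ mlin_word(1)[OF assms]]; use mlin_word(2)[OF assms] H'.cw_closed in blast)+

text \<open>\<open>iter_comult\<close> splits off the first leg just as \<open>thl\<close> does, so
  applying \<open>Psi\<close> entrywise to the iterated coproduct satisfies the recursion of
  \<open>thl\<close>.\<close>

lemma iter_thl:
 "us:H.LU ==> x .: C ==> lin_ext Dh (%xs. cw H' (map2 Psi xs us)) (iter_comult C (length us) x) = thl us x"
proof (induction us arbitrary:x)
 case Nil
 have t: "[] : tgens (replicate 0 C)" "tens (replicate 0 C) [] .: Tn 0"
 using Tn_closed[of "[]" 0] by (simp_all add: tensor_gens_def)
 show ?case using linD(3)[OF word_ext(1)[of "[]"], of "tens (replicate 0 C) []" "counit C x"] word_ext(2)[of "[]" "[]"] t by simp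
next
 case (Cons u us)
 let ?n = "length us" and ?G = "%us xs. cw H' (map2 Psi xs us)"
 have us: "u .: total H" "us:H.LU" "u # us:H.LU" using Cons.prems by auto
 note E = word_ext
 have k: "lin (Tn (Suc ?n)) Dh (lin_ext Dh (?G (u # us)))" using E(1)[OF us(3)] by simp
 have s: "lin_ext Dh (?G (u # us)) (pre ?n a t) = cn' (Psi a u) (lin_ext Dh (?G us) t)" if a: "a .: C" and t: "t .: (Tn ?n)" for a t
 proof (rule Tn_eqI[OF vD linc[OF pre(1)[OF a] k] linc[OF E(1)[OF us(2)] Dk[OF H'.ccons(1)]] t])
 fix xs assume xs: "xs:tgens (replicate ?n C)"
 then have "a # xs:tgens (replicate (length (u # us)) C)" using a by (simp add:tgens_rep del: replicate_Suc)
 from E(2)[OF us(3) this] show "lin_ext Dh (?G (u # us)) (pre ?n a (tens (replicate ?n C) xs)) = cn' (Psi a u) (lin_ext Dh (?G us) (tens (replicate ?n C) xs))"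
 using pre(2)[OF a xs] E(2)[OF us(2) xs] mlin_word(2)[OF us(2) xs] a us by simp
 qed (use a us in auto)
 note b = bilin_comp[OF bilin_pre lin_id lin_iter]
 have "lin_ext Dh (?G (u # us)) (iter_comult C (length (u # us)) x) = lin_ext Dh (?G (u # us)) (sw C (Tn (Suc ?n)) (%a b. pre ?n a (iter_comult C ?n b)) x)"
 using sweedler_sw[OF P vTn b Cons.prems(2)] by simp
 also have "... = sw C Dh (%a b. lin_ext Dh (?G (u # us)) (pre ?n a (iter_comult C ?n b))) x"
 by (rule sw_push[OF P k vTn vD Cons.prems(2)]) (use bilinD(3)[OF b] in auto)
 also have "... = thl (u # us) x" unfolding thl.simps(2)
 by (rule D_cong[OF Cons.prems(2)]) (use s us Cons.IH[OF us(2)] lin1[OF lin_iter] in auto)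
 finally show ?case .
qed

text \<open>Identifies the map of the definitions, given by iterated coproducts on words, with the
  recursively defined \<open>th\<close>, for which all compatibilities are proved.\<close>

lemma chain_meas:
 assumes x: "x .: C" and t: "t .: chains H"
 shows "chain_meas H' C Psi psi x t = th x t"
 unfolding chain_meas_def
proof (rule H.chains_lin_ext_eq(1)[OF vD th(1)[OF x] _ t])
 fix w assume w: "w:H.X"
 show "(case w of Base a=>chain H' (Base (psi x a)) | Tens us=>lin_ext Dh (%xs. chain H' (Tens (map2 Psi xs us))) (iter_comult C (length us) x)) = th x (chain H w)"
 proof (cases w)
 case (Base a)
 then show ?thesis using th(4)[OF x w] by simp
 next
 case (Tens us)
 then have us: "us ~= []" "us:H.LU" using w unfolding H.cgens_iff by auto
 have e: "map2 Psi xs us ~= []" if "xs:tgens (replicate (length us) C)" for xs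
 using that us(1) unfolding tgens_rep by (cases xs; cases us) auto
 have "lin_ext Dh (%xs. chain H' (Tens (map2 Psi xs us))) (iter_comult C (length us) x) = lin_ext Dh (%xs. cw H' (map2 Psi xs us)) (iter_comult C (length us) x)"
 proof (rule lin_ext_tensor_cong[OF _ vD linD(1)[OF lin_iter x]])
 show "vspace M" if "M:set (replicate (length us) C)" for M by (rule rep_vs[OF that])
 fix xs assume xs: "xs:tgens (replicate (length us) C)"
 show "chain H' (Tens (map2 Psi xs us)) = cw H' (map2 Psi xs us)" using e[OF xs] by (simp add:cw_def)
 show "cw H' (map2 Psi xs us) .: Dh" by (rule H'.cw_closed[OF mlin_word(2)[OF us(2) xs]])
 qed
 then show ?thesis using th(4)[OF x w] Tens iter_thl[OF us(2) x] by simp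
 qed
qed

lemma th_cycles: "x .: C ==> t:H.Z ==> th x t:H'.Z" "x .: C ==> t:H.B ==> th x t:H'.B"
 by (auto simp:cycles_def boundaries_def th_differential[symmetric]) (simp add:th_differential)

lemma hoc_klass:
 assumes x: "x .: C" and t: "t:H.Z"
 shows "hoc H' C Psi psi x (H.klass t) = H'.klass (th x t)"
proof -
 have c: "H'.B +>[Dh] chain_meas H' C Psi psi x t' = H'.klass (th x t)" if t': "t':H.klass t" for t'
 proof -
 have z: "t':H.Z" "H.klass t' = H.klass t" using H.klass_rep[OF t t'] by auto
 then have "th x (t' +[chains H] (- 1) *.[chains H] t):H'.B" using H.klass_eq_iff t th_cycles(2)[OF x] by blast
 then have "H'.klass (th x t') = H'.klass (th x t)" using H'.klass_eq_iff th_cycles(1)[OF x] z t x H.cyclesD(1) by simp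
 then show ?thesis using chain_meas[OF x H.cyclesD(1)[OF z(1)]] by (simp add:H'.klass_def)
 qed
 have "(\<Union>t'\<in>H.klass t. H'.B +>[Dh] chain_meas H' C Psi psi x t') = H'.klass (th x t)"
 proof
 show "(\<Union>t'\<in>H.klass t. H'.B +>[Dh] chain_meas H' C Psi psi x t') <= H'.klass (th x t)" by (intro UN_least) (simp add:c)
 qed (use c[OF H.klass_self[OF t]] H.klass_self[OF t] in blast)
 then show ?thesis by (simp add:hoc_def)
qed

lemma alg_measuring_hoc: "ameas (HH H) (HH H') C (hoc H' C Psi psi)"
proof -
 let ?Q = "quot Dh H'.B"
 note q = quot_ops[OF vD H'.submodule_B(2), folded H'.klass_def] and vQ = vspace_quot[OF vD H'.submodule_B(2)]
 have kQ: "lin Dh ?Q H'.klass" using lin_coset[OF vD H'.submodule_B(2)] by (simp add:H'.klass_def[abs_def])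
 \<comment> \<open>The law for shuffles holds as a Sweedler sum in the chain space. Classes are
   compared in the quotient of all chains by boundaries, which contains homology as a subspace, so
   that the sum can be moved between chains and homology.\<close>
 have iQ: "lin (HH H') ?Q (%X. X)"
 by (rule linI) (use q linD(1)[OF kQ] H'.cyclesD(1) H'.HH_simps in auto)
 note S = H.HH_simps(3-5) H'.HH_simps(3-5) hoc_klass th_cycles(1) H.Z_closed(3,4) H.sh_cycles(1) H'.sh_cycles(1)
 have c: "X .: HH H ==> EX t:H.Z. X = H.klass t" "t:H'.Z ==> H'.klass t .: HH H'" for X t
 by (auto simp:H.HH_simps(1) H'.HH_simps(1))
 have "lin (HH H) (HH H') (hoc H' C Psi psi x)" if x: "x .: C" for x
 by (rule linI) (insert x S c H.cyclesD(1), auto dest!: c(1))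
 moreover have "lin C (HH H') (%x. hoc H' C Psi psi x X)" if X: "X .: HH H" for X
 proof -
 obtain t where t: "t:H.Z" "X = H.klass t" using c(1)[OF X] by blast
 show ?thesis
 by (rule linI) (use t S c linD[OF lin_th[OF H.cyclesD(1)[OF t(1)]]] pre1[OF P] in auto)
 qed
 moreover have "hoc H' C Psi psi x (X **[HH H] Y) = sw C (HH H') (%a b. hoc H' C Psi psi a X **[HH H'] hoc H' C Psi psi b Y) x"
 if x: "x .: C" and X: "X .: HH H" and Y: "Y .: HH H" for x X Y
 proof -
 obtain s t where t: "s:H.Z" "X = H.klass s" "t:H.Z" "Y = H.klass t" using c(1)[OF X] c(1)[OF Y] by blast
 let ?F = "%a b. H'.sh (th a s) (th b t)"
 have f: "?F a b:H'.Z" if "a .: C" "b .: C" for a b using that S t by simp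
 have "sw C (HH H') (%a b. hoc H' C Psi psi a X **[HH H'] hoc H' C Psi psi b Y) x = sw C (HH H') (%a b. H'.klass (?F a b)) x"
 by (rule sw_cong[OF P H'.vspace_HH x]) (use t S f c(2) in auto)
 also have "... = sw C ?Q (%a b. H'.klass (?F a b)) x" by (rule sw_push[OF P iQ H'.vspace_HH vQ x]) (use f c(2) in auto)
 also have "... = H'.klass (sw C Dh ?F x)" by (rule sw_push[OF P kQ vD vQ x, symmetric]) (use f H'.cyclesD(1) in auto)
 also have "... = hoc H' C Psi psi x (X **[HH H] Y)" using th_sh[OF x H.cyclesD(1)[OF t(1)] H.cyclesD(1)[OF t(3)]] t S x by simp
 finally show ?thesis by simp
 qed
 moreover have "hoc H' C Psi psi x 1.[HH H] = counit C x *.[HH H'] 1.[HH H']" if x: "x .: C" for x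
 proof -
 have z: "cw H [] : H.Z" "cw H' [] : H'.Z" by (simp_all add: cycles_def H.differential H'.differential)
 then show ?thesis using hoc_klass[OF x z(1)] th(3)[OF x, of "[]"] H'.HH_simps(4)[OF z(2)] by (simp add:H.HH_simps(2) H'.HH_simps(2))
 qed
 ultimately show ?thesis unfolding alg_measuring_iff[OF P H'.walg_HH] by (auto simp:linear_family_def)
qed

end

section \<open>The enriched functor\<close>

lemma lin_TC_tens: "ccoalg C ==> ccoalg D ==> x .: C ==> y .: D ==> tens [C,D][x,y] .: tensor_coalg C D"
 using tensor2(3)[OF coalg_vs[OF cc_coalg] coalg_vs[OF cc_coalg]] by (simp add:TC_simps)

lemma sw_TC_hom:
 assumes C: "ccoalg C" and D: "ccoalg D" and M: "precoalg M" and f: "chom (tensor_coalg C D) M f"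
 and W: "vspace W" and B: "bilin M M W B" and x: "x .: C" and y: "y .: D"
 shows "sw M W B (f (tens [C,D][x,y])) = sw C W (%a b. sw D W (%c d. B (f (tens [C,D][a,c])) (f (tens [C,D][b,d]))) y) x"
proof -
 note t = lin_TC_tens[OF C D x y] and k = coalg_homD(1)[OF f]
 have b: "bilin (tensor_coalg C D) (tensor_coalg C D) W (%s t. B (f s) (f t))" by (rule bilin_comp[OF B k k])
 show "sw M W B (f (tens [C,D][x,y])) = sw C W (%a b. sw D W (%c d. B (f (tens [C,D][a,c])) (f (tens [C,D][b,d]))) y) x"
 unfolding sw_hom[OF precoalg_TC[OF C D] M f W B t] by (rule sw_TC[OF C D W b[unfolded bilin_TC[OF C D]] x y])
qed

lemma coalg_hom_tensor:
 fixes C D :: "('k::field,'c) coalg" and C' D' :: "('k,'d) coalg"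
 assumes C: "ccoalg C" and D: "ccoalg D" and C': "ccoalg C'" and D': "ccoalg D'"
 and f: "chom C C' f" and g: "chom D D' g"
 shows "chom (tensor_coalg C D) (tensor_coalg C' D') (sweedler (tensor [C',D']) (%a b. tens [C',D'][f a,g b]))" (is "chom ?T ?T' ?F")
 and "x .: C ==> y .: D ==> sweedler (tensor [C',D']) (%a b. tens [C',D'][f a,g b]) (tens [C,D][x,y]) = tens [C',D'][f x,g y]"
proof -
 note P = cc_pre[OF C] cc_pre[OF D] cc_pre[OF C'] cc_pre[OF D']
 note v = P[THEN preD(1)] and p = precoalg_TC[OF C D] and p' = precoalg_TC[OF C' D'] and fc = coalg_homD(2)[OF f] and gc = coalg_homD(2)[OF g]
 note b = bilin_comp[OF tensor2(2)[OF v(3,4)] coalg_homD(1)[OF f] coalg_homD(1)[OF g]]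
 note s = sweedler_bilin[OF v(1,2) tensor2(1)[OF v(3,4)] b] and TT = tensor2[OF preD(1)[OF p'] pre1[OF p']]
 note q = qlin_tens[OF C' D' TT(2)[unfolded bilin_TC[OF C' D']]]
 show e: "x .: C ==> y .: D ==> ?F (tens [C,D][x,y]) = tens [C',D'][f x,g y]" for x y by (rule s(2))
 have k: "lin ?T ?T' ?F" using s(1) by (simp add:lin_TC[OF C D] lin_TC[OF C' D'])
 note b' = bilin_comp[OF TT(2) k k]
 show "chom ?T ?T' ?F"
 proof (rule coalg_homI[OF p preD(1)[OF p'] k])
 fix t assume t: "t .: ?T"
 show "comult ?T' (?F t) = sw ?T (tensor [?T',?T']) (%a b. tens [?T',?T'][?F a,?F b]) t"
 proof (rule tensor_coalg_eqI[OF C D TT(1) linc[OF k preD(2)[OF p']] lin_sw[OF p TT(1) b'] _ t])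
 fix x y assume x: "x .: C" and y: "y .: D"
 show "comult ?T' (?F (tens [C,D][x,y])) = sw ?T (tensor [?T',?T']) (%a b. tens [?T',?T'][?F a,?F b]) (tens [C,D][x,y])"
 unfolding e[OF x y] sw_TC[OF C D TT(1) b'[unfolded bilin_TC[OF C D]] x y] comult_TC_tens(2)[OF C' D' fc[OF x] gc[OF y], folded tensor_coalg_tensor[OF C' D']]
 sw_hom[OF P(1,3) f TT(1) bilin_sw_param[OF P(4) v(3) TT(1) q gc[OF y]] x]
 proof (rule sw_cong[OF P(1) TT(1) x])
 fix a b assume ab: "a .: C" "b .: C"
 let ?s = "sw D (tensor [?T',?T']) (%c d. tens [?T',?T'][?F (tens [C,D][a,c]),?F (tens [C,D][b,d])]) y"
 show c: "?s .: (tensor [?T',?T'])"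
 by (rule sw_closed[OF P(2) TT(1) y]) (use ab fc gc qlinD(3)[OF q] e in simp)
 show "sw D' (tensor [?T',?T']) (%c d. tens [?T',?T'][tens [C',D'][f a,c],tens [C',D'][f b,d]]) (g y) = ?s"
 unfolding sw_hom[OF P(2,4) g TT(1) qlinD(2)[OF q fc[OF ab(1)] fc[OF ab(2)]] y]
 by (rule sw_cong[OF P(2) TT(1) y]) (use ab fc gc qlinD(3)[OF q] e in simp_all)
 qed
 qed
 show "counit ?T' (?F t) = counit ?T t"
 by (rule tensor_coalg_eqI[OF C D vspace_ground linc[OF k preD(3)[OF p']] preD(3)[OF p] _ t])
 (simp add:e counit_TC_tens(2)[OF C D] counit_TC_tens(2)[OF C' D'] fc gc coalg_homD(3)[OF f] coalg_homD(3)[OF g])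
 qed
qed

text \<open>
 Both target categories are instances of one pattern: final measurings separate their elements, so composites agree
 as soon as the linear maps that they parametrise agree.
\<close>

locale meas_category =
 fixes Obj :: "'o set" and M :: "'o=>'o=>('k::field,'m) coalg" and res :: "'o=>'o=>'m=>'e"
 and V :: "'o=>'o=>('k,'e) module" and cmp :: "'o=>'o=>'o=>('m list \<Rightarrow>\<^sub>0 'k) set=>'m" and un :: "'o=>'k=>'m"
 and comp :: "'o=>'o=>'o=>'e=>'e=>'e" and idm :: "'o=>'k=>'e"
 assumes cc: "X:Obj ==> Y:Obj ==> ccoalg (M X Y)"
 and kres: "X:Obj ==> Y:Obj ==> lin (M X Y) (V X Y) (res X Y)" and vV: "X:Obj ==> Y:Obj ==> vspace (V X Y)"
 and sep: "X:Obj ==> Y:Obj ==> separated (M X Y) {m:car (M X Y). res X Y m = 0.[V X Y]}"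
 and hom_cmp: "X:Obj ==> Y:Obj ==> Z:Obj ==> chom (tensor_coalg (M X Y) (M Y Z)) (M X Z) (cmp X Y Z)"
 and hom_un: "X:Obj ==> chom unit_coalg (M X X) (un X)"
 and res_cmp: "X:Obj ==> Y:Obj ==> Z:Obj ==> f .: M X Y ==> g .: M Y Z ==>
 res X Z (cmp X Y Z (tens [M X Y,M Y Z][f,g])) = comp X Y Z (res X Y f) (res Y Z g)"
 and res_un: "X:Obj ==> res X X (un X c) = idm X c"
 and assoc: "W:Obj ==> X:Obj ==> Y:Obj ==> Z:Obj ==> a .: V W X ==> b .: V X Y ==> d .: V Y Z ==>
 comp W Y Z (comp W X Y a b) d = comp W X Z a (comp X Y Z b d)"
 and comp_id: "X:Obj ==> Y:Obj ==> a .: V X Y ==> comp X X Y (idm X c) a = c *.[V X Y] a"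
 "X:Obj ==> Y:Obj ==> a .: V X Y ==> comp X Y Y a (idm Y c) = c *.[V X Y] a"
begin

abbreviation (input) "tn X Y Z f g == tens [M X Y,M Y Z][f,g]"
abbreviation (input) "cm X Y Z f g == cmp X Y Z (tn X Y Z f g)"

lemma pre: "X:Obj ==> Y:Obj ==> precoalg (M X Y)"
 by (rule cc_pre[OF cc])

lemma kernelI:
 assumes XY: "X:Obj" "Y:Obj" and m: "m .: M X Y" "m' .: M X Y" and eq: "res X Y m = res X Y m'"
 shows "m +[M X Y] (- 1) *.[M X Y] m' : {m:car (M X Y). res X Y m = 0.[V X Y]}"
 using linD[OF kres[OF XY]] m eq vs_eq_iff[OF vV[OF XY], of "res X Y m" "res X Y m'"] pre1[OF pre[OF XY]] by simp

lemmas homs = sw_TC_hom[OF cc cc pre hom_cmp]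

lemma counit_cmp:
 "X:Obj ==> Y:Obj ==> Z:Obj ==> f .: M X Y ==> g .: M Y Z ==> counit (M X Z) (cm X Y Z f g) = counit (M X Y) f * counit (M Y Z) g"
 using coalg_homD(3)[OF hom_cmp lin_TC_tens[OF cc cc]] counit_TC_tens(2)[OF cc cc] by simp

lemma cmp_closed: "X:Obj ==> Y:Obj ==> Z:Obj ==> f .: M X Y ==> g .: M Y Z ==> cm X Y Z f g .: M X Z"
 by (rule coalg_homD(2)[OF hom_cmp lin_TC_tens[OF cc cc]])

lemma qlin_cmp:
 assumes o: "X:Obj" "Y:Obj" "Z:Obj"
 shows "bilin (M X Y) (M Y Z) (M X Z) (%f g. cm X Y Z f g)"
proof -
 have v: "vspace (M X Y)" "vspace (M Y Z)" using preD(1)[OF pre] o by auto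
 have k: "lin (tensor [M X Y,M Y Z]) (M X Z) (cmp X Y Z)"
 using coalg_homD(1)[OF hom_cmp[OF o]] unfolding lin_TC[OF cc[OF o(1,2)] cc[OF o(2,3)]] .
 show ?thesis
 by (rule bilinI; rule linc[OF bilinD(1)[OF tensor2(2)[OF v]] k] linc[OF bilinD(2)[OF tensor2(2)[OF v]] k])
qed

lemma cmp_assoc:
 assumes o: "W:Obj" "X:Obj" "Y:Obj" "Z:Obj" and f: "f .: M W X" and g: "g .: M X Y" and h: "h .: M Y Z"
 shows "cm W Y Z (cm W X Y f g) h = cm W X Z f (cm X Y Z g h)"
proof -
 define I where "I = car (M W X) \<times> car (M X Y) \<times> car (M Y Z)"
 define F where "F = (%(f,g,h). cm W Y Z (cm W X Y f g) h)"
 define G where "G = (%(f,g,h). cm W X Z f (cm X Y Z g h))"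
 \<comment> \<open>The iterated Sweedler sum over the three hom-coalgebras; both ways of composing a
   triple have their coproduct expressed by it.\<close>
 define A :: "_=>('k,(('m set) list \<Rightarrow>\<^sub>0 'k) set) module=>_" where "A = (%(f,g,h) Q J. sw (M W X) Q (%f1 f2. sw (M X Y) Q (%g1 g2. sw (M Y Z) Q (%h1 h2. J (f1,g1,h1) (f2,g2,h2)) h) g) f)"
 note c = cmp_closed
 have "F i = G i" if "i:I" for i
 proof (rule separated_eq[OF sep[OF o(1,4)], where F = F and G = G and I = I and A = A and i = i])
 fix i assume "i:I"
 then obtain f g h where i: "i = (f,g,h)" and f: "f .: M W X" and g: "g .: M X Y" and h: "h .: M Y Z" by (auto simp:I_def)
 show FG: "F i .: M W Z" "G i .: M W Z" using c o f g h by (auto simp:F_def G_def i)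
 show "counit (M W Z) (F i) = counit (M W Z) (G i)"
 using c o f g h by (simp add:counit_cmp F_def G_def i mult.assoc)
 have "res W Z (F i) = res W Z (G i)"
 using res_cmp c o f g h linD(1)[OF kres] assoc by (simp add:F_def G_def i)
 then show "F i +[M W Z] (- 1) *.[M W Z] G i : {m:car (M W Z). res W Z m = 0.[V W Z]}" by (rule kernelI[OF o(1,4) FG])
 fix Q :: "('k,'m set) module" and pr assume Q: "vspace Q" and p: "lin (M W Z) Q pr"
 let ?T = "tensor [Q,Q]"
 have T: "vspace ?T" and B: "bilin (M W Z) (M W Z) ?T (%a b. tens [Q,Q][pr a,pr b])"
 using tensor2(1)[OF Q Q] bilin_comp[OF tensor2(2)[OF Q Q] p p] by auto
 have cl: "tens [Q,Q][pr a,pr b] .: ?T" if "a .: M W Z" "b .: M W Z" for a b using bilinD(3)[OF B that] .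
 show "sw (M W Z) ?T (%a b. tens [Q,Q][pr a,pr b]) (F i) = A i ?T (%j l. tens [Q,Q][pr (F j),pr (F l)])"
 proof -
 let ?u = "cm W X Y f g"
 have b: "bilin (M W Y) (M W Y) ?T (%a b. sw (M Y Z) ?T (%c d. tens [Q,Q][pr (cm W Y Z a c),pr (cm W Y Z b d)]) h)"
 by (rule bilinI; rule lin_sw_fun[OF pre[OF o(3,4)] _ T h];
 (rule linc[OF bilinD(1)[OF qlin_cmp] bl1[OF B]] linc[OF bilinD(1)[OF qlin_cmp] bl2[OF B]])?; use o c preD(1)[OF pre] in auto)
 have "sw (M W Z) ?T (%a b. tens [Q,Q][pr a,pr b]) (F i) = sw (M W Y) ?T (%a b. sw (M Y Z) ?T (%c d. tens [Q,Q][pr (cm W Y Z a c),pr (cm W Y Z b d)]) h) ?u"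
 unfolding F_def i prod.case by (rule homs[OF o(1,3) o(3,4) o(1,4) o(1,3,4) T B c[OF o(1,2,3) f g] h])
 also have "... = A i ?T (%j l. tens [Q,Q][pr (F j),pr (F l)])"
 unfolding F_def A_def i prod.case by (rule homs[OF o(1,2) o(2,3) o(1,3) o(1,2,3) T b f g])
 finally show ?thesis .
 qed
 show "sw (M W Z) ?T (%a b. tens [Q,Q][pr a,pr b]) (G i) = A i ?T (%j l. tens [Q,Q][pr (G j),pr (G l)])"
 proof -
 let ?u = "cm X Y Z g h"
 have "sw (M W Z) ?T (%a b. tens [Q,Q][pr a,pr b]) (G i) = sw (M W X) ?T (%a b. sw (M X Z) ?T (%c d. tens [Q,Q][pr (cm W X Z a c),pr (cm W X Z b d)]) ?u) f"
 unfolding G_def i prod.case by (rule homs[OF o(1,2) o(2,4) o(1,4) o(1,2,4) T B f c[OF o(2,3,4) g h]])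
 also have "... = A i ?T (%j l. tens [Q,Q][pr (G j),pr (G l)])"
 unfolding G_def A_def i prod.case
 proof (rule sw_cong[OF pre[OF o(1,2)] T f])
 fix a b assume ab: "a .: M W X" "b .: M W X"
 have b': "bilin (M X Z) (M X Z) ?T (%c d. tens [Q,Q][pr (cm W X Z a c),pr (cm W X Z b d)])"
 by (rule bilin_comp[OF B bilinD(2)[OF qlin_cmp[OF o(1,2,4)] ab(1)] bl2[OF qlin_cmp[OF o(1,2,4)] ab(2)]])
 show "sw (M X Z) ?T (%c d. tens [Q,Q][pr (cm W X Z a c),pr (cm W X Z b d)]) ?u = sw (M X Y) ?T (%g1 g2. sw (M Y Z) ?T
 (%h1 h2. tens [Q,Q][pr (cm W X Z a (cm X Y Z g1 h1)),pr (cm W X Z b (cm X Y Z g2 h2))]) h) g"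
 by (rule homs[OF o(2,3) o(3,4) o(2,4) o(2,3,4) T b' g h])
 show "sw (M X Y) ?T (%g1 g2. sw (M Y Z) ?T
 (%h1 h2. tens [Q,Q][pr (cm W X Z a (cm X Y Z g1 h1)),pr (cm W X Z b (cm X Y Z g2 h2))]) h) g .: ?T"
 by (rule sw_closed[OF pre[OF o(2,3)] T g], rule sw_closed[OF pre[OF o(3,4)] T h], rule cl) (use ab c o in auto)
 qed
 finally show ?thesis .
 qed
 next
 fix i and Q :: "('k,(('m set) list \<Rightarrow>\<^sub>0 'k) set) module" and J K assume "i:I" and Q: "vspace Q"
 and J: "!!j l. j:I ==> l:I ==> J j l = K j l" "!!j l. j:I ==> l:I ==> K j l .: Q"
 then obtain f g h where i: "i = (f,g,h)" and f: "f .: M W X" and g: "g .: M X Y" and h: "h .: M Y Z" by (auto simp:I_def)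
 have m: "(f,g,h):I" if "f .: M W X" "g .: M X Y" "h .: M Y Z" for f g h using that by (simp add:I_def)
 note cl = sw_closed[OF pre[OF o(3,4)] Q h] sw_closed[OF pre[OF o(2,3)] Q g]
 show "A i Q J = A i Q K" unfolding A_def i prod.case
 by (rule sw_cong[OF pre[OF o(1,2)] Q f], rule sw_cong[OF pre[OF o(2,3)] Q g], rule sw_cong[OF pre[OF o(3,4)] Q h]) (use J m cl in auto)
 qed (use that in simp)
 from this[of "(f,g,h)"] show ?thesis using f g h by (simp add:I_def F_def G_def)
qed

text \<open>Composition with the image of 1, a grouplike element, is a coalgebra endomorphism that
  leaves \<open>res\<close> unchanged; by separatedness it is the identity, and linearity gives all
  multiples.\<close>

lemma cmp_unit:
 assumes o: "X:Obj" "Y:Obj" and f: "f .: M X Y"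
 shows "cm X X Y (un X c) f = c *.[M X Y] f" "cm X Y Y f (un Y c) = c *.[M X Y] f"
proof -
 let ?N = "M X Y" let ?T = "tensor [?N,?N]"
 note uh = coalg_homD[OF hom_un, unfolded unit_simps] and v = preD(1)[OF pre[OF o]]
 have un: "un Z c = c *.[M Z Z] un Z 1" "un Z 1 .: M Z Z" "counit (M Z Z) (un Z 1) = 1" if "Z:Obj" for Z
 using linD(3)[OF uh(1)[OF that], of 1 c] uh(2,3)[OF that, of 1] by (simp_all add: unit_simps)
 have T: "vspace ?T" and B: "bilin ?N ?N ?T (%a b. tens [?N,?N][a,b])" using tensor2(1,2)[OF v v] by auto
 have swu: "sw (M Z Z) ?T J (un Z 1) = J (un Z 1) (un Z 1)" if "Z:Obj" "bilin (M Z Z) (M Z Z) ?T J" for Z J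
 using sw_hom[OF cc_pre[OF cocomm_unit_coalg] pre[OF that(1,1)] hom_un[OF that(1)] T that(2), of 1]
 sw_unit_coalg[OF T bilin_comp[OF that(2) uh(1)[OF that(1)] uh(1)[OF that(1)]], of 1] by (simp add:unit_simps)
 have main: "g f = f" if k: "lin ?N ?N g" and e: "!!f. f .: ?N ==> counit ?N (g f) = counit ?N f" and r: "!!f. f .: ?N ==> res X Y (g f) = res X Y f"
 and s: "!!f. f .: ?N ==> sw ?N ?T (%a b. tens [?N,?N][a,b]) (g f) = sw ?N ?T (%a b. tens [?N,?N][g a,g b]) f" for g
 proof (rule separated_hom_eq[OF sep[OF o] pre[OF o] _ coalg_hom_id[OF pre[OF o]] _ f])
 show "chom ?N ?N g"
 by (rule coalg_homI[OF pre[OF o] v k _ e]) (use s comult_sw[OF pre[OF o]] lin1[OF k] in simp_all)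
 show "g x +[?N] (- 1) *.[?N] x : {m:car ?N. res X Y m = 0.[V X Y]}" if "x .: ?N" for x
 by (rule kernelI[OF o linD(1)[OF k that] that r[OF that]])
 qed
 let ?l = "%f. cm X X Y (un X 1) f" and ?r = "%f. cm X Y Y f (un Y 1)"
 note ql = qlin_cmp[OF o(1,1,2)] and qr = qlin_cmp[OF o(1,2,2)]
 have rr: "res X Y f .: V X Y" if "f .: ?N" for f using linD(1)[OF kres[OF o] that] .
 have "?l f = f"
 proof (rule main[OF bilinD(2)[OF ql un(2)[OF o(1)]]])
 fix f assume f: "f .: ?N"
 show "counit ?N (?l f) = counit ?N f" using counit_cmp[OF o(1,1,2) un(2)[OF o(1)] f] un(3)[OF o(1)] by simp
 show "res X Y (?l f) = res X Y f" using res_cmp[OF o(1,1,2) un(2)[OF o(1)] f] res_un[OF o(1)] comp_id(1)[OF o rr[OF f], of 1] vV[OF o] rr[OF f] by simp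
 have b: "bilin (M X X) (M X X) ?T (%a b. sw ?N ?T (%c d. tens [?N,?N][cm X X Y a c,cm X X Y b d]) f)"
 by (rule bilinI; rule lin_sw_fun[OF pre[OF o] _ T f]; (rule linc[OF bilinD(1)[OF ql] bl1[OF B]] linc[OF bilinD(1)[OF ql] bl2[OF B]])?;
 use o cmp_closed preD(1)[OF pre] in auto)
 show "sw ?N ?T (%a b. tens [?N,?N][a,b]) (?l f) = sw ?N ?T (%a b. tens [?N,?N][?l a,?l b]) f"
 unfolding homs[OF o(1,1) o o o(1,1,2) T B un(2)[OF o(1)] f] by (rule swu[OF o(1) b])
 qed
 moreover have "?r f = f"
 proof (rule main[OF bilinD(1)[OF qr un(2)[OF o(2)]]])
 fix f assume f: "f .: ?N"
 show "counit ?N (?r f) = counit ?N f" using counit_cmp[OF o(1,2,2) f un(2)[OF o(2)]] un(3)[OF o(2)] by simp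
 show "res X Y (?r f) = res X Y f" using res_cmp[OF o(1,2,2) f un(2)[OF o(2)]] res_un[OF o(2)] comp_id(2)[OF o rr[OF f], of 1] vV[OF o] rr[OF f] by simp
 show "sw ?N ?T (%a b. tens [?N,?N][a,b]) (?r f) = sw ?N ?T (%a b. tens [?N,?N][?r a,?r b]) f"
 unfolding homs[OF o o(2,2) o o(1,2,2) T B f un(2)[OF o(2)]]
 proof (rule sw_cong[OF pre[OF o] T f])
 fix a b assume ab: "a .: ?N" "b .: ?N"
 show "sw (M Y Y) ?T (%c d. tens [?N,?N][cm X Y Y a c,cm X Y Y b d]) (un Y 1) = tens [?N,?N][?r a,?r b]"
 by (rule swu[OF o(2) bilin_comp[OF B bilinD(2)[OF qr ab(1)] bl2[OF qr ab(2)]]])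
 qed (use bilinD(3)[OF B] bl3[OF qr] un(2)[OF o(2)] in auto)
 qed
 ultimately show "cm X X Y (un X c) f = c *.[?N] f" "cm X Y Y f (un Y c) = c *.[?N] f"
 using linD(3)[OF bilinD(1)[OF ql f] un(2)[OF o(1)], of c] lin3[OF bilinD(2)[OF qr f] un(2)[OF o(2)], of c] un(1)[OF o(1)] un(1)[OF o(2)] by simp_all
qed

lemma enriched: "enriched_category \<lparr>Ob = Obj,Hom = M,Comp = cmp,Unit = un\<rparr>"
 unfolding enriched_category_def using cc hom_cmp hom_un cmp_assoc cmp_unit by simp

end

section \<open>The two enriched categories as instances\<close>

definition hcmp :: "('k::field,'u,'a) halg=>('u=>'v) \<times> ('a=>'b)=>('v=>'w) \<times> ('b=>'d)=>('u=>'w) \<times> ('a=>'d)" where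
 "hcmp H p q = (\<lambda>u\<in>car (total H). fst q (fst p u),\<lambda>a\<in>car (base H). snd q (snd p a))"

lemma HMc_facts:
 assumes "chopf X" "chopf Y"
 shows "ccoalg (HMc X Y)" "hmeas X Y (HMc X Y) (Phi_tot X Y) (phi_base X Y)"
 "separated (HMc X Y) {m:car (HMc X Y). hopf_res X (Phi_tot X Y) (phi_base X Y) m = 0.[hopf_space X Y]}"
 "hopf_compat X Y (HMc X Y) (Phi_tot X Y) (phi_base X Y)"
proof -
 note k = comm_hopfD(1)[OF assms(1)] comm_hopfD(1)[OF assms(2)]
 show 1: "ccoalg (HMc X Y)" "hmeas X Y (HMc X Y) (Phi_tot X Y) (phi_base X Y)"
 "separated (HMc X Y) {m:car (HMc X Y). hopf_res X (Phi_tot X Y) (phi_base X Y) m = 0.[hopf_space X Y]}"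
 using HMc_hopf_univ[OF k] by (auto simp:hopf_univ_def)
 show "hopf_compat X Y (HMc X Y) (Phi_tot X Y) (phi_base X Y)" by (rule hopf_measuringD(1)[OF k 1(1,2)])
qed

lemma hopf_spaceD:
 assumes "p .: hopf_space H H'"
 shows "fst p:extensional (car (total H))" "lin (total H) (total H') (fst p)" "snd p:extensional (car (base H))" "lin (base H) (base H') (snd p)"
 using assms by (auto simp:hopf_space_def vprod_def lin_space_def)

lemma cHALG_meas_category:
 "meas_category {H :: ('k::field,'u,'a) halg. chopf H} HMc (%X Y. hopf_res X (Phi_tot X Y) (phi_base X Y)) hopf_space
 (Comp cHALG) (Unit cHALG) (%X Y Z. hcmp X) (%X. hopf_res X (%c u. c *.[total X] u) (%c a. c *.[base X] a))"
proof (rule meas_category.intro, unfold mem_Collect_eq)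
 note ok = comm_hopfD(1) and F = HMc_facts
 note w = hopf_okD(1,2,8,9)[OF ok]
 fix W X Y Z :: "('k,'u,'a) halg" assume X: "chopf X"
 have un: "Unit cHALG X = HMc_induced X X unit_coalg (%c u. c *.[total X] u) (%c a. c *.[base X] a)" by (simp add:cHALG_def HALG_def)
 note u = HMc_induced[OF ok[OF X] ok[OF X] cocomm_unit_coalg hopf_measuring_unit[OF ok[OF X]]]
 show "chom unit_coalg (HMc X X) (Unit cHALG X)" unfolding un by (rule u(1))
 show "hopf_res X (Phi_tot X X) (phi_base X X) (Unit cHALG X c) = hopf_res X (%c u. c *.[total X] u) (%c a. c *.[base X] a) c" for c
 unfolding hopf_res_eq un using u(2,3) by (simp add:unit_simps)
 assume Y: "chopf Y"
 note XY = ok[OF X] ok[OF Y]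
 show "ccoalg (HMc X Y)" "lin (HMc X Y) (hopf_space X Y) (hopf_res X (Phi_tot X Y) (phi_base X Y))" "vspace (hopf_space X Y)"
 "separated (HMc X Y) {m:car (HMc X Y). hopf_res X (Phi_tot X Y) (phi_base X Y) m = 0.[hopf_space X Y]}"
 using F[OF X Y] lin_hopf_res[OF XY] vspace_hopf_space[OF XY] by auto
 fix a c assume a: "a .: hopf_space X Y"
 note aD = hopf_spaceD[OF a] and k = linD[OF hopf_spaceD(2)[OF a]] linD[OF hopf_spaceD(4)[OF a]]
 have sm: "c *.[hopf_space X Y] a = (\<lambda>u\<in>car (total X). c *.[total Y] fst a u,\<lambda>b\<in>car (base X). c *.[base Y] snd a b)"
 by (simp add:hopf_space_def vprod_def lin_space_def case_prod_beta)
 show "hcmp X (hopf_res X (%c u. c *.[total X] u) (%c a. c *.[base X] a) c) a = c *.[hopf_space X Y] a"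
 "hcmp X a (hopf_res Y (%c u. c *.[total Y] u) (%c a. c *.[base Y] a) c) = c *.[hopf_space X Y] a"
 unfolding sm by (auto simp:hcmp_def hopf_res_def k w[OF X] intro!:restrict_ext)
next
 note ok = comm_hopfD(1) and F = HMc_facts
 note w = hopf_okD(8,9)[OF ok]
 fix X Y Z :: "('k,'u,'a) halg" assume X: "chopf X" and Y: "chopf Y" and Z: "chopf Z"
 have cm: "Comp cHALG X Y Z = HMc_induced X Z (tensor_coalg (HMc X Y) (HMc Y Z)) (%t u. sweedler (total Z) (%x x'. Phi_tot Y Z x' (Phi_tot X Y x u)) t)
 (%t a. sweedler (base Z) (%x x'. phi_base Y Z x' (phi_base X Y x a)) t)" by (simp add:cHALG_def HALG_def)
 note c = F(1)[OF X Y] F(1)[OF Y Z]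
 note m = HMc_induced[OF ok[OF X] ok[OF Z] cocomm_TC[OF c] hopf_measuring_comp[OF ok[OF X] ok[OF Y] ok[OF Z] c F(2)[OF X Y] F(2)[OF Y Z]]]
 show "chom (tensor_coalg (HMc X Y) (HMc Y Z)) (HMc X Z) (Comp cHALG X Y Z)" unfolding cm by (rule m(1))
 note d = compatD[OF ok[OF X] ok[OF Y] c(1) F(4)[OF X Y]] and e = compatD[OF ok[OF Y] ok[OF Z] c(2) F(4)[OF Y Z]]
 fix f g assume f: "f .: HMc X Y" and g: "g .: HMc Y Z"
 note l = linear_family_comp(2)[OF c w(1)[OF X] w(1)[OF Z] d(3) e(3) f g] linear_family_comp(2)[OF c w(2)[OF X] w(2)[OF Z] d(4) e(4) f g]
 show "hopf_res X (Phi_tot X Z) (phi_base X Z) (Comp cHALG X Y Z (tens [HMc X Y,HMc Y Z][f,g]))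
 = hcmp X (hopf_res X (Phi_tot X Y) (phi_base X Y) f) (hopf_res Y (Phi_tot Y Z) (phi_base Y Z) g)"
 unfolding hcmp_def hopf_res_def cm using m(2,3)[OF lin_TC_tens[OF c f g]] l d(9,10)[OF f] by (auto intro!:restrict_ext)
next
 fix W X Y Z :: "('k,'u,'a) halg" and a b d
 assume a: "a .: hopf_space W X"
 show "hcmp W (hcmp W a b) d = hcmp W a (hcmp X b d)"
 using linD(1)[OF hopf_spaceD(2)[OF a]] lin1[OF hopf_spaceD(4)[OF a]] by (auto simp:hcmp_def intro!:restrict_ext)
qed

lemma lin_spaceD: "f .: lin_space V W ==> f:extensional (car V) & lin V W f"
 by (simp add:lin_space_def)

lemma walg_HH: "chopf H ==> walg (HH H)"
 by (rule comm_hopf.walg_HH) (rule comm_hopf.intro)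

lemma cHALG_tilde_meas_category:
 "meas_category {H :: ('k::field,'u,'a) halg. chopf H} (%X Y. Mc (HH X) (HH Y))
 (%X Y m. restrict (phi_c (HH X) (HH Y) m) (car (HH X))) (%X Y. lin_space (HH X) (HH Y))
 (CompT) (Unit cHALG_tilde) (%X Y Z f g. \<lambda>h\<in>car (HH X). g (f h)) (%X c. \<lambda>h\<in>car (HH X). c *.[HH X] h)"
proof (rule meas_category.intro, unfold mem_Collect_eq)
 have F: "ccoalg (Mc (HH X) (HH Y))" "ameas (HH X) (HH Y) (Mc (HH X) (HH Y)) (phi_c (HH X) (HH Y))"
 "separated (Mc (HH X) (HH Y)) {m:car (Mc (HH X) (HH Y)). restrict (phi_c (HH X) (HH Y) m) (car (HH X)) = 0.[lin_space (HH X) (HH Y)]}"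
 if "chopf X" "chopf Y" for X Y :: "('k,'u,'a) halg"
 using Mc_alg_univ[OF walg_HH walg_HH] that by (auto simp:alg_univ_def)
 note w = walg_HH and v = walgD(1)[OF walg_HH]
 have LF: "linear_family (Mc (HH X) (HH Y)) (HH X) (HH Y) (phi_c (HH X) (HH Y))" if "chopf X" "chopf Y" for X Y :: "('k,'u,'a) halg"
 using F(2)[OF that] by (simp add:alg_measuring_def)
 fix X Y Z :: "('k,'u,'a) halg" assume X: "chopf X"
 have un: "Unit cHALG_tilde X = Mc_induced (HH X) (HH X) unit_coalg (%c a. c *.[HH X] a)" by (simp add:cHALG_tilde_def Mc_unit_def)
 note u = Mc_induced[OF w[OF X] w[OF X] cocomm_unit_coalg alg_measuring_unit[OF w[OF X]]]
 show "chom unit_coalg (Mc (HH X) (HH X)) (Unit cHALG_tilde X)" unfolding un by (rule u(1))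
 show "restrict (phi_c (HH X) (HH X) (Unit cHALG_tilde X c)) (car (HH X)) = (\<lambda>h\<in>car (HH X). c *.[HH X] h)" for c
 unfolding restrict_eq_iff un using u(2) by (simp add:unit_simps)
 assume Y: "chopf Y"
 show "ccoalg (Mc (HH X) (HH Y))" "lin (Mc (HH X) (HH Y)) (lin_space (HH X) (HH Y)) (%m. restrict (phi_c (HH X) (HH Y) m) (car (HH X)))"
 "vspace (lin_space (HH X) (HH Y))"
 "separated (Mc (HH X) (HH Y)) {m:car (Mc (HH X) (HH Y)). restrict (phi_c (HH X) (HH Y) m) (car (HH X)) = 0.[lin_space (HH X) (HH Y)]}"
 using F[OF X Y] vspace_lin_space[OF v[OF X] v[OF Y]] linear_family_lin_space[OF cc_vs[OF F(1)[OF X Y]] v[OF X] v[OF Y]] LF[OF X Y] by auto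
 show "(\<lambda>h\<in>car (HH X). a ((\<lambda>h\<in>car (HH X). c *.[HH X] h) h)) = c *.[lin_space (HH X) (HH Y)] a"
 "(\<lambda>h\<in>car (HH X). (\<lambda>h\<in>car (HH Y). c *.[HH Y] h) (a h)) = c *.[lin_space (HH X) (HH Y)] a" if "a .: (lin_space (HH X) (HH Y))" for a c
 using lin_spaceD[OF that] linD[of "HH X" "HH Y" a] v[OF X] by (auto simp:lin_space_def intro!:restrict_ext)
 assume Z: "chopf Z"
 have cm: "CompT X Y Z = Mc_induced (HH X) (HH Z) (tensor_coalg (Mc (HH X) (HH Y)) (Mc (HH Y) (HH Z)))
 (%t a. sweedler (HH Z) (%x x'. phi_c (HH Y) (HH Z) x' (phi_c (HH X) (HH Y) x a)) t)" by (simp add:cHALG_tilde_def Mc_comp_def)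
 note c = F(1)[OF X Y] F(1)[OF Y Z]
 note m = Mc_induced[OF w[OF X] w[OF Z] cocomm_TC[OF c] alg_measuring_comp[OF c w[OF X] w[OF Y] w[OF Z] F(2)[OF X Y] F(2)[OF Y Z]]]
 show "chom (tensor_coalg (Mc (HH X) (HH Y)) (Mc (HH Y) (HH Z))) (Mc (HH X) (HH Z)) (CompT X Y Z)" unfolding cm by (rule m(1))
 fix f g assume f: "f .: (Mc (HH X) (HH Y))" and g: "g .: (Mc (HH Y) (HH Z))"
 show "restrict (phi_c (HH X) (HH Z) (CompT X Y Z (tens [Mc (HH X) (HH Y),Mc (HH Y) (HH Z)][f,g]))) (car (HH X))
 = (\<lambda>h\<in>car (HH X). restrict (phi_c (HH Y) (HH Z) g) (car (HH Y)) (restrict (phi_c (HH X) (HH Y) f) (car (HH X)) h))"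
 unfolding cm using m(2)[OF lin_TC_tens[OF c f g]] linear_family_comp(2)[OF c v[OF X] v[OF Z] LF[OF X Y] LF[OF Y Z] f g] lfD(3)[OF LF[OF X Y] f]
 by (auto intro!:restrict_ext)
next
 fix W X Y Z :: "('k,'u,'a) halg" and a b d
 assume "a .: (lin_space (HH W) (HH X))"
 then have "a h .: HH X" if "h .: HH W" for h using that linD(1)[of "HH W" "HH X" a] by (simp add:lin_space_def)
 then show "(\<lambda>h\<in>car (HH W). d ((\<lambda>h\<in>car (HH W). b (a h)) h)) = (\<lambda>h\<in>car (HH W). (\<lambda>h\<in>car (HH X). d (b h)) (a h))"
 by (auto intro!:restrict_ext)
qed

section \<open>Functoriality of the induced maps\<close>

lemma hopf_meas_HMc:
 "chopf X ==> chopf Y ==> hopf_meas X Y (HMc X Y) (Phi_tot X Y) (phi_base X Y)"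
 using HMc_facts[of X Y] by (simp add:hopf_meas_def hopf_meas_axioms_def comm_hopf_def)

text \<open>Already the chain maps compose. The induction on words runs over all pairs of
  \<open>f\<close> and \<open>g\<close> at once, since the legs of a composite are composites of
  legs, with different pairs acting on head and tail.\<close>

lemma Phi_hoc_comp:
 fixes X Y Z :: "('k::field,'u,'a) halg"
 assumes o: "chopf X" "chopf Y" "chopf Z"
 and f: "f .: HMc X Y" and g: "g .: HMc Y Z" and h: "h .: HH X"
 shows "Phi_hoc X Z (Comp cHALG X Y Z (tens [HMc X Y,HMc Y Z][f,g])) h = Phi_hoc Y Z g (Phi_hoc X Y f h)"
proof -
 interpret E: meas_category "{H :: ('k,'u,'a) halg. chopf H}" HMc "%X Y. hopf_res X (Phi_tot X Y) (phi_base X Y)" hopf_space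
 "Comp cHALG" "Unit cHALG" "%X Y Z. hcmp X" "%X. hopf_res X (%c u. c *.[total X] u) (%c a. c *.[base X] a)" by (rule cHALG_meas_category)
 interpret F: hopf_meas X Y "HMc X Y" "Phi_tot X Y" "phi_base X Y" by (rule hopf_meas_HMc[OF o(1,2)])
 interpret G: hopf_meas Y Z "HMc Y Z" "Phi_tot Y Z" "phi_base Y Z" by (rule hopf_meas_HMc[OF o(2,3)])
 interpret K: hopf_meas X Z "HMc X Z" "Phi_tot X Z" "phi_base X Z" by (rule hopf_meas_HMc[OF o(1,3)])
 let ?c = "%f g. Comp cHALG X Y Z (tens [HMc X Y,HMc Y Z][f,g])" and ?I = "car (HMc X Y) \<times> car (HMc Y Z)"
 have o': "X : {H. chopf H}" "Y : {H. chopf H}" "Z : {H. chopf H}" using o by auto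
 note c = E.cmp_closed[OF o']
 have r: "Phi_tot X Z (?c f g) u = Phi_tot Y Z g (Phi_tot X Y f u)" "phi_base X Z (?c f g) a = phi_base Y Z g (phi_base X Y f a)"
 if "f .: HMc X Y" "g .: HMc Y Z" "u .: total X" "a .: base X" for f g u a
 using E.res_cmp[OF o' that(1,2)] that F.mD(9,10) by (auto simp:hopf_res_def hcmp_def fun_eq_iff restrict_def dest!: spec[of _ u] spec[of _ a])
 have "K.th (case i of (f,g)=>?c f g) z = (case i of (f,g)=>G.th g (F.th f z))" if i: "i : ?I" and z: "z .: chains X" for i z
 proof (rule F.H.family_eqI[OF G.vD _ _ _ _ i z, where f = "%i z. K.th (case i of (f,g)=>?c f g) z" and g = "%i z. case i of (f,g)=>G.th g (F.th f z)"])
 fix i assume "i : ?I"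
 then obtain f g where i: "i = (f,g)" and f: "f .: HMc X Y" and g: "g .: HMc Y Z" by auto
 show "lin (chains X) (chains Z) (K.th (case i of (f,g)=>?c f g))" using K.th(1)[OF c[OF f g]] by (simp add:i)
 show "lin (chains X) (chains Z) (%z. case i of (f,g)=>G.th g (F.th f z))" using linc[OF F.th(1)[OF f] G.th(1)[OF g]] by (simp add:i)
 show "K.th (case i of (f,g)=>?c f g) (cact X a (cw X [])) = (case i of (f,g)=>G.th g (F.th f (cact X a (cw X []))))" if a: "a .: base X" for a
 using K.th(2)[OF c[OF f g] a] F.th(2)[OF f a] G.th(2)[OF g F.mD(10)[OF f a]] r(2)[OF f g F.H.U.zero_closed a] by (simp add:i)
 fix u us assume u: "u .: total X" and us: "us:F.H.LU"
 and IH: "!!i. i : ?I ==> K.th (case i of (f,g)=>?c f g) (cw X us) = (case i of (f,g)=>G.th g (F.th f (cw X us)))"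
 let ?z = "cw X us"
 have z: "?z .: chains X" by (rule F.H.cw_closed[OF us])
 have "K.th (?c f g) (ccons X u ?z) = sw (HMc X Z) (chains Z) (%a b. ccons Z (Phi_tot X Z a u) (K.th b ?z)) (?c f g)"
 by (rule K.th_cons[OF u c[OF f g] z])
 also have "... = sw (HMc X Y) (chains Z) (%a b. sw (HMc Y Z) (chains Z) (%d e. ccons Z (Phi_tot X Z (?c a d) u) (K.th (?c b e) ?z)) g) f"
 by (rule E.homs[OF o'(1,2) o'(2,3) o'(1,3) o' G.vD bilin_comp[OF G.H'.bilin_ops(2) K.kPsi[OF u] K.lin_th[OF z]] f g])
 also have "... = sw (HMc X Y) (chains Z) (%a b. G.th g (ccons Y (Phi_tot X Y a u) (F.th b ?z))) f"
 proof (rule sw_cong[OF F.P G.vD f])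
 fix a b assume ab: "a .: HMc X Y" "b .: HMc X Y"
 show "sw (HMc Y Z) (chains Z) (%d e. ccons Z (Phi_tot X Z (?c a d) u) (K.th (?c b e) ?z)) g = G.th g (ccons Y (Phi_tot X Y a u) (F.th b ?z))"
 unfolding G.th_cons[OF F.mD(9)[OF ab(1) u] g F.th_closed[OF ab(2) z]]
 by (rule G.D_cong[OF g]) (use ab u z IH[of "(b,e)" for e] r(1)[OF ab(1) _ u F.H.A.zero_closed] in auto)
 qed (use g u z in auto)
 also have "... = G.th g (F.th f (ccons X u ?z))"
 unfolding F.th_cons[OF u f z] by (rule sw_push[OF F.P G.th(1)[OF g] F.vD G.vD f, symmetric]) (use u z in auto)
 finally show "K.th (case i of (f,g)=>?c f g) (ccons X u ?z) = (case i of (f,g)=>G.th g (F.th f (ccons X u ?z)))" by (simp add:i)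
 qed
 from this[of "(f,g)"] have e: "K.th (?c f g) z = G.th g (F.th f z)" if "z .: chains X" for z using that f g by simp
 obtain t where t: "t:F.H.Z" "h = F.H.klass t" using h by (auto simp:F.H.HH_simps(1))
 show ?thesis
 unfolding Phi_hoc_def t(2) K.hoc_klass[OF c[OF f g] t(1)] F.hoc_klass[OF f t(1)] G.hoc_klass[OF g F.th_cycles(1)[OF f t(1)]] e[OF F.H.cyclesD(1)[OF t(1)]] ..
qed

text \<open>The legs of \<open>c\<close> in the field are \<open>c\<close> and 1, so along a word
  the scalar is placed on the first letter while the image of 1 acts trivially on the tail.\<close>

lemma Phi_hoc_unit:
 fixes X :: "('k::field,'u,'a) halg"
 assumes o: "chopf X" and h: "h .: HH X"
 shows "Phi_hoc X X (Unit cHALG X c) h = c *.[HH X] h"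
proof -
 interpret E: meas_category "{H :: ('k,'u,'a) halg. chopf H}" HMc "%X Y. hopf_res X (Phi_tot X Y) (phi_base X Y)" hopf_space
 "Comp cHALG" "Unit cHALG" "%X Y Z. hcmp X" "%X. hopf_res X (%c u. c *.[total X] u) (%c a. c *.[base X] a)" by (rule cHALG_meas_category)
 interpret K: hopf_meas X X "HMc X X" "Phi_tot X X" "phi_base X X" by (rule hopf_meas_HMc[OF o o])
 have o': "X : {H. chopf H}" using o by simp
 let ?u = "Unit cHALG X"
 note uh = coalg_homD[OF E.hom_un[OF o'], unfolded unit_simps]
 have r: "Phi_tot X X (?u c) u = c *.[total X] u" "phi_base X X (?u c) a = c *.[base X] a" if "u .: total X" "a .: base X" for c u a
 using E.res_un[OF o', of c] that unfolding hopf_res_eq by auto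
 have "K.th (?u c) z = c *.[chains X] z" if z: "z .: chains X" for c z
 proof (rule K.H.family_eqI[OF K.vD _ _ _ _ UNIV_I z, where f = "%c z. K.th (?u c) z" and g = "%c z. c *.[chains X] z"])
 fix c :: 'k
 have uc: "?u c .: HMc X X" using uh(2) by simp
 show "lin (chains X) (chains X) (K.th (?u c))" by (rule K.th(1)[OF uc])
 show "lin (chains X) (chains X) (%z. c *.[chains X] z)" by (rule K.H.lin_lin2(2)[OF K.vD K.vD lin_id lin_id])
 show "K.th (?u c) (cact X a (cw X [])) = c *.[chains X] cact X a (cw X [])" if a: "a .: base X" for a
 using K.th(2)[OF uc a] r(2)[OF K.H.U.zero_closed a] lin3[OF bilinD(1)[OF K.H.bilin_ops(1)], of "cw X []" a c] a by simp
 fix u us assume u: "u .: total X" and us: "us:K.H.LU" and IH: "!!c. c:UNIV ==> K.th (?u c) (cw X us) = c *.[chains X] cw X us"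
 let ?z = "cw X us"
 note z = K.H.cw_closed[OF us] and b = bilin_comp[OF K.H.bilin_ops(2) K.kPsi[OF u] K.lin_th[OF K.H.cw_closed[OF us]]]
 have "K.th (?u c) (ccons X u ?z) = sw unit_coalg (chains X) (%a b. ccons X (Phi_tot X X (?u a) u) (K.th (?u b) ?z)) c"
 unfolding K.th_cons[OF u uc z]
 by (rule sw_hom[OF cc_pre[OF cocomm_unit_coalg] K.P E.hom_un[OF o'] K.vD b]) (simp add:unit_simps)
 also have "... = ccons X (Phi_tot X X (?u c) u) (K.th (?u 1) ?z)"
 by (rule sw_unit_coalg[OF K.vD bilin_comp[OF b coalg_homD(1)[OF E.hom_un[OF o']] coalg_homD(1)[OF E.hom_un[OF o']]]])
 also have "... = c *.[chains X] ccons X u ?z"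
 using r(1)[OF u K.H.A.zero_closed] IH[of 1] z u linD(3)[OF bilinD(1)[OF K.H.bilin_ops(2) z] u, of c] by simp
 finally show "K.th (?u c) (ccons X u ?z) = c *.[chains X] ccons X u ?z" .
 qed
 moreover obtain t where t: "t:K.H.Z" "h = K.H.klass t" using h by (auto simp:K.H.HH_simps(1))
 ultimately show ?thesis
 unfolding Phi_hoc_def t(2) using K.hoc_klass[OF uh(2)[OF UNIV_I] t(1)] K.H.cyclesD(1)[OF t(1)] by (simp add:K.H.HH_simps(4)[OF t(1)])
qed

theorem theorem4p3:
  shows
    "enriched_functor
       (cHALG :: (('k::field, 'u, 'a) hopf_algebroid, 'k, ('k, 'u, 'a, 'u, 'a) hopf_univ) ecat)
       cHALG_tilde (\<lambda>H. H) tau \<and>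
     (\<forall>H H' :: ('k, 'u, 'a) hopf_algebroid. comm_hopf_algebroid H \<and> comm_hopf_algebroid H' \<longrightarrow>
        final_hopf_measuring TYPE('c) H H' (HMc H H') (Phi_tot H H') (phi_base H H') \<and>
        final_alg_measuring TYPE('c) (HH H) (HH H') (Mc (HH H) (HH H')) (phi_c (HH H) (HH H')) \<and>
        (\<forall>x\<in>carrier (HMc H H'). \<forall>h\<in>carrier (HH H).
           phi_c (HH H) (HH H') (tau H H' x) h = Phi_hoc H H' x h))"
proof -
 let ?O = "{H :: ('k,'u,'a) halg. chopf H}"
 interpret E: meas_category ?O HMc "%X Y. hopf_res X (Phi_tot X Y) (phi_base X Y)" hopf_space
 "Comp cHALG" "Unit cHALG" "%X Y Z. hcmp X" "%X. hopf_res X (%c u. c *.[total X] u) (%c a. c *.[base X] a)" by (rule cHALG_meas_category)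
 interpret F: meas_category ?O "%X Y. Mc (HH X) (HH Y)" "%X Y m. restrict (phi_c (HH X) (HH Y) m) (car (HH X))" "%X Y. lin_space (HH X) (HH Y)"
 "CompT" "Unit cHALG_tilde" "%X Y Z f g. \<lambda>h\<in>car (HH X). g (f h)" "%X c. \<lambda>h\<in>car (HH X). c *.[HH X] h"
 by (rule cHALG_tilde_meas_category)
 have ob: "Ob cHALG = ?O" "Ob cHALG_tilde = ?O" "Hom cHALG = HMc" "Hom cHALG_tilde = (%X Y. Mc (HH X) (HH Y))"
 by (simp_all add: cHALG_def HALG_def cHALG_tilde_def)
 have "cHALG = \<lparr>Ob = ?O,Hom = HMc,Comp = Comp cHALG,Unit = Unit cHALG\<rparr>"
 "cHALG_tilde = \<lparr>Ob = ?O,Hom = (%X Y. Mc (HH X) (HH Y)),Comp = CompT,Unit = Unit cHALG_tilde\<rparr>"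
 by (simp_all add: cHALG_def HALG_def cHALG_tilde_def)
 then have cat: "enriched_category (cHALG :: (('k,'u,'a) halg,_,_) ecat)" "enriched_category (cHALG_tilde :: (('k,'u,'a) halg,_,_) ecat)"
 using E.enriched F.enriched by simp_all
 have T: "chom (HMc X Y) (Mc (HH X) (HH Y)) (tau X Y)" "x .: HMc X Y ==> h .: HH X ==> phi_c (HH X) (HH Y) (tau X Y x) h = Phi_hoc X Y x h"
 if "X : ?O" "Y : ?O" for X Y x h
 proof -
 have o: "chopf X" "chopf Y" using that by auto
 interpret M: hopf_meas X Y "HMc X Y" "Phi_tot X Y" "phi_base X Y" by (rule hopf_meas_HMc[OF o])
 note I = Mc_induced[OF M.H.walg_HH M.H'.walg_HH M.C M.alg_measuring_hoc, folded Phi_hoc_def tau_def]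
 show "chom (HMc X Y) (Mc (HH X) (HH Y)) (tau X Y)" "x .: HMc X Y ==> h .: HH X ==> phi_c (HH X) (HH Y) (tau X Y x) h = Phi_hoc X Y x h"
 using I by auto
 qed
 note tc = coalg_homD(2)[OF T(1)]
 \<comment> \<open>Values of \<open>Phi_hoc\<close> are values of the final measuring at elements of
   the form \<open>tau X Y f\<close>, hence lie in the homology of the target.\<close>
 have hoc_closed: "Phi_hoc X Y f h .: HH Y" if "X : ?O" "Y : ?O" "f .: HMc X Y" "h .: HH X" for X Y f h
 proof -
 have "(\<lambda>h\<in>car (HH X). phi_c (HH X) (HH Y) (tau X Y f) h) .: (lin_space (HH X) (HH Y))"
 using linD(1)[OF F.kres[OF that(1,2)] tc[OF that(1-3)]] by simp
 then have "lin (HH X) (HH Y) (\<lambda>h\<in>car (HH X). phi_c (HH X) (HH Y) (tau X Y f) h)" using lin_spaceD by blast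
 from linD(1)[OF this that(4)] show ?thesis using T(2)[OF that] that(4) by simp
 qed
 \<comment> \<open>Both sides are coalgebra maps from a tensor coalgebra into a separated coalgebra,
   so it is enough to compare the induced maps on homology, and these on elementary tensors.\<close>
 have cmp: "tau X Z (Comp cHALG X Y Z t) = CompT X Y Z (sweedler (tensor [Mc (HH X) (HH Y),Mc (HH Y) (HH Z)]) (%f g. F.tn X Y Z (tau X Y f) (tau Y Z g)) t)"
 if o: "X : ?O" "Y : ?O" "Z : ?O" and t: "t .: (tensor_coalg (HMc X Y) (HMc Y Z))" for X Y Z t
 proof -
 note cE = E.cc[OF o(1,2)] E.cc[OF o(2,3)] and cF = F.cc[OF o(1,2)] F.cc[OF o(2,3)] and o' = o(1,3)
 note h = coalg_hom_tensor[OF cE cF T(1)[OF o(1,2)] T(1)[OF o(2,3)]] and p = precoalg_TC[OF cE]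
 note P = coalg_hom_comp[OF p E.pre[OF o'] F.pre[OF o'] E.hom_cmp[OF o] T(1)[OF o']]
 and Q = coalg_hom_comp[OF p precoalg_TC[OF cF] F.pre[OF o'] h(1) F.hom_cmp[OF o]]
 show ?thesis
 proof (rule separated_hom_eq[OF F.sep[OF o'] p P Q F.kernelI[OF o' coalg_homD(2)[OF P] coalg_homD(2)[OF Q]] t])
 fix t assume t: "t .: (tensor_coalg (HMc X Y) (HMc Y Z))"
 show "restrict (phi_c (HH X) (HH Z) (tau X Z (Comp cHALG X Y Z t))) (car (HH X))
 = restrict (phi_c (HH X) (HH Z) (CompT X Y Z (sweedler (tensor [Mc (HH X) (HH Y),Mc (HH Y) (HH Z)]) (%f g. F.tn X Y Z (tau X Y f) (tau Y Z g)) t))) (car (HH X))"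
 proof (rule tensor_coalg_eqI[OF cE F.vV[OF o'] linc[OF coalg_homD(1)[OF P] F.kres[OF o']] linc[OF coalg_homD(1)[OF Q] F.kres[OF o']] _ t])
 fix f g assume f: "f .: HMc X Y" and g: "g .: HMc Y Z"
 show "restrict (phi_c (HH X) (HH Z) (tau X Z (Comp cHALG X Y Z (E.tn X Y Z f g)))) (car (HH X))
 = restrict (phi_c (HH X) (HH Z) (CompT X Y Z (sweedler (tensor [Mc (HH X) (HH Y),Mc (HH Y) (HH Z)]) (%f g. F.tn X Y Z (tau X Y f) (tau Y Z g)) (E.tn X Y Z f g)))) (car (HH X))"
 unfolding h(2)[OF f g]
 using F.res_cmp[OF o tc[OF o(1,2) f] tc[OF o(2,3) g]] T(2)[OF o' E.cmp_closed[OF o f g]] T(2)[OF o(1,2) f] T(2)[OF o(2,3) g] hoc_closed[OF o(1,2) f] o f g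
 by (simp add:restrict_eq_iff Phi_hoc_comp)
 qed
 qed
 qed
 \<comment> \<open>The same argument with the ground field as the source coalgebra.\<close>
 have un: "tau X X (Unit cHALG X c) = Unit cHALG_tilde X c" if o: "X : ?O" for X c
 proof (rule separated_hom_eq[OF F.sep[OF o o] cc_pre[OF cocomm_unit_coalg] coalg_hom_comp[OF _ _ _ E.hom_un[OF o] T(1)[OF o o]] F.hom_un[OF o]])
 fix c :: 'k assume "c .: unit_coalg"
 then have u: "Unit cHALG X c .: HMc X X" "Unit cHALG_tilde X c .: (Mc (HH X) (HH X))"
 using coalg_homD(2)[OF E.hom_un[OF o]] coalg_homD(2)[OF F.hom_un[OF o]] by auto
 show "tau X X (Unit cHALG X c) +[Mc (HH X) (HH X)] (- 1) *.[Mc (HH X) (HH X)] Unit cHALG_tilde X c \<in>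
 {m:car (Mc (HH X) (HH X)). restrict (phi_c (HH X) (HH X) m) (car (HH X)) = 0.[lin_space (HH X) (HH X)]}"
 by (rule F.kernelI[OF o o tc[OF o o u(1)] u(2)]) (insert F.res_un[OF o, of c] T(2)[OF o o u(1)] Phi_hoc_unit[of X] o, auto simp:restrict_eq_iff)
 qed (insert E.pre[OF o o] F.pre[OF o o] cc_pre[OF cocomm_unit_coalg], simp_all add: unit_simps)
 have "enriched_functor (cHALG :: (('k,'u,'a) halg,_,_) ecat) cHALG_tilde (%H. H) tau"
 unfolding enriched_functor_def ob using cat T(1) cmp un by simp
 moreover have "final_hopf_measuring TYPE('c) H H' (HMc H H') (Phi_tot H H') (phi_base H H') &
 final_alg_measuring TYPE('c) (HH H) (HH H') (Mc (HH H) (HH H')) (phi_c (HH H) (HH H'))"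
 if "chopf H" "chopf H'" for H H' :: "('k,'u,'a) halg"
 using HMc_final[OF comm_hopfD(1)[OF that(1)] comm_hopfD(1)[OF that(2)]] Mc_final[OF walg_HH[OF that(1)] walg_HH[OF that(2)]] by blast
 ultimately show ?thesis using T(2) by simp
qed

end
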